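(* Let $\Bbbk$ be an algebraically closed field. (a) Let $A$ be a finite-dimensional basic $\Bbbk$-algebra with a filtration by two-sided ideals $A=I_0\supsetneq I_1\supsetneq\dots\supsetneq I_N=0$ such that $I_iI_j\subset I_{i+j}$ (with $I_m=0$ for $m\geq N$) and all $I_i/I_{i+1}$ are semisimple $A$-bimodules. Identify $A/I_1$ with a maximal semisimple subalgebra $S$ of $A$; for $1\le m\le N$ regard $S$ also as a subspace of $A/I_m$. Let $\tilde{\mathcal{B}}\subset\mathfrak{C}(A)$ be the set of matrices whose entry in row $r$, column $c$ lies in $S$ if $0\le c-r\le N-1$ and is zero otherwise (so each row has exactly $N$ possibly nonzero entries). Then $\tilde{\mathcal{B}}$ is a strong exact $\Delta$-subalgebra of $\mathfrak{C}=\mathfrak{C}(A)$ with respect to the first order. (b) Let $\mathfrak{D}=\mathfrak{D}(\tilde A)$ be the trivial extension algebra attached to a finite-dimensional algebra given by a quiver with relations (see context), and let $\tilde{\mathcal{B}}\subset\mathfrak{C}(\tilde A)\subset\mathfrak{D}$ be defined as in (a) with $\tilde A$ and its radical filtration in place of $A$ and its filtration. Then $\tilde{\mathcal{B}}$ is a strong exact $\Delta$-subalgebra of $\mathfrak{D}$ with respect to the first order.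
   Context: For a filtered algebra $E$ ($E=A$ with $I_j$ as in (a), or $E=\tilde A$ with $I_j=\mathrm{Rad}^j\tilde A$ and $N$ the nilpotency degree of $\mathrm{Rad}\,\tilde A$), $\mathfrak{C}(E)=\bigoplus_{r,c\in\mathbb{Z}}\mathfrak{C}_{r,c}$ is the algebra of $\mathbb{Z}\times\mathbb{Z}$-matrices with finitely many nonzero entries, where the entry in row $r$, column $c$ lies in $\mathfrak{C}_{r,c}=I_{r-c}$ if $r>c$, $E/I_{N-(c-r)}$ if $0\le c-r<N$, and $0$ if $c-r\ge N$, with multiplication induced from $E$. Primitive idempotents and simple modules are indexed by pairs $(k,i)$, with $k$ a vertex (isomorphism class of simple $E$-modules) and $i\in\mathbb{Z}$; $e_{k,i}$ is $e_k$ in position $(i,i)$. Given an algebra with quiver on vertices $\mathbf{N}=\{1,\dots,n\}$ and relations $R$, $\tilde A$ is obtained by adding, for each $k$, a vertex $\tilde k$ and an arrow $\alpha_k:k\to\tilde k$ ($\alpha_k\in e_{\tilde k}\tilde Ae_k$) with no new relations; $\tilde{\mathbf{N}}=\{\tilde1,\dots,\tilde n\}$. $\mathfrak{D}=\mathfrak{D}(\tilde A)=\mathfrak{C}\oplus\mathfrak{C}^*$, with $\mathfrak{C}=\mathfrak{C}(\tilde A)$ and $\mathfrak{C}^*=\bigoplus\mathrm{Hom}_\Bbbk(e_{y,j}\mathfrak{C}e_{x,i},\Bbbk)$ the restricted dual bimodule, is the trivial extension with product $(a,f)(b,g)=(ab,ag+fb)$. First order: for $\mathfrak{C}(A)$,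 $(k,i)>(l,j)$ iff $i>j$; for $\mathfrak{D}$, $(k,i)>(l,j)$ iff $i>j$, or $i=j$, $k\in\mathbf{N}$, $l\in\tilde{\mathbf{N}}$. Both $\mathfrak{C}(A)$ and $\mathfrak{D}$ are quasi-hereditary for the first order. The (left or right) standard module $\Delta(\lambda)$ is the quotient of the projective $P(\lambda)$ by the sum of images of all homomorphisms $P(\mu)\to P(\lambda)$, $\mu>\lambda$. Let $\Lambda$ be a basic quasi-hereditary algebra of this kind. A subalgebra $B\subset\Lambda$ is an exact Borel subalgebra if $B$ and $\Lambda$ have the same (index set of) simple modules, $B$ is directed (quasi-hereditary for the given order with simple standard left modules), the functor $\Lambda\otimes_B{}_-$ on left modules is exact, and $\Lambda\otimes_BL_B(\lambda)\cong\Delta_\Lambda(\lambda)$ for all $\lambda$. It is strong if it contains a maximal semisimple subalgebra of $\Lambda$. Dually, $B$ is a (strong exact) $\Delta$-subalgebra of $\Lambda$ if $B^{op}$ is a (strong) exact Borel subalgebra of $\Lambda^{op}$, i.e. the corresponding conditions hold for right modules, with the functor ${}_-\otimes_B\Lambda$ and right standard modules. *)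

theory Defs
  imports
    "HOL-Algebra.Algebraic_Closure"
    "HOL-Algebra.Ideal_Product"
    "HOL-Algebra.QuotRing"
    "HOL-Algebra.Free_Abelian_Groups"
    "Graph_Theory.Arc_Walk"
begin

text \<open>
  Algebras over a field \<open>K\<close> are records of type \<open>('k, 'a) module\<close> (a ring together with a scalar
  multiplication by \<open>K\<close>).  The matrix algebras below are only locally unital; for these the record
  field \<open>one\<close> is left unspecified and never used.

  A left module over such an algebra \<open>L\<close> is a record of type \<open>('l, 'm) module\<close> whose scalars are the
  elements of \<open>L\<close>; here the fields \<open>mult\<close> and \<open>one\<close> carry no information.  Only unital modules
  (\<open>L M = M\<close>) occur.  Over a locally unital \<open>K\<close>-algebra the \<open>K\<close>-structure of a unital module is
  determined by the action of \<open>L\<close> (\<open>c (a m) = (c a) m\<close>) and all \<open>L\<close>-linear maps are \<open>K\<close>-linear, so it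
  is not recorded.
\<close>

section \<open>Modules\<close>

definition left_module :: "('k, 'l) module \<Rightarrow> ('l, 'm) module \<Rightarrow> bool" where
  "left_module L M \<longleftrightarrow>
     abelian_group M \<and>
     (\<forall>a\<in>carrier L. \<forall>x\<in>carrier M. a \<odot>\<^bsub>M\<^esub> x \<in> carrier M) \<and>
     (\<forall>a\<in>carrier L. \<forall>b\<in>carrier L. \<forall>x\<in>carrier M.
        (a \<oplus>\<^bsub>L\<^esub> b) \<odot>\<^bsub>M\<^esub> x = a \<odot>\<^bsub>M\<^esub> x \<oplus>\<^bsub>M\<^esub> b \<odot>\<^bsub>M\<^esub> x \<and>
        (a \<otimes>\<^bsub>L\<^esub> b) \<odot>\<^bsub>M\<^esub> x = a \<odot>\<^bsub>M\<^esub> (b \<odot>\<^bsub>M\<^esub> x)) \<and>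
     (\<forall>a\<in>carrier L. \<forall>x\<in>carrier M. \<forall>y\<in>carrier M.
        a \<odot>\<^bsub>M\<^esub> (x \<oplus>\<^bsub>M\<^esub> y) = a \<odot>\<^bsub>M\<^esub> x \<oplus>\<^bsub>M\<^esub> a \<odot>\<^bsub>M\<^esub> y) \<and>
     (\<forall>x\<in>carrier M. \<exists>a\<in>carrier L. a \<odot>\<^bsub>M\<^esub> x = x)"
  \<comment> \<open>over an algebra with local units the last clause says that \<open>L M = M\<close>\<close>

definition lmod_hom :: "('k, 'l) module \<Rightarrow> ('l, 'm) module \<Rightarrow> ('l, 'n) module \<Rightarrow> ('m \<Rightarrow> 'n) set" where
  "lmod_hom L M N =
     {h \<in> carrier M \<rightarrow> carrier N.
        (\<forall>x\<in>carrier M. \<forall>y\<in>carrier M. h (x \<oplus>\<^bsub>M\<^esub> y) = h x \<oplus>\<^bsub>N\<^esub> h y) \<and>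
        (\<forall>a\<in>carrier L. \<forall>x\<in>carrier M. h (a \<odot>\<^bsub>M\<^esub> x) = a \<odot>\<^bsub>N\<^esub> h x)}"

definition lmod_iso :: "('k, 'l) module \<Rightarrow> ('l, 'm) module \<Rightarrow> ('l, 'n) module \<Rightarrow> bool" where
  "lmod_iso L M N \<longleftrightarrow> (\<exists>h \<in> lmod_hom L M N. bij_betw h (carrier M) (carrier N))"

definition generated_submodule :: "('r, 'z) ring_scheme \<Rightarrow> ('r, 'm) module \<Rightarrow> 'm set \<Rightarrow> 'm set" where
  "generated_submodule R M Y = \<Inter>{U. submodule U R M \<and> Y \<subseteq> U}"

definition quotient_module :: "('l, 'm) module \<Rightarrow> 'm set \<Rightarrow> ('l, 'm set) module" where
  "quotient_module M U =
     \<lparr>carrier = a_rcosets\<^bsub>M\<^esub> U, monoid.mult = undefined, one = undefined,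
      ring.zero = U, ring.add = set_add M,
      smult = (\<lambda>a Z. \<Union>x\<in>Z. U +>\<^bsub>M\<^esub> (a \<odot>\<^bsub>M\<^esub> x))\<rparr>"

definition simple_module :: "('k, 'l) module \<Rightarrow> ('l, 'm) module \<Rightarrow> bool" where
  "simple_module L M \<longleftrightarrow>
     carrier M \<noteq> {\<zero>\<^bsub>M\<^esub>} \<and> (\<forall>U. submodule U L M \<longrightarrow> U = {\<zero>\<^bsub>M\<^esub>} \<or> U = carrier M)"

definition semisimple_module :: "('k, 'l) module \<Rightarrow> ('l, 'm) module \<Rightarrow> bool" where
  "semisimple_module L M \<longleftrightarrow>
     (\<forall>U. submodule U L M \<longrightarrow>
        (\<exists>W. submodule W L M \<and> U \<inter> W = {\<zero>\<^bsub>M\<^esub>} \<and> U <+>\<^bsub>M\<^esub> W = carrier M))"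

definition maximal_submodule :: "'m set \<Rightarrow> ('k, 'l) module \<Rightarrow> ('l, 'm) module \<Rightarrow> bool" where
  "maximal_submodule U L M \<longleftrightarrow>
     submodule U L M \<and> U \<noteq> carrier M \<and>
     (\<forall>W. submodule W L M \<longrightarrow> U \<subseteq> W \<longrightarrow> W = U \<or> W = carrier M)"

definition module_radical :: "('k, 'l) module \<Rightarrow> ('l, 'm) module \<Rightarrow> 'm set" where
  "module_radical L M = carrier M \<inter> \<Inter>{U. maximal_submodule U L M}"

definition regular_module :: "('k, 'l) module \<Rightarrow> ('l, 'l) module" where
  "regular_module L =
     \<lparr>carrier = carrier L, monoid.mult = undefined, one = undefined,
      ring.zero = \<zero>\<^bsub>L\<^esub>, ring.add = ring.add L,
      smult = monoid.mult L\<rparr>"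

definition left_proj :: "('k, 'l) module \<Rightarrow> 'l \<Rightarrow> ('l, 'l) module" where
  "left_proj L x = (regular_module L)\<lparr>carrier := {a \<otimes>\<^bsub>L\<^esub> x |a. a \<in> carrier L}\<rparr>"


section \<open>Algebras\<close>

definition fd_algebra :: "'k ring \<Rightarrow> ('k, 'a) module \<Rightarrow> bool" where
  "fd_algebra K A \<longleftrightarrow>
     module K A \<and> ring A \<and>
     (\<forall>k\<in>carrier K. \<forall>x\<in>carrier A. \<forall>y\<in>carrier A.
        (k \<odot>\<^bsub>A\<^esub> x) \<otimes>\<^bsub>A\<^esub> y = k \<odot>\<^bsub>A\<^esub> (x \<otimes>\<^bsub>A\<^esub> y) \<and> x \<otimes>\<^bsub>A\<^esub> (k \<odot>\<^bsub>A\<^esub> y) = k \<odot>\<^bsub>A\<^esub> (x \<otimes>\<^bsub>A\<^esub> y)) \<and>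
     (\<exists>F \<subseteq> carrier A. finite F \<and> generated_submodule K A F = carrier A)"

definition opposite :: "('k, 'l) module \<Rightarrow> ('k, 'l) module" where
  "opposite L = L\<lparr>monoid.mult := (\<lambda>x y. y \<otimes>\<^bsub>L\<^esub> x)\<rparr>"

definition subalgebra :: "'k ring \<Rightarrow> ('k, 'l) module \<Rightarrow> 'l set \<Rightarrow> bool" where
  "subalgebra K L T \<longleftrightarrow> submodule T K L \<and> (\<forall>x\<in>T. \<forall>y\<in>T. x \<otimes>\<^bsub>L\<^esub> y \<in> T)"

definition has_local_units :: "('k, 'l) module \<Rightarrow> bool" where
  "has_local_units L \<longleftrightarrow>
     (\<forall>F. finite F \<longrightarrow> F \<subseteq> carrier L \<longrightarrow>
        (\<exists>u\<in>carrier L. u \<otimes>\<^bsub>L\<^esub> u = u \<and> (\<forall>x\<in>F. u \<otimes>\<^bsub>L\<^esub> x = x \<and> x \<otimes>\<^bsub>L\<^esub> u = x)))"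

definition semisimple_algebra :: "('k, 'l) module \<Rightarrow> bool" where
  "semisimple_algebra L \<longleftrightarrow> has_local_units L \<and> semisimple_module L (regular_module L)"

definition maximal_semisimple_subalgebra :: "'k ring \<Rightarrow> ('k, 'l) module \<Rightarrow> 'l set \<Rightarrow> bool" where
  "maximal_semisimple_subalgebra K L T \<longleftrightarrow>
     subalgebra K L T \<and> semisimple_algebra (L\<lparr>carrier := T\<rparr>) \<and>
     (\<forall>T'. subalgebra K L T' \<longrightarrow> semisimple_algebra (L\<lparr>carrier := T'\<rparr>) \<longrightarrow> T \<subseteq> T' \<longrightarrow> T' = T)"

definition primitive_idempotent :: "('k, 'l) module \<Rightarrow> 'l \<Rightarrow> bool" where
  "primitive_idempotent L x \<longleftrightarrow>
     x \<in> carrier L \<and> x \<noteq> \<zero>\<^bsub>L\<^esub> \<and> x \<otimes>\<^bsub>L\<^esub> x = x \<and>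
     \<not> (\<exists>y\<in>carrier L. \<exists>z\<in>carrier L. y \<noteq> \<zero>\<^bsub>L\<^esub> \<and> z \<noteq> \<zero>\<^bsub>L\<^esub> \<and> y \<otimes>\<^bsub>L\<^esub> y = y \<and> z \<otimes>\<^bsub>L\<^esub> z = z \<and>
           y \<otimes>\<^bsub>L\<^esub> z = \<zero>\<^bsub>L\<^esub> \<and> z \<otimes>\<^bsub>L\<^esub> y = \<zero>\<^bsub>L\<^esub> \<and> x = y \<oplus>\<^bsub>L\<^esub> z)"

text \<open>
  \<open>e\<close> is a complete family of orthogonal primitive idempotents of \<open>L\<close>, indexed by \<open>Z\<close>, with pairwise
  non-isomorphic projectives; so \<open>L\<close> is basic and \<open>Z\<close> is its index set of simple modules.  If \<open>L\<close> has an
  identity, completeness says that \<open>Z\<close> is finite and the \<open>e \<nu>\<close> sum up to the identity.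
\<close>

definition basic_family :: "('k, 'l) module \<Rightarrow> 'x set \<Rightarrow> ('x \<Rightarrow> 'l) \<Rightarrow> bool" where
  "basic_family L Z e \<longleftrightarrow>
     (\<forall>\<nu>\<in>Z. primitive_idempotent L (e \<nu>)) \<and>
     (\<forall>\<nu>\<in>Z. \<forall>\<mu>\<in>Z. \<nu> \<noteq> \<mu> \<longrightarrow> e \<nu> \<otimes>\<^bsub>L\<^esub> e \<mu> = \<zero>\<^bsub>L\<^esub>) \<and>
     (\<forall>x\<in>carrier L. \<exists>F\<subseteq>Z. finite F \<and>
        (\<Oplus>\<^bsub>L\<^esub>\<nu>\<in>F. e \<nu>) \<otimes>\<^bsub>L\<^esub> x = x \<and> x \<otimes>\<^bsub>L\<^esub> (\<Oplus>\<^bsub>L\<^esub>\<nu>\<in>F. e \<nu>) = x) \<and>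
     (\<forall>\<nu>\<in>Z. \<forall>\<mu>\<in>Z. \<nu> \<noteq> \<mu> \<longrightarrow> \<not> lmod_iso L (left_proj L (e \<nu>)) (left_proj L (e \<mu>)))"

definition basic_algebra :: "('k, 'l) module \<Rightarrow> bool" where
  "basic_algebra L \<longleftrightarrow> (\<exists>P. basic_family L P (\<lambda>x. x))"


section \<open>Standard modules, quasi-hereditary and directed algebras\<close>

text \<open>
  Throughout, \<open>e\<close> is a family of idempotents indexed by \<open>Z\<close>, and \<open>lt \<nu> \<mu>\<close> means \<open>\<nu> < \<mu>\<close>.
\<close>

definition simple_top :: "('k, 'l) module \<Rightarrow> ('x \<Rightarrow> 'l) \<Rightarrow> 'x \<Rightarrow> ('l, 'l set) module" where
  "simple_top L e \<nu> =
     quotient_module (left_proj L (e \<nu>)) (module_radical L (left_proj L (e \<nu>)))"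

definition greater_trace ::
  "'x set \<Rightarrow> ('x \<Rightarrow> 'x \<Rightarrow> bool) \<Rightarrow> ('k, 'l) module \<Rightarrow> ('x \<Rightarrow> 'l) \<Rightarrow> 'x \<Rightarrow> 'l set" where
  "greater_trace Z lt L e \<nu> =
     generated_submodule L (left_proj L (e \<nu>))
       (\<Union>\<mu>\<in>{\<mu>\<in>Z. lt \<nu> \<mu>}. \<Union>h\<in>lmod_hom L (left_proj L (e \<mu>)) (left_proj L (e \<nu>)).
          h ` carrier (left_proj L (e \<mu>)))"

definition standard_module ::
  "'x set \<Rightarrow> ('x \<Rightarrow> 'x \<Rightarrow> bool) \<Rightarrow> ('k, 'l) module \<Rightarrow> ('x \<Rightarrow> 'l) \<Rightarrow> 'x \<Rightarrow> ('l, 'l set) module" where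
  "standard_module Z lt L e \<nu> =
     quotient_module (left_proj L (e \<nu>)) (greater_trace Z lt L e \<nu>)"

definition composition_factors_below ::
  "'x set \<Rightarrow> ('x \<Rightarrow> 'x \<Rightarrow> bool) \<Rightarrow> ('k, 'l) module \<Rightarrow> ('x \<Rightarrow> 'l) \<Rightarrow> 'x \<Rightarrow> ('l, 'm) module \<Rightarrow> bool" where
  "composition_factors_below Z lt L e \<nu> M \<longleftrightarrow>
     (\<forall>U V. submodule U L M \<longrightarrow> submodule V L M \<longrightarrow> U \<subseteq> V \<longrightarrow>
        simple_module L (quotient_module (M\<lparr>carrier := V\<rparr>) U) \<longrightarrow>
        (\<exists>\<mu>\<in>Z. lt \<mu> \<nu> \<and> lmod_iso L (quotient_module (M\<lparr>carrier := V\<rparr>) U) (simple_top L e \<mu>)))"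

definition standard_filtration_above ::
  "'x set \<Rightarrow> ('x \<Rightarrow> 'x \<Rightarrow> bool) \<Rightarrow> ('k, 'l) module \<Rightarrow> ('x \<Rightarrow> 'l) \<Rightarrow> 'x \<Rightarrow> ('l, 'm) module \<Rightarrow> bool" where
  "standard_filtration_above Z lt L e \<nu> M \<longleftrightarrow>
     (\<exists>(n::nat) U. U 0 = {\<zero>\<^bsub>M\<^esub>} \<and> U n = carrier M \<and> (\<forall>i\<le>n. submodule (U i) L M) \<and>
        (\<forall>i<n. U i \<subseteq> U (Suc i) \<and>
           (\<exists>\<mu>\<in>Z. lt \<nu> \<mu> \<and>
              lmod_iso L (quotient_module (M\<lparr>carrier := U (Suc i)\<rparr>) (U i))
                (standard_module Z lt L e \<mu>))))"

text \<open>
  The kernel of \<open>\<Delta> \<nu> \<rightarrow> L \<nu>\<close> has only composition factors \<open>L \<mu>\<close> with \<open>\<mu> < \<nu>\<close>, and the kernel of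
  \<open>P \<nu> \<rightarrow> \<Delta> \<nu>\<close> has a finite filtration with factors \<open>\<Delta> \<mu>\<close>, \<open>\<mu> > \<nu>\<close>.
\<close>

definition quasi_hereditary ::
  "'x set \<Rightarrow> ('x \<Rightarrow> 'x \<Rightarrow> bool) \<Rightarrow> ('k, 'l) module \<Rightarrow> ('x \<Rightarrow> 'l) \<Rightarrow> bool" where
  "quasi_hereditary Z lt L e \<longleftrightarrow>
     (\<forall>\<nu>\<in>Z.
        lmod_iso L
          (quotient_module (standard_module Z lt L e \<nu>)
             (module_radical L (standard_module Z lt L e \<nu>)))
          (simple_top L e \<nu>) \<and>
        composition_factors_below Z lt L e \<nu>
          ((standard_module Z lt L e \<nu>)
             \<lparr>carrier := module_radical L (standard_module Z lt L e \<nu>)\<rparr>) \<and>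
        standard_filtration_above Z lt L e \<nu>
          ((left_proj L (e \<nu>))\<lparr>carrier := greater_trace Z lt L e \<nu>\<rparr>))"

definition directed_algebra ::
  "'x set \<Rightarrow> ('x \<Rightarrow> 'x \<Rightarrow> bool) \<Rightarrow> ('k, 'l) module \<Rightarrow> ('x \<Rightarrow> 'l) \<Rightarrow> bool" where
  "directed_algebra Z lt L e \<longleftrightarrow>
     quasi_hereditary Z lt L e \<and> (\<forall>\<nu>\<in>Z. simple_module L (standard_module Z lt L e \<nu>))"


section \<open>Induction along a subalgebra\<close>

definition tensor_group ::
  "('k, 'l) module \<Rightarrow> ('l, 'm) module \<Rightarrow> ('l \<times> 'm \<Rightarrow>\<^sub>0 int) monoid" where
  "tensor_group L M = free_Abelian_group (carrier L \<times> carrier M)"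

definition tensor_relations ::
  "('k, 'l) module \<Rightarrow> 'l set \<Rightarrow> ('l, 'm) module \<Rightarrow> ('l \<times> 'm \<Rightarrow>\<^sub>0 int) set" where
  "tensor_relations L B M =
     generate (tensor_group L M)
       ({frag_of (x \<oplus>\<^bsub>L\<^esub> y, m) - frag_of (x, m) - frag_of (y, m) |x y m.
           x \<in> carrier L \<and> y \<in> carrier L \<and> m \<in> carrier M} \<union>
        {frag_of (x, m \<oplus>\<^bsub>M\<^esub> n) - frag_of (x, m) - frag_of (x, n) |x m n.
           x \<in> carrier L \<and> m \<in> carrier M \<and> n \<in> carrier M} \<union>
        {frag_of (x \<otimes>\<^bsub>L\<^esub> b, m) - frag_of (x, b \<odot>\<^bsub>M\<^esub> m) |x b m.
           x \<in> carrier L \<and> b \<in> B \<and> m \<in> carrier M})"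

definition tensor_module ::
  "('k, 'l) module \<Rightarrow> 'l set \<Rightarrow> ('l, 'm) module \<Rightarrow> ('l, ('l \<times> 'm \<Rightarrow>\<^sub>0 int) set) module" where
  "tensor_module L B M =
     \<lparr>carrier = rcosets\<^bsub>tensor_group L M\<^esub> (tensor_relations L B M),
      monoid.mult = undefined, one = undefined,
      ring.zero = tensor_relations L B M,
      ring.add = set_mult (tensor_group L M),
      smult = (\<lambda>a Z. \<Union>c\<in>Z. tensor_relations L B M #>\<^bsub>tensor_group L M\<^esub>
                 frag_extend (\<lambda>(x, m). frag_of (a \<otimes>\<^bsub>L\<^esub> x, m)) c)\<rparr>"

definition tensor_map ::
  "('k, 'l) module \<Rightarrow> 'l set \<Rightarrow> ('l, 'n) module \<Rightarrow> ('m \<Rightarrow> 'n) \<Rightarrow>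
     ('l \<times> 'm \<Rightarrow>\<^sub>0 int) set \<Rightarrow> ('l \<times> 'n \<Rightarrow>\<^sub>0 int) set" where
  "tensor_map L B N h =
     (\<lambda>Z. \<Union>c\<in>Z. tensor_relations L B N #>\<^bsub>tensor_group L N\<^esub>
        frag_extend (\<lambda>(x, m). frag_of (x, h m)) c)"

definition short_exact ::
  "('k, 'l) module \<Rightarrow> ('l, 'm1) module \<Rightarrow> ('m1 \<Rightarrow> 'm2) \<Rightarrow> ('l, 'm2) module \<Rightarrow> ('m2 \<Rightarrow> 'm3) \<Rightarrow>
     ('l, 'm3) module \<Rightarrow> bool" where
  "short_exact L M1 f M2 g M3 \<longleftrightarrow>
     f \<in> lmod_hom L M1 M2 \<and> g \<in> lmod_hom L M2 M3 \<and>
     inj_on f (carrier M1) \<and> g ` carrier M2 = carrier M3 \<and>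
     f ` carrier M1 = {x \<in> carrier M2. g x = \<zero>\<^bsub>M3\<^esub>}"

text \<open>
  Exactness of \<open>L \<otimes>\<^sub>B _\<close>.  HOL cannot quantify over types inside a formula, so the type \<open>'m\<close> carrying
  the modules is a parameter; statements leave it arbitrary, hence quantify over all modules.
  (Any short exact sequence can be transported to modules carried by one common type.)
\<close>

definition induction_exact :: "'m itself \<Rightarrow> ('k, 'l) module \<Rightarrow> 'l set \<Rightarrow> bool" where
  "induction_exact _ L B \<longleftrightarrow>
     (\<forall>(M1 :: ('l, 'm) module) f (M2 :: ('l, 'm) module) g (M3 :: ('l, 'm) module).
        left_module (L\<lparr>carrier := B\<rparr>) M1 \<longrightarrow> left_module (L\<lparr>carrier := B\<rparr>) M2 \<longrightarrow>
        left_module (L\<lparr>carrier := B\<rparr>) M3 \<longrightarrow> short_exact (L\<lparr>carrier := B\<rparr>) M1 f M2 g M3 \<longrightarrow>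
        short_exact L (tensor_module L B M1) (tensor_map L B M2 f) (tensor_module L B M2)
          (tensor_map L B M3 g) (tensor_module L B M3))"


section \<open>Exact Borel subalgebras and \<open>\<Delta>\<close>-subalgebras\<close>

text \<open>
  \<open>e\<close> and \<open>f\<close> label the primitive idempotents, hence the simple modules, of \<open>L\<close> and of \<open>B\<close> by the same
  set \<open>Z\<close>.  That \<open>L\<close> is itself quasi-hereditary is a standing assumption on \<open>L\<close>, not a condition
  on \<open>B\<close>, and is not part of the definition.
\<close>

definition exact_Borel_subalgebra ::
  "'m itself \<Rightarrow> 'k ring \<Rightarrow> 'x set \<Rightarrow> ('x \<Rightarrow> 'x \<Rightarrow> bool) \<Rightarrow> ('k, 'l) module \<Rightarrow> ('x \<Rightarrow> 'l) \<Rightarrow>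
     'l set \<Rightarrow> ('x \<Rightarrow> 'l) \<Rightarrow> bool" where
  "exact_Borel_subalgebra T K Z lt L e B f \<longleftrightarrow>
     subalgebra K L B \<and>
     basic_family L Z e \<and> basic_family (L\<lparr>carrier := B\<rparr>) Z f \<and>
     directed_algebra Z lt (L\<lparr>carrier := B\<rparr>) f \<and>
     induction_exact T L B \<and>
     (\<forall>\<nu>\<in>Z. lmod_iso L (tensor_module L B (simple_top (L\<lparr>carrier := B\<rparr>) f \<nu>))
               (standard_module Z lt L e \<nu>))"

definition strong_exact_Borel_subalgebra ::
  "'m itself \<Rightarrow> 'k ring \<Rightarrow> 'x set \<Rightarrow> ('x \<Rightarrow> 'x \<Rightarrow> bool) \<Rightarrow> ('k, 'l) module \<Rightarrow> ('x \<Rightarrow> 'l) \<Rightarrow>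
     'l set \<Rightarrow> ('x \<Rightarrow> 'l) \<Rightarrow> bool" where
  "strong_exact_Borel_subalgebra T K Z lt L e B f \<longleftrightarrow>
     exact_Borel_subalgebra T K Z lt L e B f \<and>
     (\<exists>S. maximal_semisimple_subalgebra K L S \<and> S \<subseteq> B)"

definition strong_exact_Delta_subalgebra ::
  "'m itself \<Rightarrow> 'k ring \<Rightarrow> 'x set \<Rightarrow> ('x \<Rightarrow> 'x \<Rightarrow> bool) \<Rightarrow> ('k, 'l) module \<Rightarrow> ('x \<Rightarrow> 'l) \<Rightarrow>
     'l set \<Rightarrow> ('x \<Rightarrow> 'l) \<Rightarrow> bool" where
  "strong_exact_Delta_subalgebra T K Z lt L e B f \<longleftrightarrow>
     strong_exact_Borel_subalgebra T K Z lt (opposite L) e B f"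


section \<open>Filtered algebras\<close>

record ('a, 'm) bimodule = "('a, 'm) module" +
  rsmult :: "'m \<Rightarrow> 'a \<Rightarrow> 'm"

definition subbimodule :: "'m set \<Rightarrow> ('k, 'a) module \<Rightarrow> ('a, 'm) bimodule \<Rightarrow> bool" where
  "subbimodule U A M \<longleftrightarrow>
     subgroup U (add_monoid M) \<and>
     (\<forall>a\<in>carrier A. \<forall>x\<in>U. a \<odot>\<^bsub>M\<^esub> x \<in> U \<and> rsmult M x a \<in> U)"

definition semisimple_bimodule :: "('k, 'a) module \<Rightarrow> ('a, 'm) bimodule \<Rightarrow> bool" where
  "semisimple_bimodule A M \<longleftrightarrow>
     (\<forall>U. subbimodule U A M \<longrightarrow>
        (\<exists>W. subbimodule W A M \<and> U \<inter> W = {\<zero>\<^bsub>M\<^esub>} \<and> U <+>\<^bsub>M\<^esub> W = carrier M))"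

definition ideal_factor_bimodule ::
  "('k, 'a) module \<Rightarrow> 'a set \<Rightarrow> 'a set \<Rightarrow> ('a, 'a set) bimodule" where
  "ideal_factor_bimodule A I J =
     \<lparr>carrier = {J +>\<^bsub>A\<^esub> x |x. x \<in> I}, monoid.mult = undefined, one = undefined, ring.zero = J,
      ring.add = set_add A,
      smult = (\<lambda>a Z. \<Union>x\<in>Z. J +>\<^bsub>A\<^esub> (a \<otimes>\<^bsub>A\<^esub> x)),
      rsmult = (\<lambda>Z a. \<Union>x\<in>Z. J +>\<^bsub>A\<^esub> (x \<otimes>\<^bsub>A\<^esub> a))\<rparr>"

definition semisimple_filtration :: "('k, 'a) module \<Rightarrow> (nat \<Rightarrow> 'a set) \<Rightarrow> nat \<Rightarrow> bool" where
  "semisimple_filtration A I N \<longleftrightarrow>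
     0 < N \<and> (\<forall>i. ideal (I i) A) \<and>
     I 0 = carrier A \<and> (\<forall>i<N. I (Suc i) \<subset> I i) \<and> (\<forall>m\<ge>N. I m = {\<zero>\<^bsub>A\<^esub>}) \<and>
     (\<forall>i j. \<forall>x\<in>I i. \<forall>y\<in>I j. x \<otimes>\<^bsub>A\<^esub> y \<in> I (i + j)) \<and>
     (\<forall>i<N. semisimple_bimodule A (ideal_factor_bimodule A (I i) (I (Suc i))))"

definition jacobson_radical :: "('k, 'a) module \<Rightarrow> 'a set" where
  "jacobson_radical A = module_radical A (regular_module A)"

primrec radical_power :: "('k, 'a) module \<Rightarrow> nat \<Rightarrow> 'a set" where
  "radical_power A 0 = carrier A"
| "radical_power A (Suc j) = radical_power A j \<cdot>\<^bsub>A\<^esub> jacobson_radical A"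

definition radical_nilpotency :: "('k, 'a) module \<Rightarrow> nat" where
  "radical_nilpotency A = (LEAST m. radical_power A m = {\<zero>\<^bsub>A\<^esub>})"


section \<open>The matrix algebra of a filtered algebra\<close>

text \<open>
  The entry in position \<open>(r, c)\<close> ranges over the quotient of \<open>entry_num\<close> by \<open>entry_den\<close> and is stored
  as a coset: \<open>I (r - c) / 0\<close> below the diagonal, \<open>E / I (N - (c - r))\<close> for \<open>0 \<le> c - r < N\<close>, and \<open>E / E = 0\<close>
  further to the right.
\<close>

definition entry_num :: "('k, 'a) module \<Rightarrow> (nat \<Rightarrow> 'a set) \<Rightarrow> int \<Rightarrow> int \<Rightarrow> 'a set" where
  "entry_num E I r c = (if r > c then I (nat (r - c)) else carrier E)"

definition entry_den :: "('k, 'a) module \<Rightarrow> (nat \<Rightarrow> 'a set) \<Rightarrow> nat \<Rightarrow> int \<Rightarrow> int \<Rightarrow> 'a set" where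
  "entry_den E I N r c =
     (if r > c then {\<zero>\<^bsub>E\<^esub>}
      else if c - r < int N then I (nat (int N - (c - r)))
      else carrier E)"

type_synonym 'a coset_matrix = "int \<Rightarrow> int \<Rightarrow> 'a set"

text \<open>
  Products of entries are computed on representatives; the result does not depend on their choice
  because \<open>I i I j \<subseteq> I (i + j)\<close>.
\<close>

definition matrix_algebra ::
  "('k, 'a) module \<Rightarrow> (nat \<Rightarrow> 'a set) \<Rightarrow> nat \<Rightarrow> ('k, 'a coset_matrix) module" where
  "matrix_algebra E I N =
     \<lparr>carrier = {Z. (\<forall>r c. Z r c \<in> {entry_den E I N r c +>\<^bsub>E\<^esub> x |x. x \<in> entry_num E I r c}) \<and>
                    finite {(r, c). Z r c \<noteq> entry_den E I N r c}},
      monoid.mult = (\<lambda>Z Y r d. entry_den E I N r d +>\<^bsub>E\<^esub>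
                (\<Oplus>\<^bsub>E\<^esub>c\<in>{c. Z r c \<noteq> entry_den E I N r c}.
                   (SOME x. x \<in> Z r c) \<otimes>\<^bsub>E\<^esub> (SOME y. y \<in> Y c d))),
      one = undefined,
      ring.zero = entry_den E I N,
      ring.add = (\<lambda>Z Y r c. Z r c <+>\<^bsub>E\<^esub> Y r c),
      smult = (\<lambda>k Z r c. \<Union>x\<in>Z r c. entry_den E I N r c +>\<^bsub>E\<^esub> (k \<odot>\<^bsub>E\<^esub> x))\<rparr>"

definition diagonal_entry ::
  "('k, 'a) module \<Rightarrow> (nat \<Rightarrow> 'a set) \<Rightarrow> nat \<Rightarrow> ('v \<Rightarrow> 'a) \<Rightarrow> 'v \<times> int \<Rightarrow> 'a coset_matrix" where
  "diagonal_entry E I N e =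
     (\<lambda>(k, i) r c. entry_den E I N r c +>\<^bsub>E\<^esub> (if r = i \<and> c = i then e k else \<zero>\<^bsub>E\<^esub>))"

definition band_subalgebra ::
  "('k, 'a) module \<Rightarrow> (nat \<Rightarrow> 'a set) \<Rightarrow> nat \<Rightarrow> 'a set \<Rightarrow> 'a coset_matrix set" where
  "band_subalgebra E I N S =
     {Z \<in> carrier (matrix_algebra E I N).
        \<forall>r c. if 0 \<le> c - r \<and> c - r \<le> int N - 1
              then Z r c \<in> {entry_den E I N r c +>\<^bsub>E\<^esub> s |s. s \<in> S}
              else Z r c = entry_den E I N r c}"


section \<open>Trivial extensions\<close>

definition restricted_dual ::
  "'k ring \<Rightarrow> ('k, 'l) module \<Rightarrow> 'x set \<Rightarrow> ('x \<Rightarrow> 'l) \<Rightarrow> ('l \<Rightarrow> 'k) set" where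
  "restricted_dual K L Z e =
     {\<phi> \<in> carrier L \<rightarrow>\<^sub>E carrier K.
        (\<forall>a\<in>carrier L. \<forall>b\<in>carrier L. \<phi> (a \<oplus>\<^bsub>L\<^esub> b) = \<phi> a \<oplus>\<^bsub>K\<^esub> \<phi> b) \<and>
        (\<forall>k\<in>carrier K. \<forall>a\<in>carrier L. \<phi> (k \<odot>\<^bsub>L\<^esub> a) = k \<otimes>\<^bsub>K\<^esub> \<phi> a) \<and>
        finite {(\<mu>, \<nu>). \<mu> \<in> Z \<and> \<nu> \<in> Z \<and>
                  (\<exists>a\<in>carrier L. \<phi> (e \<mu> \<otimes>\<^bsub>L\<^esub> a \<otimes>\<^bsub>L\<^esub> e \<nu>) \<noteq> \<zero>\<^bsub>K\<^esub>)}}"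

text \<open>The bimodule structure on the dual is \<open>(a \<phi>) c = \<phi> (c a)\<close> and \<open>(\<phi> b) c = \<phi> (b c)\<close>.\<close>

definition trivial_extension ::
  "'k ring \<Rightarrow> ('k, 'l) module \<Rightarrow> 'x set \<Rightarrow> ('x \<Rightarrow> 'l) \<Rightarrow> ('k, 'l \<times> ('l \<Rightarrow> 'k)) module" where
  "trivial_extension K L Z e =
     \<lparr>carrier = carrier L \<times> restricted_dual K L Z e,
      monoid.mult = (\<lambda>(a, \<phi>) (b, \<psi>).
                (a \<otimes>\<^bsub>L\<^esub> b, \<lambda>c\<in>carrier L. \<psi> (c \<otimes>\<^bsub>L\<^esub> a) \<oplus>\<^bsub>K\<^esub> \<phi> (b \<otimes>\<^bsub>L\<^esub> c))),
      one = undefined,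
      ring.zero = (\<zero>\<^bsub>L\<^esub>, \<lambda>c\<in>carrier L. \<zero>\<^bsub>K\<^esub>),
      ring.add = (\<lambda>(a, \<phi>) (b, \<psi>). (a \<oplus>\<^bsub>L\<^esub> b, \<lambda>c\<in>carrier L. \<phi> c \<oplus>\<^bsub>K\<^esub> \<psi> c)),
      smult = (\<lambda>k (a, \<phi>). (k \<odot>\<^bsub>L\<^esub> a, \<lambda>c\<in>carrier L. k \<otimes>\<^bsub>K\<^esub> \<phi> c))\<rparr>"

definition ext_embed :: "'k ring \<Rightarrow> ('k, 'l) module \<Rightarrow> 'l \<Rightarrow> 'l \<times> ('l \<Rightarrow> 'k)" where
  "ext_embed K L a = (a, \<lambda>c\<in>carrier L. \<zero>\<^bsub>K\<^esub>)"


section \<open>Quivers with relations\<close>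

text \<open>
  A path is a pair of its starting vertex and its list of arrows in the order of traversal.  Products
  are written like compositions of maps: \<open>f g\<close> is first \<open>g\<close>, then \<open>f\<close>, so that an arrow \<open>k \<rightarrow> l\<close> lies in
  \<open>e\<^sub>l A e\<^sub>k\<close>.
\<close>

definition quiver_paths :: "('v, 'q) pre_digraph \<Rightarrow> ('v \<times> 'q list) set" where
  "quiver_paths Q = {(u, p). \<exists>v. pre_digraph.awalk Q u p v}"

definition path_algebra ::
  "'k ring \<Rightarrow> ('v, 'q) pre_digraph \<Rightarrow> ('k, 'v \<times> 'q list \<Rightarrow> 'k) module" where
  "path_algebra K Q =
     \<lparr>carrier = {f. (\<forall>w\<in>quiver_paths Q. f w \<in> carrier K) \<and> (\<forall>w. w \<notin> quiver_paths Q \<longrightarrow> f w = \<zero>\<^bsub>K\<^esub>) \<and>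
                    finite {w. f w \<noteq> \<zero>\<^bsub>K\<^esub>}},
      monoid.mult = (\<lambda>f g (u, p). \<Oplus>\<^bsub>K\<^esub>i\<in>{..length p}.
                f (pre_digraph.awlast Q u (take i p), drop i p) \<otimes>\<^bsub>K\<^esub> g (u, take i p)),
      one = (\<lambda>(u, p). if p = [] \<and> u \<in> verts Q then \<one>\<^bsub>K\<^esub> else \<zero>\<^bsub>K\<^esub>),
      ring.zero = (\<lambda>w. \<zero>\<^bsub>K\<^esub>),
      ring.add = (\<lambda>f g w. f w \<oplus>\<^bsub>K\<^esub> g w),
      smult = (\<lambda>k f w. k \<otimes>\<^bsub>K\<^esub> f w)\<rparr>"

definition path_algebra_vertex :: "'k ring \<Rightarrow> 'v \<Rightarrow> 'v \<times> 'q list \<Rightarrow> 'k" where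
  "path_algebra_vertex K v = (\<lambda>w. if w = (v, []) then \<one>\<^bsub>K\<^esub> else \<zero>\<^bsub>K\<^esub>)"

definition arrow_ideal_power ::
  "'k ring \<Rightarrow> ('v, 'q) pre_digraph \<Rightarrow> nat \<Rightarrow> ('v \<times> 'q list \<Rightarrow> 'k) set" where
  "arrow_ideal_power K Q m =
     {f \<in> carrier (path_algebra K Q). \<forall>u p. f (u, p) \<noteq> \<zero>\<^bsub>K\<^esub> \<longrightarrow> m \<le> length p}"

text \<open>
  The relations generate an admissible ideal; for a finite quiver this makes the quotient a
  finite-dimensional algebra whose quiver is the given one.
\<close>

definition admissible_relations ::
  "'k ring \<Rightarrow> ('v, 'q) pre_digraph \<Rightarrow> ('v \<times> 'q list \<Rightarrow> 'k) set \<Rightarrow> bool" where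
  "admissible_relations K Q R \<longleftrightarrow>
     R \<subseteq> arrow_ideal_power K Q 2 \<and> (\<exists>m. arrow_ideal_power K Q m \<subseteq> Idl\<^bsub>path_algebra K Q\<^esub> R)"

definition quotient_algebra :: "('k, 'a) module \<Rightarrow> 'a set \<Rightarrow> ('k, 'a set) module" where
  "quotient_algebra A J =
     \<lparr>carrier = a_rcosets\<^bsub>A\<^esub> J, monoid.mult = rcoset_mult A J, one = J +>\<^bsub>A\<^esub> \<one>\<^bsub>A\<^esub>,
      ring.zero = J, ring.add = set_add A, smult = (\<lambda>k Z. \<Union>x\<in>Z. J +>\<^bsub>A\<^esub> (k \<odot>\<^bsub>A\<^esub> x))\<rparr>"

text \<open>
  The new vertex attached to \<open>k\<close> is \<open>Inr k\<close>, and the new arrow from \<open>Inl k\<close> to it is \<open>Inr k\<close> as well.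
\<close>

definition extended_quiver :: "('v, 'q) pre_digraph \<Rightarrow> ('v + 'v, 'q + 'v) pre_digraph" where
  "extended_quiver Q =
     \<lparr>verts = Inl ` verts Q \<union> Inr ` verts Q, arcs = Inl ` arcs Q \<union> Inr ` verts Q,
      tail = case_sum (\<lambda>a. Inl (tail Q a)) Inl, head = case_sum (\<lambda>a. Inl (head Q a)) Inr\<rparr>"

definition lift_relation ::
  "'k ring \<Rightarrow> ('v \<times> 'q list \<Rightarrow> 'k) \<Rightarrow> ('v + 'v) \<times> ('q + 'v) list \<Rightarrow> 'k" where
  "lift_relation K f =
     (\<lambda>(u, p). if isl u \<and> list_all isl p then f (projl u, map projl p) else \<zero>\<^bsub>K\<^esub>)"

definition extended_ideal ::
  "'k ring \<Rightarrow> ('v, 'q) pre_digraph \<Rightarrow> ('v \<times> 'q list \<Rightarrow> 'k) set \<Rightarrow>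
     (('v + 'v) \<times> ('q + 'v) list \<Rightarrow> 'k) set" where
  "extended_ideal K Q R = Idl\<^bsub>path_algebra K (extended_quiver Q)\<^esub> (lift_relation K ` R)"

definition extended_algebra ::
  "'k ring \<Rightarrow> ('v, 'q) pre_digraph \<Rightarrow> ('v \<times> 'q list \<Rightarrow> 'k) set \<Rightarrow>
     ('k, (('v + 'v) \<times> ('q + 'v) list \<Rightarrow> 'k) set) module" where
  "extended_algebra K Q R =
     quotient_algebra (path_algebra K (extended_quiver Q)) (extended_ideal K Q R)"

definition extended_idempotent ::
  "'k ring \<Rightarrow> ('v, 'q) pre_digraph \<Rightarrow> ('v \<times> 'q list \<Rightarrow> 'k) set \<Rightarrow> 'v + 'v \<Rightarrow>
     (('v + 'v) \<times> ('q + 'v) list \<Rightarrow> 'k) set" where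
  "extended_idempotent K Q R v =
     extended_ideal K Q R +>\<^bsub>path_algebra K (extended_quiver Q)\<^esub> path_algebra_vertex K v"

definition extended_semisimple ::
  "'k ring \<Rightarrow> ('v, 'q) pre_digraph \<Rightarrow> ('v \<times> 'q list \<Rightarrow> 'k) set \<Rightarrow>
     (('v + 'v) \<times> ('q + 'v) list \<Rightarrow> 'k) set set" where
  "extended_semisimple K Q R =
     generated_submodule K (extended_algebra K Q R)
       (extended_idempotent K Q R ` verts (extended_quiver Q))"

definition extended_matrix_algebra where
  "extended_matrix_algebra K Q R =
     matrix_algebra (extended_algebra K Q R) (radical_power (extended_algebra K Q R))
       (radical_nilpotency (extended_algebra K Q R))"

definition extended_matrix_idempotent where
  "extended_matrix_idempotent K Q R =
     diagonal_entry (extended_algebra K Q R) (radical_power (extended_algebra K Q R))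
       (radical_nilpotency (extended_algebra K Q R)) (extended_idempotent K Q R)"

definition extended_band_subalgebra where
  "extended_band_subalgebra K Q R =
     band_subalgebra (extended_algebra K Q R) (radical_power (extended_algebra K Q R))
       (radical_nilpotency (extended_algebra K Q R)) (extended_semisimple K Q R)"

definition extended_trivial_extension where
  "extended_trivial_extension K Q R =
     trivial_extension K (extended_matrix_algebra K Q R)
       (verts (extended_quiver Q) \<times> UNIV) (extended_matrix_idempotent K Q R)"


section \<open>The first order\<close>

definition first_order :: "'v \<times> int \<Rightarrow> 'v \<times> int \<Rightarrow> bool" where
  "first_order = (\<lambda>(l, j) (k, i). j < i)"

definition first_order_ext :: "('v + 'v) \<times> int \<Rightarrow> ('v + 'v) \<times> int \<Rightarrow> bool" where
  "first_order_ext = (\<lambda>(l, j) (k, i). j < i \<or> i = j \<and> isl k \<and> \<not> isl l)"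

end

theory Submission
  imports Defs
begin
text \<open>
A \<open>\<Delta>\<close>-subalgebra is an exact Borel subalgebra of the opposite algebra, so everything is proved for left
modules over an algebra \<open>L\<close> with locally orthogonal idempotents \<open>e (v, i)\<close>, and \<open>opposite\<close> is applied at the end.

The subalgebra \<open>B\<close> has a basis of matrix units \<open>b v j i\<close> for \<open>i \<le> j < i + N\<close>, multiplying like
paths of a linear quiver in which \<open>N\<close> consecutive arrows compose to zero (locale \<open>banded\<close>).
So the projectives of \<open>B\<close> are uniserial and \<open>B\<close> is directed. The hypothesis \<open>trace_step\<close> says that
every element of \<open>e (w, j) L e (v, i)\<close> with \<open>(w, j) > (v, i)\<close> is a left multiple of the one step
\<open>b v (i + 1) i\<close>. Hence the trace of the larger projectives in \<open>L e (v, i)\<close> is \<open>L b v (i + 1) i\<close>, and in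
\<open>B e (v, i)\<close> it is \<open>B b v (i + 1) i\<close>: the standard module of \<open>L\<close> is induced from the simple module
of \<open>B\<close>. Induction is exact as soon as \<open>L\<close> is projective over \<open>B\<close> on the right, which is witnessed
by a dual basis \<open>x = \<Sum> g t \<cdot> bt t x\<close> (locale \<open>dual_basis\<close>); \<open>strong_exact_Borel\<close> combines both.

For the matrix algebra of a filtered algebra choose elements \<open>x t\<close> of exact degree \<open>dg t\<close> and functionals
\<open>kp t\<close> giving coordinates compatible with the filtration (locale \<open>adapted\<close>). Placing \<open>x t\<close> at
\<open>(c + dg t, c)\<close>, as low as its degree allows, gives the \<open>g\<close>'s, because the row moves of the band
subalgebra carry it to all positions of column \<open>c\<close> where it is not zero. In the trivial extension
the dual bimodule needs further basis elements: the coordinate functionals of \<open>x t\<close> read off in the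
last column where they are defined.

It remains to place both algebras in this situation. In the first part the given primitive
idempotents of \<open>S\<close> need corners \<open>K\<close> in \<open>S\<close>. A complete system \<open>P\<close> of primitive idempotents of the basic algebra is
conjugated into \<open>S\<close> by the unipotent element \<open>\<Sum> sp p \<cdot> p\<close>, with \<open>sp\<close> the projection to \<open>S\<close>; a nonzero corner element of \<open>S\<close>
is invertible, so the corners are division algebras, and those are \<open>K\<close> by algebraic closedness. In the second part the
Jacobson radical of the extended quiver algebra is generated by the arrows, and
the extra comparisons of old and new vertices are harmless because no path leads from a
new vertex to an old one.

Notation: \<open>x *[R] y\<close>, \<open>x +[R] y\<close>, \<open>k .*[R] x\<close>, \<open>0[R]\<close> are the operations of the structure \<open>R\<close>, and
\<open>S[R, F] %i. f i\<close> is a finite sum in \<open>R\<close>. For the structure \<open>L\<close> in focus these become \<open>x *L y\<close>, \<open>x +L y\<close>,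
\<open>k .*L x\<close>, \<open>0L\<close>, and \<open>|L|\<close> is its carrier; likewise for \<open>E\<close>, \<open>C\<close>, \<open>D\<close>, \<open>PA\<close>, \<open>PX\<close>.
\<close>

abbreviation (input) substructure (infixl "<|" 900) where "M <| U \<equiv> M\<lparr>carrier := U\<rparr>"
abbreviation (input) iff_ascii (infixr "<->" 25) where "P <-> Q \<equiv> P = Q"
abbreviation (input) mult_in ("_ *[_] _" [70, 0, 71] 70) where "x *[R] y \<equiv> x \<otimes>\<^bsub>R\<^esub> y"
abbreviation (input) add_in ("_ +[_] _" [65, 0, 66] 65) where "x +[R] y \<equiv> x \<oplus>\<^bsub>R\<^esub> y"
abbreviation (input) minus_in ("_ -[_] _" [65, 0, 66] 65) where "x -[R] y \<equiv> x \<ominus>\<^bsub>R\<^esub> y"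
abbreviation (input) smult_in ("_ .*[_] _" [70, 0, 71] 70) where "k .*[R] x \<equiv> k \<odot>\<^bsub>R\<^esub> x"
abbreviation (input) coset_in ("_ +>[_] _" [60, 0, 61] 60) where "U +>[R] x \<equiv> U +>\<^bsub>R\<^esub> x"
abbreviation (input) zero_in ("0[_]") where "0[R] \<equiv> \<zero>\<^bsub>R\<^esub>"
abbreviation (input) one_in ("1[_]") where "1[R] \<equiv> \<one>\<^bsub>R\<^esub>"
abbreviation (input) sum_in ("S[_, _] _" [0, 0, 3] 10) where "S[R, F] f \<equiv> finsum R f F"

section \<open>Modules, submodules and quotients\<close>

context abelian_group begin

lemma add_coset_iff: "z : U +> x <-> (EX u:U. z = u \<oplus> x)"
 by (simp add: a_r_coset_def r_coset_def)

lemma add_coset_self: "additive_subgroup U G ==> x : carrier G ==> x : U +> x"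
 using additive_subgroup.zero_closed[of U G] by (auto simp: add_coset_iff intro!: bexI[of _ \<zero>])

lemma add_coset_eq_iff:
 assumes "additive_subgroup U G" "x : carrier G" "y : carrier G"
 shows "U +> x = U +> y <-> (EX u:U. x = u \<oplus> y)"
proof
 assume "U +> x = U +> y"
 hence "x : U +> y" using add_coset_self[of U x] assms by simp
 thus "EX u:U. x = u \<oplus> y" by (simp add: add_coset_iff)
next
 assume "EX u:U. x = u \<oplus> y"
 hence "x : U +> y" by (simp add: add_coset_iff)
 thus "U +> x = U +> y"
  using a_repr_independence[of x U y] assms by (simp add: additive_subgroup_def)
qed

lemma add_coset_eq_self_iff:
 assumes "additive_subgroup U G" "x : carrier G" shows "U +> x = U <-> x : U"
proof -
 have "U +> \<zero> = U" using assms additive_subgroup.a_Hcarr[OF assms(1)] by (auto simp: add_coset_iff)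
 hence "U +> x = U <-> (EX u:U. x = u \<oplus> \<zero>)" using add_coset_eq_iff[of U x \<zero>] assms by auto
 thus ?thesis using additive_subgroup.a_Hcarr[OF assms(1)] by auto
qed

end

text \<open>A group with operators. This much structure is what submodules and quotients need; it covers projectives, their
quotients and tensor products, over an algebra or over a subalgebra.\<close>

locale lact = abelian_group M for L :: "('k, 'l) module" and M :: "('l, 'm) module" (structure) +
 assumes act_closed [simp, intro]: "a : carrier L ==> x : carrier M ==> a \<odot> x : carrier M"
  and act_add: "a : carrier L ==> x : carrier M ==> y : carrier M ==> a \<odot> (x \<oplus> y) = a \<odot> x \<oplus> a \<odot> y"
begin
abbreviation "MC \<equiv> carrier M"

lemma act_zero [simp]: "a : carrier L ==> a \<odot> \<zero> = \<zero>"
 by (metis act_add act_closed add.l_cancel_one' zero_closed l_zero)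

lemma submodule_sub: "submodule U L M ==> x : U ==> x : MC"
 using submodule.axioms(1) subgroup.subset by fastforce

lemma submodule_zero: "submodule U L M ==> \<zero> : U"
 using submodule.axioms(1) subgroup.one_closed by fastforce

lemma submodule_add: "submodule U L M ==> x : U ==> y : U ==> x \<oplus> y : U"
 using submodule.axioms(1) subgroup.m_closed by fastforce

lemma submodule_act: "submodule U L M ==> a : carrier L ==> x : U ==> a \<odot> x : U"
 by (rule submodule.smult_closed)

lemma submodule_neg: "submodule U L M ==> x : U ==> \<ominus> x : U"
 using submodule.axioms(1) subgroup.m_inv_closed unfolding a_inv_def by fastforce

lemma submodule_cancel:
 assumes "submodule U L M" "x \<oplus> y : U" "x : U" "y : MC" shows "y : U"
proof -
 have "y = \<ominus> x \<oplus> (x \<oplus> y)" using assms submodule_sub by (simp add: add.m_assoc[symmetric] l_neg)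
 thus ?thesis using assms submodule_add submodule_neg by metis
qed

lemma submoduleI:
 assumes "U <= MC" "\<zero> : U" "!!x y. x : U ==> y : U ==> x \<oplus> y : U"
  "!!x. x : U ==> EX y:U. x \<oplus> y = \<zero>" "!!a x. a : carrier L ==> x : U ==> a \<odot> x : U"
 shows "submodule U L M"
proof (intro submodule.intro subgroup.intro submodule_axioms.intro)
 fix x assume x: "x : U"
 then obtain y where y: "y : U" "x \<oplus> y = \<zero>" using assms(4) by blast
 hence "\<ominus> x = y" using x assms(1) minus_equality[of y x] add.m_comm[of x y] by (auto simp: subset_iff)
 thus "inv\<^bsub>add_monoid M\<^esub> x : U" using y(1) by (simp add: a_inv_def)
qed (use assms in auto)

lemma submodule_zero_module: "submodule {\<zero>} L M"
 by (rule submoduleI) auto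

lemma lact_sub: "submodule U L M ==> lact L (M<|U)"
proof -
 assume U: "submodule U L M"
 have "group ((add_monoid M)\<lparr>carrier := U\<rparr>)"
  using U submodule.axioms(1) subgroup.subgroup_is_group a_group by blast
 hence "comm_group (add_monoid (M<|U))"
  using a_comm_group U submodule_sub
  by (intro group.group_comm_groupI) (auto simp: a_comm)
 hence "abelian_group (M<|U)"
  by (intro abelian_group.intro abelian_monoid.intro abelian_group_axioms.intro)
   (auto simp: comm_group_def)
 thus ?thesis
  by (intro lact.intro lact_axioms.intro) (use U submodule_act submodule_sub in \<open>auto simp: act_add\<close>)
qed

lemma additive_submodule: "submodule U L M ==> additive_subgroup U M"
 by (simp add: additive_subgroup_def submodule.axioms(1))

lemma abelian_submodule: "submodule U L M ==> abelian_subgroup U M"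
 by (intro abelian_subgroupI3 additive_submodule abelian_group_axioms)

lemmas coset_iff = add_coset_iff

lemmas coset_self = add_coset_self[OF additive_submodule]

lemmas coset_eq_iff = add_coset_eq_iff[OF additive_submodule]

lemmas coset_eq_self_iff = add_coset_eq_self_iff[OF additive_submodule]

lemma quotient_carrier: "carrier (quotient_module M U) = {U +> x |x. x : MC}"
 by (auto simp: quotient_module_def A_RCOSETS_def')

lemma quotient_add:
 "submodule U L M ==> x : MC ==> y : MC ==>
   (U +> x) +[quotient_module M U] (U +> y) = U +> (x \<oplus> y)"
 by (simp add: quotient_module_def abelian_subgroup.a_rcos_sum abelian_submodule)

lemma quotient_zero: "0[quotient_module M U] = U"
 by (simp add: quotient_module_def)

lemma quotient_act:
 assumes "submodule U L M" "x : MC" "a : carrier L"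
 shows "a .*[quotient_module M U] (U +> x) = U +> (a \<odot> x)"
proof -
 have eq: "U +> (a \<odot> z) = U +> (a \<odot> x)" if z: "z : U +> x" for z
 proof -
  obtain u where u: "u : U" "z = u \<oplus> x" using z by (auto simp: coset_iff)
  hence "a \<odot> z = a \<odot> u \<oplus> a \<odot> x" using assms submodule_sub by (simp add: act_add)
  thus ?thesis using coset_eq_iff[of U "a \<odot> z" "a \<odot> x"] u assms submodule_act submodule_sub by auto
 qed
 have "a .*[quotient_module M U] (U +> x) = (\<Union>z\<in>U +> x. U +> (a \<odot> z))"
  by (simp add: quotient_module_def)
 also have "... = (\<Union>z\<in>U +> x. U +> (a \<odot> x))"
  by (rule arg_cong[where f = Union], rule image_cong[OF refl], rule eq)
 also have "... = U +> (a \<odot> x)"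
  using coset_self[of U x] assms by blast
 finally show ?thesis .
qed

lemma quotient_coset_zero_iff:
 "submodule U L M ==> x : MC ==> U +> x = 0[quotient_module M U] <-> x : U"
 by (simp add: quotient_zero coset_eq_self_iff)

lemma lact_quotient: "submodule U L M ==> lact L (quotient_module M U)"
proof -
 assume U: "submodule U L M"
 have "abelian_group (quotient_module M U)"
 proof (rule abelian_groupI)
  fix x assume "x : carrier (quotient_module M U)"
  then obtain y where y: "y : MC" "x = U +> y" by (auto simp: quotient_carrier)
  have "(U +> \<ominus> y) +[quotient_module M U] x = 0[quotient_module M U]"
   using y U submodule_zero[OF U] by (simp add: quotient_add l_neg quotient_coset_zero_iff)
  thus "EX y:carrier (quotient_module M U). y +[quotient_module M U] x = 0[quotient_module M U]"
   using y by (intro bexI[of _ "U +> \<ominus> y"]) (auto simp: quotient_carrier)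
  have "U = U +> \<zero>" using U submodule_zero[OF U] coset_eq_self_iff[of U \<zero>] by simp
  thus "0[quotient_module M U] +[quotient_module M U] x = x"
   using y U quotient_add[of U \<zero> y] by (simp add: quotient_zero)
 next
  show "0[quotient_module M U] : carrier (quotient_module M U)"
   using coset_eq_self_iff[OF U, of \<zero>] submodule_zero[OF U] by (auto simp: quotient_carrier quotient_zero intro!: exI[of _ \<zero>])
 qed (use U in \<open>auto simp: quotient_carrier quotient_add a_ac\<close>)
 thus ?thesis
 proof (intro lact.intro lact_axioms.intro)
  fix a x y assume "a : carrier L" "x : carrier (quotient_module M U)" "y : carrier (quotient_module M U)"
  thus "a .*[quotient_module M U] (x +[quotient_module M U] y) =
   a .*[quotient_module M U] x +[quotient_module M U] a .*[quotient_module M U] y"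
   using U by (auto simp: quotient_carrier quotient_act quotient_add act_add)
 qed (use U in \<open>auto simp: quotient_carrier quotient_act\<close>)
qed

lemma generated_submodule_eqI:
 assumes "submodule W L M" "Y <= W" "!!U. submodule U L M ==> Y <= U ==> W <= U"
 shows "generated_submodule L M Y = W"
 using assms unfolding generated_submodule_def by blast

lemma quotient_iso:
 fixes M' :: "('l, 'n) module"
 assumes U: "submodule U L M" and h: "h : lmod_hom L M M'" and M': "lact L M'"
  and surj: "h ` MC = carrier M'" and ker: "!!x. x : MC ==> h x = 0[M'] <-> x : U"
 shows "lmod_iso L (quotient_module M U) M'"
proof -
 interpret M': lact L M' by fact
 define g where "g Z = h (SOME x. x : Z)" for Z
 have hadd: "h (x \<oplus> y) = h x +[M'] h y" if "x : MC" "y : MC" for x y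
  using h that by (auto simp: lmod_hom_def)
 have hc: "h x : carrier M'" if "x : MC" for x using h that by (auto simp: lmod_hom_def)
 have hu: "h (u \<oplus> x) = h x" if "u : U" "x : MC" for u x
  using that hadd[of u x] ker[of u] submodule_sub[OF U] hc by (auto simp: M'.l_zero)
 have g: "g (U +> x) = h x" if x: "x : MC" for x
 proof -
  have "x : U +> x" using assms x by (simp add: coset_self)
  hence "(SOME z. z : U +> x) : U +> x" by (rule someI)
  then obtain u where "u : U" "(SOME z. z : U +> x) = u \<oplus> x"
   using coset_iff by blast
  thus ?thesis using hu x by (simp add: g_def)
 qed
 have heq: "EX u:U. x = u \<oplus> y" if "x : MC" "y : MC" "h x = h y" for x y
 proof -
  have "h ((x \<oplus> \<ominus> y) \<oplus> y) = h (x \<oplus> \<ominus> y) +[M'] h y" using that hadd[of "x \<oplus> \<ominus> y" y] by simp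
  moreover have "(x \<oplus> \<ominus> y) \<oplus> y = x" using that by (simp add: a_assoc l_neg)
  ultimately have "h (x \<oplus> \<ominus> y) = 0[M']" using that hc
   using M'.add.r_cancel_one'[of "h y" "h (x \<oplus> \<ominus> y)"] by simp
  hence "x \<oplus> \<ominus> y : U" using ker[of "x \<oplus> \<ominus> y"] that by simp
  thus ?thesis using \<open>(x \<oplus> \<ominus> y) \<oplus> y = x\<close> by (intro bexI[of _ "x \<oplus> \<ominus> y"]) auto
 qed
 have "g : lmod_hom L (quotient_module M U) M'"
  using U h g hc by (auto simp: lmod_hom_def quotient_carrier quotient_add quotient_act)
 moreover have "inj_on g (carrier (quotient_module M U))"
 proof (rule inj_onI)
  fix Z Z' assume "Z : carrier (quotient_module M U)" "Z' : carrier (quotient_module M U)" "g Z = g Z'"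
  then obtain x y where "x : MC" "y : MC" "Z = U +> x" "Z' = U +> y" "h x = h y"
   using g by (auto simp: quotient_carrier)
  thus "Z = Z'" using heq[of x y] coset_eq_iff[OF U, of x y] by simp
 qed
 moreover have "g ` carrier (quotient_module M U) = carrier M'"
 proof -
  have "carrier (quotient_module M U) = (%x. U +> x) ` MC" by (auto simp: quotient_carrier)
  hence "g ` carrier (quotient_module M U) = (%x. g (U +> x)) ` MC" by (simp add: image_image)
  also have "... = h ` MC" using g by (intro image_cong) auto
  finally show ?thesis using surj by simp
 qed
 ultimately show ?thesis by (auto simp: lmod_iso_def bij_betw_def)
qed

lemma lmod_iso_sym:
 fixes M' :: "('l, 'n) module"
 assumes "lmod_iso L M M'" shows "lmod_iso L M' M"
proof -
 obtain h where h: "h : lmod_hom L M M'" and b: "bij_betw h (MC) (carrier M')"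
  using assms by (auto simp: lmod_iso_def)
 let ?g = "inv_into (MC) h"
 have gb: "bij_betw ?g (carrier M') (MC)" using b by (rule bij_betw_inv_into)
 have gh: "?g (h x) = x" if "x : MC" for x using b that by (simp add: bij_betw_inv_into_left)
 have im: "EX x:MC. z = h x" if "z : carrier M'" for z using b that by (auto simp: bij_betw_def)
 have "?g : lmod_hom L M' M"
  unfolding lmod_hom_def
 proof (intro CollectI conjI ballI)
  show "?g : carrier M' \<rightarrow> MC" using gb by (auto simp: bij_betw_def)
  fix x y assume "x : carrier M'" "y : carrier M'"
  then obtain x' y' where x': "x' : MC" "x = h x'" "y' : MC" "y = h y'" using im by blast
  hence "x +[M'] y = h (x' \<oplus> y')" using h by (auto simp: lmod_hom_def)
  thus "?g (x +[M'] y) = ?g x \<oplus> ?g y" using x' by (simp add: gh)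
 next
  fix a x assume a: "a : carrier L" and "x : carrier M'"
  then obtain x' where x': "x' : MC" "x = h x'" using im by blast
  hence "a .*[M'] x = h (a \<odot> x')" using h a by (auto simp: lmod_hom_def)
  thus "?g (a .*[M'] x) = a \<odot> ?g x" using x' a by (simp add: gh)
 qed
 thus ?thesis using gb by (auto simp: lmod_iso_def)
qed

end

lemma lact_left_module: "left_module L M ==> lact L M"
 by (auto simp: left_module_def lact_def lact_axioms_def)

section \<open>Nonunital algebras\<close>

text \<open>An associative algebra over a field, without unit: the algebras of finitely supported matrices have only local units.\<close>

locale nalg = module K L + field K for K :: "'k ring" (structure) and L :: "('k, 'l) module" (structure) +
 assumes mul_closed [simp, intro]: "x : carrier L ==> y : carrier L ==> x *[L] y : carrier L"
  and mul_assoc: "x : carrier L ==> y : carrier L ==> z : carrier L ==>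
   (x *[L] y) *[L] z = x *[L] (y *[L] z)"
  and mul_distl: "x : carrier L ==> y : carrier L ==> z : carrier L ==>
   (x +[L] y) *[L] z = x *[L] z +[L] y *[L] z"
  and mul_distr: "x : carrier L ==> y : carrier L ==> z : carrier L ==>
   x *[L] (y +[L] z) = x *[L] y +[L] x *[L] z"
  and mul_smult_l: "k : carrier K ==> x : carrier L ==> y : carrier L ==>
   (k .*[L] x) *[L] y = k .*[L] (x *[L] y)"
  and mul_smult_r: "k : carrier K ==> x : carrier L ==> y : carrier L ==>
   x *[L] (k .*[L] y) = k .*[L] (x *[L] y)"
begin
abbreviation "KC \<equiv> carrier K"
abbreviation carrier_L ("|L|") where "|L| \<equiv> carrier L"
abbreviation mult_L (infixl "*L" 70) where "x *L y \<equiv> x *[L] y"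
abbreviation add_L (infixl "+L" 65) where "x +L y \<equiv> x +[L] y"
abbreviation smult_L (infixl ".*L" 70) where "k .*L x \<equiv> k .*[L] x"
abbreviation zero_L ("0L") where "0L \<equiv> 0[L]"


lemma mul_zero_l [simp]: "x : |L| ==> 0L *L x = 0L"
 using mul_distl[of "0L" "0L" x] M.add.r_cancel_one'[of "0L *L x" "0L *L x"] by simp

lemma mul_zero_r [simp]: "x : |L| ==> x *L 0L = 0L"
 using mul_distr[of x "0L" "0L"] M.add.r_cancel_one'[of "x *L 0L" "x *L 0L"] by simp

lemma finsum_mul_l:
 "finite F ==> f : F \<rightarrow> |L| ==> x : |L| ==>
   (S[L, F] %i. f i) *L x = (S[L, F] %i. f i *L x)"
proof (induction F rule: finite_induct)
 case (insert i F)
 thus ?case by (subst M.finsum_insert; simp add: mul_distl Pi_iff)+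
qed simp

lemma finsum_mul_r:
 "finite F ==> f : F \<rightarrow> |L| ==> x : |L| ==>
   x *L (S[L, F] %i. f i) = (S[L, F] %i. x *L f i)"
proof (induction F rule: finite_induct)
 case (insert i F)
 thus ?case by (subst M.finsum_insert; simp add: mul_distr Pi_iff)+
qed simp

lemma neg_eq_smult: "x : |L| ==> \<ominus>\<^bsub>L\<^esub> x = (\<ominus> \<one>) .*L x"
 by (simp add: smult_l_minus)

lemma nalg_opposite: "nalg K (opposite L)"
proof -
 have "abelian_group (opposite L)"
  using M.abelian_group_axioms M.a_comm_group M.abelian_monoid_axioms
  by (simp add: opposite_def abelian_group_def abelian_group_axioms_def abelian_monoid_def comm_group_def
   Group.comm_monoid_def Group.monoid_def comm_monoid_axioms_def group_def group_axioms_def Units_def)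
 thus ?thesis
  by (intro nalg.intro module.intro module_axioms.intro nalg_axioms.intro R.is_cring field_axioms)
   (auto simp: opposite_def smult_l_distr smult_r_distr smult_assoc1 mul_assoc mul_distl mul_distr mul_smult_l mul_smult_r)
qed

lemma lact_regular: "lact L (regular_module L)"
proof -
 have "abelian_group (regular_module L)"
  by (rule abelian_groupI) (auto simp: regular_module_def M.a_ac intro!: bexI[of _ "\<ominus>\<^bsub>L\<^esub> _"] M.l_neg)
 thus ?thesis by (intro lact.intro lact_axioms.intro) (auto simp: regular_module_def mul_distr)
qed

lemma regular_sel [simp]:
 "carrier (regular_module L) = |L|" "ring.add (regular_module L) = ring.add L"
 "0[regular_module L] = 0L" "smult (regular_module L) = monoid.mult L"
 by (auto simp: regular_module_def)

lemma left_proj_sel [simp]: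
 "carrier (left_proj L x) = {a *L x |a. a : |L|}" "ring.add (left_proj L x) = ring.add L"
 "0[left_proj L x] = 0L" "smult (left_proj L x) = monoid.mult L"
 by (auto simp: left_proj_def regular_module_def)

lemma neg_mul: "x : |L| ==> y : |L| ==> (\<ominus>\<^bsub>L\<^esub> x) *L y = \<ominus>\<^bsub>L\<^esub> (x *L y)"
 by (simp add: neg_eq_smult mul_smult_l)

lemma submodule_left_ideal: "x : |L| ==> submodule {a *L x |a. a : |L|} L (regular_module L)"
proof -
 assume x: "x : |L|"
 interpret r: lact L "regular_module L" by (rule lact_regular)
 show ?thesis
 proof (rule r.submoduleI)
  fix y assume "y : {a *L x |a. a : |L|}"
  then obtain a where a: "a : |L|" "y = a *L x" by auto
  thus "EX z:{a *L x |a. a : |L|}. y +[regular_module L] z = 0[regular_module L]"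
   using x by (intro bexI[of _ "(\<ominus>\<^bsub>L\<^esub> a) *L x"]) (auto simp: mul_distl[symmetric] M.r_neg)
 next
  show "0[regular_module L] : {a *L x |a. a : |L|}"
   using x by (auto intro!: exI[of _ "0L"])
 qed (use x in \<open>auto simp: mul_distl[symmetric] mul_assoc[symmetric]\<close>)
qed

lemma lact_left_proj: "x : |L| ==> lact L (left_proj L x)"
 using lact.lact_sub[OF lact_regular submodule_left_ideal] by (simp add: left_proj_def)

lemma subalgebraD:
 assumes "subalgebra K L B"
 shows "x : B ==> x : |L|" "0L : B" "x : B ==> y : B ==> x +L y : B"
  "x : B ==> y : B ==> x *L y : B" "k : KC ==> x : B ==> k .*L x : B"
 using assms submoduleE[of B] submodule.axioms(1) subgroup.one_closed
 by (fastforce simp: subalgebra_def)+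

lemma nalg_subalgebra: assumes "subalgebra K L B" shows "nalg K (L<|B)"
proof -
 note B = subalgebraD[OF assms]
 have neg: "EX y:B. y +L x = 0L" if "x : B" for x
  using B(1)[OF that] B(5)[OF R.a_inv_closed[OF R.one_closed] that] neg_eq_smult[of x]
  by (metis M.l_neg)
 have "abelian_group (L<|B)"
  by (rule abelian_groupI) (use B neg in \<open>auto simp: M.a_ac\<close>)
 thus ?thesis
  by (intro nalg.intro module.intro module_axioms.intro nalg_axioms.intro R.is_cring field_axioms)
   (auto simp: smult_l_distr smult_r_distr smult_assoc1 mul_assoc mul_distl mul_distr mul_smult_l mul_smult_r B)
qed

lemma finsum_subalgebra:
 assumes "subalgebra K L B" "finite F" "f : F \<rightarrow> B"
 shows "finsum (L<|B) f F = finsum L f F" "finsum L f F : B"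
proof -
 interpret B: nalg K "L<|B" by (rule nalg_subalgebra[OF assms(1)])
 note B = subalgebraD[OF assms(1)]
 have "finsum (L<|B) f F = finsum L f F & finsum L f F : B"
  using assms(2,3)
 proof (induction F rule: finite_induct)
  case (insert i F)
  thus ?case using B
   by (subst B.M.finsum_insert, simp_all, subst M.finsum_insert) (auto simp: Pi_iff)
 qed (use B in simp)
 thus "finsum (L<|B) f F = finsum L f F" "finsum L f F : B" by auto
qed

lemma finsum_mem:
 assumes "finite F" "!!i. i : F ==> f i : W" "W <= |L|" "0L : W"
  "!!x y. x : W ==> y : W ==> x +L y : W"
 shows "finsum L f F : W"
 using assms(1,2)
proof (induction F rule: finite_induct)
 case (insert i F)
 hence "f : F \<rightarrow> |L|" "f i : |L|" using assms(3) by auto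
 thus ?case using insert assms(5) by (simp add: M.finsum_insert)
qed (use assms(4) in simp)

end

subsection \<open>Nilpotent elements\<close>

primrec npow :: "('k, 'l) module => 'l => nat => 'l" where
 "npow L x 0 = x"
| "npow L x (Suc n) = npow L x n *[L] x"

definition nilp :: "('k, 'l) module => 'l => bool" where
 "nilp L x <-> (EX n. npow L x n = 0[L])"

context nalg begin

lemma npow_closed [simp, intro]: "x : |L| ==> npow L x n : |L|"
 by (induction n) auto

lemma npow_commute: "x : |L| ==> npow L x n *L x = x *L npow L x n"
 by (induction n) (auto simp: mul_assoc)

lemma npow_opposite: "x : |L| ==> npow (opposite L) x n = npow L x n"
 by (induction n) (simp_all add: opposite_def npow_commute)

lemma nilp_opposite: "x : |L| ==> nilp (opposite L) x <-> nilp L x"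
 by (simp add: nilp_def npow_opposite) (simp add: opposite_def)

lemma npow_idem: "x : |L| ==> x *L x = x ==> npow L x n = x"
 by (induction n) auto

lemma nilp_idem: "x : |L| ==> x *L x = x ==> nilp L x ==> x = 0L"
 by (auto simp: nilp_def npow_idem)

text \<open>A one-sided inverse of a nilpotent element would make every power of it invertible.\<close>

lemma nilp_not_left_invertible:
 assumes "x : |L|" "s : |L|" "e : |L|" "s *L x = e" "e *L x = x" "nilp L x"
 shows "e = 0L"
proof -
 have "npow L x n = 0L ==> e = 0L" for n
 proof (induction n)
  case 0 thus ?case using assms by simp
 next
  case (Suc n)
  have "s *L npow L x (Suc n) = e *L npow L x n"
   using assms by (simp add: npow_commute mul_assoc[symmetric])
  also have "... = npow L x n"
  proof (cases n)
   case (Suc m)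
   thus ?thesis using assms by (simp add: npow_commute mul_assoc[symmetric])
  qed (use assms in simp)
  finally show ?case using Suc assms by simp
 qed
 thus ?thesis using assms by (auto simp: nilp_def)
qed

end

subsection \<open>Semisimple algebras are von Neumann regular\<close>

text \<open>Write a local unit of \<open>x\<close> as \<open>s * x + w\<close> with \<open>w\<close> in a complement of the left
ideal generated by \<open>x\<close>; then \<open>x * w\<close> lies in both.\<close>

lemma (in nalg) semisimple_regular:
 assumes T: "subalgebra K L T" and ss: "semisimple_algebra (L<|T)" and x: "x : T"
 shows "EX s:T. x = x *L (s *L x)"
proof -
 note T' = subalgebraD[OF T]
 interpret T: nalg K "L<|T" by (rule nalg_subalgebra[OF T])
 let ?R = "regular_module (L<|T)"
 interpret rm: lact "L<|T" ?R by (rule T.lact_regular)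
 let ?U = "{a *L x |a. a : T}"
 have U: "submodule ?U (L<|T) ?R" using T.submodule_left_ideal[of x] x by simp
 then obtain W where W: "submodule W (L<|T) ?R" "?U \<inter> W = {0L}" "?U <+>\<^bsub>?R\<^esub> W = T"
  using ss by (auto simp: semisimple_algebra_def semisimple_module_def)
 obtain u where u: "u : T" "u *L x = x" "x *L u = x"
  using ss x by (auto simp: semisimple_algebra_def has_local_units_def dest!: spec[of _ "{x}"])
 have "u : ?U <+>\<^bsub>?R\<^esub> W" using W u by simp
 then obtain s w where s: "s : T" "w : W" "u = s *L x +L w"
  by (auto simp: set_add_def set_mult_def)
 have wT: "w : T" using rm.submodule_sub[OF W(1)] s by simp
 have eq: "x = x *L (s *L x) +L x *L w" using u s x wT T' by (simp add: mul_distr[symmetric])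
 have 1: "x *L (s *L x) : ?U" using s x T' by (auto simp: mul_assoc[symmetric])
 have "x : ?U" using u by (auto intro!: exI[of _ u])
 hence "x *L w : ?U" using rm.submodule_cancel[OF U, of "x *L (s *L x)" "x *L w"] 1 eq x wT T' by simp
 moreover have "x *L w : W" using rm.submodule_act[OF W(1), of x w] x s by simp
 ultimately have "x *L w = 0L" using W(2) by blast
 thus ?thesis using eq s x T' by (intro bexI[of _ s]) auto
qed

section \<open>Tensor products and induction\<close>

locale tensor_ctx = nalg K L + W: lact "L<|B" M
 for K :: "'k ring" (structure) and L :: "('k, 'l) module" (structure) and B :: "'l set"
  and M :: "('l, 'm) module" (structure) +
 assumes sub: "subalgebra K L B"
begin
abbreviation "MC \<equiv> carrier M"
abbreviation "TM \<equiv> tensor_module L B M"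

abbreviation "rel \<equiv> tensor_relations L B M"
definition "frags = carrier (tensor_group L M)"
abbreviation "cls c \<equiv> rel #>\<^bsub>tensor_group L M\<^esub> c"

lemmas B_sub = subalgebraD[OF sub]

lemma act_in [simp, intro]: "b : B ==> m : MC ==> b .*[M] m : MC"
 using W.act_closed by simp

lemma frags_iff: "c : frags <-> Poly_Mapping.keys c <= |L| \<times> MC"
 by (simp add: frags_def tensor_group_def)

lemma frags_diff [intro]: "c : frags ==> d : frags ==> c - d : frags"
 using keys_diff[of c d] unfolding frags_iff by blast

lemma frags_add [intro]: "c : frags ==> d : frags ==> c + d : frags"
 using keys_add[of c d] unfolding frags_iff by blast

lemma frags_zero [simp, intro]: "0 : frags"
 by (simp add: frags_iff)

lemma frags_of [simp, intro]: "x : |L| ==> m : MC ==> frag_of (x, m) : frags"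
 by (simp add: frags_iff)

lemma frags_induct [consumes 1, case_names zero one diff]:
 assumes "c : frags" "P 0" "!!x m. x : |L| ==> m : MC ==> P (frag_of (x, m))"
  "!!a b. a : frags ==> b : frags ==> P a ==> P b ==> P (a - b)"
 shows "P c"
 using free_Abelian_group_induct[of c "|L| \<times> MC" P] assms by (auto simp: frags_iff)

lemma rel_subgroup: "subgroup rel (tensor_group L M)"
 unfolding tensor_relations_def
proof (rule group.generate_is_subgroup)
 show "Group.group (tensor_group L M)" by (simp add: tensor_group_def)
qed (auto simp: frags_def[symmetric] B_sub)

lemma rel_frags: "c : rel ==> c : frags"
 using subgroup.subset[OF rel_subgroup] by (auto simp: frags_def)

lemma rel_zero: "0 : rel"
 using subgroup.one_closed[OF rel_subgroup] by (simp add: tensor_group_def)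

lemma rel_add: "c : rel ==> d : rel ==> c + d : rel"
 using subgroup.m_closed[OF rel_subgroup] by (simp add: tensor_group_def)

lemma rel_neg: "c : rel ==> - c : rel"
 using subgroup.m_inv_closed[OF rel_subgroup, of c] rel_frags[of c] by (simp add: tensor_group_def frags_iff)

lemma rel_diff: "c : rel ==> d : rel ==> c - d : rel"
 using rel_add[of c "- d"] rel_neg by simp

lemma rel_minus_iff: "- c : rel <-> c : rel"
 using rel_neg[of c] rel_neg[of "- c"] by auto

lemma rel_addl: "x : |L| ==> y : |L| ==> m : MC ==>
  frag_of (x +L y, m) - frag_of (x, m) - frag_of (y, m) : rel"
 unfolding tensor_relations_def by (rule generate.incl) blast

lemma rel_addr: "x : |L| ==> m : MC ==> n : MC ==>
  frag_of (x, m +[M] n) - frag_of (x, m) - frag_of (x, n) : rel"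
 unfolding tensor_relations_def by (rule generate.incl) blast

lemma rel_bal: "x : |L| ==> b : B ==> m : MC ==>
  frag_of (x *L b, m) - frag_of (x, b .*[M] m) : rel"
 unfolding tensor_relations_def by (rule generate.incl) blast

text \<open>An additive predicate need only be checked on the generating relations, since \<open>diff\<close> covers inverses as
well as products.\<close>

lemma rel_induct [consumes 1, case_names zero addl addr bal diff]:
 assumes c: "c : rel" and zero: "P 0"
  and addl: "!!x y m. x : |L| ==> y : |L| ==> m : MC ==>
   P (frag_of (x +L y, m) - frag_of (x, m) - frag_of (y, m))"
  and addr: "!!x m n. x : |L| ==> m : MC ==> n : MC ==>
   P (frag_of (x, m +[M] n) - frag_of (x, m) - frag_of (x, n))"
  and bal: "!!x b m. x : |L| ==> b : B ==> m : MC ==>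
   P (frag_of (x *L b, m) - frag_of (x, b .*[M] m))"
  and diff: "!!c d. c : frags ==> d : frags ==> P c ==> P d ==> P (c - d)"
 shows "P c"
proof -
 let ?gens = "{frag_of (x +L y, m) - frag_of (x, m) - frag_of (y, m) |x y m.
      x : |L| & y : |L| & m : MC} \<union>
    {frag_of (x, m +[M] n) - frag_of (x, m) - frag_of (x, n) |x m n.
      x : |L| & m : MC & n : MC} \<union>
    {frag_of (x *L b, m) - frag_of (x, b .*[M] m) |x b m.
      x : |L| & b : B & m : MC}"
 have gens: "P h & h : frags" if "h : ?gens" for h
 proof
  show "P h" using that by (elim UnE CollectE exE conjE) (simp_all only: addl addr bal)
  have "h : rel" unfolding tensor_relations_def by (rule generate.incl[OF that])
  thus "h : frags" by (rule rel_frags)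
 qed
 have "c : generate (tensor_group L M) ?gens" using c by (simp only: tensor_relations_def)
 hence "P c & c : frags"
 proof (induction c rule: generate.induct)
  case (inv h)
  have *: "inv\<^bsub>tensor_group L M\<^esub> h = 0 - h" using gens[OF inv] by (simp add: tensor_group_def frags_iff)
  show ?case unfolding * using gens[OF inv] zero diff[of 0 h] frags_diff[of 0 h] by auto
 next
  case (eng h1 h2)
  have *: "h1 *[tensor_group L M] h2 = h1 - (0 - h2)" by (simp add: tensor_group_def)
  have "P (0 - h2)" "0 - h2 : frags" using eng zero by (blast intro: diff)+
  hence "P (h1 - (0 - h2))" "h1 - (0 - h2) : frags" using eng by (blast intro: diff)+
  thus ?case by (simp only: *)
 qed (use gens zero in \<open>auto simp: tensor_group_def\<close>)
 thus ?thesis by blast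
qed

lemma rel_zerol: "m : MC ==> frag_of (0L, m) : rel"
 using rel_addl[of "0L" "0L" m] by (simp add: rel_minus_iff)

lemma rel_zeror: "x : |L| ==> frag_of (x, 0[M]) : rel"
 using rel_addr[of x "0[M]" "0[M]"] by (simp add: rel_minus_iff)

lemma rel_finsum:
 "finite F ==> f : F \<rightarrow> |L| ==> m : MC ==>
   frag_of (S[L, F] %i. f i, m) - (\<Sum>i\<in>F. frag_of (f i, m)) : rel"
proof (induction F rule: finite_induct)
 case (insert i F)
 have "frag_of (f i +L (S[L, F] %i. f i), m) - frag_of (f i, m) - frag_of (S[L, F] %i. f i, m) : rel"
  using insert by (intro rel_addl) auto
 from rel_add[OF this insert.IH] insert show ?case by (simp add: algebra_simps Pi_iff)
qed (simp add: rel_zerol)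

lemma cls_eq_iff: "cls c = cls d <-> c - d : rel"
proof -
 have mem: "z : cls a <-> z - a : rel" for z a
  by (auto simp: r_coset_def tensor_group_def intro: bexI[of _ "z - a"])
 show ?thesis
 proof
  assume "cls c = cls d"
  thus "c - d : rel" using mem[of c c] mem[of c d] rel_zero by simp
 next
  assume cd: "c - d : rel"
  have "z - c : rel <-> z - d : rel" for z
   using rel_add[OF _ cd, of "z - c"] rel_diff[OF _ cd, of "z - d"] by auto
  thus "cls c = cls d" using mem by blast
 qed
qed

lemma cls_zero_iff: "cls c = rel <-> c : rel"
proof -
 have "cls 0 = rel" by (auto simp: r_coset_def tensor_group_def)
 thus ?thesis using cls_eq_iff[of c 0] by simp
qed

lemma tensor_carrier: "carrier (TM) = {cls c |c. c : frags}"
 by (auto simp: tensor_module_def RCOSETS_def frags_def)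

lemma tensor_zero: "0[TM] = rel"
 by (simp add: tensor_module_def)

lemma tensor_add: "cls c +[TM] cls d = cls (c + d)"
proof
 show "cls c +[TM] cls d <= cls (c + d)"
 proof
  fix z assume "z : cls c +[TM] cls d"
  then obtain r s where "r : rel" "s : rel" "z = (r + c) + (s + d)"
   by (auto simp: tensor_module_def set_mult_def r_coset_def tensor_group_def)
  hence "z = (r + s) + (c + d)" "r + s : rel" using rel_add by auto
  thus "z : cls (c + d)" by (auto simp: r_coset_def tensor_group_def)
 qed
 show "cls (c + d) <= cls c +[TM] cls d"
 proof
  fix z assume "z : cls (c + d)"
  then obtain r where r: "r : rel" "z = (r + c) + (0 + d)"
   by (auto simp: r_coset_def tensor_group_def add.assoc)
  thus "z : cls c +[TM] cls d"
  proof -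
   have "r + c : cls c" "0 + d : cls d" using r rel_zero by (auto simp: r_coset_def tensor_group_def)
   thus ?thesis using r(2) by (auto simp: tensor_module_def set_mult_def tensor_group_def)
  qed
 qed
qed

text \<open>A map on generators that respects the relations passes to classes.\<close>

lemma Union_cls:
 fixes N :: "('l, 'n) module"
 assumes N: "tensor_ctx K L B N"
  and F: "!!r. r : rel ==> frag_extend f r : tensor_relations L B N"
 shows "(\<Union>c'\<in>cls c. tensor_relations L B N #>\<^bsub>tensor_group L N\<^esub> frag_extend f c') =
  tensor_relations L B N #>\<^bsub>tensor_group L N\<^esub> frag_extend f c" (is "_ = ?Z")
proof -
 interpret N: tensor_ctx K L B N by (rule N)
 have "tensor_relations L B N #>\<^bsub>tensor_group L N\<^esub> frag_extend f c' = ?Z" if c': "c' : cls c" for c'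
 proof -
  obtain r where "r : rel" "c' = r + c" using c' by (auto simp: r_coset_def tensor_group_def)
  hence "frag_extend f c' - frag_extend f c : tensor_relations L B N" by (simp add: frag_extend_add F)
  thus ?thesis by (rule N.cls_eq_iff[THEN iffD2])
 qed
 moreover have "cls c ~= {}" using rel_zero by (auto simp: r_coset_def)
 ultimately show ?thesis by (metis (no_types, lifting) SUP_const SUP_cong)
qed

abbreviation "lact_frag a \<equiv> frag_extend (%(x, m). frag_of (a *L x, m))"

lemma lact_frag_rel: assumes a: "a : |L|" and r: "r : rel" shows "lact_frag a r : rel"
 using r
proof (induction r rule: rel_induct)
 case (addl x y m)
 thus ?case using rel_addl[of "a *L x" "a *L y" m] a by (simp add: frag_extend_diff mul_distr)
next
 case (addr x m n)
 thus ?case using rel_addr[of "a *L x" m n] a by (simp add: frag_extend_diff)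
next
 case (bal x b m)
 thus ?case using rel_bal[of "a *L x" b m] a B_sub(1) by (simp add: frag_extend_diff mul_assoc)
qed (auto simp: rel_zero frag_extend_diff rel_diff)

lemma lact_frag_frags: assumes a: "a : |L|" and c: "c : frags" shows "lact_frag a c : frags"
 using c by (induction c rule: frags_induct) (use a in \<open>auto simp: frag_extend_diff\<close>)

lemma ctx: "tensor_ctx K L B M" by (rule tensor_ctx_axioms)

lemma tensor_act:
 assumes "a : |L|" shows "a .*[TM] cls c = cls (lact_frag a c)"
 using Union_cls[OF ctx lact_frag_rel[OF assms]] by (simp add: tensor_module_def)

lemma lact_tensor: "lact L (TM)"
proof -
 have z: "rel = cls 0" using cls_zero_iff[of 0] rel_zero by simp
 have "abelian_group (TM)"
 proof (rule abelian_groupI)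
  fix x assume "x : carrier (TM)"
  then obtain c where c: "c : frags" "x = cls c" by (auto simp: tensor_carrier)
  hence "- c : frags" by (simp add: frags_iff)
  moreover have "cls (- c) +[TM] x = 0[TM]"
   using c by (simp add: tensor_add tensor_zero cls_zero_iff rel_zero)
  ultimately show "EX y:carrier (TM). y +[TM] x = 0[TM]"
   unfolding tensor_carrier by blast
  show "0[TM] +[TM] x = x"
   using c tensor_add[of 0 c] by (simp add: tensor_zero z[symmetric])
 next
  fix x y assume "x : carrier (TM)" "y : carrier (TM)"
  then obtain c d where "c : frags" "x = cls c" "d : frags" "y = cls d" by (auto simp: tensor_carrier)
  thus "x +[TM] y : carrier (TM)"
   unfolding tensor_carrier by (auto simp: tensor_add)
 next
  show "0[TM] : carrier (TM)"
   unfolding tensor_carrier tensor_zero by (subst z) auto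
 qed (auto simp: tensor_carrier tensor_add add_ac)
 thus ?thesis
 proof (intro lact.intro lact_axioms.intro)
  fix a x y assume "a : |L|" "x : carrier (TM)" "y : carrier (TM)"
  thus "a .*[TM] (x +[TM] y) =
    a .*[TM] x +[TM] a .*[TM] y"
   by (auto simp: tensor_carrier tensor_add tensor_act frag_extend_add)
 next
  fix a x assume "a : |L|" "x : carrier (TM)"
  thus "a .*[TM] x : carrier (TM)"
   using lact_frag_frags unfolding tensor_carrier by (auto simp: tensor_act)
 qed
qed

text \<open>The universal property is stated for biadditive balanced maps on representatives, that is, in the free abelian group:
later maps out of a tensor product are evaluated there.\<close>

lemma tensor_universal:
 fixes H :: "('l, 'h) module"
 assumes "abelian_group H"
  and f: "!!x m. x : |L| ==> m : MC ==> f x m : carrier H"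
  and addl: "!!x y m. x : |L| ==> y : |L| ==> m : MC ==>
   f (x +L y) m = f x m +[H] f y m"
  and addr: "!!x m n. x : |L| ==> m : MC ==> n : MC ==>
   f x (m +[M] n) = f x m +[H] f x n"
  and bal: "!!x b m. x : |L| ==> b : B ==> m : MC ==>
   f (x *L b) m = f x (b .*[M] m)"
 obtains \<Phi> where "!!c. c : frags ==> \<Phi> c : carrier H"
  "!!c d. c : frags ==> d : frags ==> \<Phi> (c - d) = \<Phi> c -[H] \<Phi> d"
  "!!x m. x : |L| ==> m : MC ==> \<Phi> (frag_of (x, m)) = f x m"
  "!!c. c : rel ==> \<Phi> c = 0[H]"
proof -
 interpret H: abelian_group H by fact
 obtain \<Phi> where h: "\<Phi> : hom (free_Abelian_group ( |L| \<times> MC)) (add_monoid H)"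
  and of: "!!x. x : |L| \<times> MC ==> \<Phi> (frag_of x) = case_prod f x"
  by (rule comm_group.free_Abelian_group_universal[OF H.a_comm_group, of "case_prod f" "|L| \<times> MC"])
   (use f in auto)
 have c: "\<Phi> c : carrier H" if "c : frags" for c using h that by (auto simp: hom_def frags_iff)
 have add: "\<Phi> (c + d) = \<Phi> c +[H] \<Phi> d" if "c : frags" "d : frags" for c d using h that by (auto simp: hom_def frags_iff)
 have diff: "\<Phi> (c - d) = \<Phi> c -[H] \<Phi> d" if cd: "c : frags" "d : frags" for c d
 proof -
  have "\<Phi> c = \<Phi> (c - d) +[H] \<Phi> d" using add[OF frags_diff[OF cd] cd(2)] by simp
  thus ?thesis using c[OF frags_diff[OF cd]] c[OF cd(2)]
   by (simp add: H.minus_eq H.a_assoc H.r_neg)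
 qed
 have of': "\<Phi> (frag_of (x, m)) = f x m" if "x : |L|" "m : MC" for x m using of that by simp
 have cancel: "(a +[H] b) -[H] a -[H] b = 0[H]" if "a : carrier H" "b : carrier H" for a b
  using that by (simp add: H.minus_eq H.a_assoc H.a_lcomm[of b "\<ominus>\<^bsub>H\<^esub> a" "\<ominus>\<^bsub>H\<^esub> b"] H.r_neg H.r_neg2)
 have zero: "\<Phi> 0 = 0[H]"
  using diff[of 0 0] c[of 0] by (simp add: H.minus_eq H.r_neg)
 have "\<Phi> r = 0[H]" if "r : rel" for r
  using that
 proof (induction r rule: rel_induct)
  case (addl x y m)
  thus ?case using assms(3) f
   by (subst diff, blast, blast, subst diff) (auto simp: of' cancel)
 next
  case (addr x m n)
  thus ?case using assms(4) f
   by (subst diff, blast, blast, subst diff) (auto simp: of' cancel)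
 next
  case (bal x b m)
  thus ?case using assms(5) f B_sub(1)
   by (subst diff) (auto simp: of' H.minus_eq H.r_neg)
 next
  case (diff c d)
  thus ?case by (subst \<open>!!d c. c : frags ==> d : frags ==> \<Phi> (c - d) = \<Phi> c -[H] \<Phi> d\<close>) (auto simp: H.minus_eq)
 qed (rule zero)
 thus ?thesis using that[of \<Phi>] c diff of' by blast
qed

end

subsection \<open>Functoriality\<close>

lemma (in nalg) tensor_ctxI: "subalgebra K L B ==> lact (L<|B) M ==> tensor_ctx K L B M"
 by (intro tensor_ctx.intro tensor_ctx_axioms.intro nalg_axioms)

context tensor_ctx begin

lemma frag_map_rel:
 assumes N: "tensor_ctx K L B N" and h: "h : lmod_hom (L<|B) M N" and r: "r : rel"
 shows "frag_extend (%(x, m). frag_of (x, h m)) r : tensor_relations L B N"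
proof -
 interpret N: tensor_ctx K L B N by (rule N)
 have hc: "m : MC ==> h m : carrier N" for m using h by (auto simp: lmod_hom_def)
 show ?thesis
  using r
 proof (induction r rule: rel_induct)
  case (addl x y m)
  thus ?case using N.rel_addl[of x y "h m"] hc by (simp add: frag_extend_diff)
 next
  case (addr x m n)
  thus ?case using N.rel_addr[of x "h m" "h n"] hc h by (simp add: frag_extend_diff lmod_hom_def)
 next
  case (bal x b m)
  thus ?case using N.rel_bal[of x b "h m"] hc h by (simp add: frag_extend_diff lmod_hom_def)
 qed (auto simp: N.rel_zero frag_extend_diff N.rel_diff)
qed

lemma frag_map_frags:
 assumes N: "tensor_ctx K L B N" and h: "h : lmod_hom (L<|B) M N" and c: "c : frags"
 shows "frag_extend (%(x, m). frag_of (x, h m)) c : tensor_ctx.frags L N"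
proof -
 interpret N: tensor_ctx K L B N by (rule N)
 have hc: "m : MC ==> h m : carrier N" for m using h by (auto simp: lmod_hom_def)
 show ?thesis
  using c by (induction c rule: frags_induct) (auto simp: frag_extend_diff hc)
qed

lemma tensor_map_cls:
 assumes N: "tensor_ctx K L B N" and h: "h : lmod_hom (L<|B) M N"
 shows "tensor_map L B N h (cls c) =
  tensor_relations L B N #>\<^bsub>tensor_group L N\<^esub> frag_extend (%(x, m). frag_of (x, h m)) c"
 unfolding tensor_map_def by (rule Union_cls[OF N frag_map_rel[OF N h]])

lemma tensor_map_hom:
 assumes N: "tensor_ctx K L B N" and h: "h : lmod_hom (L<|B) M N"
 shows "tensor_map L B N h : lmod_hom L (TM) (tensor_module L B N)"
proof -
 interpret N: tensor_ctx K L B N by (rule N)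
 let ?F = "frag_extend (%(x, m). frag_of (x, h m))"
 have F: "?F c : N.frags" if "c : frags" for c by (rule frag_map_frags[OF N h that])
 have comm: "?F (lact_frag a c) = N.lact_frag a (?F c)" if "c : frags" for a c
  using that by (induction c rule: frags_induct) (auto simp: frag_extend_diff)
 show ?thesis
  unfolding lmod_hom_def
 proof (intro CollectI conjI ballI funcsetI)
  fix Z assume "Z : carrier (TM)"
  then obtain c where c: "c : frags" "Z = cls c" by (auto simp: tensor_carrier)
  thus "tensor_map L B N h Z : carrier (tensor_module L B N)"
   using F by (auto simp: tensor_map_cls[OF N h] N.tensor_carrier)
  fix a assume "a : |L|"
  thus "tensor_map L B N h (a .*[TM] Z) =
    a .*[tensor_module L B N] tensor_map L B N h Z"
   using c by (simp add: tensor_act N.tensor_act tensor_map_cls[OF N h] comm)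
 next
  fix Z Y assume "Z : carrier (TM)" "Y : carrier (TM)"
  then obtain c d where "c : frags" "Z = cls c" "d : frags" "Y = cls d" by (auto simp: tensor_carrier)
  thus "tensor_map L B N h (Z +[TM] Y) =
    tensor_map L B N h Z +[tensor_module L B N] tensor_map L B N h Y"
   by (simp add: tensor_add N.tensor_add tensor_map_cls[OF N h] frag_extend_add)
 qed
qed

end

subsection \<open>Exactness from a dual basis\<close>

text \<open>The data of a projective right module: linear maps \<open>bt t\<close> into \<open>B\<close> and elements \<open>g
t\<close> with \<open>x = \<Sum> g t * bt t x\<close>, a finite sum for every \<open>x\<close>. The index set may be
infinite.\<close>

locale dual_basis = nalg K L for K :: "'k ring" (structure) and L :: "('k, 'l) module" (structure) +
 fixes B :: "'l set" and T :: "'t set" and g :: "'t => 'l" and bt :: "'t => 'l => 'l"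
 assumes db_sub: "subalgebra K L B"
  and g_closed: "t : T ==> g t : carrier L"
  and bt_closed: "t : T ==> x : carrier L ==> bt t x : B"
  and bt_add: "t : T ==> x : carrier L ==> y : carrier L ==> bt t (x +[L] y) = bt t x +[L] bt t y"
  and bt_mul: "t : T ==> x : carrier L ==> b : B ==> bt t (x *[L] b) = bt t x *[L] b"
  and expand: "x : carrier L ==> EX F. finite F & F <= T & (ALL t:T - F. bt t x = 0[L]) \<and>
   x = (S[L, F] %t. g t *[L] bt t x)"
begin

lemma expand_superset:
 assumes x: "x : |L|"
 shows "EX F. finite F & F <= T & (ALL F'. finite F' --> F <= F' --> F' <= T --> x = (S[L, F'] %t. g t *L bt t x))"
proof -
 obtain F where F: "finite F" "F <= T" "ALL t:T - F. bt t x = 0L" "x = (S[L, F] %t. g t *L bt t x)"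
  using expand[OF x] by blast
 have "x = (S[L, F'] %t. g t *L bt t x)" if "finite F'" "F <= F'" "F' <= T" for F'
 proof -
  have "(S[L, F'] %t. g t *L bt t x) = (S[L, F] %t. g t *L bt t x)"
   using that F g_closed bt_closed[OF _ x] subalgebraD(1)[OF db_sub]
   by (intro M.add.finprod_mono_neutral_cong_right) (auto simp: subset_iff)
  thus ?thesis using F by simp
 qed
 thus ?thesis using F by blast
qed

text \<open>The map \<open>x \<otimes> m \<mapsto> bt t x m\<close> on representatives of tensors.\<close>

definition coordinate :: "('l, 'm) module => 't => ('l \<times> 'm \<Rightarrow>\<^sub>0 int) => 'm" where
 "coordinate M t = (SOME \<Phi>. (ALL c. c : tensor_ctx.frags L M --> \<Phi> c : carrier M) \<and>
  (ALL c d. c : tensor_ctx.frags L M --> d : tensor_ctx.frags L M --> \<Phi> (c - d) = \<Phi> c -[M] \<Phi> d) \<and>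
  (ALL x m. x : |L| --> m : carrier M --> \<Phi> (frag_of (x, m)) = bt t x .*[M] m) \<and>
  (ALL c. c : tensor_relations L B M --> \<Phi> c = 0[M]))"

lemma coordinate:
 assumes M: "left_module (L<|B) M" and t: "t : T"
 shows "c : tensor_ctx.frags L M ==> coordinate M t c : carrier M"
  "c : tensor_ctx.frags L M ==> d : tensor_ctx.frags L M ==>
    coordinate M t (c - d) = coordinate M t c -[M] coordinate M t d"
  "x : |L| ==> m : carrier M ==> coordinate M t (frag_of (x, m)) = bt t x .*[M] m"
  "c : tensor_relations L B M ==> coordinate M t c = 0[M]"
proof -
 interpret M: tensor_ctx K L B M by (rule tensor_ctxI[OF db_sub lact_left_module[OF M]])
 note act = M[unfolded left_module_def]
 obtain \<Phi> where "!!c. c : M.frags ==> \<Phi> c : carrier M"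
  "!!c d. c : M.frags ==> d : M.frags ==> \<Phi> (c - d) = \<Phi> c -[M] \<Phi> d"
  "!!x m. x : |L| ==> m : carrier M ==> \<Phi> (frag_of (x, m)) = bt t x .*[M] m"
  "!!c. c : M.rel ==> \<Phi> c = 0[M]"
  by (rule M.tensor_universal[of M "%x m. bt t x .*[M] m"])
   (use act t in \<open>auto simp: bt_closed bt_add bt_mul\<close>)
 hence "EX \<Phi>. (ALL c. c : tensor_ctx.frags L M --> \<Phi> c : carrier M) \<and>
  (ALL c d. c : tensor_ctx.frags L M --> d : tensor_ctx.frags L M --> \<Phi> (c - d) = \<Phi> c -[M] \<Phi> d) \<and>
  (ALL x m. x : |L| --> m : carrier M --> \<Phi> (frag_of (x, m)) = bt t x .*[M] m) \<and>
  (ALL c. c : tensor_relations L B M --> \<Phi> c = 0[M])" by blast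
 from someI_ex[OF this, folded coordinate_def]
 show "c : tensor_ctx.frags L M ==> coordinate M t c : carrier M"
  "c : tensor_ctx.frags L M ==> d : tensor_ctx.frags L M ==>
    coordinate M t (c - d) = coordinate M t c -[M] coordinate M t d"
  "x : |L| ==> m : carrier M ==> coordinate M t (frag_of (x, m)) = bt t x .*[M] m"
  "c : tensor_relations L B M ==> coordinate M t c = 0[M]" by blast+
qed

text \<open>Every tensor is the sum of the \<open>g t \<otimes> coordinate t\<close>.\<close>

lemma tensor_expand:
 assumes M: "left_module (L<|B) M" and c: "c : tensor_ctx.frags L M"
 shows "EX F. finite F & F <= T & (ALL F'. finite F' --> F <= F' --> F' <= T -->
  c - (\<Sum>t\<in>F'. frag_of (g t, coordinate M t c)) : tensor_relations L B M)"
proof -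
 interpret M: tensor_ctx K L B M by (rule tensor_ctxI[OF db_sub lact_left_module[OF M]])
 note co = coordinate[OF M]
 show ?thesis
  using c
 proof (induction c rule: M.frags_induct)
  case zero
  have "(\<Sum>t\<in>F'. frag_of (g t, coordinate M t 0)) : M.rel" if "finite F'" "F' <= T" for F'
   using that by (induction F' rule: finite_induct) (auto simp: co M.rel_zero g_closed intro!: M.rel_add M.rel_zeror)
  thus ?case by (auto simp: M.rel_minus_iff intro!: exI[of _ "{}"])
 next
  case (one x m)
  obtain F where F: "finite F" "F <= T"
   "!!F'. finite F' ==> F <= F' ==> F' <= T ==> x = (S[L, F'] %t. g t *L bt t x)"
   using expand_superset[OF one(1)] by blast
  have "frag_of (x, m) - (\<Sum>t\<in>F'. frag_of (g t, coordinate M t (frag_of (x, m)))) : M.rel"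
   if F': "finite F'" "F <= F'" "F' <= T" for F'
  proof -
   have in_L: "g t *L bt t x : |L|" if "t : F'" for t
    using that F' one(1) g_closed bt_closed M.B_sub(1) by blast
   have "frag_of (S[L, F'] %t. g t *L bt t x, m) - (\<Sum>t\<in>F'. frag_of (g t *L bt t x, m)) : M.rel"
    using F' one in_L by (intro M.rel_finsum) auto
   hence 1: "frag_of (x, m) - (\<Sum>t\<in>F'. frag_of (g t *L bt t x, m)) : M.rel"
    using F(3)[OF F'] by simp
   have 2: "(\<Sum>t\<in>F'. frag_of (g t *L bt t x, m)) - (\<Sum>t\<in>F'. frag_of (g t, bt t x .*[M] m)) : M.rel"
    using F'(1,3)
   proof (induction F' rule: finite_induct)
    case (insert t F')
    hence "frag_of (g t *L bt t x, m) - frag_of (g t, bt t x .*[M] m) : M.rel"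
     using one g_closed bt_closed by (intro M.rel_bal) auto
    from M.rel_add[OF this insert.IH] insert show ?case by (simp add: algebra_simps)
   qed (simp add: M.rel_zero)
   have "(\<Sum>t\<in>F'. frag_of (g t, coordinate M t (frag_of (x, m)))) = (\<Sum>t\<in>F'. frag_of (g t, bt t x .*[M] m))"
    using F' one by (intro sum.cong) (auto simp: co)
   thus ?thesis using M.rel_add[OF 1 2] by simp
  qed
  thus ?case using F(1,2) by blast
 next
  case (diff c d)
  from diff(3) obtain Fc where Fc: "finite Fc" "Fc <= T" "ALL F'. finite F' --> Fc <= F' --> F' <= T -->
    c - (\<Sum>t\<in>F'. frag_of (g t, coordinate M t c)) : M.rel"
   by (elim exE conjE) (rule that; assumption)
  from diff(4) obtain Fd where Fd: "finite Fd" "Fd <= T" "ALL F'. finite F' --> Fd <= F' --> F' <= T -->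
    d - (\<Sum>t\<in>F'. frag_of (g t, coordinate M t d)) : M.rel"
   by (elim exE conjE) (rule that; assumption)
  have "c - d - (\<Sum>t\<in>F'. frag_of (g t, coordinate M t (c - d))) : M.rel"
   if F': "finite F'" "Fc \<union> Fd <= F'" "F' <= T" for F'
  proof -
   have 1: "(\<Sum>t\<in>F'. frag_of (g t, coordinate M t c)) - (\<Sum>t\<in>F'. frag_of (g t, coordinate M t d)) -
     (\<Sum>t\<in>F'. frag_of (g t, coordinate M t (c - d))) : M.rel"
    using F'(1,3)
   proof (induction F' rule: finite_induct)
    case (insert t F')
    let ?u = "coordinate M t c" and ?v = "coordinate M t d" and ?w = "coordinate M t (c - d)"
    have t: "t : T" using insert by simp
    have cl: "?u : carrier M" "?v : carrier M" "?w : carrier M" using co(1)[OF t] diff(1,2) by blast+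
    have w: "?u = ?w +[M] ?v"
     using cl co(2)[OF t diff(1,2)] by (simp add: M.W.minus_eq M.W.a_assoc M.W.l_neg)
    have "frag_of (g t, ?u) - frag_of (g t, ?w) - frag_of (g t, ?v) : M.rel"
     using cl g_closed[OF t] M.rel_addr[of "g t" ?w ?v] w by simp
    from M.rel_add[OF this insert.IH] insert show ?case by (simp add: algebra_simps)
   qed (simp add: M.rel_zero)
   have "c - d - ((\<Sum>t\<in>F'. frag_of (g t, coordinate M t c)) - (\<Sum>t\<in>F'. frag_of (g t, coordinate M t d))) : M.rel"
    using M.rel_diff[OF Fc(3)[rule_format, of F'] Fd(3)[rule_format, of F']] F' by (simp add: algebra_simps)
   from M.rel_add[OF this 1] show ?thesis by (simp add: algebra_simps)
  qed
  thus ?case using Fc(1,2) Fd(1,2) by (intro exI[of _ "Fc \<union> Fd"]) blast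
 qed
qed

lemma coordinates_zero:
 assumes M: "left_module (L<|B) M" and c: "c : tensor_ctx.frags L M"
  and z: "!!t. t : T ==> coordinate M t c = 0[M]"
 shows "c : tensor_relations L B M"
proof -
 interpret M: tensor_ctx K L B M by (rule tensor_ctxI[OF db_sub lact_left_module[OF M]])
 obtain F where F: "finite F" "F <= T" "c - (\<Sum>t\<in>F. frag_of (g t, coordinate M t c)) : M.rel"
  using tensor_expand[OF M c] by blast
 have "(\<Sum>t\<in>F. frag_of (g t, coordinate M t c)) : M.rel"
  using F(1,2) by (induction F rule: finite_induct) (auto simp: z M.rel_zero g_closed intro!: M.rel_add M.rel_zeror)
 from M.rel_add[OF F(3) this] show ?thesis by simp
qed

lemma coordinate_natural:
 assumes M: "left_module (L<|B) M" and N: "left_module (L<|B) N"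
  and h: "h : lmod_hom (L<|B) M N" and t: "t : T" and c: "c : tensor_ctx.frags L M"
 shows "coordinate N t (frag_extend (%(x, m). frag_of (x, h m)) c) = h (coordinate M t c)"
proof -
 interpret M: tensor_ctx K L B M by (rule tensor_ctxI[OF db_sub lact_left_module[OF M]])
 interpret N: tensor_ctx K L B N by (rule tensor_ctxI[OF db_sub lact_left_module[OF N]])
 note coM = coordinate[OF M t] and coN = coordinate[OF N t]
 have hc: "h m : carrier N" if "m : carrier M" for m using h that by (auto simp: lmod_hom_def)
 have hadd: "h (m +[M] n) = h m +[N] h n" if "m : carrier M" "n : carrier M" for m n
  using h that by (auto simp: lmod_hom_def)
 have hdiff: "h (m -[M] n) = h m -[N] h n" if mn: "m : carrier M" "n : carrier M" for m n
 proof -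
  have "h m = h (m -[M] n) +[N] h n"
   using hadd[of "m -[M] n" n] mn by (simp add: M.W.minus_eq M.W.a_assoc M.W.l_neg)
  thus ?thesis using mn hc by (simp add: N.W.minus_eq N.W.a_assoc N.W.r_neg)
 qed
 have hzero: "h 0[M] = 0[N]"
  using hadd[of "0[M]" "0[M]"] N.W.add.r_cancel_one'[of "h 0[M]" "h 0[M]"] hc[of "0[M]"] by simp
 show ?thesis
  using c
 proof (induction c rule: M.frags_induct)
  case zero
  thus ?case using coM(4)[OF M.rel_zero] coN(4)[OF N.rel_zero] hzero by simp
 next
  case (one x m)
  thus ?case using h hc bt_closed[OF t] by (simp add: coM coN lmod_hom_def)
 next
  case (diff c d)
  thus ?case using M.frag_map_frags[OF N.ctx h]
   by (simp add: frag_extend_diff coM coN hdiff)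
 qed
qed

text \<open>Coordinates are natural and detect zero, so injectivity and exactness of the tensored sequence can be checked
coordinate by coordinate in the original one.\<close>

lemma short_exact_tensor:
 assumes M1: "left_module (L<|B) M1" and M2: "left_module (L<|B) M2"
  and M3: "left_module (L<|B) M3"
  and ex: "short_exact (L<|B) M1 f M2 h M3"
 shows "short_exact L (tensor_module L B M1) (tensor_map L B M2 f) (tensor_module L B M2)
  (tensor_map L B M3 h) (tensor_module L B M3)"
proof -
 interpret M1: tensor_ctx K L B M1 by (rule tensor_ctxI[OF db_sub lact_left_module[OF M1]])
 interpret M2: tensor_ctx K L B M2 by (rule tensor_ctxI[OF db_sub lact_left_module[OF M2]])
 interpret M3: tensor_ctx K L B M3 by (rule tensor_ctxI[OF db_sub lact_left_module[OF M3]])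
 let ?f = "frag_extend (%(x, m). frag_of (x, f m))" and ?h = "frag_extend (%(x, m). frag_of (x, h m))"
 have f: "f : lmod_hom (L<|B) M1 M2" and h: "h : lmod_hom (L<|B) M2 M3"
  and inj: "inj_on f (carrier M1)" and surj: "h ` carrier M2 = carrier M3"
  and mid: "f ` carrier M1 = {x : carrier M2. h x = 0[M3]}"
  using ex by (auto simp: short_exact_def)
 note fcls = M1.tensor_map_cls[OF M2.ctx f] and hcls = M2.tensor_map_cls[OF M3.ctx h]
 have fc: "f m : carrier M2" if "m : carrier M1" for m using f that by (auto simp: lmod_hom_def)
 have f0: "m = 0[M1]" if "m : carrier M1" "f m = 0[M2]" for m
 proof -
  have "f (0[M1] +[M1] 0[M1]) = f 0[M1] +[M2] f 0[M1]"
   using f M1.W.zero_closed unfolding lmod_hom_def by blast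
  hence "f 0[M1] = 0[M2]" using M2.W.add.r_cancel_one'[of "f 0[M1]" "f 0[M1]"] fc[of "0[M1]"] by simp
  thus ?thesis using inj_onD[OF inj, of m "0[M1]"] that by simp
 qed
 have inj': "inj_on (tensor_map L B M2 f) (carrier (tensor_module L B M1))"
 proof (rule inj_onI)
  fix Z Y assume "Z : carrier (tensor_module L B M1)" "Y : carrier (tensor_module L B M1)"
   and eq: "tensor_map L B M2 f Z = tensor_map L B M2 f Y"
  then obtain c d where cd: "c : M1.frags" "Z = M1.cls c" "d : M1.frags" "Y = M1.cls d"
   by (auto simp: M1.tensor_carrier)
  have "?f (c - d) : M2.rel" using eq cd by (simp add: fcls M2.cls_eq_iff frag_extend_diff)
  moreover have cd': "c - d : M1.frags" using cd by blast
  ultimately have "coordinate M1 t (c - d) = 0[M1]" if "t : T" for t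
   using that coordinate_natural[OF M1 M2 f that cd'] coordinate(4)[OF M2 that]
    coordinate(1)[OF M1 that cd'] f0 by simp
  hence "c - d : M1.rel" using coordinates_zero[OF M1 cd'] by blast
  thus "Z = Y" using cd by (simp add: M1.cls_eq_iff)
 qed
 have mid1: "tensor_map L B M3 h (tensor_map L B M2 f Z) = 0[tensor_module L B M3]"
  if Z: "Z : carrier (tensor_module L B M1)" for Z
 proof -
  obtain c where c: "c : M1.frags" "Z = M1.cls c" using Z by (auto simp: M1.tensor_carrier)
  have "?h (?f c) : M3.rel"
   using c(1)
  proof (induction c rule: M1.frags_induct)
   case (one x m)
   hence "h (f m) = 0[M3]" using mid by blast
   thus ?case using one by (simp add: M3.rel_zeror)
  qed (auto simp: frag_extend_diff M3.rel_zero M3.rel_diff)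
  thus ?thesis using c by (simp add: fcls hcls M3.cls_zero_iff M3.tensor_zero)
 qed
 have mid2: "EX Z:carrier (tensor_module L B M1). Y = tensor_map L B M2 f Z"
  if Y: "Y : carrier (tensor_module L B M2)" "tensor_map L B M3 h Y = 0[tensor_module L B M3]" for Y
 proof -
  obtain c where c: "c : M2.frags" "Y = M2.cls c" using Y by (auto simp: M2.tensor_carrier)
  have "?h c : M3.rel" using Y c by (simp add: hcls M3.cls_zero_iff M3.tensor_zero)
  hence "h (coordinate M2 t c) = 0[M3]" if "t : T" for t
   using coordinate_natural[OF M2 M3 h that c(1)] coordinate(4)[OF M3 that] by simp
  hence "EX n:carrier M1. coordinate M2 t c = f n" if "t : T" for t
   using mid coordinate(1)[OF M2 that c(1)] that by blast
  then obtain n where n: "!!t. t : T ==> n t : carrier M1 & coordinate M2 t c = f (n t)" by metis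
  obtain F where F: "finite F" "F <= T" "c - (\<Sum>t\<in>F. frag_of (g t, coordinate M2 t c)) : M2.rel"
   using tensor_expand[OF M2 c(1)] by blast
  let ?d = "\<Sum>t\<in>F. frag_of (g t, n t)"
  have "?d : M1.frags"
   using F(1,2) by (induction F rule: finite_induct) (auto simp: n g_closed)
  moreover have "?f ?d = (\<Sum>t\<in>F. frag_of (g t, coordinate M2 t c))"
   using F(1,2) by (induction F rule: finite_induct) (auto simp: n frag_extend_add)
  ultimately show ?thesis using F(3) c
   by (intro bexI[of _ "M1.cls ?d"]) (auto simp: fcls M2.cls_eq_iff M1.tensor_carrier)
 qed
 have surj': "EX Z:carrier (tensor_module L B M2). Y = tensor_map L B M3 h Z"
  if Y: "Y : carrier (tensor_module L B M3)" for Y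
 proof -
  obtain c where c: "c : M3.frags" "Y = M3.cls c" using Y by (auto simp: M3.tensor_carrier)
  have "EX d:M2.frags. ?h d = c"
   using c(1)
  proof (induction c rule: M3.frags_induct)
   case (one x m)
   hence "m : h ` carrier M2" using surj by simp
   then obtain n where "n : carrier M2" "h n = m" by auto
   thus ?case using one by (intro bexI[of _ "frag_of (x, n)"]) auto
  next
   case (diff a b)
   then obtain a' b' where "a' : M2.frags" "?h a' = a" "b' : M2.frags" "?h b' = b" by blast
   thus ?case by (intro bexI[of _ "a' - b'"]) (auto simp: frag_extend_diff)
  qed (auto intro!: bexI[of _ 0])
  then obtain d where "d : M2.frags" "?h d = c" by blast
  thus ?thesis using c by (intro bexI[of _ "M2.cls d"]) (auto simp: hcls M2.tensor_carrier)
 qed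
 note fh = M1.tensor_map_hom[OF M2.ctx f] and hh = M2.tensor_map_hom[OF M3.ctx h]
 have cl: "Z : carrier (tensor_module L B M1) ==> tensor_map L B M2 f Z : carrier (tensor_module L B M2)"
  "Y : carrier (tensor_module L B M2) ==> tensor_map L B M3 h Y : carrier (tensor_module L B M3)" for Z Y
  using fh hh by (auto simp: lmod_hom_def)
 show ?thesis
  unfolding short_exact_def
 proof (intro conjI fh hh inj')
  show "tensor_map L B M3 h ` carrier (tensor_module L B M2) = carrier (tensor_module L B M3)"
   using surj' cl(2) by blast
  show "tensor_map L B M2 f ` carrier (tensor_module L B M1) =
    {x : carrier (tensor_module L B M2). tensor_map L B M3 h x = 0[tensor_module L B M3]}"
   using mid1 mid2 cl(1) by blast
 qed
qed

lemma induction_exact: "induction_exact TYPE('m) L B"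
 unfolding induction_exact_def using short_exact_tensor by blast

end

section \<open>Complete families of local idempotents\<close>

text \<open>Orthogonal idempotents with local corners, such that passing from one idempotent to another one and back is nilpotent:
the situation of the primitive idempotents of a basic algebra with one-dimensional simple modules.\<close>

locale idempotent_family = nalg K L for K :: "'k ring" (structure) and L :: "('k, 'l) module" (structure) +
 fixes Z :: "'x set" and e :: "'x => 'l"
 assumes e_closed [simp, intro]: "nu : Z ==> e nu : carrier L"
  and e_idem [simp]: "nu : Z ==> e nu *[L] e nu = e nu"
  and e_orth: "nu : Z ==> mu : Z ==> nu ~= mu ==> e nu *[L] e mu = 0[L]"
  and e_nonzero: "nu : Z ==> e nu ~= 0[L]"
  and complete: "x : carrier L ==> EX F. finite F & F <= Z \<and>
   (S[L, F] %nu. e nu) *[L] x = x & x *[L] (S[L, F] %nu. e nu) = x"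
  and corner: "nu : Z ==> x : carrier L ==> e nu *[L] x = x ==> x *[L] e nu = x ==>
   EX k:carrier K. EX n:carrier L. nilp L n & x = k .*[L] e nu +[L] n"
  and off_corner: "nu : Z ==> mu : Z ==> nu ~= mu ==> x : carrier L ==> y : carrier L ==>
   e nu *[L] x = x ==> x *[L] e mu = x ==> e mu *[L] y = y ==> y *[L] e nu = y ==> nilp L (x *[L] y)"
begin

lemma e_assoc: "nu : Z ==> x : |L| ==> e nu *L (e nu *L x) = e nu *L x"
 by (simp add: mul_assoc[symmetric])

lemma e_orth_assoc: "nu : Z ==> mu : Z ==> nu ~= mu ==> x : |L| ==> e nu *L (e mu *L x) = 0L"
 by (simp add: mul_assoc[symmetric] e_orth)

definition unit_on :: "'x set => 'l" where
 "unit_on F = (S[L, F] %nu. e nu)"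

lemma unit_on_closed [simp, intro]: "F <= Z ==> unit_on F : |L|"
 unfolding unit_on_def by (rule M.finsum_closed) (auto simp: subset_iff)

lemma unit_on_mul: "finite F ==> F <= Z ==> x : |L| ==> unit_on F *L x = (S[L, F] %nu. e nu *L x)"
 unfolding unit_on_def by (rule finsum_mul_l) (auto simp: subset_iff)

lemma mul_unit_on: "finite F ==> F <= Z ==> x : |L| ==> x *L unit_on F = (S[L, F] %nu. x *L e nu)"
 unfolding unit_on_def by (rule finsum_mul_r) (auto simp: subset_iff)

lemma unit_on_e:
 assumes "finite F" "F <= Z" "nu : Z"
 shows "unit_on F *L e nu = (if nu : F then e nu else 0L)"
  "e nu *L unit_on F = (if nu : F then e nu else 0L)"
proof -
 have "unit_on F *L e nu = (S[L, F] %mu. if mu = nu then e nu else 0L)"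
  unfolding unit_on_mul[OF assms(1,2) e_closed[OF assms(3)]]
  using assms by (intro M.finsum_cong') (auto simp: e_orth subset_iff)
 thus "unit_on F *L e nu = (if nu : F then e nu else 0L)"
  using assms M.add.finprod_singleton_swap[of nu F "%_. e nu"]
  by (cases "nu : F") (auto intro!: M.add.finprod_one_eqI)
 have "e nu *L unit_on F = (S[L, F] %mu. if mu = nu then e nu else 0L)"
  unfolding mul_unit_on[OF assms(1,2) e_closed[OF assms(3)]]
  using assms by (intro M.finsum_cong') (auto simp: e_orth subset_iff)
 thus "e nu *L unit_on F = (if nu : F then e nu else 0L)"
  using assms M.add.finprod_singleton_swap[of nu F "%_. e nu"]
  by (cases "nu : F") (auto intro!: M.add.finprod_one_eqI)
qed

lemma unit_on_subset:
 assumes "finite F'" "F' <= Z" "F <= F'"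
 shows "unit_on F' *L unit_on F = unit_on F" "unit_on F *L unit_on F' = unit_on F"
proof -
 have F: "finite F" "F <= Z" using assms finite_subset by auto
 have "unit_on F' *L unit_on F = (S[L, F] %nu. unit_on F' *L e nu)"
  using F assms by (intro mul_unit_on) auto
 also have "... = unit_on F"
  unfolding unit_on_def[of F] using assms F by (intro M.finsum_cong') (auto simp: unit_on_e[OF assms(1,2)] subset_iff)
 finally show "unit_on F' *L unit_on F = unit_on F" .
 have "unit_on F *L unit_on F' = (S[L, F] %nu. e nu *L unit_on F')"
  using F assms by (intro unit_on_mul) auto
 also have "... = unit_on F"
  unfolding unit_on_def[of F] using assms F by (intro M.finsum_cong') (auto simp: unit_on_e[OF assms(1,2)] subset_iff)
 finally show "unit_on F *L unit_on F' = unit_on F" .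
qed

lemma complete_superset:
 assumes "x : |L|"
 shows "EX F. finite F & F <= Z & (ALL F'. finite F' --> F <= F' --> F' <= Z -->
  unit_on F' *L x = x & x *L unit_on F' = x)"
proof -
 obtain F where F: "finite F" "F <= Z" "unit_on F *L x = x" "x *L unit_on F = x"
  using complete[OF assms] unfolding unit_on_def by blast
 have "unit_on F' *L x = x & x *L unit_on F' = x" if F': "finite F'" "F <= F'" "F' <= Z" for F'
 proof
  have "unit_on F' *L (unit_on F *L x) = unit_on F *L x"
   using F(2) F'(3) assms unit_on_subset(1)[OF F'(1,3,2)] mul_assoc[of "unit_on F'" "unit_on F" x] by simp
  thus "unit_on F' *L x = x" using F by simp
  have "(x *L unit_on F) *L unit_on F' = x *L unit_on F"
   using F(2) F'(3) assms unit_on_subset(2)[OF F'(1,3,2)] mul_assoc[of x "unit_on F" "unit_on F'"] by simp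
  thus "x *L unit_on F' = x" using F by simp
 qed
 thus ?thesis using F(1,2) by blast
qed

lemma common_unit:
 assumes "finite G" "G <= |L|"
 shows "EX F. finite F & F <= Z & (ALL x:G. unit_on F *L x = x & x *L unit_on F = x)"
proof -
 obtain F where F: "!!x. x : G ==> finite (F x) & F x <= Z & (ALL F'. finite F' --> F x <= F' --> F' <= Z -->
  unit_on F' *L x = x & x *L unit_on F' = x)"
  using complete_superset assms(2) by (metis subset_iff)
 hence "finite (\<Union>(F ` G))" "\<Union>(F ` G) <= Z" using assms by auto
 moreover have "ALL x:G. unit_on (\<Union>(F ` G)) *L x = x & x *L unit_on (\<Union>(F ` G)) = x"
  using F calculation by blast
 ultimately show ?thesis by blast
qed

lemma comp_right:
 assumes x: "x : |L|" and nu: "nu : Z"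
  and off: "!!rh. rh : Z ==> rh ~= nu ==> x *L e rh = 0L"
 shows "x = x *L e nu"
proof -
 obtain F where F: "finite F" "F <= Z" "nu : F" "x *L unit_on F = x"
  using complete_superset[OF x] nu
  by (metis finite_insert insert_subset subset_insertI insertI1)
 have "(S[L, F] %rh. x *L e rh) = (S[L, F] %rh. if rh = nu then x *L e nu else 0L)"
  using F x by (intro M.finsum_cong') (auto simp: off subset_iff)
 also have "... = x *L e nu"
  using F x nu M.add.finprod_singleton_swap[of nu F "%_. x *L e nu"] by simp
 finally show ?thesis using F mul_unit_on[OF F(1,2) x] by simp
qed

lemma comp_left:
 assumes x: "x : |L|" and nu: "nu : Z"
  and off: "!!rh. rh : Z ==> rh ~= nu ==> e rh *L x = 0L"
 shows "x = e nu *L x"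
proof -
 obtain F where F: "finite F" "F <= Z" "nu : F" "unit_on F *L x = x"
  using complete_superset[OF x] nu
  by (metis finite_insert insert_subset subset_insertI insertI1)
 have "(S[L, F] %rh. e rh *L x) = (S[L, F] %rh. if rh = nu then e nu *L x else 0L)"
  using F x by (intro M.finsum_cong') (auto simp: off subset_iff)
 also have "... = e nu *L x"
  using F x nu M.add.finprod_singleton_swap[of nu F "%_. e nu *L x"] by simp
 finally show ?thesis using F unit_on_mul[OF F(1,2) x] by simp
qed

lemma zero_if_comps_zero:
 assumes x: "x : |L|" and z: "!!rh. rh : Z ==> e rh *L x = 0L"
 shows "x = 0L"
proof -
 obtain F where F: "finite F" "F <= Z" "unit_on F *L x = x"
  using complete_superset[OF x] by blast
 have "(S[L, F] %rh. e rh *L x) = 0L" using F(2) z by (intro M.add.finprod_one_eqI) auto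
 thus ?thesis using F(3) unit_on_mul[OF F(1,2) x] by simp
qed

subsection \<open>The corners are local\<close>

lemma smult_cancel_zero:
 assumes "k : KC" "k ~= \<zero>" "x : |L|" "k .*L x = 0L" shows "x = 0L"
proof -
 have ik: "inv k : KC" "inv k \<otimes> k = \<one>" using assms field_Units by auto
 have "x = (inv k \<otimes> k) .*L x" using assms ik by simp
 also have "... = inv k .*L (k .*L x)" using assms ik(1) by (simp add: smult_assoc1 del: ik)
 finally show ?thesis using assms ik by simp
qed

lemma nilp_eigen:
 assumes n: "n : |L|" "nilp L n" and z: "z : |L|" and c: "c : KC" "c ~= \<zero>"
  and eig: "n *L z = c .*L z"
 shows "z = 0L"
proof -
 have "npow L n m *L z = 0L ==> z = 0L" for m
 proof (induction m)
  case 0 thus ?case using smult_cancel_zero c z eig by simp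
 next
  case (Suc m)
  hence "c .*L (npow L n m *L z) = 0L" using n z c eig by (simp add: mul_assoc mul_smult_r)
  hence "npow L n m *L z = 0L" using smult_cancel_zero[OF c(1,2)] n z by simp
  thus ?case by (rule Suc.IH)
 qed
 moreover obtain m where "npow L n m = 0L" using n(2) by (auto simp: nilp_def)
 ultimately show ?thesis using z by (metis mul_zero_l)
qed

text \<open>If \<open>x = k e + n\<close> is idempotent with \<open>k \<noteq> 0\<close>, then \<open>n\<close> acts as \<open>- k\<close> on \<open>e - x\<close>.\<close>

lemma corner_idempotent:
 assumes nu: "nu : Z" and x: "x : |L|" "x *L x = x" "e nu *L x = x" "x *L e nu = x"
 shows "x = 0L \<or> x = e nu"
proof -
 obtain k n where k: "k : KC" and n: "n : |L|" "nilp L n" and eq: "x = k .*L e nu +L n"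
  using corner[OF nu x(1,3,4)] by blast
 show ?thesis
 proof (cases "k = \<zero>")
  case True
  hence "x = n" using eq n nu by simp
  thus ?thesis using nilp_idem n x by simp
 next
  case False
  let ?z = "e nu +L \<ominus>\<^bsub>L\<^esub> x"
  have z: "?z : |L|" using nu x by simp
  have xz: "x *L ?z = 0L"
   using nu x by (simp add: mul_distr neg_eq_smult mul_smult_r) (simp add: neg_eq_smult[symmetric] M.r_neg)
  have ez: "e nu *L ?z = ?z" using nu x by (simp add: mul_distr neg_eq_smult mul_smult_r)
  have "k .*L ?z +L n *L ?z = 0L"
  proof -
   have "(k .*L e nu +L n) *L ?z = k .*L (e nu *L ?z) +L n *L ?z"
    using k n z nu by (subst mul_distl) (auto simp: mul_smult_l)
   thus ?thesis using xz ez eq by simp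
  qed
  hence "n *L ?z = \<ominus>\<^bsub>L\<^esub> (k .*L ?z)" using n z k M.minus_unique M.a_comm by (metis M.minus_equality mul_closed smult_closed)
  hence "n *L ?z = (\<ominus> k) .*L ?z" using k z by (simp add: smult_l_minus)
  hence "?z = 0L" using nilp_eigen[of n ?z "\<ominus> k"] n z k False by (simp add: R.add.inv_eq_1_iff)
  hence "?z +L x = x" using x by simp
  hence "e nu = x" using x nu by (simp add: M.a_assoc M.l_neg)
  thus ?thesis by simp
 qed
qed

lemma e_primitive:
 assumes T: "subalgebra K L T" and nu: "nu : Z" "e nu : T"
 shows "primitive_idempotent (L<|T) (e nu)"
proof -
 have False if y: "y : T" "y ~= 0L" "y *L y = y" and z: "z : T" "z ~= 0L" "z *L z = z"
  and yz: "y *L z = 0L" "z *L y = 0L" "e nu = y +L z" for y z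
 proof -
  have yz': "y : |L|" "z : |L|" using y z subalgebraD[OF T] by auto
  have "e nu *L y = y" "y *L e nu = y" "e nu *L z = z"
   using y z yz yz' by (simp_all add: mul_distl mul_distr)
  hence "y = e nu" using corner_idempotent[OF nu(1) yz'(1) y(3)] y by blast
  thus False using \<open>e nu *L z = z\<close> yz z by simp
 qed
 thus ?thesis using nu e_nonzero by (auto simp: primitive_idempotent_def)
qed

lemma nalg_sub_sel: "carrier (left_proj (L<|T) x) = {a *L x |a. a : T}"
 "ring.add (left_proj (L<|T) x) = ring.add L" "0[left_proj (L<|T) x] = 0L"
 "smult (left_proj (L<|T) x) = monoid.mult L"
 by (auto simp: left_proj_def regular_module_def)

text \<open>An isomorphism would factor \<open>e nu\<close> as a product through \<open>e mu\<close>, but such products are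
nilpotent.\<close>

lemma e_not_iso:
 assumes T: "subalgebra K L T" and nu: "nu : Z" "e nu : T" and mu: "mu : Z" "e mu : T" and ne: "nu ~= mu"
 shows "~ lmod_iso (L<|T) (left_proj (L<|T) (e nu)) (left_proj (L<|T) (e mu))"
proof
 note T' = subalgebraD[OF T]
 assume "lmod_iso (L<|T) (left_proj (L<|T) (e nu)) (left_proj (L<|T) (e mu))"
 then obtain h where h: "h : lmod_hom (L<|T) (left_proj (L<|T) (e nu)) (left_proj (L<|T) (e mu))"
  and bij: "bij_betw h {a *L e nu |a. a : T} {a *L e mu |a. a : T}"
  by (auto simp: lmod_iso_def nalg_sub_sel)
 have hact: "h (a *L x) = a *L h x" if "a : T" "x : {a *L e nu |a. a : T}" for a x
  using h that by (auto simp: lmod_hom_def nalg_sub_sel)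
 have enu: "e nu : {a *L e nu |a. a : T}" using nu by (auto intro!: exI[of _ "e nu"])
 have emu: "e mu : {a *L e mu |a. a : T}" using mu by (auto intro!: exI[of _ "e mu"])
 let ?x = "h (e nu)"
 have "?x : {a *L e mu |a. a : T}" using bij enu by (auto simp: bij_betw_def)
 then obtain a where a: "a : T" "?x = a *L e mu" by auto
 have x: "?x : |L|" "?x *L e mu = ?x" using a mu T' by (auto simp: mul_assoc)
 have x2: "e nu *L ?x = ?x" using hact[OF nu(2) enu] nu by simp
 have "e mu : h ` {a *L e nu |a. a : T}" using bij emu by (simp add: bij_betw_def)
 then obtain c where c: "c : T" "e mu = h (c *L e nu)" by auto
 hence eq: "e mu = c *L ?x" using hact[OF c(1) enu] by simp
 let ?y = "e mu *L (c *L e nu)"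
 have "?y *L ?x = e mu *L (c *L (e nu *L ?x))" using x c nu mu T'(1) by (simp add: mul_assoc)
 also have "... = e mu *L e mu" by (simp only: x2 eq[symmetric])
 finally have yx: "?y *L ?x = e mu" using mu by simp
 have "nilp L (?y *L ?x)"
  using ne nu mu c(1) T'(1) x x2 by (intro off_corner[of mu nu]) (auto simp: mul_assoc e_assoc)
 thus False using nilp_idem[of "e mu"] e_nonzero[of mu] mu unfolding yx by simp
qed

lemma basic_family_sub:
 assumes T: "subalgebra K L T" and eT: "!!nu. nu : Z ==> e nu : T"
 shows "basic_family (L<|T) Z e"
 unfolding basic_family_def
proof (intro conjI ballI impI)
 fix x assume "x : carrier (L<|T)"
 hence "x : |L|" using subalgebraD[OF T] by simp
 then obtain F where F: "finite F" "F <= Z" "unit_on F *L x = x" "x *L unit_on F = x"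
  using complete unfolding unit_on_def by blast
 have "finsum (L<|T) e F = unit_on F"
  unfolding unit_on_def using F eT by (intro finsum_subalgebra[OF T]) auto
 thus "EX F<=Z. finite F & finsum (L<|T) e F *[L<|T] x = x \<and>
   x *[L<|T] finsum (L<|T) e F = x"
  using F by (intro exI[of _ F]) simp
qed (use e_primitive[OF T] e_not_iso[OF T] eT e_orth in auto)

subsection \<open>The maximal semisimple subalgebra\<close>

text \<open>The span of the idempotents: an element with a local unit on which each idempotent acts as a scalar is a finite
combination of them.\<close>

definition diagonal :: "'l set" where
 "diagonal = {x : |L|. ALL nu:Z. EX k:KC. e nu *L x = k .*L e nu & x *L e nu = k .*L e nu}"

lemma submoduleI_nalg:
 assumes "U <= |L|" "0L : U" "!!x y. x : U ==> y : U ==> x +L y : U"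
  "!!k x. k : KC ==> x : U ==> k .*L x : U"
 shows "submodule U K L"
proof (rule submoduleI)
 fix a assume a: "a : U"
 hence "(\<ominus> \<one>) .*L a : U" by (intro assms(4)) auto
 thus "\<ominus>\<^bsub>L\<^esub> a : U" using a assms(1) by (simp add: neg_eq_smult subset_iff)
qed (use assms in auto)

lemma diagonal_sub: "subalgebra K L diagonal"
 unfolding subalgebra_def
proof (intro conjI ballI)
 show "submodule diagonal K L"
 proof (rule submoduleI_nalg)
  fix x y assume xy: "x : diagonal" "y : diagonal"
  have "EX k:KC. e nu *L (x +L y) = k .*L e nu & (x +L y) *L e nu = k .*L e nu" if nu: "nu : Z" for nu
  proof -
   obtain k l where "k : KC" "l : KC" "e nu *L x = k .*L e nu" "x *L e nu = k .*L e nu"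
    "e nu *L y = l .*L e nu" "y *L e nu = l .*L e nu"
    using xy nu unfolding diagonal_def by blast
   thus ?thesis using xy nu
    by (intro bexI[of _ "k \<oplus> l"]) (auto simp: diagonal_def mul_distl mul_distr smult_l_distr)
  qed
  thus "x +L y : diagonal" using xy by (auto simp: diagonal_def)
 next
  fix c x assume c: "c : KC" and x: "x : diagonal"
  have "EX k:KC. e nu *L (c .*L x) = k .*L e nu & (c .*L x) *L e nu = k .*L e nu" if nu: "nu : Z" for nu
  proof -
   obtain k where "k : KC" "e nu *L x = k .*L e nu" "x *L e nu = k .*L e nu"
    using x nu unfolding diagonal_def by blast
   thus ?thesis using x c nu
    by (intro bexI[of _ "c \<otimes> k"]) (auto simp: diagonal_def mul_smult_l mul_smult_r smult_assoc1)
  qed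
  thus "c .*L x : diagonal" using x c by (auto simp: diagonal_def)
 qed (auto simp: diagonal_def intro!: bexI[of _ \<zero>])
next
 fix x y assume xy: "x : diagonal" "y : diagonal"
 have "EX k:KC. e nu *L (x *L y) = k .*L e nu & (x *L y) *L e nu = k .*L e nu" if nu: "nu : Z" for nu
 proof -
  obtain k l where kl: "k : KC" "l : KC" "e nu *L x = k .*L e nu" "x *L e nu = k .*L e nu"
   "e nu *L y = l .*L e nu" "y *L e nu = l .*L e nu"
   using xy nu unfolding diagonal_def by blast
  have c: "x : |L|" "y : |L|" using xy by (auto simp: diagonal_def)
  have "e nu *L (x *L y) = (k \<otimes> l) .*L e nu"
   using kl c nu by (simp add: mul_assoc[symmetric] mul_smult_l smult_assoc1)
  moreover have "(x *L y) *L e nu = (k \<otimes> l) .*L e nu"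
   using kl c nu by (simp add: mul_assoc mul_smult_r smult_assoc1[symmetric] R.m_comm)
  ultimately show ?thesis using kl by blast
 qed
 thus "x *L y : diagonal" using xy by (auto simp: diagonal_def)
qed

lemma e_diagonal: "nu : Z ==> e nu : diagonal"
proof -
 assume nu: "nu : Z"
 have "EX k:KC. e mu *L e nu = k .*L e mu & e nu *L e mu = k .*L e mu" if "mu : Z" for mu
  using nu that e_orth[of mu nu] e_orth[of nu mu]
  by (intro bexI[of _ "if mu = nu then \<one> else \<zero>"]) auto
 thus ?thesis using nu by (auto simp: diagonal_def)
qed

lemma unit_on_sub: "subalgebra K L T ==> (!!nu. nu : Z ==> e nu : T) ==> finite F ==> F <= Z ==> unit_on F : T"
 unfolding unit_on_def by (rule finsum_subalgebra(2)) auto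

lemma diagonal_local_units: "has_local_units (L<|diagonal)"
 unfolding has_local_units_def
proof (intro allI impI)
 fix G assume G: "finite G" "G <= carrier (L<|diagonal)"
 hence "G <= |L|" by (auto simp: diagonal_def)
 from common_unit[OF G(1) this] obtain F where F: "finite F" "F <= Z" "ALL x:G. unit_on F *L x = x & x *L unit_on F = x"
  by blast
 moreover have "unit_on F *L unit_on F = unit_on F" using F unit_on_subset by blast
 moreover have "unit_on F : diagonal" using F e_diagonal by (intro unit_on_sub[OF diagonal_sub]) auto
 ultimately show "EX u:carrier (L<|diagonal). u *[L<|diagonal] u = u \<and>
   (ALL x:G. u *[L<|diagonal] x = x & x *[L<|diagonal] u = x)"
  by (intro bexI[of _ "unit_on F"]) auto
qed

lemma diagonal_semisimple: "semisimple_algebra (L<|diagonal)"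
proof -
 let ?D = "L<|diagonal" and ?R = "regular_module (L<|diagonal)"
 note D = subalgebraD[OF diagonal_sub]
 interpret D: nalg K ?D by (rule nalg_subalgebra[OF diagonal_sub])
 interpret rm: lact ?D ?R by (rule D.lact_regular)
 have "EX W. submodule W ?D ?R & U \<inter> W = {0L} & U <+>\<^bsub>?R\<^esub> W = diagonal" if U: "submodule U ?D ?R" for U
 proof -
  let ?W = "{x : diagonal. ALL nu:Z. e nu : U --> e nu *L x = 0L}"
  have UD: "U <= diagonal" using rm.submodule_sub[OF U] by auto
  have W: "submodule ?W ?D ?R"
  proof (rule rm.submoduleI)
   fix x assume x: "x : ?W"
   have "(\<ominus> \<one>) .*L x : ?W" using x D by (auto simp: mul_smult_r)
   moreover have "x +L (\<ominus> \<one>) .*L x = 0L" using x D by (simp add: neg_eq_smult[symmetric] M.r_neg)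
   ultimately show "EX y:?W. x +[?R] y = 0[?R]" by auto
  next
   fix a x assume a: "a : carrier ?D" and x: "x : ?W"
   have "e nu *L (a *L x) = 0L" if nu: "nu : Z" "e nu : U" for nu
   proof -
    obtain k where "k : KC" "e nu *L a = k .*L e nu"
     using a nu by (auto simp: diagonal_def)
    thus ?thesis using a x nu D(1) by (simp add: mul_assoc[symmetric] mul_smult_l)
   qed
   thus "a .*[?R] x : ?W" using a x D by auto
  qed (use D in \<open>auto simp: mul_distr\<close>)
  have "x = 0L" if x: "x : U" "x : ?W" for x
  proof (rule zero_if_comps_zero)
   show xc: "x : |L|" using x D by auto
   fix nu assume nu: "nu : Z"
   show "e nu *L x = 0L"
   proof (rule ccontr)
    assume ne: "e nu *L x ~= 0L"
    obtain k where k: "k : KC" "e nu *L x = k .*L e nu" using x nu by (auto simp: diagonal_def)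
    hence k0: "k ~= \<zero>" using ne nu by auto
    have ki: "inv k : KC" "inv k \<otimes> k = \<one>" using k k0 field_Units by auto
    have "(inv k .*L e nu) *L x : U"
     using rm.submodule_act[OF U, of "inv k .*L e nu" x] D(5)[OF ki(1) e_diagonal[OF nu]] x by simp
    moreover have "(inv k .*L e nu) *L x = e nu"
     using k ki xc nu by (simp add: mul_smult_l smult_assoc1[symmetric])
    ultimately have "e nu : U" by simp
    thus False using x nu ne by auto
   qed
  qed
  hence inter: "U \<inter> ?W = {0L}" using rm.submodule_zero[OF U] rm.submodule_zero[OF W] by auto
  have "x : U <+>\<^bsub>?R\<^esub> ?W" if x: "x : diagonal" for x
  proof -
   have xc: "x : |L|" using x D by auto
   then obtain F where F: "finite F" "F <= Z" "unit_on F *L x = x"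
    using complete_superset by blast
   let ?F1 = "{nu : F. e nu : U}" and ?F2 = "{nu : F. e nu ~: U}"
   have "unit_on F = unit_on ?F1 +L unit_on ?F2"
   proof -
    have "F = ?F1 \<union> ?F2" by auto
    hence "finsum L e F = finsum L e (?F1 \<union> ?F2)" by simp
    also have "... = finsum L e ?F1 +L finsum L e ?F2"
     using F by (intro M.finsum_Un_disjoint) (auto simp: subset_iff)
    finally show ?thesis unfolding unit_on_def .
   qed
   hence xs: "x = unit_on ?F1 *L x +L unit_on ?F2 *L x"
    using F xc by (subst mul_distl[symmetric]) auto
   have "finsum L (%nu. e nu *L x) F' : U" if "finite F'" "F' <= ?F1" for F'
    using that
   proof (induction F' rule: finite_induct)
    case empty thus ?case using rm.submodule_zero[OF U] by simp
   next
    case (insert nu F')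
    hence nu: "nu : Z" "e nu : U" using F by auto
    have "e nu *L x = x *L e nu" using x nu by (auto simp: diagonal_def)
    hence "e nu *L x : U" using rm.submodule_act[OF U, of x "e nu"] x nu by simp
    thus ?case using insert rm.submodule_add[OF U, of "e nu *L x" "finsum L (%nu. e nu *L x) F'"] F xc
     by (subst M.finsum_insert) (auto simp: subset_iff)
   qed
   hence 1: "unit_on ?F1 *L x : U" using F xc by (subst unit_on_mul) auto
   have u2: "unit_on ?F2 : diagonal" using F e_diagonal by (intro unit_on_sub[OF diagonal_sub]) auto
   have "e nu *L (unit_on ?F2 *L x) = 0L" if "nu : Z" "e nu : U" for nu
   proof -
    have "e nu *L unit_on ?F2 = 0L" using that F unit_on_e(2)[of ?F2 nu] by auto
    thus ?thesis using that xc D(1)[OF u2] mul_assoc[of "e nu" "unit_on ?F2" x] by simp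
   qed
   hence 2: "unit_on ?F2 *L x : ?W" using u2 x D by auto
   show ?thesis unfolding set_add_def set_mult_def using 1 2 xs by auto
  qed
  moreover have "U <+>\<^bsub>?R\<^esub> ?W <= diagonal" using UD D by (auto simp: set_add_def set_mult_def)
  ultimately show ?thesis using W inter by blast
 qed
 thus ?thesis using diagonal_local_units by (auto simp: semisimple_algebra_def semisimple_module_def)
qed

text \<open>
  A larger semisimple subalgebra is von Neumann regular, while the corners of \<open>L\<close> have only nilpotent
  elements besides the multiples of the idempotents.
\<close>

lemma diagonal_maximal: "maximal_semisimple_subalgebra K L diagonal"
 unfolding maximal_semisimple_subalgebra_def
proof (intro conjI allI impI diagonal_sub diagonal_semisimple)
 fix T assume T: "subalgebra K L T" "semisimple_algebra (L<|T)" "diagonal <= T"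
 note T' = subalgebraD[OF T(1)]
 have eT: "e nu : T" if "nu : Z" for nu using e_diagonal that T by auto
 have reg: "EX s:T. e mu *L s = s & s *L e nu = s & x = x *L (s *L x)"
  if x: "x : T" "e nu *L x = x" "x *L e mu = x" and nu: "nu : Z" "mu : Z" for x nu mu
 proof -
  obtain s where s: "s : T" "x = x *L (s *L x)" using semisimple_regular[OF T(1,2) x(1)] by blast
  have c: "x : |L|" "s : |L|" using x s T' by auto
  have "x *L ((e mu *L (s *L e nu)) *L x) = (x *L e mu) *L (s *L (e nu *L x))"
   using c nu by (simp add: mul_assoc)
  also have "... = x" unfolding x(2,3) by (rule s(2)[symmetric])
  finally have "x = x *L ((e mu *L (s *L e nu)) *L x)" by (rule sym)
  moreover have "e mu *L (s *L e nu) : T"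
   by (rule T'(4)[OF eT[OF nu(2)] T'(4)[OF s(1) eT[OF nu(1)]]])
  moreover have "e mu *L (e mu *L (s *L e nu)) = e mu *L (s *L e nu)"
   "(e mu *L (s *L e nu)) *L e nu = e mu *L (s *L e nu)"
   using c(2) nu by (simp_all add: mul_assoc e_assoc)
  ultimately show ?thesis by blast
 qed
 have off: "x = 0L"
  if x: "x : T" "e nu *L x = x" "x *L e mu = x" and nu: "nu : Z" "mu : Z" "nu ~= mu" for x nu mu
 proof -
  obtain s where s: "s : T" "e mu *L s = s" "s *L e nu = s" "x = x *L (s *L x)"
   using reg[OF x nu(1,2)] by blast
  have c: "x : |L|" "s : |L|" using x s T' by auto
  have "nilp L (x *L s)" using x s nu c by (intro off_corner[of nu mu]) auto
  moreover have "(x *L s) *L (x *L s) = (x *L (s *L x)) *L s" using c by (simp add: mul_assoc)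
  ultimately have "x *L s = 0L" using nilp_idem[of "x *L s"] c s by simp
  hence "(x *L s) *L x = 0L" using c by simp
  thus ?thesis using s c by (simp add: mul_assoc)
 qed
 have diag: "EX k:KC. x = k .*L e nu"
  if x: "x : T" "e nu *L x = x" "x *L e nu = x" and nu: "nu : Z" for x nu
 proof -
  have xc: "x : |L|" using x T' by auto
  obtain k n where k: "k : KC" and n: "n : |L|" "nilp L n" and eq: "x = k .*L e nu +L n"
   using corner[OF nu xc x(2,3)] by blast
  have neq: "n = x +L (\<ominus> k) .*L e nu"
   using eq k n nu by (simp add: smult_l_minus M.a_comm[of "k .*L e nu" n] M.a_assoc M.r_neg)
  hence nT: "n : T" using x eT[OF nu] k T' by simp
  have en: "e nu *L n = n" "n *L e nu = n"
   unfolding neq using x xc k nu by (simp_all add: mul_distr mul_distl mul_smult_r mul_smult_l)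
  obtain s where s: "s : T" "e nu *L s = s" "s *L e nu = s" "n = n *L (s *L n)"
   using reg[OF nT en nu nu] by blast
  have sc: "s : |L|" using s T' by auto
  have "s *L n = 0L \<or> s *L n = e nu"
  proof (rule corner_idempotent[OF nu])
   have "(s *L n) *L (s *L n) = s *L (n *L (s *L n))" using sc n by (simp add: mul_assoc)
   thus "(s *L n) *L (s *L n) = s *L n" using s by simp
   show "e nu *L (s *L n) = s *L n" using s sc n nu by (simp add: mul_assoc[symmetric])
   show "(s *L n) *L e nu = s *L n" using en sc n nu by (simp add: mul_assoc)
  qed (use sc n in auto)
  moreover have "s *L n ~= e nu"
   using nilp_not_left_invertible[of n s "e nu"] n sc nu en e_nonzero by auto
  ultimately have "n = 0L" using s(4) n by simp
  thus ?thesis using eq k nu by auto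
 qed
 have "x : diagonal" if x: "x : T" for x
 proof -
  have xc: "x : |L|" using x T' by auto
  have "EX k:KC. e nu *L x = k .*L e nu & x *L e nu = k .*L e nu" if nu: "nu : Z" for nu
  proof -
   have z: "e nu *L (x *L e rh) = 0L" if "rh : Z" "nu : Z" "rh ~= nu" for rh nu
    using that x xc eT T' by (intro off[of "e nu *L (x *L e rh)" nu rh]) (auto simp: e_assoc mul_assoc)
   have "e nu *L x = (e nu *L x) *L e nu"
    using z nu xc by (intro comp_right) (auto simp: mul_assoc)
   moreover have "x *L e nu = e nu *L (x *L e nu)"
    using z nu xc by (intro comp_left) auto
   moreover obtain k where "k : KC" "e nu *L (x *L e nu) = k .*L e nu"
    using diag[of "e nu *L (x *L e nu)" nu] x xc eT T' nu by (auto simp: e_assoc mul_assoc)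
   ultimately show ?thesis using xc nu by (auto simp: mul_assoc)
  qed
  thus ?thesis using xc by (auto simp: diagonal_def)
 qed
 thus "T = diagonal" using T(3) by auto
qed

lemma diagonal_least:
 assumes T: "subalgebra K L T" and eT: "!!nu. nu : Z ==> e nu : T"
 shows "diagonal <= T"
proof
 fix x assume x: "x : diagonal"
 note B = subalgebraD[OF T]
 have xc: "x : |L|" using x by (auto simp: diagonal_def)
 obtain F where F: "finite F" "F <= Z" "unit_on F *L x = x" using complete_superset[OF xc] by blast
 have "e nu *L x : T" if nu: "nu : Z" for nu
  using x nu B(5)[OF _ eT[OF nu]] by (auto simp: diagonal_def)
 hence "finsum L (%nu. e nu *L x) F : T" using F by (intro finsum_subalgebra(2)[OF T]) auto
 thus "x : T" using F unit_on_mul[OF F(1,2) xc] by simp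
qed

end

context lact begin

lemma submodule_restrict:
 assumes U: "submodule U L M" and C: "submodule C L M" and "U <= C"
 shows "submodule U L (M<|C)"
proof -
 interpret C: lact L "M<|C" by (rule lact_sub[OF C])
 show ?thesis
  by (rule C.submoduleI)
   (use assms submodule_zero submodule_add submodule_act submodule_neg[OF U] submodule_sub[OF U] in \<open>auto intro!: bexI[of _ "\<ominus> _"] r_neg\<close>)
qed

lemma submodule_antisym_quotient:
 assumes U: "submodule U L M" and A': "submodule A' L (quotient_module M U)"
 shows "submodule {x : MC. U +> x : A'} L M"
proof -
 interpret Q: lact L "quotient_module M U" by (rule lact_quotient[OF U])
 show ?thesis
 proof (rule submoduleI)
  show "\<zero> : {x : MC. U +> x : A'}"
   using Q.submodule_zero[OF A'] quotient_coset_zero_iff[OF U, of \<zero>] submodule_zero[OF U] by (simp add: quotient_zero)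
 next
  fix x y assume "x : {x : MC. U +> x : A'}" "y : {x : MC. U +> x : A'}"
  thus "x \<oplus> y : {x : MC. U +> x : A'}"
   using Q.submodule_add[OF A', of "U +> x" "U +> y"] quotient_add[OF U] by simp
 next
  fix a x assume "a : carrier L" "x : {x : MC. U +> x : A'}"
  thus "a \<odot> x : {x : MC. U +> x : A'}"
   using Q.submodule_act[OF A', of a "U +> x"] quotient_act[OF U] by simp
 next
  fix x assume x: "x : {x : MC. U +> x : A'}"
  have "U +> (\<ominus> x) : A'"
  proof (rule Q.submodule_cancel[OF A', of "U +> x"])
   have "U +> (x \<oplus> \<ominus> x) = 0[quotient_module M U]"
    using x quotient_coset_zero_iff[OF U, of \<zero>] submodule_zero[OF U] by (simp add: r_neg)
   thus "(U +> x) +[quotient_module M U] (U +> \<ominus> x) : A'"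
    using x quotient_add[OF U, of x "\<ominus> x"] Q.submodule_zero[OF A'] by simp
  qed (use x in \<open>auto simp: quotient_carrier\<close>)
  thus "EX y:{x : MC. U +> x : A'}. x \<oplus> y = \<zero>" using x by (intro bexI[of _ "\<ominus> x"]) (auto simp: r_neg)
 qed auto
qed

lemma maximal_quotient_simple:
 assumes "maximal_submodule U L M" shows "simple_module L (quotient_module M U)"
proof -
 have U: "submodule U L M" "U ~= MC" and max: "!!W. submodule W L M ==> U <= W ==> W = U \<or> W = MC"
  using assms by (auto simp: maximal_submodule_def)
 interpret Q: lact L "quotient_module M U" by (rule lact_quotient[OF U(1)])
 obtain x where x: "x : MC" "x ~: U" using U submodule_sub by blast
 hence "U +> x ~= 0[quotient_module M U]" using quotient_coset_zero_iff[OF U(1)] by blast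
 hence 1: "carrier (quotient_module M U) ~= {0[quotient_module M U]}" using x by (auto simp: quotient_carrier)
 have 2: "A' = {0[quotient_module M U]} \<or> A' = carrier (quotient_module M U)"
  if A': "submodule A' L (quotient_module M U)" for A'
 proof -
  let ?W = "{x : MC. U +> x : A'}"
  have "U <= ?W"
  proof
   fix x assume x: "x : U"
   hence "U +> x = 0[quotient_module M U]" using quotient_coset_zero_iff[OF U(1)] submodule_sub[OF U(1)] by blast
   thus "x : ?W" using Q.submodule_zero[OF A'] submodule_sub[OF U(1) x] by simp
  qed
  then consider "?W = U" | "?W = MC" using max[OF submodule_antisym_quotient[OF U(1) A']] by blast
  thus ?thesis
  proof cases
   case 1
   have "Y = 0[quotient_module M U]" if Y: "Y : A'" for Y
   proof -
    obtain x where x: "x : MC" "Y = U +> x"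
     using Q.submodule_sub[OF A' Y] by (auto simp: quotient_carrier)
    hence "x : U" using 1 Y by blast
    thus ?thesis using x quotient_coset_zero_iff[OF U(1)] by blast
   qed
   thus ?thesis using Q.submodule_zero[OF A'] by blast
  next
   case 2
   thus ?thesis using Q.submodule_sub[OF A'] by (auto simp: quotient_carrier)
  qed
 qed
 show ?thesis using 1 2 by (auto simp: simple_module_def)
qed

lemma simple_radical: "simple_module L M ==> module_radical L M = {\<zero>}"
proof -
 assume s: "simple_module L M"
 hence "maximal_submodule {\<zero>} L M"
  using submodule_zero_module by (auto simp: simple_module_def maximal_submodule_def)
 moreover have "\<zero> : U" if "maximal_submodule U L M" for U
  using that submodule_zero by (auto simp: maximal_submodule_def)
 ultimately show ?thesis by (auto simp: module_radical_def)
qed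

lemma quotient_by_zero_iso: "lmod_iso L (quotient_module M {\<zero>}) M"
proof (rule quotient_iso[OF submodule_zero_module])
 show "(%x. x) : lmod_hom L M M" by (auto simp: lmod_hom_def)
 show "lact L M" by (rule lact_axioms)
qed auto

lemma zero_module_no_simple_factor:
 assumes "submodule U L (M\<lparr>carrier := {\<zero>}\<rparr>)" "submodule W L (M\<lparr>carrier := {\<zero>}\<rparr>)"
 shows "~ simple_module L (quotient_module ((M\<lparr>carrier := {\<zero>}\<rparr>)\<lparr>carrier := W\<rparr>) U)"
proof -
 interpret z: lact L "M\<lparr>carrier := {\<zero>}\<rparr>" by (rule lact_sub[OF submodule_zero_module])
 have U: "U = {\<zero>}" and W: "W = {\<zero>}"
  using z.submodule_sub z.submodule_zero assms by fastforce+
 have "carrier (quotient_module (M\<lparr>carrier := {\<zero>}\<rparr>) {\<zero>}) = {\<zero>\<^bsub>quotient_module (M\<lparr>carrier := {\<zero>}\<rparr>) {\<zero>}\<^esub>}"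
  using z.quotient_coset_zero_iff[OF assms(1)] U by (auto simp: z.quotient_carrier)
 thus ?thesis using U W by (simp add: simple_module_def)
qed

end

section \<open>Algebras with a band subalgebra\<close>

text \<open>The order \<open>lt\<close> stays a parameter: the two parts of the proposition differ in how it compares indices with
equal second components, and only \<open>trace_step\<close> has to notice.\<close>

locale banded = idempotent_family K L "V \<times> (UNIV :: int set)" e
 for K :: "'k ring" (structure) and L :: "('k, 'l) module" (structure)
  and V :: "'v set" and e :: "'v \<times> int => 'l" +
 fixes N :: nat and lt :: "'v \<times> int => 'v \<times> int => bool" and b :: "'v => int => int => 'l" and B :: "'l set"
 assumes N_pos: "0 < N"
  and e_b: "v : V ==> e (v, i) = b v i i"
  and b_nonzero: "v : V ==> i <= j ==> j < i + int N ==> b v j i ~= 0[L]"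
  and b_zero: "v : V ==> ~ (i <= j & j < i + int N) ==> b v j i = 0[L]"
  and b_mul: "v : V ==> w : V ==>
   b v k j *[L] b w j' i = (if v = w & j = j' & i <= j & j <= k then b v k i else 0[L])"
  and B_sub: "subalgebra K L B"
  and b_B: "v : V ==> b v j i : B"
  and B_comp: "x : B ==> v : V ==> w : V ==>
   EX k:carrier K. e (v, j) *[L] (x *[L] e (w, i)) = (if v = w then k .*[L] b v j i else 0[L])"
  and lt_irrefl: "~ lt nu nu"
  and lt_shift: "i < j ==> lt (v, i) (v, j)"
  and trace_step: "v : V ==> w : V ==> lt (v, i) (w, j) ==> x : carrier L ==>
   e (w, j) *[L] x = x ==> x *[L] e (v, i) = x ==> EX y:carrier L. x = y *[L] b v (i + 1) i"
begin

abbreviation "Z \<equiv> V \<times> (UNIV :: int set)"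
abbreviation "LB \<equiv> L<|B"
abbreviation "P v i \<equiv> left_proj LB (e (v, i))"

lemmas BD = subalgebraD[OF B_sub]

lemma b_closed [simp, intro]: "v : V ==> b v j i : |L|"
 using b_B BD(1) by blast

lemma eB: "v : V ==> e (v, i) : B"
 using b_B e_b by simp

text \<open>The submodules of the uniserial module \<open>B e (v, i)\<close>; those with \<open>m \<ge> i + N\<close> vanish.\<close>

definition U :: "'v => int => int => 'l set" where
 "U v i m = {a *L b v m i |a. a : B}"

lemma P_carrier: "carrier (P v i) = {a *L e (v, i) |a. a : B}"
 by (simp add: nalg_sub_sel)

lemma P_iff: "v : V ==> x : carrier (P v i) <-> x : B & x *L e (v, i) = x"
 using BD eB[of v i] unfolding P_carrier by (auto simp: mul_assoc intro!: exI[of _ x])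

lemma lact_P: "v : V ==> lact LB (P v i)"
 using nalg.lact_left_proj[OF nalg_subalgebra[OF B_sub]] eB by simp

lemma P_comp:
 assumes "v : V" "x : carrier (P v i)" "w : V"
 shows "EX k:KC. e (w, j) *L x = (if v = w then k .*L b v j i else 0L)"
 using B_comp[of x w v j i] assms P_iff by auto

lemma U_submodule: assumes v: "v : V" shows "submodule (U v i m) LB (P v i)"
proof -
 interpret B: nalg K LB by (rule nalg_subalgebra[OF B_sub])
 interpret r: lact LB "regular_module LB" by (rule B.lact_regular)
 have sub: "submodule {a *L b v m i |a. a : B} LB (regular_module LB)"
  using B.submodule_left_ideal[of "b v m i"] b_B[OF v] by simp
 have subP: "submodule (carrier (P v i)) LB (regular_module LB)"
  using B.submodule_left_ideal[of "e (v, i)"] eB[OF v] by (simp add: P_carrier)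
 have "U v i m <= carrier (P v i)"
 proof
  fix x assume "x : U v i m"
  then obtain a where a: "a : B" "x = a *L b v m i" by (auto simp: U_def)
  have "b v m i *L e (v, i) = b v m i"
   using v b_mul[of v v m i i i] e_b b_zero[of v i m] by auto
  thus "x : carrier (P v i)" unfolding P_iff[OF v] a(2)
   using a(1) v BD(1,4) b_B by (simp add: mul_assoc)
 qed
 moreover have "P v i = (regular_module LB)\<lparr>carrier := carrier (P v i)\<rparr>" by (simp add: left_proj_def)
 ultimately show ?thesis using r.submodule_restrict[OF sub subP] by (simp add: U_def)
qed

lemma U_zero_below:
 assumes v: "v : V" and x: "x : U v i m" and j: "j < m" shows "e (v, j) *L x = 0L"
proof -
 obtain a where a: "a : B" "x = a *L b v m i" using x by (auto simp: U_def)
 have "b v m i = e (v, m) *L b v m i"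
  using v b_mul[of v v m m m i] e_b b_zero[of v i m] by auto
 hence "e (v, j) *L x = (e (v, j) *L (a *L e (v, m))) *L b v m i"
  using a v BD(1) by (simp add: mul_assoc)
 moreover obtain k where "k : KC" "e (v, j) *L (a *L e (v, m)) = k .*L b v j m"
  using B_comp[OF a(1) v v] by auto
 moreover have "b v j m = 0L" using b_zero v j by auto
 ultimately show ?thesis using v by simp
qed

text \<open>An element of the projective \<open>P v i\<close> without components below \<open>m\<close> factors through the step from \<open>i\<close> to \<open>m\<close>.\<close>

lemma U_iff:
 assumes v: "v : V" and im: "i <= m"
 shows "x : U v i m <-> x : carrier (P v i) & (ALL j. i <= j --> j < m --> e (v, j) *L x = 0L)" (is "_ <-> ?R")
proof
 interpret P: lact LB "P v i" by (rule lact_P[OF v])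
 show "x : U v i m ==> ?R" using U_zero_below[OF v] P.submodule_sub[OF U_submodule[OF v]] by blast
 assume R: ?R
 hence xB: "x : B" and xc: "x : |L|" using P_iff[OF v] BD(1) by auto
 obtain F where F: "finite F" "F <= Z" "unit_on F *L x = x" using complete_superset[OF xc] by blast
 have comp: "e rh *L x : U v i m" if rh: "rh : Z" for rh
 proof -
  obtain w j where w: "rh = (w, j)" "w : V" using rh by auto
  obtain k where k: "k : KC" "e rh *L x = (if v = w then k .*L b v j i else 0L)"
   using P_comp[OF v _ w(2), of x i j] R w by auto
  have z: "0L : U v i m" using P.submodule_zero[OF U_submodule[OF v]] by (simp add: nalg_sub_sel)
  show ?thesis
  proof (cases "v = w & m <= j")
   case True
   hence "e rh *L x = (k .*L b v j m) *L b v m i" using k v im b_mul[of v v j m m i] by (simp add: mul_smult_l)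
   moreover have "k .*L b v j m : B" using k v b_B BD by simp
   ultimately show ?thesis by (auto simp: U_def)
  next
   case False
   have "e rh *L x = 0L"
   proof (cases "v = w")
    case True
    hence "j < m" using False by simp
    show ?thesis
    proof (cases "i <= j")
     case True thus ?thesis using R \<open>v = w\<close> \<open>j < m\<close> w by auto
    next
     case False thus ?thesis using k \<open>v = w\<close> b_zero[of v i j] v by simp
    qed
   qed (use k in simp)
   thus ?thesis using z by simp
  qed
 qed
 have "finsum L (%rh. e rh *L x) F : U v i m"
 proof (rule finsum_mem[OF F(1)])
  show "U v i m <= |L|" using BD(1) v by (auto simp: U_def)
  show "0L : U v i m" using P.submodule_zero[OF U_submodule[OF v]] by (simp add: nalg_sub_sel)
  fix x y assume "x : U v i m" "y : U v i m"
  thus "x +L y : U v i m" using P.submodule_add[OF U_submodule[OF v]] by (simp add: nalg_sub_sel)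
 qed (use comp F(2) in blast)
 thus "x : U v i m" using F(3) unit_on_mul[OF F(1,2) xc] by simp
qed

text \<open>Right multiplication by the step \<open>b v (i + 1) i\<close> is a homomorphism from the projective at \<open>(v, i +
1)\<close>, which is larger in the order.\<close>

lemma trace_hom_image:
 assumes T: "subalgebra K L T" and BT: "B <= T" and v: "v : V" and "y : T"
 shows "y *L b v (i + 1) i : (\<Union>mu\<in>{mu : Z. lt (v, i) mu}.
  \<Union>h\<in>lmod_hom (L<|T) (left_proj (L<|T) (e mu)) (left_proj (L<|T) (e (v, i))).
   h ` carrier (left_proj (L<|T) (e mu)))"
proof -
 note TD = subalgebraD[OF T]
 let ?h = "%x. x *L b v (i + 1) i"
 have bT: "b v (i + 1) i : T" "e (v, i + 1) : T" using b_B eB v BT by auto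
 have be: "b v (i + 1) i *L e (v, i) = b v (i + 1) i" "e (v, i + 1) *L b v (i + 1) i = b v (i + 1) i"
  using v b_mul e_b by auto
 have "?h : lmod_hom (L<|T) (left_proj (L<|T) (e (v, i + 1))) (left_proj (L<|T) (e (v, i)))"
  unfolding lmod_hom_def
 proof (intro CollectI conjI ballI funcsetI)
  fix x assume "x : carrier (left_proj (L<|T) (e (v, i + 1)))"
  then obtain a where a: "a : T" "x = a *L e (v, i + 1)" by (auto simp: nalg_sub_sel)
  hence "?h x = (a *L b v (i + 1) i) *L e (v, i)" using v be TD(1) by (simp add: mul_assoc)
  thus "?h x : carrier (left_proj (L<|T) (e (v, i)))"
   using a bT TD by (auto simp: nalg_sub_sel)
 qed (use bT TD v in \<open>auto simp: nalg_sub_sel mul_distl mul_assoc\<close>)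
 moreover have "y *L b v (i + 1) i = ?h (y *L e (v, i + 1))" using v be assms(4) TD(1) by (simp add: mul_assoc)
 moreover have "y *L e (v, i + 1) : carrier (left_proj (L<|T) (e (v, i + 1)))"
  using assms(4) by (auto simp: nalg_sub_sel)
 moreover have "(v, i + 1) : {mu : Z. lt (v, i) mu}" using v lt_shift by simp
 ultimately show ?thesis by blast
qed

lemma hom_image:
 assumes T: "subalgebra K L T" and eT: "e mu : T" "e (v, i) : T" and mu: "mu : Z" and v: "v : V"
  and h: "h : lmod_hom (L<|T) (left_proj (L<|T) (e mu)) (left_proj (L<|T) (e (v, i)))"
  and x: "x : h ` carrier (left_proj (L<|T) (e mu))"
 shows "EX a:T. EX y:T. x = a *L y & e mu *L y = y & y *L e (v, i) = y"
proof -
 note TD = subalgebraD[OF T]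
 obtain a where a: "a : T" "x = h (a *L e mu)" using x by (auto simp: nalg_sub_sel)
 have e: "e mu : carrier (left_proj (L<|T) (e mu))"
  using eT e_idem[OF mu] unfolding nalg_sub_sel by (metis (mono_tags, lifting) mem_Collect_eq)
 have hact: "h (c *L e mu) = c *L h (e mu)" if "c : T" for c
  using h e that unfolding lmod_hom_def by (auto simp: nalg_sub_sel)
 have "h (e mu) : carrier (left_proj (L<|T) (e (v, i)))" using h e by (auto simp: lmod_hom_def)
 then obtain c where c: "c : T" "h (e mu) = c *L e (v, i)" by (auto simp: nalg_sub_sel)
 have "h (e mu) *L e (v, i) = h (e mu)" using c v TD(1) by (simp add: mul_assoc)
 moreover have "e mu *L h (e mu) = h (e mu)" using hact[OF eT(1)] e_idem[OF mu] by simp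
 moreover have "h (e mu) : T" using c eT TD(4) by simp
 ultimately show ?thesis using a hact[OF a(1)] by blast
qed

subsection \<open>The band subalgebra is directed\<close>

lemma U_step_le: assumes v: "v : V" and "i <= m" "m <= m'" shows "U v i m' <= U v i m"
 using assms U_iff[OF v] by (auto intro: order_trans)

lemma greater_trace_B:
 assumes v: "v : V" shows "greater_trace Z lt LB e (v, i) = U v i (i + 1)"
 unfolding greater_trace_def
proof (rule lact.generated_submodule_eqI[OF lact_P[OF v] U_submodule[OF v]])
 let ?Y = "\<Union>mu\<in>{mu : Z. lt (v, i) mu}. \<Union>h\<in>lmod_hom LB (left_proj LB (e mu)) (P v i). h ` carrier (left_proj LB (e mu))"
 interpret P: lact LB "P v i" by (rule lact_P[OF v])
 show "?Y <= U v i (i + 1)"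
 proof
  fix x assume "x : ?Y"
  then obtain mu h where mu: "mu : Z" "lt (v, i) mu" and h: "h : lmod_hom LB (left_proj LB (e mu)) (P v i)"
   "x : h ` carrier (left_proj LB (e mu))" by blast
  obtain w j where w: "mu = (w, j)" "w : V" using mu by auto
  have "EX a:B. EX y:B. x = a *L y & e mu *L y = y & y *L e (v, i) = y"
   by (rule hom_image[OF B_sub _ _ mu(1) v h]) (use w v eB in auto)
  then obtain a y where a: "a : B" "x = a *L y" and y: "y : B" "e mu *L y = y" "y *L e (v, i) = y" by blast
  have yP: "y : carrier (P v i)" using y P_iff[OF v] by simp
  have "e (v, i) *L y = 0L"
  proof -
   have "mu ~= (v, i)" using mu lt_irrefl by auto
   hence "e (v, i) *L (e mu *L y) = 0L" using e_orth_assoc[of "(v, i)" mu y] v mu y BD(1) by auto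
   thus ?thesis using y by simp
  qed
  hence "y : U v i (i + 1)" using U_iff[OF v, of i "i + 1"] yP by (auto simp: order_antisym_conv)
  thus "x : U v i (i + 1)" using P.submodule_act[OF U_submodule[OF v], of a y] a by (simp add: nalg_sub_sel)
 qed
 fix W assume "submodule W LB (P v i)" "?Y <= W"
 thus "U v i (i + 1) <= W" using trace_hom_image[OF B_sub _ v, of _ i] by (auto simp: U_def)
qed

lemma e_notin_U: "v : V ==> e (v, i) ~: U v i (i + 1)"
 using U_zero_below[of v "e (v, i)" i "i + 1" i] e_nonzero[of "(v, i)"] e_idem[of "(v, i)"] by auto

text \<open>An element with a nonzero component at the top generates the whole projective.\<close>

lemma U_maximal: assumes v: "v : V" and W: "submodule W LB (P v i)" shows "W = carrier (P v i) \<or> W <= U v i (i + 1)"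
proof (rule disjCI)
 interpret P: lact LB "P v i" by (rule lact_P[OF v])
 assume "~ W <= U v i (i + 1)"
 then obtain x where x: "x : W" "x ~: U v i (i + 1)" by blast
 have xP: "x : carrier (P v i)" using x W P.submodule_sub by blast
 obtain k where k: "k : KC" "e (v, i) *L x = k .*L e (v, i)"
  using P_comp[OF v xP v, of i] e_b[OF v] by auto
 have "e (v, i) *L x ~= 0L"
 proof
  assume "e (v, i) *L x = 0L"
  hence "x : U v i (i + 1)" using U_iff[OF v, of i "i + 1"] xP by (auto simp: order_antisym_conv)
  thus False using x by simp
 qed
 hence "k ~= \<zero>" using k v by auto
 hence ki: "inv k : KC" "inv k \<otimes> k = \<one>" using k field_Units by auto
 have xc: "x : |L|" using xP P_iff[OF v] BD(1) by blast
 have "(inv k .*L e (v, i)) *L x : W"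
  using P.submodule_act[OF W, of "inv k .*L e (v, i)" x] x(1) BD(5)[OF ki(1) eB[OF v]] by (simp add: nalg_sub_sel)
 moreover have "(inv k .*L e (v, i)) *L x = e (v, i)"
  using k ki xc v by (simp add: mul_smult_l smult_assoc1[symmetric])
 ultimately have e: "e (v, i) : W" by simp
 have "y : W" if "y : carrier (P v i)" for y
  using P.submodule_act[OF W _ e, of y] that P_iff[OF v] by (simp add: nalg_sub_sel)
 thus "W = carrier (P v i)" using P.submodule_sub[OF W] by blast
qed

lemma e_in_P: "v : V ==> e (v, i) : carrier (P v i)"
 using P_iff eB e_idem by auto

lemma U_maximal_submodule: "v : V ==> maximal_submodule W LB (P v i) <-> W = U v i (i + 1)"
proof
 assume v: "v : V" and W: "maximal_submodule W LB (P v i)"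
 have "U v i (i + 1) ~= carrier (P v i)" using e_notin_U[OF v] e_in_P[OF v] by blast
 thus "W = U v i (i + 1)"
  using W U_maximal[OF v, of W] U_submodule[OF v] unfolding maximal_submodule_def by blast
next
 assume v: "v : V" and W: "W = U v i (i + 1)"
 show "maximal_submodule W LB (P v i)"
  unfolding maximal_submodule_def W
  using U_submodule[OF v] U_maximal[OF v] e_notin_U[OF v] e_in_P[OF v] by blast
qed

lemma radical_P: "v : V ==> module_radical LB (P v i) = U v i (i + 1)"
 using U_submodule lact.submodule_sub[OF lact_P U_submodule] unfolding module_radical_def by (auto simp: U_maximal_submodule)

lemma standard_B: "v : V ==> standard_module Z lt LB e (v, i) = quotient_module (P v i) (U v i (i + 1))"
 by (simp add: standard_module_def greater_trace_B)

lemma simple_top_B: "v : V ==> simple_top LB e (v, i) = quotient_module (P v i) (U v i (i + 1))"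
 by (simp add: simple_top_def radical_P)

lemma standard_simple: "v : V ==> simple_module LB (standard_module Z lt LB e (v, i))"
 unfolding standard_B by (rule lact.maximal_quotient_simple[OF lact_P]) (simp_all add: U_maximal_submodule)

lemma lact_standard: "v : V ==> lact LB (standard_module Z lt LB e (v, i))"
 unfolding standard_B by (rule lact.lact_quotient[OF lact_P U_submodule])

lemma factor_iso:
 assumes v: "v : V" and ij: "i <= j" "j < i + int N"
 shows "lmod_iso LB (quotient_module ((P v i)\<lparr>carrier := U v i j\<rparr>) (U v i (j + 1))) (standard_module Z lt LB e (v, j))"
proof -
 interpret P: lact LB "P v i" by (rule lact_P[OF v])
 let ?M = "(P v i)\<lparr>carrier := U v i j\<rparr>" and ?W = "U v i (j + 1)"
 interpret PM: lact LB ?M by (rule P.lact_sub[OF U_submodule[OF v]])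
 have W: "submodule ?W LB ?M" by (rule P.submodule_restrict[OF U_submodule[OF v] U_submodule[OF v] U_step_le[OF v ij(1)]]) simp
 interpret Pj: lact LB "P v j" by (rule lact_P[OF v])
 let ?h = "%x. ?W +>[?M] (x *L b v j i)"
 have eb: "e (v, j) *L b v j i = b v j i" using v ij b_mul[of v v j j j i] e_b by simp
 have sel: "ring.add ?M = ring.add L" "smult ?M = monoid.mult L" "ring.add (P v j) = ring.add L" "smult (P v j) = monoid.mult L"
  by (simp_all add: nalg_sub_sel)
 have PB: "x : B" "x : |L|" if "x : carrier (P v j)" for x using that P_iff[OF v] BD(1) by auto
 have xU: "x *L b v j i : U v i j" if "x : B" for x using that by (auto simp: U_def)
 have "lmod_iso LB (quotient_module (P v j) (U v j (j + 1))) (quotient_module ?M ?W)"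
 proof (rule Pj.quotient_iso[OF U_submodule[OF v] _ PM.lact_quotient[OF W]])
  show "?h : lmod_hom LB (P v j) (quotient_module ?M ?W)"
   unfolding lmod_hom_def
  proof (intro CollectI conjI ballI funcsetI)
   fix x assume x: "x : carrier (P v j)"
   show "?h x : carrier (quotient_module ?M ?W)" unfolding PM.quotient_carrier using xU PB x by auto
   fix y assume y: "y : carrier (P v j)"
   show "?h (x +[P v j] y) = ?h x +[quotient_module ?M ?W] ?h y"
    using PM.quotient_add[OF W, of "x *L b v j i" "y *L b v j i"] xU PB x y v by (simp add: sel mul_distl)
  next
   fix a x assume "a : carrier LB" and x: "x : carrier (P v j)"
   thus "?h (a .*[P v j] x) = a .*[quotient_module ?M ?W] ?h x"
    using PM.quotient_act[OF W, of "x *L b v j i" a] xU PB x v BD(1) by (simp add: sel mul_assoc)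
  qed
  show "?h ` carrier (P v j) = carrier (quotient_module ?M ?W)"
  proof
   show "?h ` carrier (P v j) <= carrier (quotient_module ?M ?W)" unfolding PM.quotient_carrier using xU PB by auto
   show "carrier (quotient_module ?M ?W) <= ?h ` carrier (P v j)"
   proof
    fix Y assume "Y : carrier (quotient_module ?M ?W)"
    then obtain a where a: "a : B" "Y = ?W +>[?M] (a *L b v j i)"
     unfolding PM.quotient_carrier by (auto simp: U_def)
    have "a *L b v j i = (a *L e (v, j)) *L b v j i" using a v BD(1) eb by (simp add: mul_assoc)
    moreover have "a *L e (v, j) : carrier (P v j)" using a by (auto simp: P_carrier)
    ultimately show "Y : ?h ` carrier (P v j)" using a by auto
   qed
  qed
  fix x assume x: "x : carrier (P v j)"
  have "?h x = 0[quotient_module ?M ?W] <-> x *L b v j i : ?W"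
   using PM.quotient_coset_zero_iff[OF W, of "x *L b v j i"] xU PB[OF x] by simp
  also have "... <-> x : U v j (j + 1)"
  proof
   assume "x : U v j (j + 1)"
   then obtain a where a: "a : B" "x = a *L b v (j + 1) j" by (auto simp: U_def)
   hence "x *L b v j i = a *L b v (j + 1) i" using v ij BD(1) b_mul[of v v "j + 1" j j i] by (simp add: mul_assoc)
   thus "x *L b v j i : ?W" using a by (auto simp: U_def)
  next
   assume "x *L b v j i : ?W"
   hence z: "e (v, j) *L (x *L b v j i) = 0L" using U_zero_below[OF v] by simp
   obtain k where k: "k : KC" "e (v, j) *L x = k .*L e (v, j)"
    using P_comp[OF v x v, of j] e_b[OF v] by auto
   have "e (v, j) *L (x *L b v j i) = (e (v, j) *L x) *L b v j i" using PB(2)[OF x] v by (simp add: mul_assoc)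
   also have "... = k .*L b v j i" using k v eb by (simp add: mul_smult_l)
   finally have "k .*L b v j i = 0L" using z by simp
   hence "k = \<zero>" using smult_cancel_zero[OF k(1)] b_nonzero[OF v ij] v by blast
   hence "e (v, j) *L x = 0L" using k v by simp
   thus "x : U v j (j + 1)" using U_iff[OF v, of j "j + 1"] x by (auto simp: order_antisym_conv)
  qed
  finally show "?h x = 0[quotient_module ?M ?W] <-> x : U v j (j + 1)" .
 qed
 thus ?thesis using lact.lmod_iso_sym[OF lact_standard[OF v], of j] by (simp add: standard_B[OF v])
qed

text \<open>The subquotients of the chain of submodules are the simple, hence standard, modules at \<open>(v, m)\<close> with
\<open>i < m < i + N\<close>.\<close>

lemma B_filtration:
 assumes v: "v : V"
 shows "standard_filtration_above Z lt LB e (v, i) ((P v i)\<lparr>carrier := greater_trace Z lt LB e (v, i)\<rparr>)"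
 unfolding standard_filtration_above_def greater_trace_B[OF v]
proof (intro exI[of _ "N - 1"] exI[of _ "%m. U v i (i + int N - int m)"] conjI allI impI)
 interpret P: lact LB "P v i" by (rule lact_P[OF v])
 have "b v (i + int N) i = 0L" using b_zero[OF v, of i "i + int N"] by simp
 thus "U v i (i + int N - int 0) = {\<zero>\<^bsub>(P v i)\<lparr>carrier := U v i (i + 1)\<rparr>\<^esub>}"
  using BD(1,2) by (auto simp: U_def nalg_sub_sel intro!: exI[of _ "0L"])
 show "U v i (i + int N - int (N - 1)) = carrier ((P v i)\<lparr>carrier := U v i (i + 1)\<rparr>)"
  using N_pos by (simp add: of_nat_diff)
 fix m assume "m <= N - 1"
 thus "submodule (U v i (i + int N - int m)) LB ((P v i)\<lparr>carrier := U v i (i + 1)\<rparr>)"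
  using N_pos by (intro P.submodule_restrict U_submodule v U_step_le) auto
next
 fix m assume m: "m < N - 1"
 thus "U v i (i + int N - int m) <= U v i (i + int N - int (Suc m))"
  by (intro U_step_le v) auto
next
 fix m assume m: "m < N - 1"
 let ?j = "i + int N - int (Suc m)"
 have eq: "i + int N - int m = ?j + 1" by simp
 have "lmod_iso LB (quotient_module ((P v i)\<lparr>carrier := U v i ?j\<rparr>) (U v i (?j + 1))) (standard_module Z lt LB e (v, ?j))"
  using m by (intro factor_iso v) auto
 thus "EX mu:Z. lt (v, i) mu & lmod_iso LB
   (quotient_module ((P v i)\<lparr>carrier := U v i (i + 1)\<rparr>\<lparr>carrier := U v i ?j\<rparr>) (U v i (i + int N - int m)))
   (standard_module Z lt LB e mu)"
  unfolding eq using m v lt_shift[of i ?j v] by (intro bexI[of _ "(v, ?j)"]) auto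
qed

lemma B_directed: "directed_algebra Z lt LB e"
 unfolding directed_algebra_def quasi_hereditary_def
proof (intro conjI ballI)
 fix nu assume "nu : Z"
 then obtain v i where v: "v : V" and [simp]: "nu = (v, i)" by auto
 interpret D: lact LB "standard_module Z lt LB e (v, i)" by (rule lact_standard[OF v])
 have rad: "module_radical LB (standard_module Z lt LB e (v, i)) = {0[standard_module Z lt LB e (v, i)]}"
  by (rule D.simple_radical[OF standard_simple[OF v]])
 show "simple_module LB (standard_module Z lt LB e nu)" using standard_simple[OF v] by simp
 show "lmod_iso LB (quotient_module (standard_module Z lt LB e nu) (module_radical LB (standard_module Z lt LB e nu)))
   (simple_top LB e nu)"
  using D.quotient_by_zero_iso rad v by (simp add: standard_B simple_top_B)
 show "composition_factors_below Z lt LB e nu (standard_module Z lt LB e nu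
   \<lparr>carrier := module_radical LB (standard_module Z lt LB e nu)\<rparr>)"
  unfolding composition_factors_below_def using D.zero_module_no_simple_factor by (auto simp: rad)
 show "standard_filtration_above Z lt LB e nu ((left_proj LB (e nu))\<lparr>carrier := greater_trace Z lt LB e nu\<rparr>)"
  using B_filtration[OF v] by simp
qed

end

subsection \<open>Inducing the simple modules\<close>

context banded begin

text \<open>By \<open>trace_step\<close> this is the trace of the larger projectives in \<open>L e (v, i)\<close>.\<close>

definition tr :: "'v => int => 'l set" where
 "tr v i = {y *L b v (i + 1) i |y. y : |L|}"

lemma b_step: "v : V ==> b v (i + 1) i *L e (v, i) = b v (i + 1) i"
 using b_mul e_b by simp

lemma lact_LP: "v : V ==> lact L (left_proj L (e (v, i)))"
 by (intro lact_left_proj) auto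

lemma tr_submodule: assumes v: "v : V" shows "submodule (tr v i) L (left_proj L (e (v, i)))"
proof -
 interpret r: lact L "regular_module L" by (rule lact_regular)
 have ec: "e (v, i) : |L|" using v by simp
 have sub: "submodule (tr v i) L (regular_module L)"
  unfolding tr_def by (rule submodule_left_ideal) (use v in simp)
 have "tr v i <= {a *L e (v, i) |a. a : |L|}"
 proof
  fix x assume "x : tr v i"
  then obtain y where y: "y : |L|" "x = y *L b v (i + 1) i" by (auto simp: tr_def)
  hence "x = (y *L b v (i + 1) i) *L e (v, i)" using v b_step[OF v] by (simp add: mul_assoc)
  thus "x : {a *L e (v, i) |a. a : |L|}" using y v by blast
 qed
 thus ?thesis
  using r.submodule_restrict[OF sub submodule_left_ideal[OF ec]] by (simp add: left_proj_def)
qed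

lemma carrier_L_sub: "subalgebra K L ( |L|)"
 by (auto simp: subalgebra_def intro: carrier_is_submodule)

lemma greater_trace_L: assumes v: "v : V" shows "greater_trace Z lt L e (v, i) = tr v i"
 unfolding greater_trace_def
proof (rule lact.generated_submodule_eqI[OF lact_LP[OF v] tr_submodule[OF v]])
 let ?Y = "\<Union>mu\<in>{mu : Z. lt (v, i) mu}. \<Union>h\<in>lmod_hom L (left_proj L (e mu)) (left_proj L (e (v, i))). h ` carrier (left_proj L (e mu))"
 have LL: "L\<lparr>carrier := carrier L\<rparr> = L" by simp
 show "?Y <= tr v i"
 proof
  fix x assume "x : ?Y"
  then obtain mu h where mu: "mu : Z" "lt (v, i) mu" and h: "h : lmod_hom L (left_proj L (e mu)) (left_proj L (e (v, i)))"
   "x : h ` carrier (left_proj L (e mu))" by blast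
  obtain w j where w: "mu = (w, j)" "w : V" using mu by auto
  have "EX a:|L|. EX y:|L|. x = a *L y & e mu *L y = y & y *L e (v, i) = y"
   by (rule hom_image[OF carrier_L_sub _ _ mu(1) v]) (use w v h in auto)
  then obtain a y where a: "a : |L|" "x = a *L y" and y: "y : |L|" "e mu *L y = y" "y *L e (v, i) = y" by blast
  obtain z where "z : |L|" "y = z *L b v (i + 1) i"
   using trace_step[OF v w(2), of i j y] y mu w by auto
  hence "x = (a *L z) *L b v (i + 1) i" "a *L z : |L|" using a v by (simp_all add: mul_assoc)
  thus "x : tr v i" by (auto simp: tr_def)
 qed
 fix W assume "submodule W L (left_proj L (e (v, i)))" "?Y <= W"
 thus "tr v i <= W" using trace_hom_image[OF carrier_L_sub _ v, of _ i] BD(1) by (auto simp: tr_def subset_iff)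
qed

text \<open>Both sides are \<open>L e (v, i)\<close> modulo \<open>L b v (i + 1) i\<close>: the simple module is the quotient of
\<open>B e (v, i)\<close> by the left multiples of the step, and induction turns \<open>B\<close> into
\<open>L\<close>.\<close>

lemma tensor_simple_iso:
 assumes v: "v : V"
 shows "lmod_iso L (tensor_module L B (simple_top LB e (v, i))) (standard_module Z lt L e (v, i))"
proof -
 let ?U = "U v i (i + 1)" and ?S = "quotient_module (P v i) (U v i (i + 1))" and ?e = "e (v, i)"
 let ?Le = "left_proj L (e (v, i))" and ?Q = "quotient_module (left_proj L (e (v, i))) (tr v i)"
 interpret P: lact LB "P v i" by (rule lact_P[OF v])
 interpret S: lact LB ?S by (rule P.lact_quotient[OF U_submodule[OF v]])
 interpret T: tensor_ctx K L B ?S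
  by (rule tensor_ctxI[OF B_sub S.lact_axioms])
 interpret Le: lact L ?Le by (rule lact_LP[OF v])
 interpret Q: lact L ?Q by (rule Le.lact_quotient[OF tr_submodule[OF v]])
 note Usub = U_submodule[OF v, of i "i + 1"] and Tsub = tr_submodule[OF v, of i]
 let ?c = "%a. ?U +>[P v i] a" and ?d = "%x. tr v i +>[?Le] x"
 have ec: "?e : |L|" using v by simp
 have selP: "ring.add (P v i) = ring.add L" "smult (P v i) = monoid.mult L" by (simp_all add: nalg_sub_sel)
 have PB: "a : B" "a : |L|" "a *L ?e = a" if "a : carrier (P v i)" for a using that P_iff[OF v] BD(1) by auto
 have eP: "?e : carrier (P v i)" by (rule e_in_P[OF v])
 have LeI: "x *L a : carrier ?Le" if "x : |L|" "a : carrier (P v i)" for x a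
 proof -
  have "x *L a = (x *L a) *L ?e" using that PB[OF that(2)] ec by (simp add: mul_assoc)
  thus ?thesis using that PB[OF that(2)] by auto
 qed
 have Ucar: "u : |L|" if "u : ?U" for u using P.submodule_sub[OF Usub that] PB by blast
 have xU: "x *L u : tr v i" if x: "x : |L|" and u: "u : ?U" for x u
 proof -
  obtain a where "a : B" "u = a *L b v (i + 1) i" using u by (auto simp: U_def)
  hence "x *L u = (x *L a) *L b v (i + 1) i" "x *L a : |L|" using x v BD(1) by (simp_all add: mul_assoc)
  thus ?thesis by (auto simp: tr_def)
 qed
 define f where "f x m = ?d (x *L (SOME a. a : m))" for x m
 have f: "f x (?c a) = ?d (x *L a)" if x: "x : |L|" and a: "a : carrier (P v i)" for x a
 proof -
  have "(SOME a'. a' : ?c a) : ?c a" by (rule someI[of _ a]) (rule P.coset_self[OF Usub a])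
  then obtain u where u: "u : ?U" "(SOME a'. a' : ?c a) = u +L a" by (auto simp: P.coset_iff selP)
  have "x *L (u +L a) = x *L u +L x *L a" using x a PB[OF a] Ucar[OF u(1)] by (simp add: mul_distr)
  moreover have "x *L (u +L a) : carrier ?Le"
   using P.add.m_closed[OF P.submodule_sub[OF Usub u(1)] a] by (intro LeI x) (simp add: selP)
  ultimately have "?d (x *L (u +L a)) = ?d (x *L a)"
   using Le.coset_eq_iff[OF Tsub, of "x *L (u +L a)" "x *L a"] LeI[OF x a] xU[OF x u(1)] by auto
  thus ?thesis by (simp add: f_def u)
 qed
 have Scar: "m : carrier ?S <-> (EX a:carrier (P v i). m = ?c a)" for m by (auto simp: P.quotient_carrier)
 obtain \<Phi> where \<Phi>: "!!x m. x : |L| ==> m : carrier ?S ==> \<Phi> (frag_of (x, m)) = f x m"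
  and \<Phi>0: "!!c. c : T.rel ==> \<Phi> c = 0[?Q]"
 proof (rule T.tensor_universal[of ?Q f])
  show "abelian_group ?Q" by (rule Q.abelian_group_axioms)
  fix x m assume x: "x : |L|" and m: "m : carrier ?S"
  then obtain a where a: "a : carrier (P v i)" "m = ?c a" by (auto simp: Scar)
  show "f x m : carrier ?Q" using LeI[OF x a(1)] by (auto simp: f[OF x a(1)] a(2) Le.quotient_carrier)
  {
   fix y assume y: "y : |L|"
   show "f (x +L y) m = f x m +[?Q] f y m"
    using x y a PB[OF a(1)] LeI Le.quotient_add[OF Tsub, of "x *L a" "y *L a"] by (simp add: f mul_distl)
  next
   fix n assume "n : carrier ?S"
   then obtain a' where a': "a' : carrier (P v i)" "n = ?c a'" by (auto simp: Scar)
   have "a +L a' : carrier (P v i)" using P.add.m_closed[OF a(1) a'(1)] by (simp add: selP)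
   thus "f x (m +[?S] n) = f x m +[?Q] f x n"
    using x a a' PB[OF a(1)] PB[OF a'(1)] LeI Le.quotient_add[OF Tsub, of "x *L a" "x *L a'"]
     P.quotient_add[OF Usub a(1) a'(1)] by (simp add: f mul_distr selP)
  next
   fix c assume c: "c : B"
   have "c *L a : carrier (P v i)" using P.act_closed[of c a] c a(1) by (simp add: selP)
   thus "f (x *L c) m = f x (c .*[?S] m)"
    using x a c PB[OF a(1)] BD(1) P.quotient_act[OF Usub a(1), of c] by (simp add: f mul_assoc selP)
  }
 qed blast
 let ?ebar = "?c ?e" and ?k = "%x. T.cls (frag_of (x, ?U +>[P v i] e (v, i)))"
 have e0: "?ebar : carrier ?S" using eP by (auto simp: Scar)
 have act_e0: "a .*[?S] ?ebar = ?c a" if a: "a : carrier (P v i)" for a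
  using P.quotient_act[OF Usub eP, of a] PB[OF a] by (simp add: selP)
 have LeL: "x : |L|" "x *L ?e = x" if "x : carrier ?Le" for x using that ec e_idem[of "(v, i)"] v by (auto simp: mul_assoc)
 have "lmod_iso L ?Q (tensor_module L B ?S)"
 proof (rule Le.quotient_iso[OF Tsub _ T.lact_tensor])
  show "?k : lmod_hom L ?Le (tensor_module L B ?S)"
   unfolding lmod_hom_def
  proof (intro CollectI conjI ballI funcsetI)
   fix x assume x: "x : carrier ?Le"
   show "?k x : carrier (tensor_module L B ?S)"
    unfolding T.tensor_carrier using T.frags_of[OF LeL(1)[OF x] e0] by blast
   fix y assume y: "y : carrier ?Le"
   have "frag_of (x +L y, ?ebar) - (frag_of (x, ?ebar) + frag_of (y, ?ebar)) : T.rel"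
    using T.rel_addl[OF LeL(1)[OF x] LeL(1)[OF y] e0] by (simp only: diff_diff_eq)
   thus "?k (x +[?Le] y) = ?k x +[tensor_module L B ?S] ?k y"
    by (simp only: T.tensor_add T.cls_eq_iff left_proj_sel)
  next
   fix a x assume "a : |L|" "x : carrier ?Le"
   thus "?k (a .*[?Le] x) = a .*[tensor_module L B ?S] ?k x" by (simp add: T.tensor_act)
  qed
  have surj: "EX x:carrier ?Le. c - frag_of (x, ?ebar) : T.rel" if "c : T.frags" for c
   using that
  proof (induction c rule: T.frags_induct)
   case zero
   thus ?case using T.rel_zerol[OF e0] Le.zero_closed by (intro bexI[of _ "0L"]) (auto simp: T.rel_minus_iff)
  next
   case (one x m)
   then obtain a where a: "a : carrier (P v i)" "m = ?c a" by (auto simp: Scar)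
   have "frag_of (x *L a, ?ebar) - frag_of (x, m) : T.rel"
    using T.rel_bal[of x a ?ebar] one PB[OF a(1)] e0 a act_e0 by simp
   hence "frag_of (x, m) - frag_of (x *L a, ?ebar) : T.rel" using T.rel_minus_iff by (metis minus_diff_eq)
   thus ?case using LeI[OF one(1) a(1)] by blast
  next
   case (diff c d)
   then obtain x y where x: "x : carrier ?Le" "c - frag_of (x, ?ebar) : T.rel"
    and y: "y : carrier ?Le" "d - frag_of (y, ?ebar) : T.rel" by blast
   let ?z = "x +[?Le] \<ominus>\<^bsub>?Le\<^esub> y"
   have z: "?z : carrier ?Le" using x y by (intro Le.add.m_closed Le.a_inv_closed)
   have "?z +[?Le] y = x" using x y by (simp add: Le.a_assoc Le.l_neg del: left_proj_sel)
   hence "frag_of (x, ?ebar) - frag_of (?z, ?ebar) - frag_of (y, ?ebar) : T.rel"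
    using T.rel_addl[of ?z y ?ebar] LeL(1)[OF z] LeL(1)[OF y(1)] e0 by simp
   from T.rel_add[OF T.rel_diff[OF x(2) y(2)] this]
   have "c - d - frag_of (?z, ?ebar) : T.rel" by (simp add: algebra_simps)
   thus ?case using z by blast
  qed
  show "?k ` carrier ?Le = carrier (tensor_module L B ?S)"
  proof
   show "?k ` carrier ?Le <= carrier (tensor_module L B ?S)" using LeL(1) e0 by (auto simp: T.tensor_carrier)
   show "carrier (tensor_module L B ?S) <= ?k ` carrier ?Le"
   proof
    fix Y assume "Y : carrier (tensor_module L B ?S)"
    then obtain c where c: "c : T.frags" "Y = T.cls c" by (auto simp: T.tensor_carrier)
    then obtain x where "x : carrier ?Le" "c - frag_of (x, ?ebar) : T.rel" using surj by blast
    thus "Y : ?k ` carrier ?Le" using c T.cls_eq_iff by blast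
   qed
  qed
  fix x assume x: "x : carrier ?Le"
  have "?k x = 0[tensor_module L B ?S] <-> frag_of (x, ?ebar) : T.rel" by (simp add: T.tensor_zero T.cls_zero_iff)
  also have "... <-> x : tr v i"
  proof
   assume "frag_of (x, ?ebar) : T.rel"
   hence "f x ?ebar = 0[?Q]" using \<Phi> \<Phi>0 LeL(1)[OF x] e0 by metis
   hence "?d x = 0[?Q]" using f[OF LeL(1)[OF x] eP] LeL(2)[OF x] by simp
   thus "x : tr v i" using Le.quotient_coset_zero_iff[OF Tsub x] by blast
  next
   assume "x : tr v i"
   then obtain y where y: "y : |L|" "x = y *L b v (i + 1) i" by (auto simp: tr_def)
   have bU: "b v (i + 1) i : ?U"
    unfolding U_def using v e_b b_mul[of v v "i + 1" "i + 1" "i + 1" i] eB[of v "i + 1"]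
    by (auto intro!: exI[of _ "e (v, i + 1)"])
   have "b v (i + 1) i .*[?S] ?ebar = 0[?S]"
    using act_e0[OF P.submodule_sub[OF Usub bU]] P.quotient_coset_zero_iff[OF Usub P.submodule_sub[OF Usub bU]] bU by simp
   hence "frag_of (x, ?ebar) - frag_of (y, 0[?S]) : T.rel"
    using T.rel_bal[of y "b v (i + 1) i" ?ebar] y e0 b_B[OF v] by simp
   from T.rel_add[OF this T.rel_zeror[OF y(1)]] show "frag_of (x, ?ebar) : T.rel" by simp
  qed
  finally show "?k x = 0[tensor_module L B ?S] <-> x : tr v i" .
 qed
 hence "lmod_iso L (tensor_module L B ?S) ?Q" by (rule Q.lmod_iso_sym)
 thus ?thesis by (simp add: simple_top_B[OF v] standard_module_def greater_trace_L[OF v])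
qed

theorem strong_exact_Borel:
 assumes "dual_basis K L B T g bt"
 shows "strong_exact_Borel_subalgebra TYPE('m) K Z lt L e B e"
 unfolding strong_exact_Borel_subalgebra_def exact_Borel_subalgebra_def
proof (intro conjI ballI exI[of _ diagonal] B_sub B_directed diagonal_maximal)
 have eB': "e nu : B" if "nu : Z" for nu using that eB by auto
 show "basic_family L Z e" using basic_family_sub[OF carrier_L_sub] by simp
 show "basic_family LB Z e" using basic_family_sub[OF B_sub eB'] by simp
 show "diagonal <= B" using diagonal_least[OF B_sub eB'] .
 show "induction_exact TYPE('m) L B" by (rule dual_basis.induction_exact[OF assms])
 fix nu assume "nu : Z"
 thus "lmod_iso L (tensor_module L B (simple_top LB e nu)) (standard_module Z lt L e nu)"
  using tensor_simple_iso by auto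
qed

end

section \<open>The matrix algebra of a filtered algebra\<close>

context abelian_monoid begin

lemma finsum_swap:
 assumes "finite A" "finite B" "!!i j. i : A ==> j : B ==> f i j : carrier G"
 shows "(\<Oplus>i\<in>A. \<Oplus>j\<in>B. f i j) = (\<Oplus>j\<in>B. \<Oplus>i\<in>A. f i j)"
 using assms(1,3)
proof (induction A rule: finite_induct)
 case empty
 have "(\<Oplus>j\<in>B. \<Oplus>i\<in>{}. f i j) = \<zero>" by (rule add.finprod_one_eqI) simp
 thus ?case by simp
next
 case (insert a A)
 hence "(\<Oplus>i\<in>insert a A. \<Oplus>j\<in>B. f i j) = (\<Oplus>j\<in>B. f a j) \<oplus> (\<Oplus>j\<in>B. \<Oplus>i\<in>A. f i j)"
  by (subst finsum_insert) (auto intro!: finsum_closed)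
 also have "... = (\<Oplus>j\<in>B. f a j \<oplus> (\<Oplus>i\<in>A. f i j))"
  using insert by (intro finsum_addf[symmetric]) (auto intro!: finsum_closed)
 also have "... = (\<Oplus>j\<in>B. \<Oplus>i\<in>insert a A. f i j)"
  using insert by (intro finsum_cong') (auto intro!: finsum_closed)
 finally show ?case .
qed

end

context nalg begin

lemma subspaceD:
 assumes "submodule D K L"
 shows "x : D ==> x : |L|" "0L : D" "x : D ==> y : D ==> x +L y : D"
  "k : KC ==> x : D ==> k .*L x : D" "x : D ==> \<ominus>\<^bsub>L\<^esub> x : D" "additive_subgroup D L"
proof -
 show "additive_subgroup D L" using assms submodule.axioms(1) by (simp add: additive_subgroup_def)
qed (use submoduleE[OF assms] assms subgroup.one_closed[OF submodule.axioms(1)[OF assms]] in auto)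

lemma subspace_finsum: "submodule D K L ==> finite F ==> (!!i. i : F ==> f i : D) ==> finsum L f F : D"
 by (rule finsum_mem) (auto dest: subspaceD)

lemma finsum_smult:
 "finite F ==> k : KC ==> f : F \<rightarrow> |L| ==> k .*L finsum L f F = (S[L, F] %i. k .*L f i)"
proof (induction F rule: finite_induct)
 case (insert i F)
 thus ?case by (subst M.finsum_insert; simp add: smult_r_distr Pi_iff)+
qed simp

end

locale filtered = nalg K E for K :: "'k ring" (structure) and E :: "('k, 'a) module" (structure) +
 fixes I :: "nat => 'a set" and N :: nat
 assumes N_pos: "0 < N"
  and I_sub: "submodule (I m) K E"
  and I_zero: "I 0 = carrier E"
  and I_end: "N <= m ==> I m = {0[E]}"
  and I_anti: "I (Suc m) <= I m"
  and I_mul: "x : I i ==> y : I j ==> x *[E] y : I (i + j)"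
begin
abbreviation carrier_E ("|E|") where "|E| \<equiv> carrier E"
abbreviation mult_E (infixl "*E" 70) where "x *E y \<equiv> x *[E] y"
abbreviation add_E (infixl "+E" 65) where "x +E y \<equiv> x +[E] y"
abbreviation smult_E (infixl ".*E" 70) where "k .*E x \<equiv> k .*[E] x"
abbreviation zero_E ("0E") where "0E \<equiv> 0[E]"


abbreviation "C \<equiv> matrix_algebra E I N"
abbreviation carrier_C ("|C|") where "|C| \<equiv> carrier C"
abbreviation mult_C (infixl "*C" 70) where "x *C y \<equiv> x *[C] y"
abbreviation add_C (infixl "+C" 65) where "x +C y \<equiv> x +[C] y"
abbreviation smult_C (infixl ".*C" 70) where "k .*C x \<equiv> k .*[C] x"
abbreviation zero_C ("0C") where "0C \<equiv> 0[C]"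

abbreviation "num \<equiv> entry_num E I"
abbreviation "den \<equiv> entry_den E I N"

lemmas ID = subspaceD[OF I_sub]

lemma I_mono: "i <= j ==> I j <= I i"
 by (induction j rule: dec_induct) (use I_anti in auto)

lemma num_eq: "num r c = I (nat (r - c))"
 using I_zero by (auto simp: entry_num_def)

lemma den_eq: "den r c = I (nat (int N - max 0 (c - r)))"
 using I_zero I_end[of N] by (auto simp: entry_den_def max_def)

lemma num_sub: "submodule (num r c) K E"
 by (simp add: num_eq I_sub)

lemma den_sub: "submodule (den r c) K E"
 by (simp add: den_eq I_sub)

lemma num_mono: "r <= r' ==> c' <= c ==> num r' c' <= num r c"
 unfolding num_eq by (intro I_mono) auto

lemma den_num: "x : den r c ==> x : num r c"
proof (cases "r > c")
 case True
 assume "x : den r c"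
 thus ?thesis using True subspaceD(2)[OF num_sub] by (simp add: entry_den_def)
next
 case False
 assume "x : den r c"
 thus ?thesis using False subspaceD(1)[OF den_sub] by (simp add: entry_num_def)
qed

lemma num_closed: "x : num r c ==> x : |E|"
 using subspaceD(1)[OF num_sub] .

lemma den_closed: "x : den r c ==> x : |E|"
 using subspaceD(1)[OF den_sub] .

text \<open>
  All three are the subadditivity of the positive part: entries have filtration degree at least
  \<open>(r - c)\<^sup>+\<close>, and the degree \<open>N - (c - r)\<^sup>+\<close> is where they are cut off.
\<close>

lemma num_mul_num: "x : num r c ==> y : num c d ==> x *E y : num r d"
proof -
 assume "x : num r c" "y : num c d"
 moreover have "nat (r - d) <= nat (r - c) + nat (c - d)" by arith
 ultimately show ?thesis unfolding num_eq using I_mul I_mono by blast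
qed

lemma den_mul_num: "x : den r c ==> y : num c d ==> x *E y : den r d"
proof -
 assume "x : den r c" "y : num c d"
 moreover have "nat (int N - max 0 (d - r)) <= nat (int N - max 0 (c - r)) + nat (c - d)" by arith
 ultimately show ?thesis unfolding num_eq den_eq using I_mul I_mono by blast
qed

lemma num_mul_den: "x : num r c ==> y : den c d ==> x *E y : den r d"
proof -
 assume "x : num r c" "y : den c d"
 moreover have "nat (int N - max 0 (d - r)) <= nat (r - c) + nat (int N - max 0 (d - c))" by arith
 ultimately show ?thesis unfolding num_eq den_eq using I_mul I_mono by blast
qed

lemma den_coset_zero [simp]: "den r c +>[E] 0E = den r c"
 using M.add_coset_eq_self_iff[OF subspaceD(6)[OF den_sub], of "0E"] subspaceD(2)[OF den_sub] by simp

text \<open>Elements of the matrix algebra are handled through matrices of representatives.\<close>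

definition Mat :: "(int => int => 'a) set" where
 "Mat = {z. (ALL r c. z r c : num r c) & finite {(r, c). z r c ~= 0E}}"

definition mk :: "(int => int => 'a) => int => int => 'a set" where
 "mk z = (%r c. den r c +>[E] z r c)"

definition mm :: "(int => int => 'a) => (int => int => 'a) => int => int => 'a" where
 "mm z y r d = (S[E, {c. z r c ~= 0E}] %c. z r c *E y c d)"

lemma Mat_num: "z : Mat ==> z r c : num r c"
 by (simp add: Mat_def)

lemma Mat_closed [simp, intro]: "z : Mat ==> z r c : |E|"
 using Mat_num num_closed by blast

lemma Mat_finite: "z : Mat ==> finite {(r, c). z r c ~= 0E}"
 by (simp add: Mat_def)

lemma Mat_range: "z : Mat ==> EX R. finite R & (ALL r c. z r c ~= 0E --> r : R & c : R)"
proof -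
 assume z: "z : Mat"
 let ?A = "{(r, c). z r c ~= 0E}"
 have "finite (fst ` ?A \<union> snd ` ?A)" using Mat_finite[OF z] by simp
 moreover have "ALL r c. z r c ~= 0E --> r : fst ` ?A \<union> snd ` ?A & c : fst ` ?A \<union> snd ` ?A" by force
 ultimately show ?thesis by blast
qed

lemma Mat_row_finite: "z : Mat ==> finite {c. z r c ~= 0E}"
 using Mat_range[of z] by (auto intro: finite_subset)

lemma MatI: "(!!r c. z r c : num r c) ==> finite R ==> (!!r c. z r c ~= 0E ==> r : R & c : R) ==> z : Mat"
 unfolding Mat_def by (auto intro: finite_subset[of _ "R \<times> R"])

lemma mk_eq_iff: "z : Mat ==> y : Mat ==> mk z = mk y <-> (ALL r c. EX u:den r c. z r c = u +E y r c)"
 by (auto simp: mk_def fun_eq_iff M.add_coset_eq_iff[OF subspaceD(6)[OF den_sub]])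

lemma mk_carrier: "z : Mat ==> mk z : |C|"
proof -
 assume z: "z : Mat"
 have "{(r, c). mk z r c ~= den r c} <= {(r, c). z r c ~= 0E}"
  using z subspaceD(2)[OF den_sub] by (auto simp: mk_def M.add_coset_eq_self_iff[OF subspaceD(6)[OF den_sub]])
 hence "finite {(r, c). mk z r c ~= den r c}" using Mat_finite[OF z] finite_subset by blast
 thus ?thesis using Mat_num[OF z] by (auto simp: matrix_algebra_def mk_def)
qed

lemma mk_surj: "Y : |C| ==> EX z:Mat. Y = mk z"
proof -
 assume Y: "Y : |C|"
 hence ex: "EX x. x : num r c & Y r c = den r c +>[E] x" for r c
  by (simp add: matrix_algebra_def) blast
 define z where "z r c = (if Y r c = den r c then 0E else SOME x. x : num r c & Y r c = den r c +>[E] x)" for r c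
 have zp: "z r c : num r c & Y r c = den r c +>[E] z r c" for r c
 proof (cases "Y r c = den r c")
  case True
  thus ?thesis using subspaceD(2)[OF num_sub] by (simp add: z_def)
 next
  case False
  thus ?thesis using someI_ex[OF ex[of r c]] by (simp add: z_def)
 qed
 have "{(r, c). z r c ~= 0E} <= {(r, c). Y r c ~= den r c}" by (auto simp: z_def)
 hence "z : Mat" using Y zp finite_subset by (auto simp: Mat_def matrix_algebra_def)
 moreover have "Y = mk z" using zp by (auto simp: mk_def fun_eq_iff)
 ultimately show ?thesis by blast
qed

lemma carrier_C: "|C| = mk ` Mat"
 using mk_surj mk_carrier by blast

lemma Mat_add: "z : Mat ==> y : Mat ==> (%r c. z r c +E y r c) : Mat"
proof -
 assume z: "z : Mat" and y: "y : Mat"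
 obtain R R' where "finite R" "ALL r c. z r c ~= 0E --> r : R & c : R" "finite R'" "ALL r c. y r c ~= 0E --> r : R' & c : R'"
  using Mat_range[OF z] Mat_range[OF y] by blast
 thus ?thesis
 proof (intro MatI[of _ "R \<union> R'"])
  fix r c show "z r c +E y r c : num r c" using subspaceD(3)[OF num_sub] Mat_num z y by blast
  assume "z r c +E y r c ~= 0E"
  hence "z r c ~= 0E \<or> y r c ~= 0E" by auto
  thus "r : R \<union> R' & c : R \<union> R'"
   using \<open>ALL r c. z r c ~= 0E --> r : R & c : R\<close> \<open>ALL r c. y r c ~= 0E --> r : R' & c : R'\<close> by blast
 qed simp
qed

lemma mk_add: "z : Mat ==> y : Mat ==> mk z +C mk y = mk (%r c. z r c +E y r c)"
 using abelian_subgroup.a_rcos_sum[OF abelian_subgroupI3[OF subspaceD(6)[OF den_sub] M.abelian_group_axioms]]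
 by (auto simp: matrix_algebra_def mk_def fun_eq_iff)

lemma Mat_zero: "(%r c. 0E) : Mat"
 using subspaceD(2)[OF num_sub] by (auto simp: Mat_def)

lemma mk_zero: "0C = mk (%r c. 0E)"
 by (simp add: matrix_algebra_def mk_def fun_eq_iff)

lemma mk_zero_iff: "z : Mat ==> mk z = 0C <-> (ALL r c. z r c : den r c)"
 using M.add_coset_eq_self_iff[OF subspaceD(6)[OF den_sub]] by (auto simp: matrix_algebra_def mk_def fun_eq_iff)

lemma Mat_smult: "k : KC ==> z : Mat ==> (%r c. k .*E z r c) : Mat"
proof -
 assume k: "k : KC" and z: "z : Mat"
 have "{(r, c). k .*E z r c ~= 0E} <= {(r, c). z r c ~= 0E}" using k by auto
 thus ?thesis using subspaceD(4)[OF num_sub] k Mat_num[OF z] Mat_finite[OF z] finite_subset by (auto simp: Mat_def)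
qed

lemma mk_smult: assumes k: "k : KC" and z: "z : Mat" shows "k .*C mk z = mk (%r c. k .*E z r c)"
proof -
 have "(\<Union>x\<in>den r c +>[E] z r c. den r c +>[E] (k .*E x)) = den r c +>[E] (k .*E z r c)" for r c
 proof -
  have "den r c +>[E] (k .*E x) = den r c +>[E] (k .*E z r c)" if x: "x : den r c +>[E] z r c" for x
  proof -
   obtain u where u: "u : den r c" "x = u +E z r c" using x by (auto simp: M.add_coset_iff)
   hence "k .*E x = k .*E u +E k .*E z r c" "k .*E u : den r c"
    using k z den_closed subspaceD(4)[OF den_sub] by (auto simp: smult_r_distr)
   thus ?thesis using M.add_coset_eq_iff[OF subspaceD(6)[OF den_sub], of "k .*E x" "k .*E z r c"] k z u den_closed by auto
  qed
  hence "(\<Union>x\<in>den r c +>[E] z r c. den r c +>[E] (k .*E x)) = (\<Union>x\<in>den r c +>[E] z r c. den r c +>[E] (k .*E z r c))"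
   by (intro arg_cong[where f = Union] image_cong) auto
  thus ?thesis using M.add_coset_self[OF subspaceD(6)[OF den_sub], of "z r c"] z by auto
 qed
 thus ?thesis by (simp add: matrix_algebra_def mk_def)
qed

lemma coset_finsum_cong:
 assumes D: "submodule D K E" and F: "finite F" "f : F \<rightarrow> |E|" "g : F \<rightarrow> |E|"
  and fg: "!!i. i : F ==> EX u:D. f i = u +E g i"
 shows "EX u:D. finsum E f F = u +E finsum E g F"
 using F fg
proof (induction F rule: finite_induct)
 case empty
 thus ?case using subspaceD(2)[OF D] by (intro bexI[of _ "0E"]) auto
next
 case (insert i F)
 then obtain u w where u: "u : D" "f i = u +E g i" and w: "w : D" "finsum E f F = w +E finsum E g F" by blast
 have cl: "g i : |E|" "finsum E g F : |E|" "u : |E|" "w : |E|"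
  using insert u w subspaceD(1)[OF D] by (auto simp: Pi_iff)
 have "finsum E f (insert i F) = f i +E finsum E f F" "finsum E g (insert i F) = g i +E finsum E g F"
  using insert by (auto intro!: M.finsum_insert)
 hence "finsum E f (insert i F) = (u +E w) +E finsum E g (insert i F)"
  using u w cl by (simp add: M.a_ac)
 thus ?case using subspaceD(3)[OF D u(1) w(1)] by blast
qed

lemma mm_superset:
 assumes "z : Mat" "y : Mat" "finite F" "{c. z r c ~= 0E} <= F"
 shows "mm z y r d = (S[E, F] %c. z r c *E y c d)"
 unfolding mm_def using assms by (intro M.add.finprod_mono_neutral_cong_left) auto

lemma Mat_mm: assumes z: "z : Mat" and y: "y : Mat" shows "mm z y : Mat"
proof -
 obtain R R' where R: "finite R" "!!r c. z r c ~= 0E ==> r : R & c : R"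
  and R': "finite R'" "!!r c. y r c ~= 0E ==> r : R' & c : R'"
  using Mat_range[OF z] Mat_range[OF y] by metis
 show ?thesis
 proof (rule MatI[of _ "R \<union> R'"])
  fix r d
  show "mm z y r d : num r d"
   unfolding mm_def using Mat_row_finite[OF z] Mat_num[OF z] Mat_num[OF y]
   by (intro subspace_finsum[OF num_sub]) (auto intro!: num_mul_num[OF Mat_num[OF z] Mat_num[OF y]])
  assume ne: "mm z y r d ~= 0E"
  have "EX c. z r c ~= 0E & y c d ~= 0E"
  proof (rule ccontr)
   assume "\<nexists>c. z r c ~= 0E & y c d ~= 0E"
   hence "mm z y r d = 0E" unfolding mm_def using z by (intro M.add.finprod_one_eqI) auto
   thus False using ne by simp
  qed
  thus "r : R \<union> R' & d : R \<union> R'" using R R' by blast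
 qed (use R(1) R'(1) in simp)
qed

lemma mk_mul: assumes z: "z : Mat" and y: "y : Mat" shows "mk z *C mk y = mk (mm z y)"
proof -
 have "den r d +>[E] (S[E, {c. mk z r c ~= den r c}] %c. (SOME x. x : mk z r c) *E (SOME x. x : mk y c d)) =
   den r d +>[E] mm z y r d" for r d
 proof -
  let ?F = "{c. mk z r c ~= den r c}" and ?F' = "{c. z r c ~= 0E}"
  have some: "EX u:den r c. (SOME x. x : mk w r c) = u +E w r c" if "w : Mat" for w r c
  proof -
   have "(SOME x. x : mk w r c) : mk w r c"
    by (rule someI[of _ "w r c"]) (use M.add_coset_self[OF subspaceD(6)[OF den_sub], of "w r c"] that in \<open>simp add: mk_def\<close>)
   thus ?thesis by (simp add: mk_def M.add_coset_iff)
  qed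
  have in_den: "mk z r c = den r c <-> z r c : den r c" for c
   using M.add_coset_eq_self_iff[OF subspaceD(6)[OF den_sub]] z by (simp add: mk_def)
  hence sub: "?F <= ?F'" using subspaceD(2)[OF den_sub] by auto
  have fin: "finite ?F'" "finite ?F" using Mat_row_finite[OF z] finite_subset[OF sub] by auto
  define f where "f c = (if c : ?F then (SOME x. x : mk z r c) *E (SOME x. x : mk y c d) else 0E)" for c
  have fg: "f c : |E| & (EX u:den r d. f c = u +E z r c *E y c d)" for c
  proof (cases "c : ?F")
   case True
   obtain u w where u: "u : den r c" "(SOME x. x : mk z r c) = u +E z r c"
    and w: "w : den c d" "(SOME x. x : mk y c d) = w +E y c d" using some z y by blast
   have uc: "u : |E|" "w : |E|" using u w den_closed by auto
   have "w +E y c d : num c d" using subspaceD(3)[OF num_sub] den_num[OF w(1)] Mat_num[OF y] by blast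
   hence 1: "u *E (w +E y c d) +E z r c *E w : den r d"
    using subspaceD(3)[OF den_sub] den_mul_num[OF u(1)] num_mul_den[OF Mat_num[OF z] w(1)] by blast
   have "f c = (u *E (w +E y c d) +E z r c *E w) +E z r c *E y c d"
    using True u w uc z y by (simp add: f_def mul_distl mul_distr M.a_ac)
   thus ?thesis using 1 uc z y u w True den_closed by (auto simp: f_def)
  next
   case False
   hence "z r c : den r c" using in_den by simp
   hence 1: "z r c *E y c d : den r d" using den_mul_num Mat_num[OF y] by blast
   have "\<ominus>\<^bsub>E\<^esub> (z r c *E y c d) +E z r c *E y c d = 0E" using z y by (simp add: M.l_neg)
   thus ?thesis using False subspaceD(5)[OF den_sub 1]
    by (intro conjI bexI[of _ "\<ominus>\<^bsub>E\<^esub> (z r c *E y c d)"]) (simp_all add: f_def)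
  qed
  have "(S[E, ?F] %c. (SOME x. x : mk z r c) *E (SOME x. x : mk y c d)) = finsum E f ?F"
   using fg by (intro M.finsum_cong') (auto simp: f_def)
  also have "... = finsum E f ?F'"
   using fg fin sub by (intro M.add.finprod_mono_neutral_cong_left) (auto simp: f_def)
  finally have eq: "(S[E, ?F] %c. (SOME x. x : mk z r c) *E (SOME x. x : mk y c d)) = finsum E f ?F'" .
  have "EX u:den r d. finsum E f ?F' = u +E mm z y r d"
   unfolding mm_def using fg fin z y by (intro coset_finsum_cong[OF den_sub]) auto
  moreover have "finsum E f ?F' : |E|" "mm z y r d : |E|" using fg Mat_closed[OF Mat_mm[OF z y]] by auto
  ultimately have "den r d +>[E] finsum E f ?F' = den r d +>[E] mm z y r d"
   using M.add_coset_eq_iff[OF subspaceD(6)[OF den_sub], of "finsum E f ?F'" "mm z y r d"] by simp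
  thus ?thesis by (simp only: eq)
 qed
 thus ?thesis by (simp add: matrix_algebra_def mk_def)
qed

lemma mm_assoc: assumes "x : Mat" "y : Mat" "z : Mat" shows "mm (mm x y) z = mm x (mm y z)"
proof (intro ext)
 fix r d
 obtain R1 R2 where R: "finite R1" "!!r c. x r c ~= 0E ==> r : R1 & c : R1"
  "finite R2" "!!r c. y r c ~= 0E ==> r : R2 & c : R2"
  using Mat_range[OF assms(1)] Mat_range[OF assms(2)] by metis
 obtain R3 where R3: "finite R3" "!!r c. mm x y r c ~= 0E ==> r : R3 & c : R3"
  using Mat_range[OF Mat_mm[OF assms(1,2)]] by metis
 let ?F = "R1 \<union> R2 \<union> R3"
 have F: "finite ?F" using R R3 by simp
 have "mm (mm x y) z r d = (S[E, ?F] %c. mm x y r c *E z c d)"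
  using R R3 assms by (intro mm_superset Mat_mm) auto
 also have "... = (S[E, ?F] %c. S[E, ?F] %b. x r b *E (y b c *E z c d))"
 proof (rule M.finsum_cong'[OF refl])
  fix c
  have "mm x y r c = (S[E, ?F] %b. x r b *E y b c)" using R R3 assms by (intro mm_superset) auto
  thus "mm x y r c *E z c d = (S[E, ?F] %b. x r b *E (y b c *E z c d))"
   using F assms by (simp add: finsum_mul_l mul_assoc)
 qed (intro funcsetI M.finsum_closed mul_closed Mat_closed assms)+
 also have "... = (S[E, ?F] %b. S[E, ?F] %c. x r b *E (y b c *E z c d))"
  using F assms by (intro M.finsum_swap) auto
 also have "... = (S[E, ?F] %b. x r b *E mm y z b d)"
 proof (rule M.finsum_cong'[OF refl])
  fix b
  have "mm y z b d = (S[E, ?F] %c. y b c *E z c d)" using R R3 assms by (intro mm_superset) auto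
  thus "(S[E, ?F] %c. x r b *E (y b c *E z c d)) = x r b *E mm y z b d"
   using F assms by (simp add: finsum_mul_r)
 qed (intro funcsetI mul_closed Mat_closed Mat_mm assms)+
 also have "... = mm x (mm y z) r d"
  using R R3 assms by (intro mm_superset[symmetric] Mat_mm) auto
 finally show "mm (mm x y) z r d = mm x (mm y z) r d" .
qed

lemma mm_addl: "x : Mat ==> y : Mat ==> z : Mat ==>
 mm (%r c. x r c +E y r c) z = (%r c. mm x z r c +E mm y z r c)"
proof (intro ext)
 fix r d assume a: "x : Mat" "y : Mat" "z : Mat"
 let ?F = "{c. x r c ~= 0E} \<union> {c. y r c ~= 0E}"
 have F: "finite ?F" using a Mat_row_finite by simp
 have "mm (%r c. x r c +E y r c) z r d = (S[E, ?F] %c. (x r c +E y r c) *E z c d)"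
  using a F by (intro mm_superset Mat_add) auto
 also have "... = (S[E, ?F] %c. x r c *E z c d +E y r c *E z c d)"
  using a by (intro M.finsum_cong') (auto simp: mul_distl)
 also have "... = mm x z r d +E mm y z r d"
  using a F mm_superset[of x z ?F r d] mm_superset[of y z ?F r d] by (subst M.finsum_addf) auto
 finally show "mm (%r c. x r c +E y r c) z r d = mm x z r d +E mm y z r d" .
qed

lemma mm_addr: "x : Mat ==> y : Mat ==> z : Mat ==>
 mm x (%r c. y r c +E z r c) = (%r c. mm x y r c +E mm x z r c)"
proof (intro ext)
 fix r d assume a: "x : Mat" "y : Mat" "z : Mat"
 have "mm x (%r c. y r c +E z r c) r d = (S[E, {c. x r c ~= 0E}] %c. x r c *E y c d +E x r c *E z c d)"
  unfolding mm_def using a by (intro M.finsum_cong') (auto simp: mul_distr)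
 also have "... = mm x y r d +E mm x z r d"
  unfolding mm_def using a by (subst M.finsum_addf) auto
 finally show "mm x (%r c. y r c +E z r c) r d = mm x y r d +E mm x z r d" .
qed

lemma mm_smult_r: "k : KC ==> x : Mat ==> y : Mat ==> mm x (%r c. k .*E y r c) = (%r c. k .*E mm x y r c)"
proof (intro ext)
 fix r d assume a: "k : KC" "x : Mat" "y : Mat"
 have "mm x (%r c. k .*E y r c) r d = (S[E, {c. x r c ~= 0E}] %c. k .*E (x r c *E y c d))"
  unfolding mm_def using a by (intro M.finsum_cong') (auto simp: mul_smult_r)
 thus "mm x (%r c. k .*E y r c) r d = k .*E mm x y r d"
  unfolding mm_def using a Mat_row_finite by (subst finsum_smult) auto
qed

lemma mm_smult_l: "k : KC ==> x : Mat ==> y : Mat ==> mm (%r c. k .*E x r c) y = (%r c. k .*E mm x y r c)"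
proof (intro ext)
 fix r d assume a: "k : KC" "x : Mat" "y : Mat"
 have "mm (%r c. k .*E x r c) y r d = (S[E, {c. x r c ~= 0E}] %c. (k .*E x r c) *E y c d)"
  using a Mat_row_finite by (intro mm_superset Mat_smult) auto
 also have "... = (S[E, {c. x r c ~= 0E}] %c. k .*E (x r c *E y c d))"
  using a by (intro M.finsum_cong') (auto simp: mul_smult_l)
 finally show "mm (%r c. k .*E x r c) y r d = k .*E mm x y r d"
  unfolding mm_def using a Mat_row_finite by (subst finsum_smult) auto
qed

theorem nalg_C: "nalg K C"
proof -
 have "abelian_group C"
 proof (rule abelian_groupI)
  fix x assume "x : |C|"
  then obtain z where z: "z : Mat" "x = mk z" by (auto simp: carrier_C)
  have nz: "(%r c. (\<ominus> \<one>) .*E z r c) : Mat" using z by (intro Mat_smult) auto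
  have "(\<ominus> \<one>) .*E z r c +E z r c = 0E" for r c
   using z neg_eq_smult[of "z r c"] M.l_neg[of "z r c"] by (metis Mat_closed)
  hence "mk (%r c. (\<ominus> \<one>) .*E z r c) +C x = 0C" using z nz by (simp add: mk_add mk_zero)
  thus "EX y:|C|. y +C x = 0C" using mk_carrier[OF nz] by blast
 qed (auto simp: carrier_C mk_add mk_zero Mat_zero Mat_add M.a_ac)
 thus ?thesis
  by (intro nalg.intro module.intro module_axioms.intro nalg_axioms.intro R.is_cring field_axioms)
   (auto simp: carrier_C mk_add mk_smult mk_mul Mat_add Mat_smult Mat_mm mm_assoc mm_addl mm_addr mm_smult_l mm_smult_r
    smult_l_distr smult_r_distr smult_assoc1)
qed

end

section \<open>Adapted coordinates\<close>

context abelian_monoid begin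

lemma finsum_Sigma:
 assumes "finite A" "!!a. a : A ==> finite (B a)" "!!a b. a : A ==> b : B a ==> f a b : carrier G"
 shows "(\<Oplus>a\<in>A. \<Oplus>b\<in>B a. f a b) = (\<Oplus>p\<in>Sigma A B. f (fst p) (snd p))"
 using assms
proof (induction A rule: finite_induct)
 case (insert a A)
 have inner: "(\<Oplus>b\<in>B a. f a b) = (\<Oplus>p\<in>Pair a ` B a. f (fst p) (snd p))"
  using insert.prems by (subst finsum_reindex) (auto simp: inj_on_def)
 have "(\<Oplus>a\<in>insert a A. \<Oplus>b\<in>B a. f a b) = (\<Oplus>b\<in>B a. f a b) \<oplus> (\<Oplus>a\<in>A. \<Oplus>b\<in>B a. f a b)"
  using insert by (subst finsum_insert) (auto intro!: finsum_closed)
 also have "... = (\<Oplus>p\<in>Pair a ` B a. f (fst p) (snd p)) \<oplus> (\<Oplus>p\<in>Sigma A B. f (fst p) (snd p))"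
  using insert inner by simp
 also have "... = (\<Oplus>p\<in>Pair a ` B a \<union> Sigma A B. f (fst p) (snd p))"
  using insert by (intro finsum_Un_disjoint[symmetric]) auto
 also have "Pair a ` B a \<union> Sigma A B = Sigma (insert a A) B" by auto
 finally show ?case .
qed simp

end

context nalg begin

lemma subspaceI:
 assumes "U <= |L|" "0L : U" "!!x y. x : U ==> y : U ==> x +L y : U"
  "!!k x. k : KC ==> x : U ==> k .*L x : U"
 shows "submodule U K L"
proof (rule submoduleI)
 fix a assume a: "a : U"
 hence "(\<ominus> \<one>) .*L a : U" by (intro assms(4)) auto
 thus "\<ominus>\<^bsub>L\<^esub> a : U" using a assms(1) by (simp add: neg_eq_smult subset_iff)
qed (use assms in auto)

definition adjoin :: "'l set => 'l => 'l set" where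
 "adjoin W f = {w +L k .*L f |w k. w : W & k : KC}"

lemma adjoin_sub: assumes W: "submodule W K L" and f: "f : |L|" shows "submodule (adjoin W f) K L"
proof (rule subspaceI)
 note WD = subspaceD[OF W]
 show "adjoin W f <= |L|" using WD f by (auto simp: adjoin_def)
 show "0L : adjoin W f"
  unfolding adjoin_def using WD f by (intro CollectI exI[of _ "0L"] exI[of _ \<zero>]) simp
 fix x y assume "x : adjoin W f" "y : adjoin W f"
 then obtain w k w' k' where "w : W" "k : KC" "x = w +L k .*L f" "w' : W" "k' : KC" "y = w' +L k' .*L f"
  by (auto simp: adjoin_def)
 hence "x +L y = (w +L w') +L (k \<oplus> k') .*L f" using WD(1) f by (simp add: smult_l_distr M.a_ac)
 thus "x +L y : adjoin W f" unfolding adjoin_def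
  using \<open>w : W\<close> \<open>w' : W\<close> \<open>k : carrier K\<close> \<open>k' : carrier K\<close> WD(3) by blast
next
 note WD = subspaceD[OF W]
 fix c x assume c: "c : KC" and "x : adjoin W f"
 then obtain w k where w: "w : W" "k : KC" "x = w +L k .*L f" by (auto simp: adjoin_def)
 hence "c .*L x = c .*L w +L (c \<otimes> k) .*L f" using WD(1) f c by (simp add: smult_r_distr smult_assoc1)
 thus "c .*L x : adjoin W f" unfolding adjoin_def using w c WD(4)[OF c w(1)] by blast
qed

lemma adjoin_sup: "submodule W K L ==> f : |L| ==> W <= adjoin W f & f : adjoin W f"
proof -
 assume W: "submodule W K L" and f: "f : |L|"
 note WD = subspaceD[OF W]
 have "w = w +L \<zero> .*L f" if "w : W" for w using that WD f by simp
 moreover have "f = 0L +L \<one> .*L f" using f by simp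
 ultimately show ?thesis unfolding adjoin_def using WD(2) by blast
qed

text \<open>
  Linear functionals \<open>kp t\<close> on \<open>U\<close> with vectors \<open>x t\<close> recovering every element of \<open>U\<close> up to \<open>W\<close>.
\<close>

definition dual_system :: "'l set => 'l set => nat => (nat => 'l) => (nat => 'l => 'k) => bool" where
 "dual_system U W n x kp <-> (ALL t<n. x t : U & (ALL y:U. kp t y : KC) \<and>
   (ALL y:U. ALL z:U. kp t (y +L z) = kp t y \<oplus> kp t z) \<and>
   (ALL k:KC. ALL y:U. kp t (k .*L y) = k \<otimes> kp t y) & (ALL y:U \<inter> W. kp t y = \<zero>)) \<and>
  (ALL y:U. EX w:W. y = (S[L, {..<n}] %t. kp t y .*L x t) +L w)"

text \<open>\<open>U\<close> is contained in \<open>W\<close> extended by finitely many vectors; each of them either contributes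
one functional or can be dropped.\<close>

lemma dual_system_exists:
 assumes U: "submodule U K L" and W: "submodule W K L" and "set fs <= |L|" "U <= fold (%f W. adjoin W f) fs W"
 shows "EX n x kp. dual_system U W n x kp"
 using assms(2-4)
proof (induction fs arbitrary: W)
 case Nil
 hence "U <= W" by simp
 hence "dual_system U W 0 (%_. 0L) (%_ _. \<zero>)" using subspaceD(1)[OF U] by (auto simp: dual_system_def intro!: bexI)
 thus ?case by blast
next
 case (Cons f fs)
 note WD = subspaceD[OF Cons.prems(1)] and UD = subspaceD[OF U]
 have f: "f : |L|" using Cons.prems by simp
 let ?W' = "adjoin W f"
 note W' = adjoin_sub[OF Cons.prems(1) f] and sup = adjoin_sup[OF Cons.prems(1) f]
 note W'D = subspaceD[OF W']
 obtain n x kp where ds: "dual_system U ?W' n x kp" using Cons.IH[OF W'] Cons.prems by auto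
 have xU: "x t : U" and kpK: "y : U ==> kp t y : KC"
  and kpadd: "y : U ==> z : U ==> kp t (y +L z) = kp t y \<oplus> kp t z"
  and kpsm: "k : KC ==> y : U ==> kp t (k .*L y) = k \<otimes> kp t y"
  and kp0: "y : U ==> y : ?W' ==> kp t y = \<zero>" if "t < n" for t y z k
  using ds that by (auto simp: dual_system_def)
 let ?sg = "%y. S[L, {..<n}] %t. kp t y .*L x t"
 have exp: "EX w:?W'. y = ?sg y +L w" if "y : U" for y using ds that by (auto simp: dual_system_def)
 have sgU: "?sg y : U" if "y : U" for y
  using that xU kpK UD(4) by (intro subspace_finsum[OF U]) auto
 define rh where "rh y = \<ominus>\<^bsub>L\<^esub> ?sg y +L y" for y
 have rhU: "rh y : U" if "y : U" for y unfolding rh_def using UD(3)[OF UD(5)[OF sgU[OF that]] that] .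
 have rheq: "y = ?sg y +L rh y" if "y : U" for y
  using UD(1)[OF that] UD(1)[OF sgU[OF that]] by (simp add: rh_def M.a_assoc[symmetric] M.r_neg)
 have rhW: "rh y : ?W'" if y: "y : U" for y
 proof -
  obtain w where w: "w : ?W'" "y = ?sg y +L w" using exp[OF y] by blast
  have "?sg y +L rh y = ?sg y +L w" using rheq[OF y] w(2) by metis
  hence "rh y = w" by (rule M.add.l_cancel[OF _ UD(1)[OF rhU[OF y]] W'D(1)[OF w(1)] UD(1)[OF sgU[OF y]]])
  thus ?thesis using w by simp
 qed
 have sgadd: "?sg (y +L z) = ?sg y +L ?sg z" if yz: "y : U" "z : U" for y z
 proof -
  have "?sg (y +L z) = (S[L, {..<n}] %t. kp t y .*L x t +L kp t z .*L x t)"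
   using yz kpadd kpK xU UD(1) by (intro M.finsum_cong') (auto simp: smult_l_distr)
  thus ?thesis using yz kpK xU UD(1) by (subst M.finsum_addf[symmetric]) auto
 qed
 have rhadd: "rh (y +L z) = rh y +L rh z" if yz: "y : U" "z : U" for y z
  unfolding rh_def sgadd[OF yz] using UD(1)[OF yz(1)] UD(1)[OF yz(2)] UD(1)[OF sgU[OF yz(1)]] UD(1)[OF sgU[OF yz(2)]]
  by (simp add: M.minus_add M.a_ac)
 have sgsm: "?sg (k .*L y) = k .*L ?sg y" if y: "y : U" and k: "k : KC" for k y
 proof -
  have "?sg (k .*L y) = (S[L, {..<n}] %t. k .*L (kp t y .*L x t))"
   using y k kpsm kpK xU UD(1) by (intro M.finsum_cong') (auto simp: smult_assoc1)
  thus ?thesis using y k kpK xU UD(1) by (subst finsum_smult) auto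
 qed
 have rhsm: "rh (k .*L y) = k .*L rh y" if y: "y : U" and k: "k : KC" for k y
  unfolding rh_def sgsm[OF y k] using k UD(1)[OF y] UD(1)[OF sgU[OF y]]
  by (simp add: smult_r_distr smult_r_minus)
 show ?case
 proof (cases "U \<inter> ?W' <= W")
  case True
  have "rh y : W" if "y : U" for y using True rhU[OF that] rhW[OF that] by blast
  hence "EX w:W. y = ?sg y +L w" if "y : U" for y using rheq[OF that] that by blast
  moreover have "kp t y = \<zero>" if "t < n" "y : U" "y : W" for t y using kp0 that sup by blast
  ultimately have "dual_system U W n x kp"
   unfolding dual_system_def using xU kpK kpadd kpsm by auto
  thus ?thesis by blast
 next
  case False
  then obtain g where g: "g : U" "g : ?W'" "g ~: W" by blast
  have gc: "g : |L|" using UD g by blast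
  have uniq: "k = k'" if k: "k : KC" "k' : KC" and w: "w : W" "w' : W"
   and eq: "k .*L g +L w = k' .*L g +L w'" for k k' w w'
  proof (rule ccontr)
   assume ne: "k ~= k'"
   let ?d = "k \<oplus> \<ominus> k'"
   have d0: "?d ~= \<zero>" using ne k by (metis R.minus_eq R.r_right_minus_eq)
   have wc: "w : |L|" "w' : |L|" using w WD by auto
   have "?d .*L g = k .*L g +L \<ominus>\<^bsub>L\<^esub> (k' .*L g)" using k gc by (simp add: smult_l_distr smult_l_minus)
   also have "... = (k .*L g +L w) +L (\<ominus>\<^bsub>L\<^esub> w +L \<ominus>\<^bsub>L\<^esub> (k' .*L g))"
    using k gc wc by (simp add: M.a_assoc M.r_neg2)
   also have "... = (k' .*L g +L w') +L (\<ominus>\<^bsub>L\<^esub> w +L \<ominus>\<^bsub>L\<^esub> (k' .*L g))" by (simp only: eq)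
   also have "... = w' +L \<ominus>\<^bsub>L\<^esub> w"
    using k gc wc by (simp add: M.a_ac M.r_neg2 M.r_neg1) (metis M.a_comm M.a_lcomm M.r_neg M.r_zero M.a_inv_closed smult_closed M.add.m_closed)
   finally have "?d .*L g : W" using WD(3)[OF w(2) WD(5)[OF w(1)]] by simp
   hence "inv ?d .*L (?d .*L g) : W" using d0 k field_Units WD(4) by auto
   moreover have "inv ?d .*L (?d .*L g) = g"
    using d0 k field_Units gc by (simp add: smult_assoc1[symmetric])
   ultimately show False using g by simp
  qed
  have ex: "EX k:KC. EX w:W. z = k .*L g +L w" if z: "z : ?W'" for z
  proof -
   obtain w0 k0 where g0: "w0 : W" "k0 : KC" "g = w0 +L k0 .*L f" using g by (auto simp: adjoin_def)
   obtain w1 k1 where z1: "w1 : W" "k1 : KC" "z = w1 +L k1 .*L f" using z by (auto simp: adjoin_def)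
   have "k0 ~= \<zero>"
   proof
    assume "k0 = \<zero>"
    hence "g = w0" using g0 f WD by simp
    thus False using g g0 by simp
   qed
   hence ik: "inv k0 : KC" "inv k0 \<otimes> k0 = \<one>" using g0 field_Units by auto
   let ?c = "k1 \<otimes> inv k0"
   have c: "?c : KC" using z1 ik by simp
   have "?c \<otimes> k0 = k1" using z1 ik g0 by (simp add: R.m_assoc)
   hence cf: "?c .*L (k0 .*L f) = k1 .*L f" using c g0 f smult_assoc1[of ?c k0 f] by simp
   have w0c: "w0 : |L|" "w1 : |L|" using g0 z1 WD by auto
   have "?c .*L g +L (w1 +L \<ominus>\<^bsub>L\<^esub> (?c .*L w0)) = z"
    using c g0 z1 w0c f cf by (simp add: smult_r_distr M.a_ac M.r_neg2 M.r_neg1 M.r_neg)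
   moreover have "w1 +L \<ominus>\<^bsub>L\<^esub> (?c .*L w0) : W" by (rule WD(3)[OF z1(1) WD(5)[OF WD(4)[OF c g0(1)]]])
   ultimately show ?thesis using c by metis
  qed
  define lam where "lam z = (SOME k. k : KC & (EX w:W. z = k .*L g +L w))" for z
  have lam: "lam z : KC & (EX w:W. z = lam z .*L g +L w)" if "z : ?W'" for z
   unfolding lam_def by (rule someI_ex) (use ex[OF that] in blast)
  have lamI: "lam z = k" if k: "k : KC" "w : W" "z = k .*L g +L w" "z : ?W'" for z k w
  proof -
   obtain w' where "w' : W" "z = lam z .*L g +L w'" using lam[OF k(4)] by blast
   thus ?thesis using uniq[of "lam z" k w' w] lam[OF k(4)] k by metis
  qed
  have lam_add: "lam (y +L z) = lam y \<oplus> lam z" if yz: "y : ?W'" "z : ?W'" for y z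
  proof -
   obtain w w' where w: "w : W" "y = lam y .*L g +L w" "w' : W" "z = lam z .*L g +L w'" using lam yz by metis
   have l: "lam y : KC" "lam z : KC" using lam yz by auto
   have wc: "w : |L|" "w' : |L|" using w WD by auto
   have "(lam y .*L g +L w) +L (lam z .*L g +L w') = (lam y \<oplus> lam z) .*L g +L (w +L w')"
    using l wc gc by (simp add: smult_l_distr M.a_ac)
   hence "y +L z = (lam y \<oplus> lam z) .*L g +L (w +L w')" using w by simp
   thus ?thesis using l w WD(3) W'D(3)[OF yz] by (intro lamI) auto
  qed
  have lam_sm: "lam (k .*L y) = k \<otimes> lam y" if k: "k : KC" and y: "y : ?W'" for k y
  proof -
   obtain w where w: "w : W" "y = lam y .*L g +L w" using lam y by metis
   have l: "lam y : KC" using lam y by auto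
   have wc: "w : |L|" using w WD by auto
   have "k .*L (lam y .*L g +L w) = (k \<otimes> lam y) .*L g +L k .*L w"
    using l wc gc k by (simp add: smult_r_distr smult_assoc1)
   hence "k .*L y = (k \<otimes> lam y) .*L g +L k .*L w" using w by simp
   thus ?thesis using l w k WD(4) W'D(4)[OF k y] by (intro lamI) auto
  qed
  have lam0: "lam w = \<zero>" if "w : W" for w
   using that gc WD sup by (intro lamI[of \<zero> w]) auto
  let ?x = "%t. if t < n then x t else g" and ?kp = "%t y. if t < n then kp t y else lam (rh y)"
  have "EX w:W. y = (S[L, {..<Suc n}] %t. ?kp t y .*L ?x t) +L w" if y: "y : U" for y
  proof -
   obtain w where w: "w : W" "rh y = lam (rh y) .*L g +L w" using lam[OF rhW[OF y]] by blast
   have cl: "lam (rh y) .*L g : |L|" "w : |L|" "?sg y : |L|"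
    using lam[OF rhW[OF y]] gc w WD UD(1)[OF sgU[OF y]] by auto
   have "(S[L, {..<Suc n}] %t. ?kp t y .*L ?x t) = (S[L, insert n {..<n}] %t. ?kp t y .*L ?x t)"
    by (simp only: lessThan_Suc)
   also have "... = lam (rh y) .*L g +L (S[L, {..<n}] %t. ?kp t y .*L ?x t)"
    using cl y kpK xU UD(1) by (subst M.finsum_insert) auto
   also have "(S[L, {..<n}] %t. ?kp t y .*L ?x t) = ?sg y"
    using y kpK xU UD(1) by (intro M.finsum_cong') auto
   finally have s: "(S[L, {..<Suc n}] %t. ?kp t y .*L ?x t) = lam (rh y) .*L g +L ?sg y" .
   have "y = ?sg y +L (lam (rh y) .*L g +L w)" using rheq[OF y] w(2) by simp
   also have "... = (lam (rh y) .*L g +L ?sg y) +L w" using cl by (simp add: M.a_ac)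
   finally have "y = (S[L, {..<Suc n}] %t. ?kp t y .*L ?x t) +L w" unfolding s .
   thus ?thesis using w(1) by blast
  qed
  moreover have "lam (rh y) = \<zero>" if y: "y : U" "y : W" for y
  proof -
   have yW: "y : ?W'" using y sup by auto
   have "?sg y = 0L" using y yW kp0 xU UD(1) by (intro M.add.finprod_one_eqI) auto
   hence "rh y = y" using rheq[OF y(1)] UD(1)[OF rhU[OF y(1)]] by simp
   thus ?thesis using lam0 y by simp
  qed
  ultimately have "dual_system U W (Suc n) ?x ?kp"
   unfolding dual_system_def
   using xU kpK kpadd kpsm kp0 sup g lam rhU rhW lam_add lam_sm rhadd rhsm by (auto simp: subset_iff)
  thus ?thesis by blast
 qed
qed

end

locale split_filtered = filtered K E I N for K :: "'k ring" (structure) and E :: "('k, 'a) module" (structure)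
  and I :: "nat => 'a set" and N :: nat +
 fixes V :: "'v set" and e :: "'v => 'a" and S :: "'a set"
 assumes V_fin: "finite V"
  and ev_closed [simp, intro]: "v : V ==> e v : carrier E"
  and ev_idem [simp]: "v : V ==> e v *[E] e v = e v"
  and ev_orth: "v : V ==> w : V ==> v ~= w ==> e v *[E] e w = 0[E]"
  and ev_notin: "v : V ==> e v ~: I 1"
  and ev_sum: "x : carrier E ==> (S[E, V] %v. e v) *[E] x = x" "x : carrier E ==> x *[E] (S[E, V] %v. e v) = x"
  and S_sub: "subalgebra K E S"
  and ev_S: "v : V ==> e v : S"
  and S_comp: "s : S ==> v : V ==> w : V ==>
   EX k:carrier K. e v *[E] (s *[E] e w) = (if v = w then k .*[E] e v else 0[E])"
  and split: "x : carrier E ==> EX s:S. EX y:I 1. x = s +[E] y"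
  and fin_gen: "EX fs. set fs <= carrier E & (ALL W. submodule W K E --> set fs <= W --> W = carrier E)"

text \<open>The functional \<open>kp t\<close> is defined on the whole algebra, but it is a coordinate of the filtration: it kills
the elements of degree greater than \<open>dg t\<close> and is compatible with the idempotents on both sides.\<close>

locale adapted = split_filtered K E I N V e S for K :: "'k ring" (structure) and E :: "('k, 'a) module" (structure)
  and I :: "nat => 'a set" and N :: nat and V :: "'v set" and e :: "'v => 'a" and S :: "'a set" +
 fixes T :: "'t set" and x :: "'t => 'a" and kp :: "'t => 'a => 'k" and dg :: "'t => nat"
  and lv :: "'t => 'v" and rv :: "'t => 'v"
 assumes T_fin: "finite T" and dg: "t : T ==> dg t < N"
  and x_I: "t : T ==> x t : I (dg t)"
  and lv: "t : T ==> lv t : V" and rv: "t : T ==> rv t : V"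
  and lv_x: "t : T ==> e (lv t) *[E] x t = x t" and x_rv: "t : T ==> x t *[E] e (rv t) = x t"
  and kp_K: "t : T ==> y : carrier E ==> kp t y : carrier K"
  and kp_add: "t : T ==> y : carrier E ==> z : carrier E ==> kp t (y +[E] z) = kp t y \<oplus> kp t z"
  and kp_smult: "t : T ==> k : carrier K ==> y : carrier E ==> kp t (k .*[E] y) = k \<otimes> kp t y"
  and kp_zero: "t : T ==> y : I (Suc (dg t)) ==> kp t y = \<zero>"
  and kp_l: "t : T ==> v : V ==> y : carrier E ==> kp t (e v *[E] y) = (if v = lv t then kp t y else \<zero>)"
  and kp_r: "t : T ==> v : V ==> y : carrier E ==> kp t (y *[E] e v) = (if v = rv t then kp t y else \<zero>)"
  and x_expand: "y : carrier E ==> y = (S[E, T] %t. kp t y .*[E] x t)"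

context split_filtered begin

lemma ev_assoc: "v : V ==> y : |E| ==> e v *E (e v *E y) = e v *E y"
 by (simp add: mul_assoc[symmetric])

lemma ev_orth_assoc: "v : V ==> w : V ==> v ~= w ==> y : |E| ==> e v *E (e w *E y) = 0E"
 by (simp add: mul_assoc[symmetric] ev_orth)

lemma I_ideal: "y : I m ==> z : |E| ==> y *E z : I m & z *E y : I m"
 using I_mul[of y m z 0] I_mul[of z 0 y m] I_zero by auto

lemma fold_adjoin:
 assumes "submodule W K E" "set fs <= |E|"
 shows "submodule (fold (%f W. adjoin W f) fs W) K E & W <= fold (%f W. adjoin W f) fs W \<and>
  set fs <= fold (%f W. adjoin W f) fs W"
 using assms
proof (induction fs arbitrary: W)
 case (Cons f fs)
 thus ?case using Cons.IH[OF adjoin_sub[of W f]] adjoin_sup[of W f] by auto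
qed simp

lemma dual_system_I: "EX n x kp. dual_system (I m) (I (Suc m)) n x kp"
proof -
 obtain fs where fs: "set fs <= |E|" "!!W. submodule W K E ==> set fs <= W ==> W = |E|"
  using fin_gen by blast
 have "fold (%f W. adjoin W f) fs (I (Suc m)) = |E|"
  using fs fold_adjoin[OF I_sub fs(1)] by blast
 hence "I m <= fold (%f W. adjoin W f) fs (I (Suc m))" using ID(1) by blast
 thus ?thesis by (rule dual_system_exists[OF I_sub I_sub fs(1)])
qed

text \<open>Coordinates of the pieces \<open>I m / I (m + 1)\<close> are extended to all of the algebra by peeling off the parts
of lower degree; cutting with pairs of idempotents makes them homogeneous.\<close>

theorem adapted_exists: "EX (T :: (('v \<times> 'v) \<times> nat \<times> nat) set) x kp dg lv rv. adapted K E I N V e S T x kp dg lv rv"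
proof -
 obtain n x kp where ds: "!!m. dual_system (I m) (I (Suc m)) (n m) (x m) (kp m)"
  using dual_system_I by metis
 have xI: "x m s : I m" and kpK: "y : I m ==> kp m s y : KC"
  and kpadd: "y : I m ==> z : I m ==> kp m s (y +E z) = kp m s y \<oplus> kp m s z"
  and kpsm: "k : KC ==> y : I m ==> kp m s (k .*E y) = k \<otimes> kp m s y"
  and kp0: "y : I m ==> y : I (Suc m) ==> kp m s y = \<zero>" if "s < n m" for m s y z k
  using ds[of m] that by (auto simp: dual_system_def)
 let ?sg = "%m y. S[E, {..<n m}] %s. kp m s y .*E x m s"
 have exp: "EX w:I (Suc m). y = ?sg m y +E w" if "y : I m" for m y using ds[of m] that by (auto simp: dual_system_def)
 have xc: "x m s : |E|" if "s < n m" for m s using xI[OF that] ID(1) by blast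
 have sgc: "?sg m y : |E|" if "y : I m" for m y using that kpK xc by (intro M.finsum_closed) auto
 define rh where "rh = rec_nat (%y. y) (%m r y. \<ominus>\<^bsub>E\<^esub> ?sg m (r y) +E r y)"
 have rh0: "rh 0 y = y" and rhSuc: "rh (Suc m) y = \<ominus>\<^bsub>E\<^esub> ?sg m (rh m y) +E rh m y" for m y by (simp_all add: rh_def)
 have step: "\<ominus>\<^bsub>E\<^esub> ?sg m y +E y : I (Suc m)" if y: "y : I m" for m y
 proof -
  obtain w where w: "w : I (Suc m)" "y = ?sg m y +E w" using exp[OF y] by blast
  have "\<ominus>\<^bsub>E\<^esub> ?sg m y +E (?sg m y +E w) = w" using sgc[OF y] ID(1)[OF w(1)] by (simp add: M.r_neg1)
  thus ?thesis using w by metis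
 qed
 have rhI: "rh m y : I m" if "y : |E|" for m y
  by (induction m) (use that I_zero step rh0 rhSuc in auto)
 have rhc: "rh m y : |E|" if "y : |E|" for m y using rhI[OF that] ID(1) by blast
 have sgadd: "?sg m (y +E z) = ?sg m y +E ?sg m z" if yz: "y : I m" "z : I m" for m y z
 proof -
  have "?sg m (y +E z) = (S[E, {..<n m}] %s. kp m s y .*E x m s +E kp m s z .*E x m s)"
   using yz kpadd kpK xc by (intro M.finsum_cong') (auto simp: smult_l_distr)
  thus ?thesis using yz kpK xc by (subst M.finsum_addf[symmetric]) auto
 qed
 have sgsm: "?sg m (k .*E y) = k .*E ?sg m y" if y: "y : I m" and k: "k : KC" for m k y
 proof -
  have "?sg m (k .*E y) = (S[E, {..<n m}] %s. k .*E (kp m s y .*E x m s))"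
   using y k kpsm kpK xc by (intro M.finsum_cong') (auto simp: smult_assoc1)
  thus ?thesis using y k kpK xc by (subst finsum_smult) auto
 qed
 have rhadd: "rh m (y +E z) = rh m y +E rh m z" if yz: "y : |E|" "z : |E|" for m y z
 proof (induction m)
  case (Suc m)
  thus ?case using sgadd[OF rhI[OF yz(1), of m] rhI[OF yz(2), of m]] rhc[OF yz(1), of m] rhc[OF yz(2), of m]
    sgc[OF rhI[OF yz(1), of m]] sgc[OF rhI[OF yz(2), of m]]
   by (simp add: rhSuc M.minus_add M.a_ac)
 qed (simp add: rh0)
 have rhsm: "rh m (k .*E y) = k .*E rh m y" if y: "y : |E|" and k: "k : KC" for m k y
 proof (induction m)
  case (Suc m)
  thus ?case using sgsm[OF rhI[OF y, of m] k] rhc[OF y, of m] sgc[OF rhI[OF y, of m]] k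
   by (simp add: rhSuc smult_r_distr smult_r_minus)
 qed (simp add: rh0)
 have rhid: "rh j y = y" if y: "y : I m" "j <= m" for j m y
  using y(2)
 proof (induction j)
  case (Suc j)
  have yj: "y : I j" "y : I (Suc j)" using y(1) Suc.prems I_mono[of j m] I_mono[of "Suc j" m] by auto
  have "?sg j y = 0E" using yj kp0 xc by (intro M.add.finprod_one_eqI) auto
  thus ?case using Suc ID(1)[OF y(1)] by (simp add: rhSuc)
 qed (simp add: rh0)
 have sum: "y = (S[E, {..<m}] %j. ?sg j (rh j y)) +E rh m y" if y: "y : |E|" for m y
 proof (induction m)
  case 0
  thus ?case using y by (simp add: rh0)
 next
  case (Suc m)
  let ?s = "S[E, {..<m}] %j. ?sg j (rh j y)"
  have sc: "?s : |E|" using sgc[OF rhI[OF y]] by (intro M.finsum_closed) auto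
  have "(S[E, {..<Suc m}] %j. ?sg j (rh j y)) = ?sg m (rh m y) +E ?s"
   unfolding lessThan_Suc using sgc[OF rhI[OF y]] by (subst M.finsum_insert) auto
  moreover have "(?sg m (rh m y) +E ?s) +E rh (Suc m) y = ?s +E rh m y"
   using sc sgc[OF rhI[OF y, of m]] rhc[OF y, of m]
   by (simp add: rhSuc M.a_comm[of "?sg m (rh m y)" ?s] M.a_assoc M.r_neg2)
  ultimately show ?case using Suc by simp
 qed
 let ?J = "Sigma {..<N} (%j. {..<n j})"
 have finJ: "finite ?J" by simp
 have expand: "y = (S[E, ?J] %p. kp (fst p) (snd p) (rh (fst p) y) .*E x (fst p) (snd p))" if y: "y : |E|" for y
 proof -
  have "rh N y = 0E" using rhI[OF y, of N] I_end[of N] by simp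
  hence "y = (S[E, {..<N}] %j. ?sg j (rh j y))" using sum[OF y, of N] sgc[OF rhI[OF y]]
   by (metis (no_types, lifting) M.finsum_closed M.r_zero Pi_I)
  also have "... = (S[E, ?J] %p. kp (fst p) (snd p) (rh (fst p) y) .*E x (fst p) (snd p))"
   using rhI[OF y] kpK xc by (intro M.finsum_Sigma) auto
  finally show ?thesis .
 qed
 let ?T = "(V \<times> V) \<times> ?J"
 define l where "l t = fst (fst t)" for t :: "('v \<times> 'v) \<times> nat \<times> nat"
 define r where "r t = snd (fst t)" for t :: "('v \<times> 'v) \<times> nat \<times> nat"
 define m where "m t = fst (snd t)" for t :: "('v \<times> 'v) \<times> nat \<times> nat"
 define s where "s t = snd (snd t)" for t :: "('v \<times> 'v) \<times> nat \<times> nat"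
 let ?x = "%t. e (l t) *E (x (m t) (s t) *E e (r t))"
 let ?k = "%t y. kp (m t) (s t) (rh (m t) (e (l t) *E (y *E e (r t))))"
 have T: "l t : V" "r t : V" "m t < N" "s t < n (m t)" if "t : ?T" for t
  using that by (auto simp: l_def r_def m_def s_def)
 have cc: "e (l t) *E (y *E e (r t)) : |E|" if "t : ?T" "y : |E|" for t y
  using T[OF that(1)] that(2) by simp
 have "adapted K E I N V e S ?T ?x ?k m l r"
 proof (intro adapted.intro adapted_axioms.intro split_filtered_axioms)
  show "finite ?T" using V_fin finJ by simp
  fix t assume t: "t : ?T"
  note Tt = T[OF t] and ct = cc[OF t] and xct = xc[OF T(4)[OF t]]
  show "m t < N" "l t : V" "r t : V" using Tt by auto
  show "?x t : I (m t)" using I_ideal[of "x (m t) (s t) *E e (r t)" "m t" "e (l t)"] I_ideal[OF xI[OF Tt(4)], of "e (r t)"] Tt by simp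
  show "e (l t) *E ?x t = ?x t" using Tt xct by (simp add: ev_assoc)
  show "?x t *E e (r t) = ?x t" using Tt xct by (simp add: mul_assoc)
  {
   fix y assume y: "y : |E|"
   show "?k t y : KC" using kpK[OF Tt(4)] rhI[OF ct[OF y]] by blast
   {
    fix z assume z: "z : |E|"
    have "e (l t) *E ((y +E z) *E e (r t)) = e (l t) *E (y *E e (r t)) +E e (l t) *E (z *E e (r t))"
     using y z Tt by (simp add: mul_distl mul_distr)
    thus "?k t (y +E z) = ?k t y \<oplus> ?k t z"
     using rhadd[OF ct[OF y] ct[OF z]] kpadd[OF Tt(4) rhI[OF ct[OF y]] rhI[OF ct[OF z]]] by simp
   }
   {
    fix k assume k: "k : KC"
    have "e (l t) *E ((k .*E y) *E e (r t)) = k .*E (e (l t) *E (y *E e (r t)))"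
     using y k Tt by (simp add: mul_smult_l mul_smult_r)
    thus "?k t (k .*E y) = k \<otimes> ?k t y"
     using rhsm[OF ct[OF y] k] kpsm[OF Tt(4) k rhI[OF ct[OF y]]] by simp
   }
   have k0: "?k t 0E = \<zero>"
    using rhid[OF ID(2), of "m t" "m t"] kp0[OF Tt(4) ID(2) ID(2)] Tt by simp
   fix v assume v: "v : V"
   show "?k t (e v *E y) = (if v = l t then ?k t y else \<zero>)"
   proof (cases "v = l t")
    case True
    thus ?thesis using y v Tt by (simp add: mul_assoc ev_assoc)
   next
    case False
    hence "e (l t) *E ((e v *E y) *E e (r t)) = 0E" using y v Tt by (simp add: mul_assoc ev_orth_assoc)
    thus ?thesis using False k0 Tt by simp
   qed
   show "?k t (y *E e v) = (if v = r t then ?k t y else \<zero>)"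
   proof (cases "v = r t")
    case True
    thus ?thesis using y v Tt by (simp add: mul_assoc)
   next
    case False
    hence "e (l t) *E ((y *E e v) *E e (r t)) = 0E" using y v Tt by (simp add: mul_assoc ev_orth)
    thus ?thesis using False k0 Tt by simp
   qed
  }
  fix y assume y: "y : I (Suc (m t))"
  hence "e (l t) *E (y *E e (r t)) : I (Suc (m t))"
   using I_ideal Tt by simp
  thus "?k t y = \<zero>"
   using rhid[of "e (l t) *E (y *E e (r t))" "Suc (m t)" "m t"] kp0[OF Tt(4)] I_anti[of "m t"] by auto
 next
  fix y assume y: "y : |E|"
  have inner: "e a *E (y *E e b) = (S[E, ?J] %p. ?k ((a, b), p) y .*E ?x ((a, b), p))" if ab: "a : V" "b : V" for a b
  proof -
   let ?y = "e a *E (y *E e b)"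
   have yc: "?y : |E|" using y ab by simp
   let ?f = "%p. kp (fst p) (snd p) (rh (fst p) ?y) .*E x (fst p) (snd p)"
   have fc: "?f p : |E|" if "p : ?J" for p using that rhI[OF yc] kpK xc by auto
   have "?y = e a *E (?y *E e b)" using y ab by (simp add: mul_assoc ev_assoc)
   also have "... = e a *E ((S[E, ?J] %p. ?f p) *E e b)" using expand[OF yc] by simp
   also have "... = (S[E, ?J] %p. e a *E (?f p *E e b))"
    using fc ab finJ by (simp add: finsum_mul_l finsum_mul_r Pi_iff)
   also have "... = (S[E, ?J] %p. ?k ((a, b), p) y .*E ?x ((a, b), p))"
    using rhI[OF yc] kpK xc ab by (intro M.finsum_cong') (auto simp: mul_smult_l mul_smult_r l_def r_def m_def s_def)
   finally show ?thesis .
  qed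
  have tc: "?k t y .*E ?x t : |E|" if "t : ?T" for t
   using T[OF that] xc kpK[OF T(4)[OF that] rhI[OF cc[OF that y]]] by auto
  have "y = (S[E, V] %a. e a) *E (y *E (S[E, V] %b. e b))" using ev_sum y by simp
  also have "y *E (S[E, V] %b. e b) = (S[E, V] %b. y *E e b)"
   using V_fin y by (intro finsum_mul_r) auto
  also have "(S[E, V] %a. e a) *E (S[E, V] %b. y *E e b) = (S[E, V] %a. e a *E (S[E, V] %b. y *E e b))"
   using V_fin y by (intro finsum_mul_l) (auto intro!: M.finsum_closed)
  also have "... = (S[E, V] %a. S[E, V] %b. e a *E (y *E e b))"
  proof (rule M.finsum_cong'[OF refl])
   fix a assume "a : V"
   thus "e a *E (S[E, V] %b. y *E e b) = (S[E, V] %b. e a *E (y *E e b))"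
    using V_fin y by (intro finsum_mul_r) auto
  qed (use y in \<open>auto intro!: M.finsum_closed\<close>)
  also have "... = (S[E, V \<times> V] %p. e (fst p) *E (y *E e (snd p)))"
   using V_fin y by (intro M.finsum_Sigma) auto
  also have "... = (S[E, V \<times> V] %p. S[E, ?J] %q. ?k (p, q) y .*E ?x (p, q))"
   using inner tc by (intro M.finsum_cong') (auto intro!: M.finsum_closed)
  also have "... = (S[E, ?T] %t. ?k (fst t, snd t) y .*E ?x (fst t, snd t))"
   using V_fin finJ tc by (intro M.finsum_Sigma) auto
  finally show "y = (S[E, ?T] %t. ?k t y .*E ?x t)" by simp
 qed
 thus ?thesis by blast
qed

end

section \<open>Matrix units\<close>

sublocale filtered \<subseteq> C: nalg K "matrix_algebra E I N"
 by (rule nalg_C)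

context filtered begin

definition single :: "int => int => 'a => int => int => 'a" where
 "single r c y = (%r' c'. if r' = r & c' = c then y else 0E)"

definition sgl :: "int => int => 'a => int => int => 'a set" where
 "sgl r c y = mk (single r c y)"

lemma single_Mat: "y : num r c ==> single r c y : Mat"
 by (rule MatI[of _ "{r, c}"]) (auto simp: single_def subspaceD(2)[OF num_sub] split: if_splits)

lemma sgl_closed [simp, intro]: "y : num r c ==> sgl r c y : |C|"
 unfolding sgl_def by (intro mk_carrier single_Mat)

lemma sgl_add: "y : num r c ==> z : num r c ==> sgl r c y +C sgl r c z = sgl r c (y +E z)"
 unfolding sgl_def by (subst mk_add[OF single_Mat single_Mat], assumption+) (rule arg_cong[where f = mk], simp add: single_def fun_eq_iff)

lemma sgl_smult: "k : KC ==> y : num r c ==> k .*C sgl r c y = sgl r c (k .*E y)"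
 unfolding sgl_def by (subst mk_smult[OF _ single_Mat], assumption+) (rule arg_cong[where f = mk], simp add: single_def fun_eq_iff)

lemma sgl_zero_iff: "y : num r c ==> sgl r c y = 0C <-> y : den r c"
 unfolding sgl_def by (subst mk_zero_iff[OF single_Mat]) (auto simp: single_def subspaceD(2)[OF den_sub])

lemma sgl_zero [simp]: "sgl r c 0E = 0C"
 using sgl_zero_iff subspaceD(2)[OF num_sub] subspaceD(2)[OF den_sub] by blast

lemma sgl_mul_mk:
 assumes y: "y : num r' r" and z: "z : Mat"
 shows "(%a c. if a = r' then y *E z r c else 0E) : Mat"
  "sgl r' r y *C mk z = mk (%a c. if a = r' then y *E z r c else 0E)"
proof -
 have "mm (single r' r y) z = (%a c. if a = r' then y *E z r c else 0E)"
 proof (intro ext)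
  fix a d
  have "mm (single r' r y) z a d = (S[E, {r}] %c. single r' r y a c *E z c d)"
   using y z by (intro mm_superset single_Mat) (auto simp: single_def)
  also have "... = (if a = r' then y *E z r d else 0E)"
   using y z num_closed[OF y] by (simp add: single_def)
  finally show "mm (single r' r y) z a d = (if a = r' then y *E z r d else 0E)" .
 qed
 thus "(%a c. if a = r' then y *E z r c else 0E) : Mat"
  "sgl r' r y *C mk z = mk (%a c. if a = r' then y *E z r c else 0E)"
  using Mat_mm[OF single_Mat[OF y] z] mk_mul[OF single_Mat[OF y] z] by (simp_all add: sgl_def)
qed

lemma mk_mul_sgl:
 assumes y: "y : num c c'" and z: "z : Mat"
 shows "(%r a. if a = c' then z r c *E y else 0E) : Mat"
  "mk z *C sgl c c' y = mk (%r a. if a = c' then z r c *E y else 0E)"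
proof -
 have "mm z (single c c' y) = (%r a. if a = c' then z r c *E y else 0E)"
 proof (intro ext)
  fix r a
  let ?F = "{b. z r b ~= 0E} \<union> {c}"
  have "mm z (single c c' y) r a = (S[E, ?F] %b. z r b *E single c c' y b a)"
   using y z Mat_row_finite[OF z] by (intro mm_superset single_Mat) auto
  also have "... = (S[E, ?F] %b. if c = b then (if a = c' then z r c *E y else 0E) else 0E)"
   using y z num_closed[OF y] by (intro M.finsum_cong') (auto simp: single_def)
  also have "... = (if a = c' then z r c *E y else 0E)"
   using Mat_row_finite[OF z] z num_closed[OF y]
    M.add.finprod_singleton[of c ?F "%_. if a = c' then z r c *E y else 0E"] by auto
  finally show "mm z (single c c' y) r a = (if a = c' then z r c *E y else 0E)" .
 qed
 thus "(%r a. if a = c' then z r c *E y else 0E) : Mat"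
  "mk z *C sgl c c' y = mk (%r a. if a = c' then z r c *E y else 0E)"
  using Mat_mm[OF z single_Mat[OF y]] mk_mul[OF z single_Mat[OF y]] by (simp_all add: sgl_def)
qed

lemma sgl_mul:
 assumes y: "y : num r c" and z: "z : num c' d"
 shows "sgl r c y *C sgl c' d z = (if c = c' then sgl r d (y *E z) else 0C)"
proof -
 have "sgl r c y *C sgl c' d z = mk (%a b. if a = r then y *E single c' d z c b else 0E)"
  unfolding sgl_def[of c'] using sgl_mul_mk(2)[OF y single_Mat[OF z]] .
 also have "(%a b. if a = r then y *E single c' d z c b else 0E) = (if c = c' then single r d (y *E z) else (%_ _. 0E))"
  using num_closed[OF y] by (auto simp: single_def fun_eq_iff)
 finally show ?thesis by (simp add: sgl_def mk_zero)
qed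

lemma sgl_mk_sgl:
 assumes "y : num r' r" "z : Mat" "w : num c c'"
 shows "sgl r' r y *C (mk z *C sgl c c' w) = sgl r' c' (y *E (z r c *E w))"
proof -
 have "sgl r' r y *C (mk z *C sgl c c' w) =
   mk (%a b. if a = r' then y *E (if b = c' then z r c *E w else 0E) else 0E)"
  using sgl_mul_mk(2)[OF assms(1) mk_mul_sgl(1)[OF assms(3,2)]] mk_mul_sgl(2)[OF assms(3,2)] by simp
 also have "(%a b. if a = r' then y *E (if b = c' then z r c *E w else 0E) else 0E) = single r' c' (y *E (z r c *E w))"
  using num_closed[OF assms(1)] by (auto simp: single_def fun_eq_iff)
 finally show ?thesis by (simp add: sgl_def)
qed

lemma C_induct [consumes 1, case_names zero sgl add]:
 assumes Y: "Y : |C|" and zero: "P 0C" and sgl: "!!r c y. y : num r c ==> P (sgl r c y)"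
  and add: "!!Y Z. Y : |C| ==> Z : |C| ==> P Y ==> P Z ==> P (Y +C Z)"
 shows "P Y"
proof -
 have *: "P (mk z)" if "finite A" "z : Mat" "{(r, c). z r c ~= 0E} <= A" for A z
  using that
 proof (induction A arbitrary: z rule: finite_induct)
  case empty
  hence "z = (%_ _. 0E)" by (auto simp: fun_eq_iff)
  thus ?case using zero by (simp add: mk_zero)
 next
  case (insert p A)
  obtain r c where p: "p = (r, c)" by (cases p)
  let ?z = "%r' c'. if r' = r & c' = c then 0E else z r' c'"
  obtain R where R: "finite R" "!!r c. z r c ~= 0E ==> r : R & c : R" using Mat_range[OF insert.prems(1)] by blast
  have z': "?z : Mat"
  proof (rule MatI[OF _ R(1)])
   show "?z r' c' : num r' c'" for r' c'
    using Mat_num[OF insert.prems(1), of r' c'] subspaceD(2)[OF num_sub, of r' c'] by (cases "r' = r & c' = c") auto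
   show "r' : R & c' : R" if "?z r' c' ~= 0E" for r' c'
    using R(2)[of r' c'] that by (simp split: if_splits)
  qed
  have "P (mk ?z)" using insert.prems p by (intro insert.IH z') auto
  moreover have "mk z = mk ?z +C sgl r c (z r c)"
   unfolding sgl_def mk_add[OF z' single_Mat[OF Mat_num[OF insert.prems(1)]]]
   by (rule arg_cong[where f = mk]) (use insert.prems(1) in \<open>auto simp: single_def fun_eq_iff\<close>)
  ultimately show ?case using add sgl Mat_num[OF insert.prems(1)] mk_carrier[OF z'] by auto
 qed
 obtain z where z: "z : Mat" "Y = mk z" using mk_surj[OF Y] by blast
 thus ?thesis using *[OF Mat_finite[OF z(1)] z(1)] by simp
qed

lemma finsum_sgl:
 "finite F ==> (!!i. i : F ==> f i : num r c) ==> (S[C, F] %i. sgl r c (f i)) = sgl r c (finsum E f F)"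
proof (induction F rule: finite_induct)
 case (insert i F)
 have "finsum E f F : num r c" using insert by (intro subspace_finsum[OF num_sub]) auto
 moreover have "finsum E f (insert i F) = f i +E finsum E f F" using insert num_closed by (intro M.finsum_insert) auto
 moreover have "(S[C, insert i F] %i. sgl r c (f i)) = sgl r c (f i) +C (S[C, F] %i. sgl r c (f i))"
  using insert by (intro C.M.finsum_insert) auto
 ultimately show ?case using insert by (simp add: sgl_add)
qed simp

lemma num_diag: "num r r = |E|"
 by (simp add: num_eq I_zero)

lemma nilp_sgl: assumes y: "y : I 1" shows "nilp C (sgl r r y)"
proof -
 have yc: "y : |E|" using ID(1)[OF y] .
 have "npow C (sgl r r y) n = sgl r r (npow E y n)" for n
  using yc by (induction n) (auto simp: sgl_mul num_diag)
 moreover have "npow E y n : I (Suc n)" for n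
  using y I_mul[of _ "Suc _" y 1] by (induction n) auto
 hence "npow E y N = 0E" using I_end[of "Suc N"] by auto
 ultimately show ?thesis unfolding nilp_def by (intro exI[of _ N]) simp
qed

end

lemma (in nalg) finsum_opposite: "finsum (opposite L) f F = finsum L f F"
 by (simp add: finsum_def opposite_def)

lemma (in idempotent_family) idempotent_family_opposite: "idempotent_family K (opposite L) Z e"
proof (intro idempotent_family.intro idempotent_family_axioms.intro nalg_opposite)
 fix nu x assume "nu : Z" "x : carrier (opposite L)" "e nu *[opposite L] x = x" "x *[opposite L] e nu = x"
 then obtain k n where "k : KC" "n : |L|" "nilp L n" "x = k .*L e nu +L n"
  using corner[of nu x] by (auto simp: opposite_def)
 thus "EX k:KC. EX n:carrier (opposite L). nilp (opposite L) n & x = k .*[opposite L] e nu +[opposite L] n"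
  by (intro bexI[of _ k] bexI[of _ n]) (auto simp: nilp_opposite, auto simp: opposite_def)
next
 fix nu mu x y assume a: "nu : Z" "mu : Z" "nu ~= mu" "x : carrier (opposite L)" "y : carrier (opposite L)"
  "e nu *[opposite L] x = x" "x *[opposite L] e mu = x" "e mu *[opposite L] y = y" "y *[opposite L] e nu = y"
 hence "nilp L (y *L x)" using off_corner[of nu mu y x] by (simp add: opposite_def)
 thus "nilp (opposite L) (x *[opposite L] y)" using a nilp_opposite[of "y *L x"] by (simp add: opposite_def)
next
 fix x assume "x : carrier (opposite L)"
 thus "EX F. finite F & F <= Z & (S[opposite L, F] %nu. e nu) *[opposite L] x = x \<and>
   x *[opposite L] (S[opposite L, F] %nu. e nu) = x"
  unfolding finsum_opposite using complete[of x] by (auto simp: opposite_def)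
qed (use e_orth e_nonzero in \<open>auto simp: opposite_def\<close>)

lemma subalgebra_opposite: "subalgebra K L T ==> subalgebra K (opposite L) T"
proof -
 assume T: "subalgebra K L T"
 have "subgroup T (add_monoid L) ==> subgroup T (add_monoid (opposite L))"
  by (simp add: opposite_def)
 thus ?thesis using T by (auto simp: subalgebra_def submodule_def submodule_axioms_def) (auto simp: opposite_def)
qed

context banded begin

lemma B_induct:
 assumes x: "x : B" and W: "W <= |L|" "0L : W" "!!x y. x : W ==> y : W ==> x +L y : W"
  and gen: "!!k v j i. k : KC ==> v : V ==> k .*L b v j i : W"
 shows "x : W"
proof -
 have xc: "x : |L|" using BD(1)[OF x] .
 obtain F where F: "finite F" "F <= Z" "unit_on F *L x = x" "x *L unit_on F = x"
  using complete_superset[OF xc] by blast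
 have comp: "e nu *L (x *L e mu) : W" if "nu : Z" "mu : Z" for nu mu
 proof -
  obtain v j where "nu = (v, j)" "v : V" using \<open>nu : Z\<close> by (cases nu) auto
  moreover obtain w i where "mu = (w, i)" "w : V" using \<open>mu : Z\<close> by (cases mu) auto
  ultimately show ?thesis using B_comp[OF x, of v w j i] gen W(2) by auto
 qed
 have "e nu *L x : W" if nu: "nu : Z" for nu
 proof -
  have "e nu *L x = e nu *L (S[L, F] %mu. x *L e mu)" using F(4) mul_unit_on[OF F(1,2) xc] by simp
  also have "... = (S[L, F] %mu. e nu *L (x *L e mu))"
   using F(1,2) xc nu e_closed by (intro finsum_mul_r) blast+
  finally show ?thesis using comp[OF nu] F(2) finsum_mem[OF F(1) _ W(1-3), of "%mu. e nu *L (x *L e mu)"] by (metis subsetD)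
 qed
 hence "(S[L, F] %nu. e nu *L x) : W" using F(2) by (intro finsum_mem[OF F(1) _ W(1-3)]) blast
 thus ?thesis using F(3) unit_on_mul[OF F(1,2) xc] by simp
qed

text \<open>Linearity over \<open>B\<close> need only be tested on the matrix units.\<close>

lemma dual_basisI:
 assumes g: "!!t. t : T ==> g t : |L|"
  and btB: "!!t x. t : T ==> x : |L| ==> bt t x : B"
  and add: "!!t x y. t : T ==> x : |L| ==> y : |L| ==> bt t (x +L y) = bt t x +L bt t y"
  and sm: "!!t k x. t : T ==> k : KC ==> x : |L| ==> bt t (k .*L x) = k .*L bt t x"
  and mul: "!!t x v j i. t : T ==> x : |L| ==> v : V ==> bt t (x *L b v j i) = bt t x *L b v j i"
  and exp: "!!x. x : |L| ==> EX F. finite F & F <= T & (ALL t:T - F. bt t x = 0L) \<and>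
   x = (S[L, F] %t. g t *L bt t x)"
 shows "dual_basis K L B T g bt"
proof (intro dual_basis.intro dual_basis_axioms.intro nalg_axioms B_sub g btB add exp)
 fix t x c assume t: "t : T" and x: "x : |L|" and c: "c : B"
 let ?W = "{c : |L|. bt t (x *L c) = bt t x *L c}"
 have btc: "bt t y : |L|" if "y : |L|" for y using btB[OF t that] BD(1) by blast
 have "bt t 0L = 0L"
  using add[OF t M.zero_closed M.zero_closed] btc[OF M.zero_closed] M.add.r_cancel_one'[of "bt t 0L" "bt t 0L"] by simp
 hence "c : ?W"
  using x btc[OF x] t by (intro B_induct[OF c]) (auto simp: mul_distr mul_smult_r add sm mul)
 thus "bt t (x *L c) = bt t x *L c" by simp
qed auto

end

section \<open>The band subalgebra of the matrix algebra\<close>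

context split_filtered begin

abbreviation "eC \<equiv> diagonal_entry E I N e"
abbreviation "ZZ \<equiv> V \<times> (UNIV :: int set)"
abbreviation "Band \<equiv> band_subalgebra E I N S"

text \<open>The matrix units of the band; outside of it the value \<open>0\<close> makes the multiplication rule uniform.\<close>

definition bC :: "'v => int => int => int => int => 'a set" where
 "bC v i j = (if i <= j & j < i + int N then sgl i j (e v) else 0C)"

lemma eC_sgl: "eC (v, i) = sgl i i (e v)"
 by (auto simp: diagonal_entry_def sgl_def mk_def single_def)

lemma ev_num: "v : V ==> i <= j ==> e v : num i j"
 by (simp add: num_eq I_zero)

lemma I1: "y : I m ==> 1 <= m ==> y : I 1"
 using I_mono[of 1 m] by auto

lemma corner_E: "v : V ==> w : V ==> y : |E| ==>
 EX k:KC. EX z:I 1. e v *E (y *E e w) = (if v = w then k .*E e v else 0E) +E z"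
proof -
 assume v: "v : V" "w : V" and y: "y : |E|"
 obtain s z where sz: "s : S" "z : I 1" "y = s +E z" using split[OF y] by blast
 have c: "s : |E|" "z : |E|" using subalgebraD(1)[OF S_sub] sz ID(1) by auto
 have "e v *E (y *E e w) = e v *E (s *E e w) +E e v *E (z *E e w)"
  using sz c v by (simp add: mul_distl mul_distr)
 moreover have "e v *E (z *E e w) : I 1" using I_ideal sz(2) v by simp
 moreover obtain k where "k : KC" "e v *E (s *E e w) = (if v = w then k .*E e v else 0E)"
  using S_comp[OF sz(1) v] by blast
 ultimately show ?thesis by (intro bexI[of _ k] bexI[of _ "e v *E (z *E e w)"]) simp_all
qed

lemma eC_closed: "nu : ZZ ==> eC nu : |C|"
 by (auto simp: eC_sgl num_diag)

lemma unit_C: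
 assumes Y: "Y : |C|"
 shows "EX R. finite R & (ALL R'. finite R' --> R <= R' -->
  (S[C, V \<times> R'] %nu. eC nu) *C Y = Y & Y *C (S[C, V \<times> R'] %nu. eC nu) = Y)"
 using Y
proof (induction Y rule: C_induct)
 case zero
 have "(S[C, V \<times> R'] %nu. eC nu) : |C|" for R' by (intro C.M.finsum_closed funcsetI eC_closed) auto
 thus ?case by (intro exI[of _ "{}"]) simp
next
 case (sgl r c y)
 have yc: "y : |E|" using num_closed[OF sgl] .
 have "(S[C, V \<times> R'] %nu. eC nu) *C sgl r c y = sgl r c y & sgl r c y *C (S[C, V \<times> R'] %nu. eC nu) = sgl r c y"
  if R': "finite R'" "{r, c} <= R'" for R'
 proof
  have fin: "finite (V \<times> R')" using V_fin R' by simp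
  have ec: "eC : V \<times> R' \<rightarrow> |C|" using eC_closed by auto
  have l: "e v *E y : num r c" and rr: "y *E e v : num r c" if "v : V" for v
   using num_mul_num[OF _ sgl, of "e v" r] num_mul_num[OF sgl, of "e v" c] that by (simp_all add: num_diag)
  have "(S[C, V \<times> R'] %nu. eC nu) *C sgl r c y = (S[C, V \<times> R'] %nu. eC nu *C sgl r c y)"
   using fin ec sgl by (intro C.finsum_mul_l) auto
  also have "... = (S[C, (%v. (v, r)) ` V] %nu. eC nu *C sgl r c y)"
   using fin ec R' sgl by (intro C.M.add.finprod_mono_neutral_cong_right) (auto simp: eC_sgl sgl_mul num_diag)
  also have "... = (S[C, V] %v. eC (v, r) *C sgl r c y)"
   using ec R' sgl eC_closed by (subst C.M.finsum_reindex) (auto simp: inj_on_def)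
  also have "... = (S[C, V] %v. sgl r c (e v *E y))"
   using sgl l by (intro C.M.finsum_cong') (auto simp: eC_sgl sgl_mul num_diag)
  also have "... = sgl r c ((S[E, V] %v. e v) *E y)"
   using V_fin l yc by (simp add: finsum_sgl finsum_mul_l Pi_iff)
  finally show "(S[C, V \<times> R'] %nu. eC nu) *C sgl r c y = sgl r c y" using ev_sum yc by simp
  have "sgl r c y *C (S[C, V \<times> R'] %nu. eC nu) = (S[C, V \<times> R'] %nu. sgl r c y *C eC nu)"
   using fin ec sgl by (intro C.finsum_mul_r) auto
  also have "... = (S[C, (%v. (v, c)) ` V] %nu. sgl r c y *C eC nu)"
   using fin ec R' sgl by (intro C.M.add.finprod_mono_neutral_cong_right) (auto simp: eC_sgl sgl_mul num_diag)
  also have "... = (S[C, V] %v. sgl r c y *C eC (v, c))"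
   using ec R' sgl eC_closed by (subst C.M.finsum_reindex) (auto simp: inj_on_def)
  also have "... = (S[C, V] %v. sgl r c (y *E e v))"
   using sgl rr by (intro C.M.finsum_cong') (auto simp: eC_sgl sgl_mul num_diag)
  also have "... = sgl r c (y *E (S[E, V] %v. e v))"
   using V_fin rr yc by (simp add: finsum_sgl finsum_mul_r Pi_iff)
  finally show "sgl r c y *C (S[C, V \<times> R'] %nu. eC nu) = sgl r c y" using ev_sum yc by simp
 qed
 thus ?case by (intro exI[of _ "{r, c}"]) simp
next
 case (add Y Z)
 obtain R1 where R1: "finite R1" "ALL R'. finite R' --> R1 <= R' -->
   (S[C, V \<times> R'] %nu. eC nu) *C Y = Y & Y *C (S[C, V \<times> R'] %nu. eC nu) = Y" using add(3) by (elim exE conjE)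
 obtain R2 where R2: "finite R2" "ALL R'. finite R' --> R2 <= R' -->
   (S[C, V \<times> R'] %nu. eC nu) *C Z = Z & Z *C (S[C, V \<times> R'] %nu. eC nu) = Z" using add(4) by (elim exE conjE)
 have u: "(S[C, V \<times> R'] %nu. eC nu) : |C|" for R' by (intro C.M.finsum_closed funcsetI eC_closed) auto
 show ?case
  using R1 R2 add(1,2) u by (intro exI[of _ "R1 \<union> R2"]) (simp add: C.mul_distl C.mul_distr)
qed

lemma eC_family: "idempotent_family K C ZZ eC"
proof (intro idempotent_family.intro idempotent_family_axioms.intro nalg_C eC_closed)
 fix nu assume "nu : ZZ"
 then obtain v i where v: "nu = (v, i)" "v : V" by auto
 show "eC nu *C eC nu = eC nu" using v by (simp add: eC_sgl sgl_mul num_diag)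
 have "e v ~: den i i" using v ev_notin[of v] I_mono[of 1 N] N_pos by (auto simp: den_eq)
 thus "eC nu ~= 0C" using v by (simp add: eC_sgl sgl_zero_iff num_diag)
 fix x assume x: "x : |C|" "eC nu *C x = x" "x *C eC nu = x"
 obtain z where z: "z : Mat" "x = mk z" using mk_surj x by blast
 have "x = eC nu *C (x *C eC nu)" using x by simp
 hence xs: "x = sgl i i (e v *E (z i i *E e v))" using z v by (simp add: eC_sgl sgl_mk_sgl num_diag)
 obtain k y where k: "k : KC" "y : I 1" "e v *E (z i i *E e v) = k .*E e v +E y"
  using corner_E[OF v(2) v(2), of "z i i"] z by auto
 have "x = k .*C eC nu +C sgl i i y"
  using xs k v ID(1)[OF k(2)] by (simp add: eC_sgl sgl_smult sgl_add num_diag)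
 thus "EX k:KC. EX n:|C|. nilp C n & x = k .*C eC nu +C n"
  using k nilp_sgl[OF k(2)] ID(1)[OF k(2)] by (intro bexI[of _ k] bexI[of _ "sgl i i y"]) (auto simp: num_diag)
next
 fix nu mu assume "nu : ZZ" "mu : ZZ" and ne: "nu ~= mu"
 then obtain v i w j where v: "nu = (v, i)" "v : V" and w: "mu = (w, j)" "w : V" by auto
 show "eC nu *C eC mu = 0C" using v w ne by (auto simp: eC_sgl sgl_mul num_diag ev_orth)
 fix x y assume x: "x : |C|" and y: "y : |C|" and ex: "eC nu *C x = x" "x *C eC mu = x"
  and ey: "eC mu *C y = y" "y *C eC nu = y"
 obtain z z' where z: "z : Mat" "x = mk z" "z' : Mat" "y = mk z'" using mk_surj x y by blast
 let ?x = "e v *E (z i j *E e w)" and ?y = "e w *E (z' j i *E e v)"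
 have "x = eC nu *C (x *C eC mu)" "y = eC mu *C (y *C eC nu)" using ex ey by simp_all
 hence xs: "x = sgl i j ?x" "y = sgl j i ?y" using z v w by (simp_all add: eC_sgl sgl_mk_sgl num_diag)
 have ez: "a *E (c *E d) : num p q" if "c : num p q" "a : |E|" "d : |E|" for a c d p q
 proof -
  have "c *E d : num p q" by (rule num_mul_num[OF that(1)]) (use that in \<open>simp add: num_diag\<close>)
  thus ?thesis by (intro num_mul_num[of a p p]) (use that in \<open>simp_all add: num_diag\<close>)
 qed
 have nx: "?x : num i j" using ez[OF Mat_num[OF z(1)]] v w by simp
 have ny: "?y : num j i" using ez[OF Mat_num[OF z(3)]] v w by simp
 have "?x *E ?y : I 1"
 proof -
  consider "i > j" | "i < j" | "i = j" "v ~= w" using ne v w by force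
  thus ?thesis
  proof cases
   case 1
   hence "?x : I 1" using nx I1 by (simp add: num_eq)
   thus ?thesis using I_ideal num_closed[OF ny] by blast
  next
   case 2
   hence "?y : I 1" using ny I1 by (simp add: num_eq)
   thus ?thesis using I_ideal num_closed[OF nx] by blast
  next
   case 3
   hence "?x : I 1" using corner_E[OF v(2) w(2), of "z i j"] z ID(1) by auto
   thus ?thesis using I_ideal num_closed[OF ny] by blast
  qed
 qed
 thus "nilp C (x *C y)" using nilp_sgl nx ny unfolding xs by (simp add: sgl_mul)
next
 fix x assume "x : |C|"
 then obtain R where "finite R" "(S[C, V \<times> R] %nu. eC nu) *C x = x & x *C (S[C, V \<times> R] %nu. eC nu) = x"
  using unit_C by blast
 thus "EX F. finite F & F <= ZZ & (S[C, F] %nu. eC nu) *C x = x & x *C (S[C, F] %nu. eC nu) = x"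
  using V_fin by (intro exI[of _ "V \<times> R"]) auto
qed

lemma bC_sgl: "v : V ==> i <= j ==> bC v i j = sgl i j (e v)"
proof -
 assume v: "v : V" and ij: "i <= j"
 have "e v : den i j" if "~ j < i + int N" using that v ij by (simp add: den_eq I_zero)
 thus ?thesis using v ij sgl_zero_iff[OF ev_num[OF v ij]] by (auto simp: bC_def)
qed

lemma bC_closed [simp, intro]: "v : V ==> bC v i j : |C|"
 by (auto simp: bC_def ev_num)

lemma bC_mul: "v : V ==> w : V ==>
 bC v i j *C bC w j' k = (if v = w & j = j' & i <= j & j <= k then bC v i k else 0C)"
proof -
 assume v: "v : V" "w : V"
 show ?thesis
 proof (cases "i <= j & j' <= k")
  case True
  thus ?thesis using v by (auto simp: bC_sgl sgl_mul ev_num ev_orth)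
 next
  case False
  hence "bC v i j = 0C \<or> bC w j' k = 0C" by (auto simp: bC_def)
  thus ?thesis using False v by auto
 qed
qed

lemma bC_nonzero: "v : V ==> i <= j ==> j < i + int N ==> bC v i j ~= 0C"
proof
 assume v: "v : V" and ij: "i <= j" "j < i + int N" and z: "bC v i j = 0C"
 hence "e v : den i j" using sgl_zero_iff[OF ev_num[OF v ij(1)]] by (simp add: bC_sgl)
 thus False using I1[of "e v" "nat (int N - max 0 (j - i))"] ev_notin[OF v] ij by (simp add: den_eq)
qed

text \<open>Matrices with representatives in \<open>S\<close>, supported in the band.\<close>

lemma Band_iff: "Y : Band <-> (EX z:Mat. Y = mk z & (ALL r c. if r <= c & c < r + int N then z r c : S else z r c = 0E))"
proof
 assume Y: "Y : Band"
 hence Yc: "Y : |C|" by (simp add: band_subalgebra_def)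
 have band: "if 0 <= c - r & c - r <= int N - 1 then Y r c : {den r c +>[E] s |s. s : S} else Y r c = den r c" for r c
  using Y unfolding band_subalgebra_def by blast
 have ex: "EX s:S. Y r c = den r c +>[E] s" if "r <= c & c < r + int N" for r c
 proof -
  have "0 <= c - r & c - r <= int N - 1" using that by auto
  hence "Y r c : {den r c +>[E] s |s. s : S}" using band[of c r] by (simp only: if_True)
  thus ?thesis by blast
 qed
 have off: "Y r c = den r c" if "~ (r <= c & c < r + int N)" for r c
 proof -
  have "~ (0 <= c - r & c - r <= int N - 1)" using that by auto
  thus ?thesis using band[of c r] by (simp only: if_False)
 qed
 define z where "z r c = (if r <= c & c < r + int N & Y r c ~= den r c then SOME s. s : S & Y r c = den r c +>[E] s else 0E)" for r c
 have S0: "0E : S" by (rule subalgebraD(2)[OF S_sub])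
 have zp: "z r c : S & Y r c = den r c +>[E] z r c" for r c
 proof (cases "r <= c & c < r + int N & Y r c ~= den r c")
  case True
  hence "EX s. s : S & Y r c = den r c +>[E] s" using ex[of r c] by blast
  from someI_ex[OF this] show ?thesis using True by (simp add: z_def)
 next
  case False
  thus ?thesis using off[of r c] S0 by (auto simp: z_def)
 qed
 have zn: "z r c : num r c" for r c
  using zp[of r c] subalgebraD(1)[OF S_sub] subspaceD(2)[OF num_sub, of r c] by (cases "r <= c") (auto simp: num_eq I_zero z_def)
 have "{(r, c). z r c ~= 0E} <= {(r, c). Y r c ~= den r c}" by (auto simp: z_def)
 moreover have "finite {(r, c). Y r c ~= den r c}" using Yc by (simp add: matrix_algebra_def)
 ultimately have "finite {(r, c). z r c ~= 0E}" by (rule finite_subset)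
 hence "z : Mat" using zn by (simp add: Mat_def)
 moreover have "Y = mk z" using zp by (auto simp: mk_def fun_eq_iff)
 moreover have "if r <= c & c < r + int N then z r c : S else z r c = 0E" for r c
 proof (cases "r <= c & c < r + int N")
  case True
  thus ?thesis using zp[of r c] by simp
 next
  case False
  hence "z r c = 0E" unfolding z_def by (intro if_not_P) blast
  thus ?thesis using S0 by simp
 qed
 ultimately show "EX z:Mat. Y = mk z & (ALL r c. if r <= c & c < r + int N then z r c : S else z r c = 0E)" by blast
next
 assume "EX z:Mat. Y = mk z & (ALL r c. if r <= c & c < r + int N then z r c : S else z r c = 0E)"
 then obtain z where z: "z : Mat" "Y = mk z" "!!r c. if r <= c & c < r + int N then z r c : S else z r c = 0E" by blast
 have "if 0 <= c - r & c - r <= int N - 1 then Y r c : {den r c +>[E] s |s. s : S} else Y r c = den r c" for r c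
 proof (cases "r <= c & c < r + int N")
  case True
  thus ?thesis using z(3)[of r c] by (auto simp: z(2) mk_def)
 next
  case False
  thus ?thesis using z(3)[of r c] by (auto simp: z(2) mk_def)
 qed
 thus "Y : Band" using mk_carrier[OF z(1)] unfolding z(2) band_subalgebra_def by blast
qed

lemma Band_sub: "subalgebra K C Band"
 unfolding subalgebra_def
proof (intro conjI ballI)
 note SD = subalgebraD[OF S_sub]
 let ?b = "%z. ALL r c. if r <= c & c < r + int N then z r c : S else z r c = 0E"
 show "submodule Band K C"
 proof (rule C.subspaceI)
  show "Band <= |C|" by (auto simp: band_subalgebra_def)
  show "0C : Band" unfolding Band_iff using Mat_zero SD(2) by (intro bexI[of _ "%_ _. 0E"]) (auto simp: mk_zero)
  fix Y Y' assume "Y : Band" "Y' : Band"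
  then obtain z z' where z: "z : Mat" "Y = mk z" "?b z" "z' : Mat" "Y' = mk z'" "?b z'" unfolding Band_iff by blast
  have "?b (%r c. z r c +E z' r c)"
  proof (intro allI)
   fix r c
   show "if r <= c & c < r + int N then z r c +E z' r c : S else z r c +E z' r c = 0E"
    using z(3)[rule_format, of r c] z(6)[rule_format, of r c] SD(3) by (auto split: if_splits)
  qed
  thus "Y +C Y' : Band" unfolding Band_iff using mk_add Mat_add z by blast
 next
  fix k Y assume k: "k : KC" and "Y : Band"
  then obtain z where z: "z : Mat" "Y = mk z" "?b z" unfolding Band_iff by blast
  have "?b (%r c. k .*E z r c)"
  proof (intro allI)
   fix r c
   show "if r <= c & c < r + int N then k .*E z r c : S else k .*E z r c = 0E"
    using z(3)[rule_format, of r c] k SD(5) by (auto split: if_splits)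
  qed
  thus "k .*C Y : Band" unfolding Band_iff using mk_smult Mat_smult k z by blast
 qed
 fix Y Y' assume "Y : Band" "Y' : Band"
 then obtain z z' where z: "z : Mat" "Y = mk z" "?b z" "z' : Mat" "Y' = mk z'" "?b z'" unfolding Band_iff by blast
 let ?w = "%r d. if r <= d & d < r + int N then mm z z' r d else 0E"
 have w: "?w : Mat"
 proof -
  obtain R where R: "finite R" "!!r c. mm z z' r c ~= 0E ==> r : R & c : R" using Mat_range[OF Mat_mm[OF z(1,4)]] by blast
  show ?thesis
  proof (rule MatI[OF _ R(1)])
   show "?w r c : num r c" for r c
    using Mat_num[OF Mat_mm[OF z(1,4)], of r c] subspaceD(2)[OF num_sub, of r c] by simp
   show "r : R & c : R" if "?w r c ~= 0E" for r c using R(2)[of r c] that by (simp split: if_splits)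
  qed
 qed
 have S': "z r c : S" "z' r c : S" for r c
  using z(3)[rule_format, of r c] z(6)[rule_format, of r c] SD(2) by (auto split: if_splits)
 have "?b ?w"
 proof -
  have "mm z z' r d : S" for r d
   unfolding mm_def using Mat_row_finite[OF z(1)] SD(4)[OF S'] by (intro finsum_subalgebra(2)[OF S_sub]) auto
  thus ?thesis by auto
 qed
 moreover have "mk (mm z z') = mk ?w"
  unfolding mk_eq_iff[OF Mat_mm[OF z(1,4)] w]
 proof (intro allI)
  fix r d
  show "EX u:den r d. mm z z' r d = u +E ?w r d"
  proof (cases "r <= d")
   case True
   have c: "mm z z' r d : |E|" using Mat_closed[OF Mat_mm[OF z(1,4)]] .
   show ?thesis
   proof (cases "d < r + int N")
    case True
    thus ?thesis using c \<open>r <= d\<close> subspaceD(2)[OF den_sub] by (intro bexI[of _ "0E"]) auto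
   next
    case False
    hence "den r d = |E|" using \<open>r <= d\<close> by (simp add: den_eq I_zero)
    thus ?thesis using c False by (intro bexI[of _ "mm z z' r d"]) auto
   qed
  next
   case False
   have "z r c *E z' c d = 0E" for c
   proof -
    have "~ r <= c \<or> ~ c <= d" using False by auto
    hence "z r c = 0E \<or> z' c d = 0E"
     using z(3)[rule_format, of r c] z(6)[rule_format, of c d] by auto
    thus ?thesis using z(1,4) by auto
   qed
   hence "mm z z' r d = 0E" unfolding mm_def by (intro M.add.finprod_one_eqI) simp
   thus ?thesis using False subspaceD(2)[OF den_sub] by (intro bexI[of _ "0E"]) auto
  qed
 qed
 moreover have "Y *C Y' = mk (mm z z')" using mk_mul[OF z(1,4)] z(2,5) by simp
 ultimately show "Y *C Y' : Band" unfolding Band_iff using w by (intro bexI[OF _ w] conjI) simp_all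
qed

lemma bC_Band: "v : V ==> bC v i j : Band"
proof (cases "i <= j & j < i + int N")
 case True
 assume v: "v : V"
 have "single i j (e v) r c : S & (~ (r <= c & c < r + int N) --> single i j (e v) r c = 0E)" for r c
  using True v ev_S[OF v] subalgebraD(2)[OF S_sub] by (auto simp: single_def)
 hence "sgl i j (e v) : Band"
  unfolding Band_iff sgl_def using single_Mat[OF ev_num[OF v, of i j]] True by (intro bexI[of _ "single i j (e v)"]) auto
 thus ?thesis using True by (simp add: bC_def)
next
 case False
 hence "bC v i j = 0C" by (auto simp: bC_def)
 thus ?thesis using C.subalgebraD(2)[OF Band_sub] by simp
qed

lemma Band_comp:
 assumes Y: "Y : Band" and v: "v : V" "w : V"
 shows "EX k:KC. eC (v, i) *C (Y *C eC (w, j)) = (if v = w then k .*C bC v i j else 0C)"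
proof -
 obtain z where z: "z : Mat" "Y = mk z" "!!r c. if r <= c & c < r + int N then z r c : S else z r c = 0E"
  using Y unfolding Band_iff by blast
 have eq: "eC (v, i) *C (Y *C eC (w, j)) = sgl i j (e v *E (z i j *E e w))"
  using z v by (simp add: eC_sgl sgl_mk_sgl num_diag)
 show ?thesis
 proof (cases "i <= j & j < i + int N")
  case True
  hence "z i j : S" using z(3)[of i j] by simp
  then obtain k where "k : KC" "e v *E (z i j *E e w) = (if v = w then k .*E e v else 0E)"
   using S_comp v by blast
  thus ?thesis using True v eq by (intro bexI[of _ k]) (auto simp: bC_def sgl_smult ev_num)
 next
  case False
  hence "z i j = 0E" using z(3)[of i j] by auto
  thus ?thesis using v eq by (intro bexI[of _ \<zero>]) auto
 qed
qed

text \<open>Everything to the right of the diagonal position factors through the first band step.\<close>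

text \<open>Right of the diagonal the entry spaces shrink as the distance from it grows, so an element of position \<open>(i,
j)\<close> has a representative that also makes sense at \<open>(i + 1, j)\<close>.\<close>

lemma C_step:
 assumes v: "v : V" and w: "w : V" and ij: "i < j" and x: "x : |C|" "eC (v, i) *C x = x" "x *C eC (w, j) = x"
 shows "EX y:|C|. x = bC v i (i + 1) *C y"
proof -
 obtain z where z: "z : Mat" "x = mk z" using mk_surj x by blast
 let ?y = "e v *E (z i j *E e w)"
 have "x = eC (v, i) *C (x *C eC (w, j))" using x by simp
 hence xs: "x = sgl i j ?y" using z v w by (simp add: eC_sgl sgl_mk_sgl num_diag)
 have yc: "?y : |E|" using z v w by simp
 hence "?y : num (i + 1) j" using ij by (simp add: num_eq I_zero)
 moreover have "e v *E ?y = ?y" using z v w by (simp add: ev_assoc)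
 ultimately have "bC v i (i + 1) *C sgl (i + 1) j ?y = x" using v xs ij by (simp add: bC_sgl sgl_mul ev_num)
 thus ?thesis using \<open>?y : num (i + 1) j\<close> by (metis sgl_closed)
qed

lemma banded_C: "banded K (opposite C) V eC N first_order (%v j i. bC v i j) Band"
proof (intro banded.intro banded_axioms.intro idempotent_family.idempotent_family_opposite[OF eC_family] N_pos
  subalgebra_opposite[OF Band_sub] bC_Band)
 show "~ first_order nu nu" for nu :: "'v \<times> int" by (cases nu) (simp add: first_order_def)
 fix v w i j x assume "v : V" "w : V" "first_order (v, i) (w, j)" "x : carrier (opposite C)"
  "eC (w, j) *[opposite C] x = x" "x *[opposite C] eC (v, i) = x"
 thus "EX y:carrier (opposite C). x = y *[opposite C] bC v i (i + 1)"
  using C_step[of v w i j x] by (auto simp: opposite_def first_order_def)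
next
 fix x v w i j assume "x : Band" "v : V" "w : V"
 then obtain k where "k : KC" "eC (w, i) *C (x *C eC (v, j)) = (if w = v then k .*C bC w i j else 0C)"
  using Band_comp[of x w v i j] by blast
 thus "EX k:KC. eC (v, j) *[opposite C] (x *[opposite C] eC (w, i)) =
   (if v = w then k .*[opposite C] bC v i j else 0[opposite C])"
  using \<open>v : V\<close> \<open>w : V\<close> \<open>x : Band\<close> C.subalgebraD(1)[OF Band_sub] eC_closed
  by (intro bexI[of _ k]) (auto simp: opposite_def C.mul_assoc)
qed (use N_pos bC_nonzero bC_mul in \<open>auto simp: bC_def eC_sgl opposite_def first_order_def\<close>)

end

section \<open>The dual basis of the matrix algebra over the band subalgebra\<close>

lemma (in abelian_monoid) finsum_single:
 assumes "finite F" "w : carrier G" "!!r. r : F ==> r ~= i ==> f r = \<zero>" "i : F ==> f i = w" "i ~: F ==> w = \<zero>"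
 shows "finsum G f F = w"
proof (cases "i : F")
 case True
 have "finsum G f F = (\<Oplus>r\<in>F. if i = r then w else \<zero>)" using assms True by (intro finsum_cong') auto
 thus ?thesis using add.finprod_singleton[of i F "%_. w"] True assms by simp
next
 case False
 hence "finsum G f F = \<zero>" using assms by (intro add.finprod_one_eqI) metis
 thus ?thesis using False assms by simp
qed

lemma opposite_sel [simp]:
 "carrier (opposite L) = carrier L" "ring.add (opposite L) = ring.add L" "0[opposite L] = 0[L]"
 "smult (opposite L) = smult L" "x *[opposite L] y = y *[L] x"
 by (simp_all add: opposite_def)

context adapted begin

text \<open>Representatives are chosen once; the coordinates used below do not depend on the choice.\<close>

definition ent :: "(int => int => 'a set) => int => int => 'a" where
 "ent Y = (SOME z. z : Mat & Y = mk z)"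

abbreviation "win t c \<equiv> {c + int (dg t) - int N<..c + int (dg t)}"

text \<open>The lowest position in column \<open>c\<close> that admits \<open>x t\<close>.\<close>

definition gC :: "'t \<times> int => int => int => 'a set" where
 "gC = (%(t, c). sgl (c + int (dg t)) c (x t))"

text \<open>In the window \<open>win t c\<close> the band connects row \<open>r\<close> with row \<open>c + dg t\<close>. Below it
the coordinate vanishes on the entry space, above it \<open>x t\<close> itself is zero.\<close>

definition btC :: "'t \<times> int => (int => int => 'a set) => int => int => 'a set" where
 "btC = (%(t, c) Y. S[C, win t c] %r. kp t (ent Y r c) .*C bC (lv t) r (c + int (dg t)))"

lemma ent_mk: "Y : |C| ==> ent Y : Mat & mk (ent Y) = Y"
proof -
 assume "Y : |C|"
 hence "EX z. z : Mat & Y = mk z" using mk_surj by blast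
 from someI_ex[OF this] show ?thesis unfolding ent_def by simp
qed

lemma kp_I: "t : T ==> y : I m ==> dg t < m ==> kp t y = \<zero>"
 using kp_zero[of t y] I_mono[of "Suc (dg t)" m] by auto

lemma kp_0 [simp]: "t : T ==> kp t 0E = \<zero>"
 using kp_zero[of t "0E"] ID(2) by simp

lemma kp_num: "t : T ==> y : num r c ==> c + int (dg t) < r ==> kp t y = \<zero>"
 by (rule kp_I[of t y "nat (r - c)"]) (auto simp: num_eq)

lemma kp_den: "t : T ==> y : den r c ==> c + int (dg t) < r + int N ==> kp t y = \<zero>"
 using dg[of t] by (intro kp_I[of t y "nat (int N - max 0 (c - r))"]) (auto simp: den_eq)

lemma kp_ent:
 assumes t: "t : T" and z: "z : Mat" and rc: "c + int (dg t) < r + int N"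
 shows "kp t (ent (mk z) r c) = kp t (z r c)"
proof -
 note E = ent_mk[OF mk_carrier[OF z]]
 obtain u where u: "u : den r c" "ent (mk z) r c = u +E z r c"
  using E z mk_eq_iff[of "ent (mk z)" z] by blast
 show ?thesis using t z u kp_den[OF t u(1) rc] den_closed[OF u(1)] by (simp add: kp_add kp_K)
qed

lemma btC_mk: "t : T ==> z : Mat ==> btC (t, c) (mk z) = (S[C, win t c] %r. kp t (z r c) .*C bC (lv t) r (c + int (dg t)))"
 unfolding btC_def prod.case by (intro C.M.finsum_cong') (auto simp: kp_ent kp_K lv)

lemma bC_win: "r ~: win t c ==> bC v r (c + int (dg t)) = 0C"
 by (auto simp: bC_def)

lemma btC_sgl:
 assumes t: "t : T" and y: "y : num r c'"
 shows "btC (t, c) (sgl r c' y) = (if c = c' then kp t y .*C bC (lv t) r (c + int (dg t)) else 0C)"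
 unfolding sgl_def btC_mk[OF t single_Mat[OF y]]
 using t num_closed[OF y] bC_win[of r c t "lv t"] lv[OF t]
 by (intro C.M.finsum_single[of _ _ r]) (auto simp: single_def kp_K lv)

lemma gC_closed: "p : T \<times> UNIV ==> gC p : |C|"
 using x_I by (auto simp: gC_def num_eq intro!: sgl_closed)

lemma btC_Band: "t : T ==> btC (t, c) Y : Band" if "Y : |C|"
 unfolding btC_def prod.case using ent_mk[OF that] lv bC_Band
 by (intro C.finsum_subalgebra(2)[OF Band_sub]) (auto intro!: C.subalgebraD(5)[OF Band_sub] kp_K)

lemma btC_closed: "t : T ==> Y : |C| ==> btC (t, c) Y : |C|"
 using btC_Band C.subalgebraD(1)[OF Band_sub] by blast

lemma btC_add:
 assumes t: "t : T" and Y: "Y : |C|" "Z : |C|"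
 shows "btC (t, c) (Y +C Z) = btC (t, c) Y +C btC (t, c) Z"
proof -
 obtain y z where yz: "y : Mat" "Y = mk y" "z : Mat" "Z = mk z" using mk_surj Y by blast
 have "btC (t, c) (Y +C Z) = (S[C, win t c] %r. kp t (y r c) .*C bC (lv t) r (c + int (dg t)) +C kp t (z r c) .*C bC (lv t) r (c + int (dg t)))"
  unfolding yz(2,4) mk_add[OF yz(1,3)] btC_mk[OF t Mat_add[OF yz(1,3)]]
  using t yz by (intro C.M.finsum_cong') (auto simp: kp_add kp_K lv C.smult_l_distr)
 thus ?thesis unfolding yz(2,4) btC_mk[OF t yz(1)] btC_mk[OF t yz(3)]
  using t yz by (subst C.M.finsum_addf[symmetric]) (auto simp: kp_K lv)
qed

lemma btC_smult:
 assumes t: "t : T" and k: "k : KC" and Y: "Y : |C|"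
 shows "btC (t, c) (k .*C Y) = k .*C btC (t, c) Y"
proof -
 obtain y where y: "y : Mat" "Y = mk y" using mk_surj Y by blast
 have "btC (t, c) (k .*C Y) = (S[C, win t c] %r. k .*C (kp t (y r c) .*C bC (lv t) r (c + int (dg t))))"
  unfolding y(2) mk_smult[OF k y(1)] btC_mk[OF t Mat_smult[OF k y(1)]]
  using t y k by (intro C.M.finsum_cong') (auto simp: kp_smult kp_K lv C.smult_assoc1)
 thus ?thesis unfolding y(2) btC_mk[OF t y(1)]
  using t y k by (subst C.finsum_smult) (auto simp: kp_K lv)
qed

lemma btC_mul:
 assumes t: "t : T" and Y: "Y : |C|" and v: "v : V"
 shows "btC (t, c) (bC v i j *C Y) = bC v i j *C btC (t, c) Y"
proof (cases "i <= j & j < i + int N")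
 case False
 hence b0: "bC v i j = 0C" by (auto simp: bC_def)
 have "btC (t, c) 0C = 0C"
  using btC_smult[OF t R.zero_closed Y, of c] Y btC_closed[OF t Y] by simp
 thus ?thesis using b0 Y btC_closed[OF t Y] by simp
next
 case True
 obtain z where z: "z : Mat" "Y = mk z" using mk_surj Y by blast
 let ?d = "c + int (dg t)"
 let ?w = "if v = lv t then kp t (z j c) .*C bC v i ?d else 0C"
 note sm = sgl_mul_mk[OF ev_num[OF v conjunct1[OF True]] z(1)]
 have zc: "z j c : |E|" using z by simp
 have w0: "?w = 0C" if "j ~: win t c"
 proof (cases "j > ?d")
  case True
  thus ?thesis using kp_num[OF t Mat_num[OF z(1)], of c j] v lv[OF t] by simp
 next
  case F: False
  hence "j + int N <= ?d" using that by auto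
  hence "bC v i ?d = 0C" using True by (simp add: bC_def)
  thus ?thesis using zc t by (auto simp: kp_K)
 qed
 have w1: "?w = 0C" if "i ~: win t c" using bC_win[OF that, of v] zc t by (auto simp: kp_K)
 have wc: "?w : |C|" using t v zc by (auto simp: kp_K)
 have "btC (t, c) (bC v i j *C Y) = btC (t, c) (mk (%a c. if a = i then e v *E z j c else 0E))"
  using sm(2) True v z by (simp add: bC_sgl)
 also have "... = ?w"
  unfolding btC_mk[OF t sm(1)] using wc w1 t zc v lv
  by (intro C.M.finsum_single[of _ _ i]) (auto simp: kp_l)
 also have "?w = (S[C, win t c] %r. kp t (z r c) .*C (bC v i j *C bC (lv t) r ?d))"
  using wc w0 t z v lv True
  by (intro C.M.finsum_single[of _ _ j, symmetric]) (auto simp: bC_mul kp_K)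
 also have "... = bC v i j *C btC (t, c) Y"
  unfolding z(2) btC_mk[OF t z(1)] using t v z lv
  by (subst C.finsum_mul_r) (auto simp: C.mul_smult_r kp_K intro!: C.M.finsum_cong')
 finally show ?thesis .
qed

lemma coordinate_sgl:
 assumes t: "t : T" and y: "y : num r c"
 shows "kp t y .*E x t : num r c"
  "btC (t, c) (sgl r c y) *C gC (t, c) = sgl r c (kp t y .*E x t)"
proof -
 let ?d = "c + int (dg t)"
 have xn: "x t : num ?d c" using x_I[OF t] by (simp add: num_eq)
 have k: "kp t y : KC" using kp_K[OF t num_closed[OF y]] .
 have l: "lv t : V" "x t : |E|" using lv t num_closed[OF xn] by auto
 have "kp t y .*E x t : num r c & btC (t, c) (sgl r c y) *C gC (t, c) = sgl r c (kp t y .*E x t)"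
 proof (cases "r <= ?d")
  case True
  have n: "x t : num r c" using num_mono[OF True, of c c] xn by auto
  have "bC (lv t) r ?d *C gC (t, c) = sgl r c (x t)"
   using True l xn lv_x[OF t] by (simp add: bC_sgl gC_def sgl_mul ev_num)
  thus ?thesis using n k l xn t y subspaceD(4)[OF num_sub k n]
   by (simp add: btC_sgl C.mul_smult_l sgl_smult gC_def)
 next
  case False
  hence "kp t y = \<zero>" using kp_num[OF t y] by simp
  thus ?thesis using l xn t y subspaceD(2)[OF num_sub] by (simp add: btC_sgl gC_def)
 qed
 thus "kp t y .*E x t : num r c" "btC (t, c) (sgl r c y) *C gC (t, c) = sgl r c (kp t y .*E x t)" by auto
qed

lemma C_expand:
 assumes "Y : |C|"
 shows "EX F. finite F & (ALL F'. finite F' --> F <= F' -->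
  (ALL t:T. ALL c. c ~: F' --> btC (t, c) Y = 0C) & (S[C, T \<times> F'] %p. btC p Y *C gC p) = Y)"
 using assms
proof (induction Y rule: C_induct)
 case zero
 have z: "btC p 0C = 0C" if "p : T \<times> UNIV" for p
  using that btC_smult[OF _ R.zero_closed C.M.zero_closed] btC_closed[OF _ C.M.zero_closed] by (cases p) auto
 have "(S[C, T \<times> F'] %p. btC p 0C *C gC p) = 0C" for F'
  using gC_closed z by (intro C.M.add.finprod_one_eqI) auto
 thus ?case using z by (intro exI[of _ "{}"]) auto
next
 case (sgl r c y)
 have "(S[C, T \<times> F'] %p. btC p (sgl r c y) *C gC p) = sgl r c y" if F': "finite F'" "c : F'" for F'
 proof -
  have "(S[C, T \<times> F'] %p. btC p (sgl r c y) *C gC p) = (S[C, (%t. (t, c)) ` T] %p. btC p (sgl r c y) *C gC p)"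
   using F' T_fin sgl gC_closed
   by (intro C.M.add.finprod_mono_neutral_cong_right) (auto simp: btC_sgl image_iff intro!: btC_closed)
  also have "... = (S[C, T] %t. btC (t, c) (sgl r c y) *C gC (t, c))"
   using sgl gC_closed by (subst C.M.finsum_reindex) (auto simp: inj_on_def intro!: btC_closed)
  also have "... = (S[C, T] %t. sgl r c (kp t y .*E x t))"
   using coordinate_sgl sgl by (intro C.M.finsum_cong') auto
  also have "... = sgl r c y"
   using coordinate_sgl(1)[OF _ sgl] T_fin x_expand[OF num_closed[OF sgl]] by (simp add: finsum_sgl)
  finally show ?thesis .
 qed
 thus ?case using sgl by (intro exI[of _ "{c}"]) (auto simp: btC_sgl)
next
 case (add Y Z)
 obtain F1 where F1: "finite F1" "ALL F'. finite F' --> F1 <= F' -->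
  (ALL t:T. ALL c. c ~: F' --> btC (t, c) Y = 0C) & (S[C, T \<times> F'] %p. btC p Y *C gC p) = Y" using add(3) by (elim exE conjE)
 obtain F2 where F2: "finite F2" "ALL F'. finite F' --> F2 <= F' -->
  (ALL t:T. ALL c. c ~: F' --> btC (t, c) Z = 0C) & (S[C, T \<times> F'] %p. btC p Z *C gC p) = Z" using add(4) by (elim exE conjE)
 show ?case
 proof (intro exI[of _ "F1 \<union> F2"] conjI allI impI)
  show "finite (F1 \<union> F2)" using F1 F2 by simp
  fix F' assume F': "finite F'" "F1 \<union> F2 <= F'"
  have 1: "ALL t:T. ALL c. c ~: F' --> btC (t, c) Y = 0C" "(S[C, T \<times> F'] %p. btC p Y *C gC p) = Y" using F1(2) F' by auto
  have 2: "ALL t:T. ALL c. c ~: F' --> btC (t, c) Z = 0C" "(S[C, T \<times> F'] %p. btC p Z *C gC p) = Z" using F2(2) F' by auto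
  show "ALL t:T. ALL c. c ~: F' --> btC (t, c) (Y +C Z) = 0C" 
  proof (intro ballI allI impI)
   fix t c assume "t : T" "c ~: F'"
   thus "btC (t, c) (Y +C Z) = 0C" using 1(1) 2(1) by (simp add: btC_add[OF _ add(1,2)])
  qed
  have g: "gC p : |C|" "btC p Y : |C|" "btC p Z : |C|"
   "btC p (Y +C Z) *C gC p = btC p Y *C gC p +C btC p Z *C gC p" if pT: "p : T \<times> F'" for p
  proof -
   obtain t c where p: "p = (t, c)" "t : T" using pT by (cases p) auto
   show g: "gC p : |C|" using gC_closed[of p] p by simp
   show Yc: "btC p Y : |C|" "btC p Z : |C|" using btC_closed[OF p(2)] add(1,2) p(1) by simp_all
   have "btC p (Y +C Z) = btC p Y +C btC p Z" using btC_add[OF p(2) add(1,2)] p(1) by simp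
   thus "btC p (Y +C Z) *C gC p = btC p Y *C gC p +C btC p Z *C gC p" using g Yc by (simp add: C.mul_distl)
  qed
  have "(S[C, T \<times> F'] %p. btC p (Y +C Z) *C gC p) = (S[C, T \<times> F'] %p. btC p Y *C gC p +C btC p Z *C gC p)"
   by (rule C.M.finsum_cong'[OF refl]) (use g in blast)+
  also have "... = (S[C, T \<times> F'] %p. btC p Y *C gC p) +C (S[C, T \<times> F'] %p. btC p Z *C gC p)"
   by (rule C.M.finsum_addf) (use g in blast)+
  also have "... = Y +C Z" using 1(2) 2(2) by simp
  finally show "(S[C, T \<times> F'] %p. btC p (Y +C Z) *C gC p) = Y +C Z" .
 qed
qed

theorem matrix_algebra_Delta:
 "strong_exact_Delta_subalgebra TYPE('m) K (V \<times> UNIV) first_order C eC Band eC"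
 unfolding strong_exact_Delta_subalgebra_def
proof (rule banded.strong_exact_Borel[OF banded_C banded.dual_basisI[OF banded_C, of "T \<times> UNIV" gC btC]], unfold opposite_sel)
 fix p assume p: "p : T \<times> (UNIV :: int set)"
 then obtain t c where t: "p = (t, c)" "t : T" by auto
 show "gC p : |C|" using gC_closed[OF p] .
 fix Y assume Y: "Y : |C|"
 show "btC p Y : Band" using btC_Band[OF Y t(2)] t by simp
 show "btC p (Y +C Z) = btC p Y +C btC p Z" if "Z : |C|" for Z using btC_add[OF t(2) Y that] t by simp
 show "btC p (k .*C Y) = k .*C btC p Y" if "k : KC" for k using btC_smult[OF t(2) that Y] t by simp
 show "btC p (bC v i j *C Y) = bC v i j *C btC p Y" if "v : V" for v i j using btC_mul[OF t(2) Y that] t by simp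
next
 fix Y assume Y: "Y : |C|"
 obtain F where F: "finite F" "ALL F'. finite F' --> F <= F' -->
  (ALL t:T. ALL c. c ~: F' --> btC (t, c) Y = 0C) & (S[C, T \<times> F'] %p. btC p Y *C gC p) = Y"
  using C_expand[OF Y] by (elim exE conjE)
 hence "(ALL t:T. ALL c. c ~: F --> btC (t, c) Y = 0C) & (S[C, T \<times> F] %p. btC p Y *C gC p) = Y" using F by (auto simp del: split_paired_All)
 thus "EX F. finite F & F <= T \<times> UNIV & (ALL t:T \<times> UNIV - F. btC t Y = 0C) & Y = (S[opposite C, F] %t. btC t Y *C gC t)"
  using F(1) T_fin by (intro exI[of _ "T \<times> F"]) (auto simp: C.finsum_opposite)
qed

end

section \<open>Trivial extensions\<close>

context idempotent_family begin

abbreviation "Rd \<equiv> restricted_dual K L Z e"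
abbreviation "D \<equiv> trivial_extension K L Z e"
abbreviation carrier_D ("|D|") where "|D| \<equiv> carrier D"
abbreviation mult_D (infixl "*D" 70) where "x *D y \<equiv> x *[D] y"
abbreviation add_D (infixl "+D" 65) where "x +D y \<equiv> x +[D] y"
abbreviation smult_D (infixl ".*D" 70) where "k .*D x \<equiv> k .*[D] x"
abbreviation zero_D ("0D") where "0D \<equiv> 0[D]"


lemma RdD:
 assumes "ph : Rd"
 shows "a : |L| ==> ph a : KC" "a ~: |L| ==> ph a = undefined"
  "a : |L| ==> b : |L| ==> ph (a +L b) = ph a \<oplus> ph b"
  "k : KC ==> a : |L| ==> ph (k .*L a) = k \<otimes> ph a" "ph 0L = \<zero>"
  "finite A ==> f : A \<rightarrow> |L| ==> ph (finsum L f A) = (\<Oplus>i\<in>A. ph (f i))"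
proof -
 have 1: "ph a : KC" if "a : |L|" for a using assms that by (auto simp: restricted_dual_def)
 have 2: "ph (a +L b) = ph a \<oplus> ph b" if "a : |L|" "b : |L|" for a b
  using assms that by (auto simp: restricted_dual_def)
 show "a : |L| ==> ph a : KC" "a : |L| ==> b : |L| ==> ph (a +L b) = ph a \<oplus> ph b" by (fact 1 2)+
 show "a ~: |L| ==> ph a = undefined" "k : KC ==> a : |L| ==> ph (k .*L a) = k \<otimes> ph a"
  using assms by (auto simp: restricted_dual_def)
 show 0: "ph 0L = \<zero>" using 2[of "0L" "0L"] 1[of "0L"] R.add.r_cancel_one'[of "ph 0L" "ph 0L"] by simp
 show "finite A ==> f : A \<rightarrow> |L| ==> ph (finsum L f A) = (\<Oplus>i\<in>A. ph (f i))"
 proof (induction A rule: finite_induct)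
  case (insert i A)
  hence "(\<Oplus>i\<in>insert i A. ph (f i)) = ph (f i) \<oplus> (\<Oplus>i\<in>A. ph (f i))" using 1 by (intro R.finsum_insert) auto
  moreover have "ph (finsum L f (insert i A)) = ph (f i) \<oplus> ph (finsum L f A)"
   using insert 2 by (subst M.finsum_insert) auto
  ultimately show ?case using insert by simp
 qed (simp add: 0)
qed

text \<open>
  The finiteness condition on a functional says that it only depends on the corner cut out by finitely
  many of the idempotents; in this form it is inherited by the bimodule operations.
\<close>

lemma RdI:
 assumes "!!a. a : |L| ==> ph a : KC" "!!a. a ~: |L| ==> ph a = undefined"
  "!!a b. a : |L| ==> b : |L| ==> ph (a +L b) = ph a \<oplus> ph b"
  "!!k a. k : KC ==> a : |L| ==> ph (k .*L a) = k \<otimes> ph a"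
  and F: "finite F" "F <= Z" and supp: "!!a. a : |L| ==> ph (unit_on F *L a) = ph a & ph (a *L unit_on F) = ph a"
 shows "ph : Rd"
proof -
 have 0: "ph 0L = \<zero>"
  using assms(3)[of "0L" "0L"] assms(1)[of "0L"] R.add.r_cancel_one'[of "ph 0L" "ph 0L"] by simp
 have "{(mu, nu). mu : Z & nu : Z & (EX a:|L|. ph (e mu *L a *L e nu) ~= \<zero>)} <= F \<times> F"
 proof clarify
  fix mu nu a assume m: "mu : Z" "nu : Z" "a : |L|" and ne: "ph (e mu *L a *L e nu) ~= \<zero>"
  show "mu : F & nu : F"
  proof (rule ccontr)
   assume n: "~ (mu : F & nu : F)"
   have "ph (e mu *L a *L e nu) = ph (unit_on F *L (e mu *L a *L e nu))" "ph (e mu *L a *L e nu) = ph ((e mu *L a *L e nu) *L unit_on F)"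
    using supp m by simp_all
   moreover have "unit_on F *L (e mu *L a *L e nu) = (unit_on F *L e mu) *L (a *L e nu)"
    "(e mu *L a *L e nu) *L unit_on F = (e mu *L a) *L (e nu *L unit_on F)"
    using m F by (simp_all add: mul_assoc)
   ultimately show False using n ne m F 0 by (auto simp: unit_on_e)
  qed
 qed
 hence "finite {(mu, nu). mu : Z & nu : Z & (EX a:|L|. ph (e mu *L a *L e nu) ~= \<zero>)}"
  by (rule finite_subset) (simp add: F)
 thus ?thesis using assms(1-4) by (auto simp: restricted_dual_def extensional_def)
qed

lemma Rd_supp:
 assumes ph: "ph : Rd"
 shows "EX F. finite F & F <= Z & (ALL F'. finite F' --> F <= F' --> F' <= Z -->
  (ALL a:|L|. ph (unit_on F' *L a) = ph a & ph (a *L unit_on F') = ph a))"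
proof -
 note P = RdD[OF ph]
 let ?A = "{(mu, nu). mu : Z & nu : Z & (EX a:|L|. ph (e mu *L a *L e nu) ~= \<zero>)}"
 let ?F = "fst ` ?A \<union> snd ` ?A"
 have A: "finite ?A" using ph by (simp add: restricted_dual_def)
 have F: "finite ?F" "?F <= Z" using A by auto
 have van: "ph (e mu *L a *L e nu) = \<zero>" if "mu : Z" "nu : Z" "mu ~: ?F \<or> nu ~: ?F" "a : |L|" for mu nu a
 proof (rule ccontr)
  assume "ph (e mu *L a *L e nu) ~= \<zero>"
  hence "(mu, nu) : ?A" using that by blast
  hence "fst (mu, nu) : fst ` ?A" "snd (mu, nu) : snd ` ?A" by (rule imageI)+
  thus False using that(3) unfolding fst_conv snd_conv by blast
 qed
 have l: "ph (e mu *L a) = \<zero>" and r: "ph (a *L e mu) = \<zero>" if mu: "mu : Z" "mu ~: ?F" and a: "a : |L|" for mu a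
 proof -
  obtain G where G: "finite G" "G <= Z" "unit_on G *L a = a" "a *L unit_on G = a"
   using complete_superset[OF a] by blast
  have "e mu *L a = (S[L, G] %nu. e mu *L a *L e nu)"
   using G a mu mul_unit_on[OF G(1,2), of "e mu *L a"] by (simp add: mul_assoc)
  hence "ph (e mu *L a) = (\<Oplus>nu\<in>G. ph (e mu *L a *L e nu))"
   using P(6)[OF G(1), of "%nu. e mu *L a *L e nu"] G(2) mu a by (auto simp: subset_iff Pi_iff)
  also have "... = \<zero>" by (rule R.add.finprod_one_eqI) (use van mu a G(2) in blast)
  finally show "ph (e mu *L a) = \<zero>" .
  have "a *L e mu = (S[L, G] %nu. e nu *L (a *L e mu))"
   using G a mu unit_on_mul[OF G(1,2), of "a *L e mu"] by (simp add: mul_assoc[symmetric])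
  hence "ph (a *L e mu) = (\<Oplus>nu\<in>G. ph (e nu *L (a *L e mu)))"
   using P(6)[OF G(1), of "%nu. e nu *L (a *L e mu)"] G(2) mu a by (auto simp: subset_iff Pi_iff)
  also have "... = \<zero>"
  proof (rule R.add.finprod_one_eqI)
   fix nu assume "nu : G"
   thus "ph (e nu *L (a *L e mu)) = \<zero>" using van[of nu mu a] mu a G(2) by (auto simp: mul_assoc)
  qed
  finally show "ph (a *L e mu) = \<zero>" .
 qed
 have "ph (unit_on F' *L a) = ph a & ph (a *L unit_on F') = ph a"
  if F': "finite F'" "?F <= F'" "F' <= Z" and a: "a : |L|" for F' a
 proof
  obtain G0 where G0: "finite G0" "G0 <= Z" "ALL F'. finite F' --> G0 <= F' --> F' <= Z --> unit_on F' *L a = a & a *L unit_on F' = a"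
   using complete_superset[OF a] by blast
  let ?G = "G0 \<union> F'"
  have G: "finite ?G" "?G <= Z" "F' <= ?G" and Ga: "unit_on ?G *L a = a" "a *L unit_on ?G = a" using G0 F' by auto
  have "ph a = (\<Oplus>nu\<in>?G. ph (e nu *L a))"
   using P(6)[OF G(1), of "%nu. e nu *L a"] G(2) a Ga unit_on_mul[OF G(1,2) a] by (auto simp: subset_iff Pi_iff)
  also have "... = (\<Oplus>nu\<in>F'. ph (e nu *L a))"
  proof (rule R.add.finprod_mono_neutral_cong_right[OF G(1,3)])
   show "ph (e nu *L a) = \<zero>" if "nu : ?G - F'" for nu using l[of nu a] a G(2) F'(2) that by blast
   show "(%nu. ph (e nu *L a)) : ?G \<rightarrow> KC" using P(1) a G(2) by (auto simp: subset_iff)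
  qed simp
  also have "... = ph (unit_on F' *L a)"
   using P(6)[OF F'(1), of "%nu. e nu *L a"] F'(3) a unit_on_mul[OF F'(1,3) a] by (auto simp: subset_iff Pi_iff)
  finally show "ph (unit_on F' *L a) = ph a" by simp
  have "ph a = (\<Oplus>nu\<in>?G. ph (a *L e nu))"
   using P(6)[OF G(1), of "%nu. a *L e nu"] G(2) a Ga mul_unit_on[OF G(1,2) a] by (auto simp: subset_iff Pi_iff)
  also have "... = (\<Oplus>nu\<in>F'. ph (a *L e nu))"
  proof (rule R.add.finprod_mono_neutral_cong_right[OF G(1,3)])
   show "ph (a *L e nu) = \<zero>" if "nu : ?G - F'" for nu using r[of nu a] a G(2) F'(2) that by blast
   show "(%nu. ph (a *L e nu)) : ?G \<rightarrow> KC" using P(1) a G(2) by (auto simp: subset_iff)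
  qed simp
  also have "... = ph (a *L unit_on F')"
   using P(6)[OF F'(1), of "%nu. a *L e nu"] F'(3) a mul_unit_on[OF F'(1,3) a] by (auto simp: subset_iff Pi_iff)
  finally show "ph (a *L unit_on F') = ph a" by simp
 qed
 hence "ALL F'. finite F' --> ?F <= F' --> F' <= Z -->
  (ALL a:|L|. ph (unit_on F' *L a) = ph a & ph (a *L unit_on F') = ph a)" by (intro allI impI ballI)
 with F show ?thesis by (intro exI conjI)
qed

lemma Rd_add: assumes "ph : Rd" "ps : Rd" shows "(\<lambda>c\<in>|L|. ph c \<oplus> ps c) : Rd"
proof -
 note P = RdD[OF assms(1)] and Q = RdD[OF assms(2)]
 obtain F where F: "finite F" "F <= Z" "ALL F'. finite F' --> F <= F' --> F' <= Z -->
  (ALL a:|L|. ph (unit_on F' *L a) = ph a & ph (a *L unit_on F') = ph a)" using Rd_supp[OF assms(1)] by blast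
 obtain G where G: "finite G" "G <= Z" "ALL F'. finite F' --> G <= F' --> F' <= Z -->
  (ALL a:|L|. ps (unit_on F' *L a) = ps a & ps (a *L unit_on F') = ps a)" using Rd_supp[OF assms(2)] by blast
 show ?thesis
  using F G by (intro RdI[of _ "F \<union> G"]) (auto simp: P(1,3,4) Q(1,3,4) R.a_ac R.r_distr)
qed

lemma Rd_smult: assumes "k : KC" "ph : Rd" shows "(\<lambda>c\<in>|L|. k \<otimes> ph c) : Rd"
proof -
 note P = RdD[OF assms(2)]
 obtain F where F: "finite F" "F <= Z" "ALL F'. finite F' --> F <= F' --> F' <= Z -->
  (ALL a:|L|. ph (unit_on F' *L a) = ph a & ph (a *L unit_on F') = ph a)" using Rd_supp[OF assms(2)] by blast
 show ?thesis
  using F assms(1) by (intro RdI[of _ "F"]) (auto simp: P(1,3,4) R.m_lcomm R.r_distr)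
qed

lemma Rd_zero: "(\<lambda>c\<in>|L|. \<zero>) : Rd"
 by (rule RdI[of _ "{}"]) auto

lemma Rd_mul: assumes "ph : Rd" "ps : Rd" "a : |L|" "b : |L|"
 shows "(\<lambda>c\<in>|L|. ps (c *L a) \<oplus> ph (b *L c)) : Rd"
proof -
 note P = RdD[OF assms(1)] and Q = RdD[OF assms(2)]
 have l: "(\<lambda>c\<in>|L|. ps (c *L a)) : Rd"
 proof -
  obtain F where F: "finite F" "F <= Z" "ALL F'. finite F' --> F <= F' --> F' <= Z -->
   (ALL a:|L|. ps (unit_on F' *L a) = ps a & ps (a *L unit_on F') = ps a)" using Rd_supp[OF assms(2)] by blast
  obtain G where G: "finite G" "G <= Z" "ALL F'. finite F' --> G <= F' --> F' <= Z --> unit_on F' *L a = a & a *L unit_on F' = a"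
   using complete_superset[OF assms(3)] by blast
  show ?thesis using F G assms(3)
   by (intro RdI[of _ "F \<union> G"]) (auto simp: Q(1,3,4) mul_distl mul_smult_l mul_assoc)
 qed
 have r: "(\<lambda>c\<in>|L|. ph (b *L c)) : Rd"
 proof -
  obtain F where F: "finite F" "F <= Z" "ALL F'. finite F' --> F <= F' --> F' <= Z -->
   (ALL a:|L|. ph (unit_on F' *L a) = ph a & ph (a *L unit_on F') = ph a)" using Rd_supp[OF assms(1)] by blast
  obtain G where G: "finite G" "G <= Z" "ALL F'. finite F' --> G <= F' --> F' <= Z --> unit_on F' *L b = b & b *L unit_on F' = b"
   using complete_superset[OF assms(4)] by blast
  show ?thesis using F G assms(4)
   by (intro RdI[of _ "F \<union> G"]) (auto simp: P(1,3,4) mul_distr mul_smult_r mul_assoc[symmetric])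
 qed
 have "(\<lambda>c\<in>|L|. (\<lambda>c\<in>|L|. ps (c *L a)) c \<oplus> (\<lambda>c\<in>|L|. ph (b *L c)) c) : Rd" by (rule Rd_add[OF l r])
 moreover have "(\<lambda>c\<in>|L|. (\<lambda>c\<in>|L|. ps (c *L a)) c \<oplus> (\<lambda>c\<in>|L|. ph (b *L c)) c) = (\<lambda>c\<in>|L|. ps (c *L a) \<oplus> ph (b *L c))"
  by (intro restrict_ext) simp
 ultimately show ?thesis by simp
qed

lemma D_sel:
 "|D| = |L| \<times> Rd"
 "(a, ph) *D (b, ps) = (a *L b, \<lambda>c\<in>|L|. ps (c *L a) \<oplus> ph (b *L c))"
 "(a, ph) +D (b, ps) = (a +L b, \<lambda>c\<in>|L|. ph c \<oplus> ps c)"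
 "0D = (0L, \<lambda>c\<in>|L|. \<zero>)" "k .*D (a, ph) = (k .*L a, \<lambda>c\<in>|L|. k \<otimes> ph c)"
 by (simp_all add: trivial_extension_def)

theorem nalg_D: "nalg K D"
proof -
 have ext: "(\<lambda>c\<in>|L|. f c) = g <-> (ALL c:|L|. f c = g c)" if "ALL c. c ~: |L| --> g c = undefined" for f g :: "'l => 'k"
  using that by (auto simp: fun_eq_iff restrict_def)
 note cl = Rd_add Rd_smult Rd_zero Rd_mul
 note sel = D_sel restrict_apply' RdD(1) RdD(2) RdD(3) RdD(4)
 have "abelian_group D"
 proof (rule abelian_groupI)
  fix x assume "x : |D|"
  then obtain a ph where x: "x = (a, ph)" "a : |L|" "ph : Rd" by (auto simp: D_sel)
  hence "(\<ominus>\<^bsub>L\<^esub> a, \<lambda>c\<in>|L|. \<ominus> \<one> \<otimes> ph c) +D x = 0D"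
   using RdD[OF x(3)] by (simp add: D_sel M.l_neg R.l_minus R.l_neg restrict_def fun_eq_iff)
  moreover have "(\<ominus>\<^bsub>L\<^esub> a, \<lambda>c\<in>|L|. \<ominus> \<one> \<otimes> ph c) : |D|" using x Rd_smult[of "\<ominus> \<one>" ph] by (simp add: D_sel)
  ultimately show "EX y:|D|. y +D x = 0D" by blast
 next
  fix x y z assume "x : |D|" "y : |D|" "z : |D|"
  thus "x +D y +D z = x +D (y +D z)"
   by (auto simp: D_sel RdD(1) M.a_assoc R.a_assoc restrict_def fun_eq_iff)
 next
  fix x y assume "x : |D|" "y : |D|"
  thus "x +D y : |D|" "x +D y = y +D x"
   by (auto simp: D_sel RdD(1) M.a_comm R.a_comm restrict_def fun_eq_iff intro!: Rd_add[unfolded restrict_def])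
 next
  fix x assume "x : |D|"
  thus "0D +D x = x"
   by (auto simp: D_sel RdD(1,2) restrict_def fun_eq_iff)
 qed (simp add: D_sel Rd_zero)
 thus ?thesis
 proof (intro nalg.intro module.intro module_axioms.intro nalg_axioms.intro R.is_cring field_axioms)
  fix x assume "x : |D|"
  thus "\<one> .*D x = x" by (auto simp: D_sel RdD(1,2) restrict_def fun_eq_iff)
 next
  fix k x assume "k : KC" "x : |D|"
  thus "k .*D x : |D|" by (auto simp: D_sel intro!: Rd_smult)
 next
  fix k l x assume "k : KC" "l : KC" "x : |D|"
  thus "(k \<oplus> l) .*D x = k .*D x +D l .*D x" "(k \<otimes> l) .*D x = k .*D (l .*D x)"
   by (auto simp: D_sel RdD(1) restrict_def fun_eq_iff smult_l_distr smult_assoc1 R.l_distr R.m_assoc)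
 next
  fix k x y assume k: "k : KC" and "x : |D|" "y : |D|"
  then obtain a ph b ps where x: "x = (a, ph)" "a : |L|" "ph : Rd" "y = (b, ps)" "b : |L|" "ps : Rd" by (auto simp: D_sel)
  show "k .*D (x +D y) = k .*D x +D k .*D y"
   using x k RdD(1)[OF x(3)] RdD(1)[OF x(6)] by (auto simp: D_sel restrict_def fun_eq_iff smult_r_distr R.r_distr)
  show "(k .*D x) *D y = k .*D (x *D y)" "x *D (k .*D y) = k .*D (x *D y)"
   using x k RdD(1,4)[OF x(3)] RdD(1,4)[OF x(6)]
   by (auto simp: D_sel restrict_def fun_eq_iff mul_smult_l mul_smult_r R.r_distr)
 next
  fix x y assume "x : |D|" "y : |D|"
  thus "x *D y : |D|" by (auto simp: D_sel intro!: Rd_mul)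
 next
  fix x y z assume "x : |D|" "y : |D|" "z : |D|"
  then obtain a ph b ps c \<chi> where x: "x = (a, ph)" "a : |L|" "ph : Rd" "y = (b, ps)" "b : |L|" "ps : Rd"
   "z = (c, \<chi>)" "c : |L|" "\<chi> : Rd" by (auto simp: D_sel)
  note P = RdD(1,3)[OF x(3)] RdD(1,3)[OF x(6)] RdD(1,3)[OF x(9)]
  show "(x *D y) *D z = x *D (y *D z)"
   using x P by (auto simp: D_sel restrict_def fun_eq_iff mul_assoc R.a_ac)
  show "(x +D y) *D z = x *D z +D y *D z"
   using x P by (auto simp: D_sel restrict_def fun_eq_iff mul_distl mul_distr R.a_ac)
  show "x *D (y +D z) = x *D y +D x *D z"
   using x P by (auto simp: D_sel restrict_def fun_eq_iff mul_distl mul_distr R.a_ac)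
 qed
qed

sublocale D: nalg K "trivial_extension K L Z e"
 by (rule nalg_D)

abbreviation "emb \<equiv> ext_embed K L"

lemma emb_closed [simp, intro]: "a : |L| ==> emb a : |D|"
 by (simp add: ext_embed_def D_sel Rd_zero)

lemma emb_hom:
 "emb 0L = 0D" "a : |L| ==> b : |L| ==> emb a +D emb b = emb (a +L b)"
 "a : |L| ==> b : |L| ==> emb a *D emb b = emb (a *L b)"
 "k : KC ==> a : |L| ==> k .*D emb a = emb (k .*L a)"
 "emb a = emb b <-> a = b"
 by (auto simp: ext_embed_def D_sel restrict_def fun_eq_iff)

lemma emb_mul: "a : |L| ==> ph : Rd ==> b : |L| ==>
  emb b *D (a, ph) = (b *L a, \<lambda>c\<in>|L|. ph (c *L b))"
 "a : |L| ==> ph : Rd ==> b : |L| ==>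
  (a, ph) *D emb b = (a *L b, \<lambda>c\<in>|L|. ph (b *L c))"
 using RdD(1)[of ph] by (auto simp: ext_embed_def D_sel restrict_def fun_eq_iff)

lemma emb_finsum: "finite F ==> f : F \<rightarrow> |L| ==> (S[D, F] %i. emb (f i)) = emb (finsum L f F)"
proof (induction F rule: finite_induct)
 case (insert i F)
 hence "(S[D, insert i F] %i. emb (f i)) = emb (f i) +D (S[D, F] %i. emb (f i))" by (intro D.M.finsum_insert) auto
 thus ?case using insert by (simp add: emb_hom(2) Pi_iff M.finsum_insert)
qed (simp add: emb_hom)

text \<open>The dual bimodule squares to zero, so in \<open>(a, ph) ^ n\<close> at most one factor is a functional, and for large
\<open>n\<close> a long power of \<open>a\<close> stands on one of its sides.\<close>

lemma nilp_pair:
 assumes a: "a : |L|" "nilp L a" and ph: "ph : Rd"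
 shows "nilp D (a, ph)"
proof -
 let ?x = "(a, ph)"
 have xc: "?x : |D|" using a ph by (simp add: D_sel)
 have fst: "fst (npow D ?x n) = npow L a n" for n
 proof (induction n)
  case (Suc n)
  thus ?case by (cases "npow D ?x n") (simp add: D_sel)
 qed simp
 have split: "npow D ?x (Suc (m + n)) = npow D ?x m *D npow D ?x n" for m n
  by (induction n) (use xc in \<open>simp_all add: D.mul_assoc\<close>)
 obtain m where m: "npow L a m = 0L" using a by (auto simp: nilp_def)
 obtain b ps where n: "npow D ?x m = (b, ps)" by (cases "npow D ?x m")
 have b: "b = 0L" using fst[of m] m n by simp
 have "(b, ps) : |D|" using D.npow_closed[OF xc, of m] n by simp
 hence ps: "ps : Rd" by (simp add: D_sel)
 have "npow D ?x (Suc (m + m)) = 0D"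
  unfolding split n b using RdD(5)[OF ps] by (simp add: D_sel restrict_def fun_eq_iff)
 thus ?thesis unfolding nilp_def by blast
qed

theorem trivial_extension_family: "idempotent_family K D Z (emb \<circ> e)"
proof (intro idempotent_family.intro idempotent_family_axioms.intro nalg_D)
 fix nu assume nu: "nu : Z"
 show "(emb \<circ> e) nu : |D|" using nu by simp
 show "(emb \<circ> e) nu *D (emb \<circ> e) nu = (emb \<circ> e) nu" using nu by (simp add: emb_hom)
 show "(emb \<circ> e) nu ~= 0D" using nu e_nonzero[OF nu] by (simp add: emb_hom(1)[symmetric] emb_hom(5))
 fix x assume x: "x : |D|" "(emb \<circ> e) nu *D x = x" "x *D (emb \<circ> e) nu = x"
 then obtain a ph where a: "x = (a, ph)" "a : |L|" "ph : Rd" by (auto simp: D_sel)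
 hence "e nu *L a = a" "a *L e nu = a" using x nu by (simp_all add: emb_mul)
 then obtain k n where k: "k : KC" "n : |L|" "nilp L n" "a = k .*L e nu +L n" using corner[OF nu a(2)] by blast
 have "x = k .*D (emb \<circ> e) nu +D (n, ph)"
  using k a nu RdD(1,2)[OF a(3)] by (auto simp: ext_embed_def D_sel restrict_def fun_eq_iff)
 thus "EX k:KC. EX n:|D|. nilp D n & x = k .*D (emb \<circ> e) nu +D n"
  using k(1) nilp_pair[OF k(2,3) a(3)] k(2) a(3) by (intro bexI[of _ k] bexI[of _ "(n, ph)"]) (auto simp: D_sel)
next
 fix nu mu assume nu: "nu : Z" "mu : Z" "nu ~= mu"
 show "(emb \<circ> e) nu *D (emb \<circ> e) mu = 0D" using nu e_orth[OF nu] by (simp add: emb_hom)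
 fix x y assume x: "x : |D|" "(emb \<circ> e) nu *D x = x" "x *D (emb \<circ> e) mu = x"
  and y: "y : |D|" "(emb \<circ> e) mu *D y = y" "y *D (emb \<circ> e) nu = y"
 obtain a ph where a: "x = (a, ph)" "a : |L|" "ph : Rd" using x(1) by (auto simp: D_sel)
 obtain b ps where b: "y = (b, ps)" "b : |L|" "ps : Rd" using y(1) by (auto simp: D_sel)
 have "nilp L (a *L b)" using a b x y nu by (intro off_corner[of nu mu]) (simp_all add: emb_mul)
 thus "nilp D (x *D y)" unfolding a(1) b(1) D_sel(2) using a b by (intro nilp_pair Rd_mul) auto
next
 fix x assume "x : |D|"
 then obtain a ph where a: "x = (a, ph)" "a : |L|" "ph : Rd" by (auto simp: D_sel)
 obtain F where F: "finite F" "F <= Z" "ALL F'. finite F' --> F <= F' --> F' <= Z -->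
  (ALL a:|L|. ph (unit_on F' *L a) = ph a & ph (a *L unit_on F') = ph a)" using Rd_supp[OF a(3)] by blast
 obtain G where G: "finite G" "G <= Z" "ALL F'. finite F' --> G <= F' --> F' <= Z --> unit_on F' *L a = a & a *L unit_on F' = a"
  using complete_superset[OF a(2)] by blast
 let ?H = "F \<union> G"
 have H: "finite ?H" "?H <= Z" using F G by auto
 have "(S[D, ?H] %nu. (emb \<circ> e) nu) = emb (unit_on ?H)"
  unfolding unit_on_def comp_def using H by (intro emb_finsum) (auto simp: subset_iff)
 moreover have "emb (unit_on ?H) *D x = x" "x *D emb (unit_on ?H) = x"
  using a F G H RdD(2)[OF a(3)] by (auto simp: emb_mul restrict_def fun_eq_iff)
 ultimately show "EX F. finite F & F <= Z & (S[D, F] %nu. (emb \<circ> e) nu) *D x = x & x *D (S[D, F] %nu. (emb \<circ> e) nu) = x"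
  using H by (intro exI[of _ ?H]) simp
qed

lemma emb_subalgebra:
 assumes T: "subalgebra K L T"
 shows "subalgebra K D (emb ` T)"
 unfolding subalgebra_def
proof (intro conjI ballI)
 note TD = subalgebraD[OF T]
 show "submodule (emb ` T) K D"
 proof (rule D.subspaceI)
  show "emb ` T <= |D|" using TD(1) by blast
  show "0D : emb ` T" using TD(2) emb_hom(1) by (metis imageI)
 qed (use TD in \<open>auto simp: emb_hom\<close>)
qed (use subalgebraD[OF T] in \<open>auto simp: emb_hom\<close>)

end

section \<open>The trivial extension of the matrix algebra\<close>

context idempotent_family begin

lemma Rd_finsum:
 "finite A ==> f : A \<rightarrow> Rd ==> (\<lambda>M\<in>|L|. \<Oplus>i\<in>A. f i M) : Rd \<and>
   (S[D, A] %i. (0L, f i)) = (0L, \<lambda>M\<in>|L|. \<Oplus>i\<in>A. f i M)"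
proof (induction A rule: finite_induct)
 case empty
 have "(\<lambda>M\<in>|L|. \<Oplus>i\<in>{}. f i M) = (\<lambda>M\<in>|L|. \<zero>)" by (intro restrict_ext) simp
 thus ?case using Rd_zero by (simp only: D.M.finsum_empty D_sel(4) simp_thms)
next
 case (insert i A)
 let ?s = "\<lambda>M\<in>|L|. \<Oplus>i\<in>A. f i M"
 have fi: "f i : Rd" and fA: "!!j. j : A ==> f j : Rd" using insert by auto
 hence "f : A \<rightarrow> Rd" by blast
 from insert.IH[OF this] have IH: "?s : Rd" "(S[D, A] %i. (0L, f i)) = (0L, ?s)" by blast+
 have s: "(\<Oplus>j\<in>insert i A. f j M) = f i M \<oplus> (\<Oplus>j\<in>A. f j M)" if M: "M : |L|" for M
  using insert.hyps RdD(1)[OF fi M] RdD(1)[OF fA M] by (intro R.finsum_insert) auto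
 have eq: "(\<lambda>M\<in>|L|. \<Oplus>j\<in>insert i A. f j M) = (\<lambda>M\<in>|L|. f i M \<oplus> ?s M)"
  by (intro restrict_ext) (simp add: s)
 have "(S[D, insert i A] %j. (0L, f j)) = (0L, f i) +D (S[D, A] %j. (0L, f j))"
  using insert.hyps fi fA by (intro D.M.finsum_insert) (auto simp: D_sel(1))
 hence "(S[D, insert i A] %j. (0L, f j)) = (0L, \<lambda>M\<in>|L|. f i M \<oplus> ?s M)"
  by (simp only: IH(2) D_sel(3) M.l_zero M.zero_closed)
 thus ?case using Rd_add[OF fi IH(1)] by (simp only: eq simp_thms)
qed

end

sublocale split_filtered \<subseteq> F: idempotent_family K "matrix_algebra E I N" "V \<times> (UNIV :: int set)" "diagonal_entry E I N e"
 by (rule eC_family)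

context adapted begin

abbreviation "DC \<equiv> trivial_extension K C ZZ eC"

text \<open>Coordinates of a matrix entry; they are well defined only near enough to the diagonal.\<close>

definition cf :: "'t => int => int => (int => int => 'a set) => 'k" where
 "cf t r c = (\<lambda>Y\<in>|C|. kp t (ent Y r c))"

lemma cf_mk: "t : T ==> z : Mat ==> c + int (dg t) < r + int N ==> cf t r c (mk z) = kp t (z r c)"
 by (simp add: cf_def mk_carrier kp_ent)

lemma cf_sgl: "t : T ==> y : num r' c' ==> c + int (dg t) < r + int N ==>
  cf t r c (sgl r' c' y) = (if r = r' & c = c' then kp t y else \<zero>)"
 unfolding sgl_def by (simp add: cf_mk single_Mat) (simp add: single_def)

lemma cf_Rd:
 assumes t: "t : T" and rc: "c + int (dg t) < r + int N"
 shows "cf t r c : F.Rd"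
proof -
 have cl: "cf t r c Y : KC" if Y: "Y : |C|" for Y
  using t ent_mk[OF Y] Y by (simp add: cf_def kp_K)
 moreover have "cf t r c (Y +C Z) = cf t r c Y \<oplus> cf t r c Z" if Y: "Y : |C|" "Z : |C|" for Y Z
 proof -
  obtain y z where yz: "y : Mat" "Y = mk y" "z : Mat" "Z = mk z" using mk_surj Y by blast
  show ?thesis
   unfolding yz(2,4) mk_add[OF yz(1,3)] cf_mk[OF t Mat_add[OF yz(1,3)] rc] cf_mk[OF t yz(1) rc] cf_mk[OF t yz(3) rc]
   using t yz by (simp add: kp_add)
 qed
 moreover have "cf t r c (k .*C Y) = k \<otimes> cf t r c Y" if k: "k : KC" and Y: "Y : |C|" for k Y
 proof -
  obtain y where y: "y : Mat" "Y = mk y" using mk_surj Y by blast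
  show ?thesis
   unfolding y(2) mk_smult[OF k y(1)] cf_mk[OF t Mat_smult[OF k y(1)] rc] cf_mk[OF t y(1) rc]
   using t y k by (simp add: kp_smult)
 qed
 moreover have pos: "i = r & j = c" if v: "v : V" "w : V" and Y: "Y : |C|"
  and ne: "cf t r c (eC (v, i) *C Y *C eC (w, j)) ~= \<zero>" for v i w j Y
 proof -
  obtain y where y: "y : Mat" "Y = mk y" using mk_surj Y by blast
  have "eC (v, i) *C Y *C eC (w, j) = eC (v, i) *C (Y *C eC (w, j))"
   using Y v eC_closed by (intro C.mul_assoc) auto
  also have "... = sgl i j (e v *E (y i j *E e w))" unfolding y(2) eC_sgl using y v by (intro sgl_mk_sgl) (auto simp: num_diag)
  finally have eq: "eC (v, i) *C Y *C eC (w, j) = sgl i j (e v *E (y i j *E e w))" .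
  have "y i j *E e w : num i j" by (rule num_mul_num[OF Mat_num[OF y(1)]]) (use v in \<open>simp add: num_diag\<close>)
  hence n: "e v *E (y i j *E e w) : num i j" using num_mul_num[of "e v" i i] v by (simp add: num_diag)
  show ?thesis using ne unfolding eq cf_sgl[OF t n rc] by (auto split: if_splits)
 qed
 moreover have "{(mu, nu). mu : ZZ & nu : ZZ & (EX a:|C|. cf t r c (eC mu *C a *C eC nu) ~= \<zero>)} <= (V \<times> {r}) \<times> (V \<times> {c})"
  by clarsimp (use pos in blast)
 hence "finite {(mu, nu). mu : ZZ & nu : ZZ & (EX a:|C|. cf t r c (eC mu *C a *C eC nu) ~= \<zero>)}"
  by (rule finite_subset) (simp add: V_fin)
 ultimately show ?thesis unfolding restricted_dual_def by (auto simp: cf_def)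
qed

text \<open>The last column in which the coordinate \<open>kp t\<close> of row \<open>r\<close> is well defined: one further,
elements of degree \<open>dg t\<close> become zero.\<close>

definition cR :: "'t => int => int" where "cR t r = r - int (dg t) + int N - 1"

abbreviation "winR t r \<equiv> {r - int (dg t)..cR t r}"

text \<open>The values of a functional on the elements \<open>x t\<close> of row \<open>r\<close>, recorded by the band elements
that move the column \<open>cR t r\<close> to the columns of these elements.\<close>

definition btR :: "'t \<times> int => ((int => int => 'a set) => 'k) => int => int => 'a set" where
 "btR = (%(t, r) ph. S[C, winR t r] %c. ph (sgl r c (x t)) .*C bC (rv t) c (cR t r))"

definition gR :: "'t \<times> int => (int => int => 'a set) => 'k" where
 "gR = (%(t, r). cf t r (cR t r))"

lemma gR_Rd: "p : T \<times> UNIV ==> gR p : F.Rd"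
 by (auto simp: gR_def cR_def intro!: cf_Rd)

lemma x_closed [simp, intro]: "t : T ==> x t : |E|"
 using x_I ID(1) by blast

lemma x_num: "t : T ==> r - int (dg t) <= c ==> x t : num r c"
 using x_I[of t] I_mono[of "nat (r - c)" "dg t"] by (auto simp: num_eq nat_le_iff)

lemma x_den: "t : T ==> cR t r < c ==> x t : den r c"
 using x_I[of t] I_mono[of "nat (int N - max 0 (c - r))" "dg t"] dg[of t] by (auto simp: den_eq cR_def nat_le_iff)

lemma x_ev: "t : T ==> v : V ==> x t *E e v = (if v = rv t then x t else 0E)"
proof -
 assume t: "t : T" and v: "v : V"
 have "x t *E e v = (x t *E e (rv t)) *E e v" using x_rv[OF t] by simp
 also have "... = x t *E (e (rv t) *E e v)" using t v rv by (intro mul_assoc) auto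
 finally show ?thesis using t v rv[OF t] ev_orth[of "rv t" v] x_rv[OF t] by auto
qed

lemma ph_x: "ph : F.Rd ==> t : T ==> c : winR t r ==> ph (sgl r c (x t)) : KC"
 by (intro F.RdD(1) sgl_closed x_num) auto

lemma btR_Band: "ph : F.Rd ==> t : T ==> btR (t, r) ph : Band"
 unfolding btR_def prod.case using ph_x[of ph t] rv bC_Band
 by (intro C.finsum_subalgebra(2)[OF Band_sub]) (auto intro!: C.subalgebraD(5)[OF Band_sub])

lemma btR_closed: "ph : F.Rd ==> t : T ==> btR (t, r) ph : |C|"
 using btR_Band C.subalgebraD(1)[OF Band_sub] by blast

lemma btR_add:
 assumes ph: "ph : F.Rd" "ps : F.Rd" and t: "t : T"
 shows "btR (t, r) (\<lambda>M\<in>|C|. ph M \<oplus> ps M) = btR (t, r) ph +C btR (t, r) ps"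
proof -
 note k = ph_x[OF ph(1) t, of _ r] ph_x[OF ph(2) t, of _ r]
 have "btR (t, r) (\<lambda>M\<in>|C|. ph M \<oplus> ps M) = (S[C, winR t r] %c. ph (sgl r c (x t)) .*C bC (rv t) c (cR t r)
   +C ps (sgl r c (x t)) .*C bC (rv t) c (cR t r))"
  unfolding btR_def prod.case using k t rv x_num[OF t]
  by (intro C.M.finsum_cong') (auto simp: C.smult_l_distr)
 thus ?thesis unfolding btR_def prod.case using k t rv by (subst C.M.finsum_addf[symmetric]) auto
qed

lemma btR_smult:
 assumes ph: "ph : F.Rd" and t: "t : T" and k: "k : KC"
 shows "btR (t, r) (\<lambda>M\<in>|C|. k \<otimes> ph M) = k .*C btR (t, r) ph"
proof -
 note kk = ph_x[OF ph(1) t, of _ r]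
 have "btR (t, r) (\<lambda>M\<in>|C|. k \<otimes> ph M) = (S[C, winR t r] %c. k .*C (ph (sgl r c (x t)) .*C bC (rv t) c (cR t r)))"
  unfolding btR_def prod.case using k kk t rv x_num[OF t]
  by (intro C.M.finsum_cong') (auto simp: C.smult_assoc1)
 thus ?thesis unfolding btR_def prod.case using k kk t rv by (subst C.finsum_smult) auto
qed

lemma btR_mul:
 assumes ph: "ph : F.Rd" and t: "t : T" and v: "v : V"
 shows "btR (t, r) (\<lambda>M\<in>|C|. ph (M *C bC v i j)) = bC v i j *C btR (t, r) ph"
proof -
 let ?c = "cR t r" and ?ph = "\<lambda>M\<in>|C|. ph (M *C bC v i j)"
 note kk = ph_x[OF ph(1) t, of _ r] and rvt = rv[OF t]
 have sc: "sgl r c (x t) : |C|" if "r - int (dg t) <= c" for c using x_num[OF t that] by auto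
 have R: "bC v i j *C btR (t, r) ph = (S[C, winR t r] %c. ph (sgl r c (x t)) .*C (bC v i j *C bC (rv t) c ?c))"
  unfolding btR_def prod.case using v kk rvt
  by (subst C.finsum_mul_r) (auto simp: C.mul_smult_r intro!: C.M.finsum_cong')
 have L: "btR (t, r) ?ph = (S[C, winR t r] %c. ph (sgl r c (x t) *C bC v i j) .*C bC (rv t) c ?c)"
  unfolding btR_def prod.case using v rvt sc F.RdD(1)[OF ph] by (intro C.M.finsum_cong') auto
 show ?thesis
 proof (cases "i <= j & j < i + int N")
  case False
  hence b0: "bC v i j = 0C" by (auto simp: bC_def)
  have "btR (t, r) ?ph = 0C"
   unfolding L using b0 sc F.RdD(5)[OF ph] rvt by (intro C.M.add.finprod_one_eqI) auto
  thus ?thesis using b0 btR_closed[OF ph t] by simp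
 next
  case ij: True
  have prod: "sgl r c (x t) *C bC v i j = (if c = i & v = rv t then sgl r j (x t) else 0C)" if "c : winR t r" for c
   using that ij v x_num[OF t, of r c] ev_num[OF v, of i j] by (auto simp: bC_sgl sgl_mul x_ev[OF t])
  have win: "bC v k ?c = 0C" if "k ~: winR t r" for k using that by (auto simp: bC_def cR_def)
  show ?thesis
  proof (cases "r - int (dg t) <= j")
   case j: True
   have k: "ph (sgl r j (x t)) : KC" using F.RdD(1)[OF ph sc[OF j]] .
   let ?w = "if v = rv t then ph (sgl r j (x t)) .*C bC v i ?c else 0C"
   have w: "?w : |C|" using k v by auto
   have wi: "?w = 0C" if "i ~: winR t r" using win[OF that] k by auto
   have wj: "?w = 0C" if "j ~: winR t r"
   proof -
    have "sgl r j (x t) = 0C" using that j x_den[OF t, of r j] sgl_zero_iff[OF x_num[OF t j]] by auto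
    thus ?thesis using F.RdD(5)[OF ph] v by auto
   qed
   have "btR (t, r) ?ph = ?w"
    unfolding L using w wi prod F.RdD(5)[OF ph] rvt v by (intro C.M.finsum_single[of _ _ i]) auto
   also have "?w = bC v i j *C btR (t, r) ph"
    unfolding R using w wj kk rvt v ij by (intro C.M.finsum_single[of _ _ j, symmetric]) (auto simp: bC_mul)
   finally show ?thesis .
  next
   case False
   have "btR (t, r) ?ph = 0C"
    unfolding L using False ij prod F.RdD(5)[OF ph] rvt by (intro C.M.add.finprod_one_eqI) auto
   moreover have "bC v i j *C btR (t, r) ph = 0C"
    unfolding R using False ij kk rvt v by (intro C.M.add.finprod_one_eqI) (auto simp: bC_mul)
   ultimately show ?thesis by simp
  qed
 qed
qed

lemma gR_btR_sgl:
 assumes ph: "ph : F.Rd" and t: "t : T" and y: "y : num r c"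
 shows "gR (t, r') (sgl r c y *C btR (t, r') ph) = (if r = r' then ph (sgl r c (kp t y .*E x t)) else \<zero>)"
proof -
 let ?c = "cR t r'"
 note kk = ph_x[OF ph(1) t, of _ r'] and rvt = rv[OF t] and yc = num_closed[OF y]
 have ky: "kp t y : KC" using kp_K[OF t yc] .
 have gR: "gR (t, r') : F.Rd" by (rule gR_Rd) (simp add: t)
 have yn: "y *E e (rv t) : num r c'" if "c <= c'" for c'
  using num_mul_num[OF y ev_num[OF rvt that]] .
 have prod: "sgl r c y *C bC (rv t) c' ?c = (if c = c' then sgl r ?c (y *E e (rv t)) else 0C)" if "c' : winR t r'" for c'
  using that y rvt ev_num[OF rvt, of c' ?c] by (simp add: bC_sgl sgl_mul)
 have pc: "sgl r c y *C bC (rv t) c' ?c : |C|" for c' using y rvt by auto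
 have gv: "gR (t, r') (sgl r c y *C bC (rv t) c' ?c) = (if c = c' & r = r' then kp t y else \<zero>)" if "c' : winR t r'" for c'
  using that F.RdD(5)[OF gR] prod[OF that] cf_sgl[OF t yn, of "?c" ?c r'] kp_r[OF t rvt yc]
  by (auto simp: gR_def cR_def)
 have kx: "kp t y .*E x t : num r c" using coordinate_sgl(1)[OF t y] .
 have kpc: "ph (sgl r' c' (x t)) .*C (sgl r c y *C bC (rv t) c' ?c) : |C|" if "c' : winR t r'" for c'
  using C.smult_closed[OF kk[OF that] pc] .
 have "sgl r c y *C btR (t, r') ph = (S[C, winR t r'] %c'. ph (sgl r' c' (x t)) .*C (sgl r c y *C bC (rv t) c' ?c))"
  unfolding btR_def prod.case using y kk rvt
  by (subst C.finsum_mul_r) (auto simp: C.mul_smult_r intro!: C.M.finsum_cong')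
 hence "gR (t, r') (sgl r c y *C btR (t, r') ph)
   = gR (t, r') (S[C, winR t r'] %c'. ph (sgl r' c' (x t)) .*C (sgl r c y *C bC (rv t) c' ?c))" by simp
 also have "... = (\<Oplus>c'\<in>winR t r'. gR (t, r') (ph (sgl r' c' (x t)) .*C (sgl r c y *C bC (rv t) c' ?c)))"
  by (rule F.RdD(6)[OF gR]) (use kpc in blast)+
 also have "... = (\<Oplus>c'\<in>winR t r'. ph (sgl r' c' (x t)) \<otimes> (if c = c' & r = r' then kp t y else \<zero>))"
 proof (rule R.finsum_cong'[OF refl])
  fix c' assume c': "c' : winR t r'"
  show "gR (t, r') (ph (sgl r' c' (x t)) .*C (sgl r c y *C bC (rv t) c' ?c)) = ph (sgl r' c' (x t)) \<otimes> (if c = c' & r = r' then kp t y else \<zero>)"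
   unfolding F.RdD(4)[OF gR kk[OF c'] pc] gv[OF c'] ..
 qed (use kk ky in auto)
 also have "... = (if r = r' then ph (sgl r c (kp t y .*E x t)) else \<zero>)"
 proof (rule R.finsum_single[of _ _ c])
  show "(if r = r' then ph (sgl r c (kp t y .*E x t)) else \<zero>) : KC" using F.RdD(1)[OF ph sgl_closed[OF kx]] by auto
  {
   assume c: "c : winR t r'"
   show "ph (sgl r' c (x t)) \<otimes> (if c = c & r = r' then kp t y else \<zero>) = (if r = r' then ph (sgl r c (kp t y .*E x t)) else \<zero>)"
   proof (cases "r = r'")
    case True
    have xn: "x t : num r c" using x_num[OF t] c True by auto
    have "ph (sgl r c (kp t y .*E x t)) = kp t y \<otimes> ph (sgl r c (x t))"
     using F.RdD(4)[OF ph ky sgl_closed[OF xn]] sgl_smult[OF ky xn] by simp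
    thus ?thesis using True ky kk[OF c] by (simp add: R.m_comm)
   qed (use kk[OF c] in simp)
  }
  assume "c ~: winR t r'"
  hence "sgl r c (kp t y .*E x t) = 0C" if "r = r'"
  proof (cases "c < r - int (dg t)")
   case True
   thus ?thesis using kp_num[OF t y] t by simp
  next
   case False
   hence "x t : den r c" using x_den[OF t, of r c] \<open>c ~: winR t r'\<close> that by auto
   thus ?thesis using sgl_zero_iff[OF kx] subspaceD(4)[OF den_sub ky] by simp
  qed
  thus "(if r = r' then ph (sgl r c (kp t y .*E x t)) else \<zero>) = \<zero>" using F.RdD(5)[OF ph] by simp
 qed (use kk ky in auto)
 finally show ?thesis .
qed

text \<open>Away from finitely many rows a functional of the restricted dual vanishes.\<close>

lemma Rd_rows: "ph : F.Rd ==> EX W. finite W & (ALL r c y. y : num r c --> r ~: W --> ph (sgl r c y) = \<zero>)"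
proof -
 assume ph: "ph : F.Rd"
 obtain F where F: "finite F" "F <= ZZ" "ALL F'. finite F' --> F <= F' --> F' <= ZZ -->
  (ALL a:|C|. ph (F.unit_on F' *C a) = ph a & ph (a *C F.unit_on F') = ph a)"
  using F.Rd_supp[OF ph] by (elim exE conjE)
 from spec[OF F(3), of F] F(1,2) have F3: "ALL a:|C|. ph (F.unit_on F *C a) = ph a" by blast
 have "ph (sgl r c y) = \<zero>" if y: "y : num r c" and r: "r ~: snd ` F" for r c y
 proof -
  have "eC nu *C sgl r c y = 0C" if "nu : F" for nu
  proof -
   obtain v i where nu: "nu = (v, i)" by (cases nu)
   hence "v : V" "i ~= r" using that F(2) r by (auto simp: image_iff)
   thus ?thesis unfolding nu eC_sgl using y by (simp add: sgl_mul num_diag)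
  qed
  hence "F.unit_on F *C sgl r c y = 0C"
   unfolding F.unit_on_mul[OF F(1,2) sgl_closed[OF y]] by (intro C.M.add.finprod_one_eqI) blast
  moreover have "ph (F.unit_on F *C sgl r c y) = ph (sgl r c y)" using F3 sgl_closed[OF y] by blast
  ultimately show ?thesis using F.RdD(5)[OF ph] by simp
 qed
 hence "ALL r c y. y : num r c --> r ~: snd ` F --> ph (sgl r c y) = \<zero>" by (intro allI impI)
 moreover have "finite (snd ` F)" using F(1) by simp
 ultimately show ?thesis by (intro exI conjI)
qed

text \<open>Evaluating on a matrix with one entry \<open>y\<close> reduces this to the expansion of \<open>y\<close> in the
elements \<open>x t\<close>.\<close>

lemma Rd_expand:
 assumes ph: "ph : F.Rd" and W: "finite W" "ALL r c y. y : num r c --> r ~: W --> ph (sgl r c y) = \<zero>" and Y: "Y : |C|"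
 shows "ph Y = (\<Oplus>p\<in>T \<times> W. gR p (Y *C btR p ph))"
 using Y
proof (induction Y rule: C_induct)
 note g = gR_Rd[THEN F.RdD(1)] and g0 = gR_Rd[THEN F.RdD(5)]
 have btc: "btR p ph : |C|" if "p : T \<times> UNIV" for p using that btR_closed[OF ph] by auto
 {
  case zero
  have "(\<Oplus>p\<in>T \<times> W. gR p (0C *C btR p ph)) = \<zero>" using btc g0 by (intro R.add.finprod_one_eqI) auto
  thus ?case using F.RdD(5)[OF ph] by simp
 next
  case (add Y Z)
  have p: "gR p (Y *C btR p ph) : KC" "gR p (Z *C btR p ph) : KC"
   "gR p ((Y +C Z) *C btR p ph) = gR p (Y *C btR p ph) \<oplus> gR p (Z *C btR p ph)" if "p : T \<times> W" for p
  proof -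
   have p: "p : T \<times> UNIV" using that by auto
   show "gR p (Y *C btR p ph) : KC" "gR p (Z *C btR p ph) : KC"
    "gR p ((Y +C Z) *C btR p ph) = gR p (Y *C btR p ph) \<oplus> gR p (Z *C btR p ph)"
    using add(1,2) btc[OF p] g[OF p] F.RdD(3)[OF gR_Rd[OF p]] by (simp_all add: C.mul_distl)
  qed
  have "(\<Oplus>p\<in>T \<times> W. gR p ((Y +C Z) *C btR p ph)) = (\<Oplus>p\<in>T \<times> W. gR p (Y *C btR p ph) \<oplus> gR p (Z *C btR p ph))"
   by (rule R.finsum_cong'[OF refl]) (use p in blast)+
  also have "... = ph Y \<oplus> ph Z" unfolding add(3,4) by (rule R.finsum_addf) (use p in blast)+
  finally show ?case using F.RdD(3)[OF ph add(1,2)] by simp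
 next
  case (sgl r c y)
  let ?s = "%t. ph (sgl r c (kp t y .*E x t))"
  have kx: "kp t y .*E x t : num r c" if "t : T" for t using coordinate_sgl(1)[OF that sgl] .
  have sK: "?s t : KC" if "t : T" for t using F.RdD(1)[OF ph sgl_closed[OF kx[OF that]]] .
  have "(\<Oplus>t\<in>T. ?s t) = ph (S[C, T] %t. sgl r c (kp t y .*E x t))"
   using T_fin kx by (intro F.RdD(6)[OF ph, symmetric]) auto
  hence tot: "(\<Oplus>t\<in>T. ?s t) = ph (sgl r c y)"
   using finsum_sgl[OF T_fin, of "%t. kp t y .*E x t", OF kx] x_expand[OF num_closed[OF sgl]] by simp
  have val: "gR (t, r') (sgl r c y *C btR (t, r') ph) = (if r = r' then ?s t else \<zero>)" if "t : T" for t r'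
   using gR_btR_sgl[OF ph that sgl] .
  show ?case
  proof (cases "r : W")
   case True
   have "(\<Oplus>p\<in>T \<times> W. gR p (sgl r c y *C btR p ph)) = (\<Oplus>p\<in>(%t. (t, r)) ` T. gR p (sgl r c y *C btR p ph))"
    using True W T_fin val sK by (intro R.add.finprod_mono_neutral_cong_right) (auto simp: image_iff)
   also have "... = (\<Oplus>t\<in>T. gR (t, r) (sgl r c y *C btR (t, r) ph))"
    using val sK by (subst R.finsum_reindex) (auto simp: inj_on_def)
   also have "... = (\<Oplus>t\<in>T. ?s t)" using val sK by (intro R.finsum_cong') auto
   finally show ?thesis using tot by simp
  next
   case False
   hence "(\<Oplus>p\<in>T \<times> W. gR p (sgl r c y *C btR p ph)) = \<zero>"
    using val by (intro R.add.finprod_one_eqI) auto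
   thus ?thesis using W(2) False sgl by simp
  qed
 }
qed

end

context adapted begin

text \<open>The position \<open>(j, i)\<close> is below the diagonal, where the step to the next column is the inclusion of a
filtration piece into a larger one. A functional on the smaller piece extends to the larger one; coordinates make this
explicit.\<close>

lemma Rd_factor:
 assumes ph: "ph : F.Rd" and v: "v : V" "w : V" and ij: "i < j"
  and l: "!!M. M : |C| ==> ph (eC (w, j) *C M) = ph M" and r: "!!M. M : |C| ==> ph (M *C eC (v, i)) = ph M"
 shows "EX ps:F.Rd. ALL M:|C|. ph M = ps (M *C bC v i (i + 1))"
proof -
 (* the other elements x t do not fit at the position (j, i) *)
 let ?T = "{t : T. j - i <= int (dg t)}"
 have T: "finite ?T" using T_fin by simp
 have near: "i + 1 + int (dg t) < j + int N" if "t : T" for t using dg[OF that] ij by linarith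
 have kx: "ph (sgl j i (x t)) : KC" if "t : ?T" for t
  using that F.RdD(1)[OF ph] x_num[of t j i] by auto
 let ?f = "%t. \<lambda>M\<in>|C|. ph (sgl j i (x t)) \<otimes> cf t j (i + 1) M"
 have f: "?f : ?T \<rightarrow> F.Rd" using F.Rd_smult[OF kx cf_Rd] near by blast
 let ?ps = "\<lambda>M\<in>|C|. \<Oplus>t\<in>?T. ?f t M"
 have ps: "?ps : F.Rd" using F.Rd_finsum[OF T f] by (rule conjunct1)
 have "ph Y = ?ps (Y *C bC v i (i + 1))" if Y: "Y : |C|" for Y
 proof -
  obtain z where z: "z : Mat" "Y = mk z" using mk_surj Y by blast
  let ?y = "z j i *E e v"
  have yn: "?y : num j i" by (rule num_mul_num[OF Mat_num[OF z(1)]]) (use v in \<open>simp add: num_diag\<close>)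
  have yc: "?y : |E|" using num_closed[OF yn] .
  have "ph Y = ph (eC (w, j) *C (Y *C eC (v, i)))"
   using l[of "Y *C eC (v, i)"] r[OF Y] Y eC_closed v by auto
  also have "eC (w, j) *C (Y *C eC (v, i)) = sgl j i (e w *E ?y)"
   unfolding z(2) eC_sgl using z v by (intro sgl_mk_sgl) (auto simp: num_diag)
  also have "... = eC (w, j) *C sgl j i ?y" using yn v by (simp add: eC_sgl sgl_mul num_diag)
  also have "ph ... = ph (sgl j i ?y)" by (rule l) (rule sgl_closed[OF yn])
  also have "sgl j i ?y = (S[C, T] %t. sgl j i (kp t ?y .*E x t))"
   using finsum_sgl[OF T_fin, of "%t. kp t ?y .*E x t", OF coordinate_sgl(1)[OF _ yn]] x_expand[OF yc] by simp
  also have "ph ... = (\<Oplus>t\<in>T. ph (sgl j i (kp t ?y .*E x t)))"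
   by (rule F.RdD(6)[OF ph T_fin]) (use coordinate_sgl(1)[OF _ yn] in blast)
  also have "... = (\<Oplus>t\<in>?T. ph (sgl j i (x t)) \<otimes> kp t ?y)"
  proof (rule R.add.finprod_mono_neutral_cong_right[OF T_fin])
   show "ph (sgl j i (kp t ?y .*E x t)) = \<zero>" if "t : T - ?T" for t
    using that kp_num[of t ?y j i] yn F.RdD(5)[OF ph] by auto
   show "ph (sgl j i (kp t ?y .*E x t)) = ph (sgl j i (x t)) \<otimes> kp t ?y" if t: "t : ?T" for t
   proof -
    have xn: "x t : num j i" and k: "kp t ?y : KC" using t x_num[of t j i] kp_K yc by auto
    have "ph (sgl j i (kp t ?y .*E x t)) = ph (kp t ?y .*C sgl j i (x t))" unfolding sgl_smult[OF k xn] ..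
    also have "... = kp t ?y \<otimes> ph (sgl j i (x t))" by (rule F.RdD(4)[OF ph k sgl_closed[OF xn]])
    finally show ?thesis using k kx[OF t] by (simp add: R.m_comm)
   qed
   show "(%t. ph (sgl j i (kp t ?y .*E x t))) : T \<rightarrow> KC"
    using F.RdD(1)[OF ph sgl_closed[OF coordinate_sgl(1)[OF _ yn]]] by blast
  qed auto
  also have "... = (\<Oplus>t\<in>?T. ?f t (Y *C bC v i (i + 1)))"
  proof (rule R.finsum_cong'[OF refl])
   show "(%t. ?f t (Y *C bC v i (i + 1))) : ?T \<rightarrow> KC"
    by (intro Pi_I F.RdD(1)[OF funcset_mem[OF f]]) (use Y v in auto)
   fix t assume t: "t : ?T"
   hence tT: "t : T" by simp
   have b: "bC v i (i + 1) = sgl i (i + 1) (e v)" using v by (simp add: bC_sgl)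
   have en: "e v : num i (i + 1)" using ev_num[OF v(1)] by simp
   have "cf t j (i + 1) (Y *C bC v i (i + 1)) = kp t ?y"
    unfolding z(2) b mk_mul_sgl(2)[OF en z(1)] cf_mk[OF tT mk_mul_sgl(1)[OF en z(1)] near[OF tT]] by simp
   moreover have "Y *C bC v i (i + 1) : |C|" using Y v by simp
   ultimately show "ph (sgl j i (x t)) \<otimes> kp t ?y = ?f t (Y *C bC v i (i + 1))" by simp
  qed
  finally show ?thesis using Y v by simp
 qed
 thus ?thesis using ps by blast
qed

definition gD :: "'t \<times> int + 't \<times> int => (int => int => 'a set) \<times> ((int => int => 'a set) => 'k)" where
 "gD = case_sum (%p. F.emb (gC p)) (%p. (0C, gR p))"

definition btD :: "'t \<times> int + 't \<times> int => (int => int => 'a set) \<times> ((int => int => 'a set) => 'k) =>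
  (int => int => 'a set) \<times> ((int => int => 'a set) => 'k)" where
 "btD = case_sum (%p a. F.emb (btC p (fst a))) (%p a. F.emb (btR p (snd a)))"

lemma D_expand:
 assumes Y: "Y : |C|" and ph: "ph : F.Rd"
 shows "EX F. finite F & F <= T \<times> UNIV <+> T \<times> UNIV & (ALL p:(T \<times> UNIV <+> T \<times> UNIV) - F. btD p (Y, ph) = 0[DC]) \<and>
  (Y, ph) = (S[DC, F] %p. btD p (Y, ph) *[DC] gD p)"
proof -
 obtain G where G: "finite G" "ALL F'. finite F' --> G <= F' -->
  (ALL t:T. ALL c. c ~: F' --> btC (t, c) Y = 0C) & (S[C, T \<times> F'] %p. btC p Y *C gC p) = Y"
  using C_expand[OF Y] by (elim exE conjE)
 from spec[OF G(2), of G] G(1) have G: "finite G" "ALL t:T. ALL c. c ~: G --> btC (t, c) Y = 0C" "(S[C, T \<times> G] %p. btC p Y *C gC p) = Y" by auto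
 obtain W where W: "finite W" "ALL r c y. y : num r c --> r ~: W --> ph (sgl r c y) = \<zero>" using Rd_rows[OF ph] by blast
 have btRW: "btR (t, r) ph = 0C" if t: "t : T" and r: "r ~: W" for t r
  unfolding btR_def prod.case
 proof (rule C.M.add.finprod_one_eqI)
  fix c assume "c : winR t r"
  hence "ph (sgl r c (x t)) = \<zero>" using W(2) r x_num[OF t] by auto
  thus "ph (sgl r c (x t)) .*C bC (rv t) c (cR t r) = 0C" using rv[OF t] by simp
 qed
 let ?F1 = "Inl ` (T \<times> G)" and ?F2 = "Inr ` (T \<times> W)"
 let ?h = "%p. btD p (Y, ph) *[DC] gD p"
 have bt1: "btC p Y : |C|" "btR p ph : |C|" "gC p : |C|" "gR p : F.Rd" if "p : T \<times> UNIV" for p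
  using that btC_closed[OF _ Y] btR_closed[OF ph] gC_closed gR_Rd by auto
 have h1: "?h (Inl p) = F.emb (btC p Y *C gC p)" and h1c: "?h (Inl p) : carrier DC" if "p : T \<times> UNIV" for p
  using bt1[OF that] by (simp_all add: btD_def gD_def F.emb_hom)
 have h2: "?h (Inr p) = (0C, \<lambda>M\<in>|C|. gR p (M *C btR p ph))" and h2c: "(\<lambda>M\<in>|C|. gR p (M *C btR p ph)) : F.Rd"
  if "p : T \<times> UNIV" for p
 proof -
  show h: "?h (Inr p) = (0C, \<lambda>M\<in>|C|. gR p (M *C btR p ph))"
   using bt1[OF that] by (simp add: btD_def gD_def F.emb_mul)
  have "btD (Inr p) (Y, ph) : carrier DC" using bt1[OF that] by (simp add: btD_def F.emb_closed)
  moreover have "gD (Inr p) : carrier DC" using bt1[OF that] by (simp add: gD_def F.D_sel(1))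
  ultimately have "?h (Inr p) : carrier DC" by (rule F.D.mul_closed)
  thus "(\<lambda>M\<in>|C|. gR p (M *C btR p ph)) : F.Rd" unfolding h by (simp add: F.D_sel)
 qed
 have s1: "(S[DC, ?F1] %p. ?h p) = F.emb Y"
 proof -
  have "(S[DC, ?F1] %p. ?h p) = (S[DC, T \<times> G] %p. ?h (Inl p))"
   using h1c by (intro F.D.M.finsum_reindex) auto
  also have "... = (S[DC, T \<times> G] %p. F.emb (btC p Y *C gC p))"
   using h1 h1c by (intro F.D.M.finsum_cong') auto
  also have "... = F.emb (S[C, T \<times> G] %p. btC p Y *C gC p)"
   using T_fin G(1) bt1 by (intro F.emb_finsum) auto
  finally show ?thesis using G(3) by simp
 qed
 have s2: "(S[DC, ?F2] %p. ?h p) = (0C, ph)"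
 proof -
  have c: "?h (Inr p) : carrier DC" if "p : T \<times> W" for p
   using h2[of p] h2c[of p] that by (auto simp: F.D_sel)
  have "(S[DC, ?F2] %p. ?h p) = (S[DC, T \<times> W] %p. ?h (Inr p))"
   using c by (intro F.D.M.finsum_reindex) auto
  also have "... = (S[DC, T \<times> W] %p. (0C, \<lambda>M\<in>|C|. gR p (M *C btR p ph)))"
  proof (rule F.D.M.finsum_cong'[OF refl])
   show "(%p. (0C, \<lambda>M\<in>|C|. gR p (M *C btR p ph))) : T \<times> W \<rightarrow> carrier DC" using h2c by (auto simp: F.D_sel(1))
   show "?h (Inr p) = (0C, \<lambda>M\<in>|C|. gR p (M *C btR p ph))" if "p : T \<times> W" for p using h2[of p] that by blast
  qed
  also have "... = (0C, \<lambda>M\<in>|C|. \<Oplus>p\<in>T \<times> W. (\<lambda>M\<in>|C|. gR p (M *C btR p ph)) M)"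
  proof (rule conjunct2[OF F.Rd_finsum])
   show "finite (T \<times> W)" using T_fin W by simp
   show "(%p. \<lambda>M\<in>|C|. gR p (M *C btR p ph)) : T \<times> W \<rightarrow> F.Rd" using h2c by auto
  qed
  also have "(\<lambda>M\<in>|C|. \<Oplus>p\<in>T \<times> W. (\<lambda>M\<in>|C|. gR p (M *C btR p ph)) M) = ph"
  proof
   fix M show "(\<lambda>M\<in>|C|. \<Oplus>p\<in>T \<times> W. (\<lambda>M\<in>|C|. gR p (M *C btR p ph)) M) M = ph M"
    using Rd_expand[OF ph W, of M] F.RdD(2)[OF ph, of M] by (cases "M : |C|") simp_all
  qed
  finally show ?thesis .
 qed
 have "(S[DC, ?F1 \<union> ?F2] %p. ?h p) = (S[DC, ?F1] %p. ?h p) +[DC] (S[DC, ?F2] %p. ?h p)"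
 proof (rule F.D.M.finsum_Un_disjoint)
  show "?h : ?F1 \<rightarrow> carrier DC" using h1c by auto
  have "?h (Inr p) : carrier DC" if "p : T \<times> W" for p using h2[of p] h2c[of p] that by (auto simp: F.D_sel(1))
  thus "?h : ?F2 \<rightarrow> carrier DC" by auto
 qed (use T_fin G W in auto)
 also have "... = (Y, ph)"
  unfolding s1 s2 using Y F.RdD(1,2)[OF ph] by (auto simp: ext_embed_def F.D_sel restrict_def fun_eq_iff)
 finally have "(Y, ph) = (S[DC, ?F1 \<union> ?F2] %p. ?h p)" by simp
 moreover have "btD p (Y, ph) = 0[DC]" if pT: "p : (T \<times> UNIV <+> T \<times> UNIV) - (?F1 \<union> ?F2)" for p
 proof (cases p)
  case (Inl p')
  obtain t c where p': "p' = (t, c)" by (cases p')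
  hence "t : T" "c ~: G" using pT Inl by auto
  thus ?thesis using G(2) Inl p' by (simp add: btD_def F.emb_hom(1))
 next
  case (Inr p')
  obtain t r where p': "p' = (t, r)" by (cases p')
  hence "t : T" "r ~: W" using pT Inr by auto
  thus ?thesis using btRW Inr p' by (simp add: btD_def F.emb_hom(1))
 qed
 moreover have "finite (?F1 \<union> ?F2)" "?F1 \<union> ?F2 <= T \<times> UNIV <+> T \<times> UNIV" using T_fin G W by auto
 ultimately show ?thesis by (intro exI[of _ "?F1 \<union> ?F2"]) blast
qed

context
 fixes lt :: "'v \<times> int => 'v \<times> int => bool" and q :: "'v => 'v => bool"
 assumes lt: "!!v i w j. lt (v, i) (w, j) <-> i < j \<or> i = j & q v w"
  and q_irr: "!!v. ~ q v v"
  and q_hom: "!!v w y. v : V ==> w : V ==> q v w ==> y : |E| ==> e w *E (y *E e v) = 0E"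
begin

abbreviation "bD v i j \<equiv> F.emb (bC v i j)"

lemma D_step:
 assumes v: "v : V" "w : V" and l: "lt (v, i) (w, j)" and U: "U : carrier DC"
  "F.emb (eC (v, i)) *[DC] U = U" "U *[DC] F.emb (eC (w, j)) = U"
 shows "EX Y:carrier DC. U = bD v i (i + 1) *[DC] Y"
proof -
 obtain a ph where a: "U = (a, ph)" "a : |C|" "ph : F.Rd" using U(1) by (auto simp: F.D_sel)
 have ec: "eC (v, i) : |C|" "eC (w, j) : |C|" using eC_closed v by auto
 have X2: "eC (v, i) *C a = a" "(\<lambda>M\<in>|C|. ph (M *C eC (v, i))) = ph"
  using U(2) unfolding a(1) F.emb_mul(1)[OF a(2,3) ec(1)] by auto
 have X3: "a *C eC (w, j) = a" "(\<lambda>M\<in>|C|. ph (eC (w, j) *C M)) = ph"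
  using U(3) unfolding a(1) F.emb_mul(2)[OF a(2,3) ec(2)] by auto
 have r: "ph (M *C eC (v, i)) = ph M" and ll: "ph (eC (w, j) *C M) = ph M" if "M : |C|" for M
  using fun_cong[OF X2(2), of M] fun_cong[OF X3(2), of M] that by simp_all
 have A: "EX y:|C|. a = bC v i (i + 1) *C y"
 proof (cases "i < j")
  case True
  thus ?thesis using C_step[OF v _ a(2) X2(1) X3(1)] by blast
 next
  case False
  hence ij: "i = j" "q v w" using l lt by auto
  hence ne: "v ~= w" using q_irr by auto
  obtain z where z: "z : Mat" "a = mk z" using mk_surj a by blast
  let ?y = "e v *E (z i i *E e w)"
  have "a = eC (v, i) *C (a *C eC (w, i))" using X2 X3 ij by simp
  also have "... = sgl i i ?y" unfolding z(2) eC_sgl using z v by (intro sgl_mk_sgl) (auto simp: num_diag)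
  finally have as: "a = sgl i i ?y" .
  obtain k u where "k : KC" "u : I 1" "?y = (if v = w then k .*E e v else 0E) +E u"
   using corner_E[OF v, of "z i i"] z by blast
  hence "?y : I 1" using ne ID(1) by simp
  hence yn: "?y : num (i + 1) i" by (simp add: num_eq)
  have "e v *E ?y = ?y" using z v by (simp add: ev_assoc)
  hence "bC v i (i + 1) *C sgl (i + 1) i ?y = a" using as v yn ev_num[OF v(1), of i "i + 1"] by (simp add: bC_sgl sgl_mul)
  thus ?thesis using sgl_closed[OF yn] by (intro bexI[of _ "sgl (i + 1) i ?y"]) auto
 qed
 have B: "EX ps:F.Rd. ALL M:|C|. ph M = ps (M *C bC v i (i + 1))"
 proof (cases "i < j")
  case True
  thus ?thesis by (rule Rd_factor[OF a(3) v _ ll r])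
 next
  case False
  hence ij: "i = j" "q v w" using l lt by auto
  have "ph M = \<zero>" if M: "M : |C|" for M
  proof -
   obtain z where z: "z : Mat" "M = mk z" using mk_surj M by blast
   have "eC (w, j) *C (M *C eC (v, i)) = sgl j i (e w *E (z j i *E e v))"
    unfolding z(2) eC_sgl using z v by (intro sgl_mk_sgl) (auto simp: num_diag)
   also have "... = 0C" using q_hom[OF v ij(2), of "z j i"] z by simp
   finally have "eC (w, j) *C (M *C eC (v, i)) = 0C" .
   thus ?thesis using ll[of "M *C eC (v, i)"] r[OF M] M ec F.RdD(5)[OF a(3)] by simp
  qed
  thus ?thesis using F.Rd_zero v by (intro bexI[of _ "\<lambda>M\<in>|C|. \<zero>"]) auto
 qed
 obtain y ps where y: "y : |C|" "a = bC v i (i + 1) *C y" "ps : F.Rd" "ALL M:|C|. ph M = ps (M *C bC v i (i + 1))"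
  using A B by blast
 have "ph = (\<lambda>M\<in>|C|. ps (M *C bC v i (i + 1)))"
  using y(4) F.RdD(2)[OF a(3)] by (auto simp: fun_eq_iff restrict_def)
 hence "U = bD v i (i + 1) *[DC] (y, ps)" using a y v by (simp add: F.emb_mul)
 thus ?thesis using y by (intro bexI[of _ "(y, ps)"]) (auto simp: F.D_sel)
qed

lemma banded_D: "banded K (opposite DC) V (F.emb \<circ> eC) N lt (%v j i. bD v i j) (F.emb ` Band)"
proof (intro banded.intro banded_axioms.intro idempotent_family.idempotent_family_opposite[OF F.trivial_extension_family] N_pos)
 show "subalgebra K (opposite DC) (F.emb ` Band)" by (rule subalgebra_opposite[OF F.emb_subalgebra[OF Band_sub]])
 show "~ lt nu nu" for nu using lt q_irr by (cases nu) auto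
 show "lt (v, i) (v, j)" if "i < j" for v i j using lt that by simp
 show "bD v i j : F.emb ` Band" if "v : V" for v i j using bC_Band[OF that] by blast
 show "(F.emb \<circ> eC) (v, i) = bD v i i" if "v : V" for v i using N_pos by (simp add: bC_def eC_sgl)
 show "bD v i j ~= 0[opposite DC]" if "v : V" "i <= j" "j < i + int N" for v i j
  using bC_nonzero[OF that] by (simp add: F.emb_hom(1)[symmetric] F.emb_hom(5))
 show "bD v i j = 0[opposite DC]" if "~ (i <= j & j < i + int N)" for v i j
  using that by (auto simp: bC_def F.emb_hom(1))
 show "bD v j k *[opposite DC] bD w i j' = (if v = w & j = j' & i <= j & j <= k then bD v i k else 0[opposite DC])"
  if "v : V" "w : V" for v w k j j' i
  using that by (auto simp: F.emb_hom(1,3) bC_mul)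
 show "EX k:KC. (F.emb \<circ> eC) (v, j) *[opposite DC] (U *[opposite DC] (F.emb \<circ> eC) (w, i)) =
   (if v = w then k .*[opposite DC] bD v i j else 0[opposite DC])" if U: "U : F.emb ` Band" and v: "v : V" "w : V" for U v w i j
 proof -
  obtain Y where Y: "Y : Band" "U = F.emb Y" using U by blast
  have c: "Y : |C|" "eC (v, j) : |C|" "eC (w, i) : |C|" using C.subalgebraD(1)[OF Band_sub Y(1)] eC_closed v by auto
  obtain k where "k : KC" "eC (w, i) *C (Y *C eC (v, j)) = (if w = v then k .*C bC w i j else 0C)"
   using Band_comp[OF Y(1) v(2,1)] by blast
  thus ?thesis using Y(2) c v
   by (intro bexI[of _ k]) (auto simp: F.emb_hom(1,3,4) C.mul_assoc)
 qed
 show "EX y:carrier (opposite DC). U = y *[opposite DC] bD v i (i + 1)"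
  if "v : V" "w : V" "lt (v, i) (w, j)" "U : carrier (opposite DC)" "(F.emb \<circ> eC) (w, j) *[opposite DC] U = U"
   "U *[opposite DC] (F.emb \<circ> eC) (v, i) = U" for v w i j U
  using D_step[of v w i j U] that by simp
qed

theorem trivial_extension_Delta:
 "strong_exact_Delta_subalgebra TYPE('m) K (V \<times> UNIV) lt DC (F.emb \<circ> eC) (F.emb ` Band) (F.emb \<circ> eC)"
 unfolding strong_exact_Delta_subalgebra_def
proof (rule banded.strong_exact_Borel[OF banded_D banded.dual_basisI[OF banded_D, of "T \<times> UNIV <+> T \<times> UNIV" gD btD]], unfold opposite_sel)
 fix p assume p: "p : T \<times> (UNIV :: int set) <+> T \<times> (UNIV :: int set)"
 show "gD p : carrier DC" 
 proof (cases p)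
  case (Inl p')
  thus ?thesis using p gC_closed[of p'] F.emb_closed[of "gC p'"] by (auto simp: gD_def)
 next
  case (Inr p')
  thus ?thesis using p gR_Rd[of p'] by (auto simp: gD_def F.D_sel(1))
 qed
 fix U assume "U : carrier DC"
 then obtain Y ph where U: "U = (Y, ph)" "Y : |C|" "ph : F.Rd" by (auto simp: F.D_sel)
 show "btD p U : F.emb ` Band" using p btC_Band[OF U(2)] btR_Band[OF U(3)] by (auto simp: btD_def U(1))
 show "btD p (U +[DC] U') = btD p U +[DC] btD p U'" if U'c: "U' : carrier DC" for U'
 proof -
  obtain Y' ph' where U': "U' = (Y', ph')" "Y' : |C|" "ph' : F.Rd" using U'c by (auto simp: F.D_sel)
  show ?thesis using p btC_closed U U'
   by (auto simp: btD_def F.D_sel(3) btC_add btR_add F.emb_hom(2) btC_closed btR_closed)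
 qed
 show "btD p (k .*[DC] U) = k .*[DC] btD p U" if "k : KC" for k
  using p U that by (auto simp: btD_def F.D_sel(5) btC_smult btR_smult F.emb_hom(4) btC_closed btR_closed)
 show "btD p (bD v i j *[DC] U) = bD v i j *[DC] btD p U" if "v : V" for v i j
  using p U that by (auto simp: btD_def F.emb_mul(1) btC_mul btR_mul F.emb_hom(3) btC_closed btR_closed)
next
 fix U assume "U : carrier DC"
 then obtain Y ph where U: "U = (Y, ph)" "Y : |C|" "ph : F.Rd" by (auto simp: F.D_sel)
 show "EX F. finite F & F <= T \<times> UNIV <+> T \<times> UNIV & (ALL t:(T \<times> UNIV <+> T \<times> UNIV) - F. btD t U = 0[DC]) \<and>
   U = (S[opposite DC, F] %t. btD t U *[DC] gD t)"
  using D_expand[OF U(2,3)] unfolding U(1)[symmetric] F.D.finsum_opposite .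
qed

end

end

section \<open>Division algebras over an algebraically closed field\<close>

lemma (in algebraically_closed) exists_root:
 assumes "set p <= carrier L" "1 < length p" "hd p ~= \<zero>"
 shows "EX x:carrier L. eval p x = \<zero>"
proof -
 have p: "p : carrier (poly_ring L)" using assms by (auto simp: univ_poly_carrier[symmetric] polynomial_def)
 have "size (roots p) = degree p" using roots_over_carrier[OF p] by (simp add: splitted_def)
 hence "roots p ~= {#}" using assms(2) by auto
 then obtain x where "x \<in># roots p" by blast
 hence "is_root p x" using roots_mem_iff_is_root[OF p] by simp
 thus ?thesis by (auto simp: is_root_def)
qed

context nalg begin

primrec horner :: "'k => 'k list => 'k" where
 "horner x [] = \<zero>"
| "horner x (c # cs) = c \<oplus> x \<otimes> horner x cs"

primrec act :: "'l => 'l => 'k list => 'l" where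
 "act f s [] = 0L"
| "act f s (c # cs) = c .*L f +L s *L act f s cs"

primrec syndiv :: "'k => 'k list => 'k list" where
 "syndiv x [] = []"
| "syndiv x (c # cs) = (if cs = [] then [] else horner x cs # syndiv x cs)"

lemma horner_closed [simp, intro]: "set cs <= KC ==> x : KC ==> horner x cs : KC"
 by (induction cs) auto

lemma act_closed [simp, intro]: "set cs <= KC ==> f : |L| ==> s : |L| ==> act f s cs : |L|"
 by (induction cs) auto

lemma horner_eval: "set cs <= KC ==> x : KC ==> ring.eval K (rev cs) x = horner x cs"
proof (induction cs)
 case (Cons c cs)
 hence "ring.eval K (rev cs @ [c]) x = ring.eval K (rev cs) x \<otimes> x \<oplus> c" by (intro R.eval_append_aux) auto
 thus ?case using Cons by (simp add: R.m_comm R.a_comm)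
qed simp

lemma syndiv_props:
 assumes "set cs <= KC" "x : KC"
 shows "set (syndiv x cs) <= KC" "length (syndiv x cs) = length cs - 1"
  "1 < length cs ==> last (syndiv x cs) = last cs"
proof -
 show "set (syndiv x cs) <= KC" using assms by (induction cs) auto
 show len: "length (syndiv x cs) = length cs - 1" using assms by (induction cs) auto
 show "1 < length cs ==> last (syndiv x cs) = last cs"
  using assms(1)
 proof (induction cs)
  case (Cons c cs)
  show ?case
  proof (cases "1 < length cs")
   case True
   hence "syndiv x cs ~= []" by (cases cs rule: list.exhaust) auto
   thus ?thesis using Cons True by auto
  next
   case False
   then obtain d where "cs = [d]" using Cons.prems by (cases cs) auto
   thus ?thesis using Cons.prems assms(2) by simp
  qed
 qed simp
qed

text \<open>Division with remainder by a linear factor, evaluated at \<open>s\<close>.\<close>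

lemma act_syndiv:
 assumes f: "f : |L|" "f *L f = f" and s: "s : |L|" "f *L s = s" "s *L f = s" and x: "x : KC"
 shows "set cs <= KC ==> cs ~= [] ==>
  act f s cs = horner x cs .*L f +L (s +L (\<ominus> x) .*L f) *L act f s (syndiv x cs)"
proof (induction cs)
 case (Cons c cs)
 show ?case
 proof (cases "cs = []")
  case True
  thus ?thesis using Cons f s x by simp
 next
  case False
  let ?A = "act f s (syndiv x cs)" and ?h = "horner x cs" and ?d = "s +L (\<ominus> x) .*L f"
  have A: "?A : |L|" using syndiv_props(1)[of cs x] Cons.prems x f s by auto
  have h: "?h : KC" and c: "c : KC" using Cons.prems x by auto
  have d: "?d : |L|" using s f x by simp
  have IH: "act f s cs = ?h .*L f +L ?d *L ?A" using Cons False by auto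
  have comm: "s *L ?d = ?d *L s" using s f x by (simp add: mul_distl mul_distr mul_smult_l mul_smult_r)
  have l: "s *L act f s cs = ?h .*L s +L ?d *L (s *L ?A)"
   unfolding IH using s f h A d comm by (simp add: mul_distr mul_smult_r mul_assoc[symmetric])
  have df: "?d *L f = ?d" using s f x by (simp add: mul_distl mul_smult_l)
  have "?d *L (?h .*L f +L s *L ?A) = ?h .*L ?d +L ?d *L (s *L ?A)"
   using s f h A d df by (simp add: mul_distr mul_smult_r)
  moreover have "?h .*L ?d = ?h .*L s +L (\<ominus> (x \<otimes> ?h)) .*L f"
   using s f x h by (simp add: smult_r_distr smult_assoc1[symmetric] R.l_minus R.r_minus R.m_comm[of _ x])
  moreover have "(c \<oplus> x \<otimes> ?h) .*L f = c .*L f +L (x \<otimes> ?h) .*L f" using c x h f by (simp add: smult_l_distr)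
  moreover have "(x \<otimes> ?h) .*L f +L (\<ominus> (x \<otimes> ?h)) .*L f = 0L"
   using x h f by (simp add: smult_l_distr[symmetric] R.r_neg)
  moreover have "(a +L b) +L ((u +L b') +L v) = a +L (u +L v)"
   if "a : |L|" "b : |L|" "u : |L|" "b' : |L|" "v : |L|" "b +L b' = 0L" for a b u b' v
  proof -
   have "(a +L b) +L ((u +L b') +L v) = (b +L b') +L (a +L (u +L v))" using that(1-5) by (simp add: M.a_ac)
   thus ?thesis using that by simp
  qed
  ultimately have "(c \<oplus> x \<otimes> ?h) .*L f +L ?d *L (?h .*L f +L s *L ?A) = c .*L f +L s *L act f s cs"
   using s f c x h A d by (simp add: l)
  thus ?thesis using False by simp
 qed
qed simp

lemma act_append:
 assumes "f : |L|" "s : |L|"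
 shows "set p <= KC ==> set r <= KC ==>
  act f s (p @ r) = act f s p +L act f s (replicate (length p) \<zero> @ r)"
proof (induction p)
 case (Cons c p)
 have "set (replicate (length p) \<zero> @ r) <= KC" using Cons by auto
 thus ?case using Cons assms by (simp add: mul_distr M.a_assoc)
qed (use assms in simp)

lemma act_smult:
 assumes "f : |L|" "s : |L|" "a : KC"
 shows "set p <= KC ==> act f s (map ((\<otimes>) a) p) = a .*L act f s p"
 using assms by (induction p) (auto simp: smult_r_distr smult_assoc1 mul_smult_r)

lemma smult_eq_zero: "k : KC ==> y : |L| ==> k .*L y = 0L ==> k = \<zero> \<or> y = 0L"
proof (rule ccontr)
 assume k: "k : KC" "y : |L|" "k .*L y = 0L" and n: "~ (k = \<zero> \<or> y = 0L)"
 hence "k : Units K" using field_Units by auto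
 hence "y = (inv k \<otimes> k) .*L y" "inv k : KC" using k by auto
 thus False using k n smult_assoc1[of "inv k" k y] by simp
qed

text \<open>
  Two polynomials whose coefficients live in disjoint ranges of degrees have a nonzero combination
  killed by a given functional; finitely many functionals are killed successively.
\<close>

text \<open>In finite dimension the powers of \<open>s\<close> are linearly dependent.\<close>

lemma annihilating_polynomial:
 assumes f: "f : |L|" and s: "s : |L|" and n: "dual_system ( |L|) {0L} n x kp"
 shows "EX cs. set cs <= KC & cs ~= [] & last cs ~= \<zero> & act f s cs = 0L"
proof -
 have kp: "kp t y : KC" "kp t (y +L z) = kp t y \<oplus> kp t z" "k : KC ==> kp t (k .*L y) = k \<otimes> kp t y"
  if "t < n" "y : |L|" "z : |L|" for t y z k
  using n that by (auto simp: dual_system_def)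
 have main: "t <= n ==> EX p r. p = replicate m \<zero> @ r & set p <= KC & r ~= [] & last p ~= \<zero> & (ALL t'<t. kp t' (act f s p) = \<zero>)" for t m
 proof (induction t arbitrary: m)
  case 0
  thus ?case by (intro exI[of _ "replicate m \<zero> @ [\<one>]"] exI[of _ "[\<one>]"]) auto
 next
  case (Suc t)
  hence t: "t < n" by simp
  obtain p r where p: "p = replicate m \<zero> @ r" "set p <= KC" "r ~= []" "last p ~= \<zero>" "ALL t'<t. kp t' (act f s p) = \<zero>"
   using Suc.IH[of m] t by auto
  obtain p' r' where p': "p' = replicate (length p) \<zero> @ r'" "set p' <= KC" "r' ~= []" "last p' ~= \<zero>" "ALL t'<t. kp t' (act f s p') = \<zero>"
   using Suc.IH[of "length p"] t by auto
  have c: "act f s p : |L|" "act f s p' : |L|" using f s p p' by auto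
  show ?case
  proof (cases "kp t (act f s p) = \<zero>")
   case True
   hence "ALL t'<Suc t. kp t' (act f s p) = \<zero>" using p(5) less_Suc_eq by auto
   thus ?thesis using p by blast
  next
   case False
   define a where "a = \<ominus> kp t (act f s p')"
   define b where "b = kp t (act f s p)"
   have ab: "a : KC" "b : KC" "b ~= \<zero>" using False kp(1)[OF t c(1) c(1)] kp(1)[OF t c(2) c(2)] by (auto simp: a_def b_def)
   let ?p = "map ((\<otimes>) a) p @ map ((\<otimes>) b) r'"
   have r': "set r' <= KC" using p' by simp
   have "act f s ?p = act f s (map ((\<otimes>) a) p) +L act f s (replicate (length p) \<zero> @ map ((\<otimes>) b) r')"
    using act_append[OF f s, of "map ((\<otimes>) a) p" "map ((\<otimes>) b) r'"] ab p r' by (auto simp: subset_iff)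
   also have "replicate (length p) \<zero> @ map ((\<otimes>) b) r' = map ((\<otimes>) b) p'" using ab p' by (simp add: map_replicate)
   finally have eq: "act f s ?p = a .*L act f s p +L b .*L act f s p'"
    using act_smult[OF f s ab(1) p(2)] act_smult[OF f s ab(2) p'(2)] by simp
   have val: "kp t' (act f s ?p) = a \<otimes> kp t' (act f s p) \<oplus> b \<otimes> kp t' (act f s p')" if "t' < n" for t'
    unfolding eq using kp[OF that] ab c by simp
   have "kp t' (act f s ?p) = \<zero>" if "t' < Suc t" for t'
   proof (cases "t' = t")
    case True
    have "kp t (act f s p') : KC" using kp(1)[OF t c(2) c(2)] .
    hence "a \<otimes> b \<oplus> b \<otimes> kp t (act f s p') = \<zero>" unfolding a_def using ab(2) by (simp add: R.l_minus R.m_comm[of b] R.l_neg)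
    thus ?thesis using val[OF t] True by (simp add: b_def)
   next
    case False
    thus ?thesis using val[of t'] that t p(5) p'(5) ab by simp
   qed
   moreover have "last ?p ~= \<zero>"
   proof -
    have l: "last r' : KC" "last r' ~= \<zero>" using p' r' by (auto simp: subset_iff)
    hence "b \<otimes> last r' ~= \<zero>" using ab integral by blast
    thus ?thesis using p'(3) by (simp add: last_map)
   qed
   moreover have "?p = replicate m \<zero> @ (map ((\<otimes>) a) r @ map ((\<otimes>) b) r')" using p(1) ab by (simp add: map_replicate)
   moreover have "set ?p <= KC" using ab p(2) r' by auto
   moreover have "map ((\<otimes>) a) r @ map ((\<otimes>) b) r' ~= []" using p(3) by simp
   ultimately show ?thesis by blast
  qed
 qed
 obtain p r where p: "p = replicate 0 \<zero> @ r" "set p <= KC" "r ~= []" "last p ~= \<zero>" "ALL t'<n. kp t' (act f s p) = \<zero>"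
  using main[of n 0] by blast
 have c: "act f s p : |L|" using p f s by auto
 obtain w where w: "w : {0L}" "act f s p = (S[L, {..<n}] %t. kp t (act f s p) .*L x t) +L w"
  using n c unfolding dual_system_def by blast
 have xc: "x t : |L|" if "t < n" for t using n that unfolding dual_system_def by blast
 have "(S[L, {..<n}] %t. kp t (act f s p) .*L x t) = 0L"
  using p(5) xc by (intro M.add.finprod_one_eqI) auto
 hence "act f s p = 0L" using w by simp
 thus ?thesis using p by auto
qed

text \<open>A polynomial of least degree that kills \<open>s\<close> has a linear factor. If its value at \<open>s\<close> were
not zero, it would be invertible, and cancelling it would leave a polynomial of smaller degree.\<close>

lemma scalar_of_division:
 assumes ac: "algebraically_closed K"
  and f: "f : |L|" "f *L f = f" "f ~= 0L" and s: "s : |L|" "f *L s = s" "s *L f = s"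
  and inv: "!!k. k : KC ==> s +L k .*L f ~= 0L ==> EX d:|L|. d *L (s +L k .*L f) = f"
  and cs: "set cs <= KC" "cs ~= []" "last cs ~= \<zero>" "act f s cs = 0L"
 shows "EX k:KC. s = k .*L f"
 using cs
proof (induction cs rule: length_induct)
 case (1 cs)
 show ?case
 proof (cases "1 < length cs")
  case False
  then obtain c where c: "cs = [c]" using 1 by (cases cs) auto
  thus ?thesis using 1 f s smult_eq_zero[of c f] by simp
 next
  case True
  have "hd (rev cs) ~= \<zero>" using 1 by (simp add: hd_rev)
  then obtain x where x: "x : KC" "horner x cs = \<zero>"
   using algebraically_closed.exists_root[OF ac, of "rev cs"] True 1(2) horner_eval[of cs] by auto
  let ?d = "s +L (\<ominus> x) .*L f" and ?q = "syndiv x cs"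
  note q = syndiv_props[OF 1(2) x(1)]
  have qc: "act f s ?q : |L|" using q f s by auto
  have fq: "f *L act f s cs' = act f s cs'" if "set cs' <= KC" for cs'
   using that f s by (cases cs') (simp_all add: mul_distr mul_smult_r mul_assoc[symmetric])
  show ?thesis
  proof (cases "?d = 0L")
   case True
   have "s = ?d +L x .*L f"
    using s f x by (simp add: M.a_assoc smult_l_distr[symmetric] R.l_neg)
   thus ?thesis using True x f by auto
  next
   case False
   have "?d *L act f s ?q = 0L"
    using act_syndiv[OF f(1,2) s x(1) 1(2,3)] 1(5) x f s qc by simp
   moreover obtain d where d: "d : |L|" "d *L ?d = f" using inv[of "\<ominus> x"] False x by auto
   ultimately have "f *L act f s ?q = 0L" using mul_assoc[of d ?d "act f s ?q"] s f x qc by simp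
   hence "act f s ?q = 0L" using fq q by simp
   moreover have "?q ~= []" "last ?q ~= \<zero>" "length ?q < length cs" using q True 1(4) by auto
   ultimately show ?thesis using 1(1) q(1) by blast
  qed
 qed
qed

end

section \<open>Basic algebras over an algebraically closed field\<close>

lemma (in nalg) left_proj_iso:
 assumes pc: "p : |L|" "q : |L|" "p *L p = p" "q *L q = q"
  and c: "s : |L|" "t : |L|" "s *L q = s" "t *L p = t" and st: "s *L t = p" "t *L s = q"
 shows "lmod_iso L (left_proj L p) (left_proj L q)"
 unfolding lmod_iso_def
proof (rule bexI[of _ "%x. x *L s"])
 have fwd: "x *L s : {a *L q |a. a : |L|}" if "x : |L|" for x
  using that mul_assoc[OF that c(1) pc(2)] c by (auto intro!: exI[of _ "x *L s"])
 have bwd: "x *L t : {a *L p |a. a : |L|}" if "x : |L|" for x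
  using that mul_assoc[OF that c(2) pc(1)] c by (auto intro!: exI[of _ "x *L t"])
 have inv1: "(x *L s) *L t = x" if "x : {a *L p |a. a : |L|}" for x
  using that c pc st by (auto simp: mul_assoc)
 have inv2: "(x *L t) *L s = x" if "x : {a *L q |a. a : |L|}" for x
  using that c pc st by (auto simp: mul_assoc)
 have sub: "x : |L|" if "x : {a *L r |a. a : |L|}" "r : |L|" for x r using that by auto
 show "bij_betw (%x. x *L s) (carrier (left_proj L p)) (carrier (left_proj L q))"
  unfolding left_proj_sel
 proof (rule bij_betw_byWitness[where f' = "%x. x *L t"])
  show "ALL a:{a *L p |a. a : |L|}. (a *L s) *L t = a" using inv1 by blast
  show "ALL a:{a *L q |a. a : |L|}. (a *L t) *L s = a" using inv2 by blast
  show "(%x. x *L s) ` {a *L p |a. a : |L|} <= {a *L q |a. a : |L|}" using fwd sub[OF _ pc(1)] by blast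
  show "(%x. x *L t) ` {a *L q |a. a : |L|} <= {a *L p |a. a : |L|}" using bwd sub[OF _ pc(2)] by blast
 qed
 have "(%x. x *L s) : {a *L p |a. a : |L|} \<rightarrow> {a *L q |a. a : |L|}" using fwd sub[OF _ pc(1)] by blast
 thus "(%x. x *L s) : lmod_hom L (left_proj L p) (left_proj L q)"
  unfolding lmod_hom_def left_proj_sel
 proof (intro CollectI conjI ballI)
  fix x y assume "x : {a *L p |a. a : |L|}" "y : {a *L p |a. a : |L|}"
  thus "(x +L y) *L s = x *L s +L y *L s" by (intro mul_distl c(1) sub[OF _ pc(1)])
 next
  fix a x assume "a : |L|" "x : {a *L p |a. a : |L|}"
  thus "(a *L x) *L s = a *L (x *L s)" using mul_assoc[OF _ sub[OF _ pc(1)] c(1)] by blast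
 qed
qed

locale basic_split = filtered K E I N for K :: "'k ring" (structure) and E :: "('k, 'a) module" (structure)
  and I :: "nat => 'a set" and N :: nat +
 fixes P :: "'a set" and S :: "'a set"
 assumes E_ring: "ring E"
  and K_closed: "algebraically_closed K"
  and P_family: "basic_family E P (%x. x)"
  and S_sub: "subalgebra K E S"
  and S_semisimple: "semisimple_algebra (E<|S)"
  and S_int: "S \<inter> I 1 = {0[E]}"
  and S_sum: "x : carrier E ==> EX s:S. EX y:I 1. x = s +[E] y"
  and E_fin_gen: "EX fs. set fs <= carrier E & (ALL W. submodule W K E --> set fs <= W --> W = carrier E)"
begin
abbreviation one_E ("1E") where "1E \<equiv> 1[E]"


interpretation E: ring E by (rule E_ring)

lemmas SD = subalgebraD[OF S_sub]

lemma I1_ideal: "y : I 1 ==> z : |E| ==> y *E z : I 1 & z *E y : I 1"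
 using I_mul[of y 1 z 0] I_mul[of z 0 y 1] I_zero by auto

text \<open>The projection to \<open>S\<close> along the ideal \<open>I 1\<close>.\<close>

definition sp :: "'a => 'a" where
 "sp y = (SOME s. s : S & (EX z:I 1. y = s +E z))"

lemma sp_eq: "s : S ==> z : I 1 ==> sp (s +E z) = s"
proof -
 assume s: "s : S" and z: "z : I 1"
 have ex: "EX s'. s' : S & (EX z':I 1. s +E z = s' +E z')" using s z by blast
 obtain z' where z': "sp (s +E z) : S" "z' : I 1" "s +E z = sp (s +E z) +E z'"
  using someI_ex[OF ex] unfolding sp_def by blast
 let ?t = "sp (s +E z)"
 have c: "s : |E|" "z : |E|" "?t : |E|" "z' : |E|" using s z z' SD(1) ID(1) by auto
 have "s -[E] ?t = (s +E z) -[E] (?t +E z)" using c by (simp add: M.minus_eq M.minus_add M.a_ac M.r_neg M.r_neg2)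
 also have "... = (?t +E z') -[E] (?t +E z)" using z'(3) by simp
 also have "... = z' -[E] z" using c by (simp add: M.minus_eq M.minus_add M.a_ac M.r_neg M.r_neg2)
 finally have eq: "s -[E] ?t = z' -[E] z" .
 have "s -[E] ?t : S"
  using SD(3)[OF s SD(5)[of "\<ominus> \<one>", OF _ z'(1)]] c neg_eq_smult[of ?t] by (simp add: M.minus_eq)
 moreover have "z' -[E] z : I 1" using ID(3)[OF z'(2) ID(5)[OF z]] by (simp add: M.minus_eq)
 ultimately have "s -[E] ?t = 0E" using S_int eq by auto
 thus ?thesis using c by (simp add: E.r_right_minus_eq)
qed

lemma sp_props: "y : |E| ==> sp y : S & (EX z:I 1. y = sp y +E z)"
 using S_sum[of y] sp_eq by auto

lemma sp_closed [simp, intro]: "y : |E| ==> sp y : |E|"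
 using sp_props SD(1) by blast

lemma sp_S: "s : S ==> sp s = s"
 using sp_eq[of s "0E"] SD(1) ID(2) by simp

lemma sp_I: "z : I 1 ==> sp z = 0E"
 using sp_eq[of "0E" z] SD(2) ID(1) by simp

lemma sp_add: "x : |E| ==> y : |E| ==> sp (x +E y) = sp x +E sp y"
proof -
 assume x: "x : |E|" and y: "y : |E|"
 obtain z w where z: "z : I 1" "x = sp x +E z" "w : I 1" "y = sp y +E w" using sp_props x y by blast
 have "(sp x +E z) +E (sp y +E w) = (sp x +E sp y) +E (z +E w)"
  using x y z(1,3) ID(1) by (simp add: M.a_ac)
 hence "x +E y = (sp x +E sp y) +E (z +E w)" using z(2,4) by simp
 thus ?thesis using sp_eq[OF SD(3) ID(3)[OF z(1,3)]] sp_props x y by metis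
qed

lemma sp_mul: "x : |E| ==> y : |E| ==> sp (x *E y) = sp x *E sp y"
proof -
 assume x: "x : |E|" and y: "y : |E|"
 obtain z w where z: "z : I 1" "x = sp x +E z" "w : I 1" "y = sp y +E w" using sp_props x y by blast
 have c: "z : |E|" "w : |E|" using z ID(1) by auto
 have "(sp x +E z) *E (sp y +E w) = sp x *E sp y +E (z *E (sp y +E w) +E sp x *E w)"
  using x y c by (simp add: E.l_distr E.r_distr M.a_ac)
 hence "x *E y = sp x *E sp y +E (z *E y +E sp x *E w)" using z(2,4) by simp
 moreover have "z *E y +E sp x *E w : I 1" using I1_ideal z x y by (intro ID(3)) auto
 ultimately show ?thesis using sp_eq[OF SD(4)] sp_props x y by metis
qed

lemma nilp_idem_I1: "y : I 1 ==> y *E y = y ==> y = 0E"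
proof -
 assume y: "y : I 1" "y *E y = y"
 have "y : I (Suc n)" for n using y I_mul[of y "Suc _" y 1] by (induction n) auto
 thus ?thesis using I_end[of "Suc N"] by auto
qed

lemma one_S: "1E : S"
proof -
 obtain z where z: "z : I 1" "1E = sp 1E +E z" using sp_props by blast
 have c: "z : |E|" "sp 1E : |E|" using z ID(1) by auto
 have idem: "sp 1E *E sp 1E = sp 1E" using sp_mul[of "1E" "1E"] by simp
 have "sp 1E = sp 1E *E (sp 1E +E z)" using c z(2) by (metis E.r_one)
 hence "sp 1E +E sp 1E *E z = sp 1E" using c idem by (simp add: E.r_distr)
 hence 0: "sp 1E *E z = 0E" using c by (simp add: M.add.l_cancel_one')
 have "z = (sp 1E +E z) *E z" using c z(2) by (metis E.l_one)
 hence "z = z *E z" using c 0 by (simp add: E.l_distr)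
 hence "z = 0E" using nilp_idem_I1[OF z(1)] by simp
 thus ?thesis using z c sp_props[of "1E"] by simp
qed

lemma sp_one: "sp 1E = 1E"
 using sp_S one_S by blast

text \<open>Elements congruent to the identity modulo the nilpotent ideal \<open>I 1\<close> are invertible.\<close>

lemma unipotent_left_inverse:
 assumes u: "u : |E|" "sp u = 1E"
 shows "EX v:|E|. v *E u = 1E & sp v = 1E"
proof -
 have "EX v m. v : |E| & m : I (Suc k) & v *E u = 1E +E m" for k
 proof (induction k)
  case 0
  obtain z where z: "z : I 1" "u = 1E +E z" using sp_props[OF u(1)] u(2) by auto
  thus ?case using u by (intro exI[of _ "1E"] exI[of _ z]) auto
 next
  case (Suc k)
  then obtain v m where v: "v : |E|" "m : I (Suc k)" "v *E u = 1E +E m" by blast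
  have m: "m : |E|" using v ID(1) by blast
  have "((1E -[E] m) *E v) *E u = (1E -[E] m) *E (1E +E m)" using v m u by (simp add: E.m_assoc)
  also have "... = 1E +E (\<ominus>\<^bsub>E\<^esub> (m *E m))"
   using m by (simp add: M.minus_eq E.l_distr E.r_distr E.l_minus M.a_assoc M.r_neg2 M.r_neg1)
  finally have "((1E -[E] m) *E v) *E u = 1E +E (\<ominus>\<^bsub>E\<^esub> (m *E m))" .
  moreover have "\<ominus>\<^bsub>E\<^esub> (m *E m) : I (Suc (Suc k))"
   using ID(5)[OF I_mul[OF v(2,2)]] I_mono[of "Suc (Suc k)" "Suc k + Suc k"] by auto
  moreover have "(1E -[E] m) *E v : |E|" using v m by simp
  ultimately show ?case by (intro exI conjI)
 qed
 from this[of N] obtain v m where v: "v : |E|" "m : I (Suc N)" "v *E u = 1E +E m" by (elim exE conjE)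
 hence vu: "v *E u = 1E" using I_end[of "Suc N"] by simp
 hence "sp v *E sp u = 1E" using sp_mul[OF v(1) u(1)] sp_one by simp
 hence "sp v = 1E" using u v by simp
 thus ?thesis using v vu by blast
qed

lemma unipotent_inverse:
 assumes u: "u : |E|" "sp u = 1E"
 shows "EX v:|E|. v *E u = 1E & u *E v = 1E"
proof -
 obtain v where v: "v : |E|" "v *E u = 1E" "sp v = 1E" using unipotent_left_inverse[OF u] by blast
 obtain w where w: "w : |E|" "w *E v = 1E" using unipotent_left_inverse[OF v(1,3)] by blast
 have "w = w *E (v *E u)" using v w by simp
 also have "... = (w *E v) *E u" by (rule mul_assoc[OF w(1) v(1) u(1), symmetric])
 also have "... = u" using w u by simp
 finally show ?thesis using v w by blast
qed

subsection \<open>Moving the primitive idempotents into \<open>S\<close>\<close>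

lemma P_props:
 shows "p : P ==> p : |E|" "p : P ==> p ~= 0E" "p : P ==> p *E p = p"
  "p : P ==> q : P ==> p ~= q ==> p *E q = 0E"
  "finite P" "(S[E, P] %p. p) = 1E"
proof -
 have prim: "p : |E| & p ~= 0E & p *E p = p" if "p : P" for p
  using P_family that by (auto simp: basic_family_def primitive_idempotent_def)
 thus "p : P ==> p : |E|" "p : P ==> p ~= 0E" "p : P ==> p *E p = p" by auto
 have orth: "p *E q = 0E" if "p : P" "q : P" "p ~= q" for p q
  using P_family that by (simp add: basic_family_def)
 thus "p : P ==> q : P ==> p ~= q ==> p *E q = 0E" by auto
 have "ALL x:|E|. EX F<=P. finite F & (S[E, F] %nu. nu) *E x = x & x *E (S[E, F] %nu. nu) = x"
  using P_family by (simp add: basic_family_def)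
 then obtain F where F: "F <= P" "finite F" "(S[E, F] %p. p) *E 1E = 1E" using E.one_closed by blast
 have Fc: "(S[E, F] %p. p) : |E|" using F prim by (intro M.finsum_closed) auto
 hence sum: "(S[E, F] %p. p) = 1E" using F by simp
 have "P <= F"
 proof
  fix q assume q: "q : P"
  show "q : F"
  proof (rule ccontr)
   assume "q ~: F"
   have "(S[E, F] %p. q *E p) = 0E"
    using F q \<open>q ~: F\<close> by (intro M.add.finprod_one_eqI orth) auto
   moreover have "q *E (S[E, F] %p. p) = (S[E, F] %p. q *E p)" using F q prim by (intro finsum_mul_r) auto
   ultimately show False using sum prim[OF q] by simp
  qed
 qed
 hence "P = F" using F by blast
 thus "finite P" "(S[E, P] %p. p) = 1E" using F sum by auto
qed

lemma P_primitive:
 assumes p: "p : P" and x: "x : |E|" "x *E x = x" "p *E x = x" "x *E p = x"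
 shows "x = 0E \<or> x = p"
proof (rule ccontr)
 assume n: "~ (x = 0E \<or> x = p)"
 note pc = P_props(1)[OF p] P_props(3)[OF p]
 let ?y = "p -[E] x"
 have eqs: "?y *E ?y = ?y" "x *E ?y = 0E" "?y *E x = 0E" "p = x +E ?y"
  using x pc by (simp_all add: M.minus_eq E.l_distr E.r_distr E.l_minus E.r_minus M.r_neg M.a_ac M.r_neg2)
 have "?y : |E|" "?y ~= 0E" using x pc n by (auto simp: E.r_right_minus_eq)
 moreover have "primitive_idempotent E p" using P_family p by (simp add: basic_family_def)
 ultimately show False using eqs x n unfolding primitive_idempotent_def by blast
qed

text \<open>Since \<open>cu * p = sp p * p = sp p * cu\<close>, conjugation with this element takes \<open>p\<close> to \<open>sp
p\<close>.\<close>

definition cu :: 'a where "cu = (S[E, P] %p. sp p *E p)"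
definition cv :: 'a where "cv = (SOME v. v : |E| & v *E cu = 1E & cu *E v = 1E)"

lemma sp_finsum: "finite F ==> f : F \<rightarrow> |E| ==> sp (finsum E f F) = (S[E, F] %i. sp (f i))"
proof (induction F rule: finite_induct)
 case (insert i F)
 hence "(S[E, insert i F] %i. sp (f i)) = sp (f i) +E (S[E, F] %i. sp (f i))" by (intro M.finsum_insert) auto
 thus ?case using insert by (simp add: sp_add Pi_iff M.finsum_insert)
qed (simp add: sp_I ID(2))

lemma sp_P: "p : P ==> q : P ==> sp p *E sp q = (if p = q then sp p else 0E)"
 using sp_mul[of p q, symmetric] P_props(1,3,4) sp_I[OF ID(2)] by auto

lemma cu_props: "cu : |E|" "p : P ==> sp p *E cu = cu *E p" "sp cu = 1E"
proof -
 have f: "(%p. sp p *E p) : P \<rightarrow> |E|" using P_props(1) by auto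
 thus c: "cu : |E|" unfolding cu_def by (rule M.finsum_closed)
 have "sp cu = (S[E, P] %p. sp (sp p *E p))" unfolding cu_def by (rule sp_finsum[OF P_props(5) f])
 also have "... = (S[E, P] %p. sp p)"
 proof (rule M.finsum_cong'[OF refl])
  fix p assume p: "p : P"
  thus "sp (sp p *E p) = sp p" using P_props(1)[OF p] sp_props[of p] sp_P[of p p] by (simp add: sp_mul sp_S)
 qed (use P_props(1) in auto)
 also have "... = sp (S[E, P] %p. p)" using P_props(1,5) by (intro sp_finsum[symmetric]) auto
 finally show "sp cu = 1E" using P_props(6) sp_one by simp
 assume p: "p : P"
 note pc = P_props(1)[OF p]
 have t: "sp p *E p : |E|" using pc by simp
 have "sp p *E cu = (S[E, P] %q. sp p *E (sp q *E q))"
  unfolding cu_def using P_props(5) f pc by (intro finsum_mul_r) auto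
 also have "... = sp p *E p"
 proof (rule M.finsum_single[OF P_props(5) t, of p])
  show "sp p *E (sp q *E q) = 0E" if "q : P" "q ~= p" for q
   using that pc P_props(1)[OF that(1)] sp_P[OF p that(1)] by (simp add: E.m_assoc[symmetric])
  show "sp p *E (sp p *E p) = sp p *E p" using pc sp_P[OF p p] by (simp add: E.m_assoc[symmetric])
 qed (use p in simp)
 also have "... = (S[E, P] %q. (sp q *E q) *E p)"
 proof (rule M.finsum_single[OF P_props(5) t, of p, symmetric])
  show "(sp q *E q) *E p = 0E" if "q : P" "q ~= p" for q
   using that pc P_props(1)[OF that(1)] P_props(4)[OF that(1) p that(2)] by (simp add: E.m_assoc)
  show "(sp p *E p) *E p = sp p *E p" using pc P_props(3)[OF p] by (simp add: E.m_assoc)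
 qed (use p in simp)
 also have "... = cu *E p" unfolding cu_def using P_props(5) f pc by (intro finsum_mul_l[symmetric]) auto
 finally show "sp p *E cu = cu *E p" .
qed

lemma cv_props: "cv : |E|" "cv *E cu = 1E" "cu *E cv = 1E" "p : P ==> cv *E sp p = p *E cv"
proof -
 have "EX v. v : |E| & v *E cu = 1E & cu *E v = 1E" using unipotent_inverse[OF cu_props(1,3)] by blast
 from someI_ex[OF this] show c: "cv : |E|" "cv *E cu = 1E" "cu *E cv = 1E" unfolding cv_def by auto
 assume p: "p : P"
 note pc = P_props(1)[OF p]
 have "cv *E sp p = cv *E (sp p *E cu) *E cv" using c pc cu_props(1) by (simp add: E.m_assoc)
 also have "... = p *E cv" unfolding cu_props(2)[OF p] using c pc cu_props(1) by (simp add: E.m_assoc[symmetric])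
 finally show "cv *E sp p = p *E cv" .
qed

lemma sp_P_nonzero: "p : P ==> sp p ~= 0E"
proof
 assume p: "p : P" and 0: "sp p = 0E"
 hence "p : I 1" using sp_props[OF P_props(1)[OF p]] ID(1) by force
 thus False using nilp_idem_I1[of p] P_props(2,3)[OF p] by simp
qed

lemma sp_P_primitive:
 assumes p: "p : P" and x: "x : |E|" "x *E x = x" "sp p *E x = x" "x *E sp p = x"
 shows "x = 0E \<or> x = sp p"
proof -
 note c = cu_props(1) cv_props(1-3) P_props(1)[OF p]
 let ?y = "cv *E (x *E cu)"
 have rt: "cu *E (?y *E cv) = x"
 proof -
  have "cu *E (?y *E cv) = (cu *E cv) *E (x *E (cu *E cv))" using c(1,2) x(1) by (simp add: E.m_assoc)
  thus ?thesis using c x by simp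
 qed
 have "?y *E ?y = cv *E ((x *E (cu *E cv)) *E (x *E cu))" using c(1,2) x(1) by (simp add: E.m_assoc)
 hence 1: "?y *E ?y = ?y" using c x by (simp add: E.m_assoc[symmetric])
 have "p *E ?y = (p *E cv) *E (x *E cu)" using c(1,2,5) x(1) by (simp add: E.m_assoc)
 also have "... = cv *E ((sp p *E x) *E cu)" unfolding cv_props(4)[OF p, symmetric] using c(1,2,5) x(1) by (simp add: E.m_assoc)
 finally have 2: "p *E ?y = ?y" using x by simp
 have "?y *E p = cv *E (x *E (cu *E p))" using c(1,2,5) x(1) by (simp add: E.m_assoc)
 also have "... = cv *E ((x *E sp p) *E cu)" unfolding cu_props(2)[OF p, symmetric] using c(1,2,5) x(1) by (simp add: E.m_assoc)
 finally have 3: "?y *E p = ?y" using x by simp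
 have "?y = 0E \<or> ?y = p" using P_primitive[OF p _ 1 2 3] c(1,2) x(1) by simp
 thus ?thesis
 proof
  assume "?y = 0E"
  thus ?thesis using rt c by simp
 next
  assume y: "?y = p"
  have "cu *E (p *E cv) = (cu *E p) *E cv" using c(1,2,5) by (simp add: E.m_assoc)
  also have "... = sp p *E (cu *E cv)" unfolding cu_props(2)[OF p, symmetric] using c(1,2,5) by (simp add: E.m_assoc)
  finally show ?thesis using rt y c by simp
 qed
qed

lemma sp_P_not_equivalent:
 assumes p: "p : P" and q: "q : P" and ne: "p ~= q"
  and s: "s : |E|" "sp p *E s = s" "s *E sp q = s"
  and t: "t : |E|" "sp q *E t = t" "t *E sp p = t"
 shows "~ (s *E t = sp p & t *E s = sp q)"
proof
 assume st: "s *E t = sp p & t *E s = sp q"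
 have conj: "(cv *E (a *E cu)) *E (cv *E (b *E cu)) = cv *E ((a *E b) *E cu)"
  if "a : |E|" "b : |E|" for a b
 proof -
  have "(cv *E (a *E cu)) *E (cv *E (b *E cu)) = cv *E (a *E ((cu *E cv) *E (b *E cu)))"
   using that cu_props(1) cv_props(1) by (simp add: E.m_assoc)
  thus ?thesis using that cu_props(1) cv_props(1,3) by (simp add: E.m_assoc)
 qed
 have conjP: "cv *E (sp r *E cu) = r" if r: "r : P" for r
  unfolding cu_props(2)[OF r] using P_props(1)[OF r] cu_props(1) cv_props(1,2) by (simp add: E.m_assoc[symmetric])
 let ?s = "cv *E (s *E cu)" and ?t = "cv *E (t *E cu)"
 have c: "?s : |E|" "?t : |E|" using s t cu_props(1) cv_props(1) by auto
 have pc: "p : |E|" "q : |E|" using P_props(1) p q by auto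
 have st': "?s *E ?t = p" "?t *E ?s = q" using conj[of s t] conj[of t s] conjP p q s t st by auto
 have s': "?s *E q = ?s" using conj[of s "sp q"] conjP[OF q] s pc by simp
 have t': "?t *E p = ?t" using conj[of t "sp p"] conjP[OF p] t pc by simp
 have "lmod_iso E (left_proj E p) (left_proj E q)"
  by (rule left_proj_iso[OF pc P_props(3)[OF p] P_props(3)[OF q] c s' t' st'])
 thus False using P_family p q ne by (simp add: basic_family_def)
qed

end

context basic_split begin

interpretation E: ring E by (rule E_ring)

text \<open>As the idempotents are primitive, the regularity of \<open>S\<close> makes a nonzero corner element one half of an
isomorphism between the projectives of \<open>sp p\<close> and \<open>sp q\<close>.\<close>

lemma corner_inverse:
 assumes p: "p : P" and q: "q : P" and s: "s : S" "sp p *E s = s" "s *E sp q = s" "s ~= 0E"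
 shows "EX t:|E|. sp q *E t = t & t *E sp p = t & s *E t = sp p & t *E s = sp q"
proof -
 have c: "s : |E|" "sp p : |E|" "sp q : |E|" using SD(1)[OF s(1)] P_props(1) p q by auto
 have pp: "sp p *E sp p = sp p" "sp q *E sp q = sp q" using sp_P p q by auto
 obtain r where r: "r : S" "s = s *E (r *E s)" using semisimple_regular[OF S_sub S_semisimple s(1)] by blast
 have rc: "r : |E|" using SD(1)[OF r(1)] .
 let ?t = "sp q *E (r *E sp p)"
 have tc: "?t : |E|" using c rc by simp
 have st: "s *E ?t = s *E (r *E sp p)"
 proof -
  have "s *E ?t = (s *E sp q) *E (r *E sp p)" using c rc by (simp add: E.m_assoc)
  thus ?thesis using s by simp
 qed
 have ts: "?t *E s = sp q *E (r *E s)" using c rc s by (simp add: E.m_assoc)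
 have sts: "(s *E ?t) *E s = s"
 proof -
  have "(s *E ?t) *E s = s *E (r *E (sp p *E s))" unfolding st using c rc by (simp add: E.m_assoc)
  thus ?thesis using s r by simp
 qed
 have 1: "s *E ?t = 0E \<or> s *E ?t = sp p"
 proof (rule sp_P_primitive[OF p])
  show "s *E ?t : |E|" using c tc by simp
  have "(s *E ?t) *E (s *E ?t) = ((s *E ?t) *E s) *E ?t" using c tc by (simp only: mul_assoc mul_closed)
  thus "(s *E ?t) *E (s *E ?t) = s *E ?t" by (simp only: sts)
  have "sp p *E (s *E ?t) = (sp p *E s) *E ?t" using c tc by (simp only: mul_assoc mul_closed)
  thus "sp p *E (s *E ?t) = s *E ?t" by (simp only: s)
  show "(s *E ?t) *E sp p = s *E ?t" unfolding st using c rc pp by (simp add: E.m_assoc)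
 qed
 have 2: "?t *E s = 0E \<or> ?t *E s = sp q"
 proof (rule sp_P_primitive[OF q])
  show "?t *E s : |E|" using c tc by simp
  have "(?t *E s) *E (?t *E s) = ?t *E ((s *E ?t) *E s)" using c tc by (simp only: mul_assoc mul_closed)
  thus "(?t *E s) *E (?t *E s) = ?t *E s" by (simp only: sts)
  show "(?t *E s) *E sp q = ?t *E s" using mul_assoc[OF tc c(1,3)] s by simp
  show "sp q *E (?t *E s) = ?t *E s" unfolding ts using c rc pp by (simp add: E.m_assoc[symmetric])
 qed
 have "s *E ?t = sp p" using 1 sts s(4) c by auto
 moreover have "?t *E s = sp q"
 proof -
  have "s *E (?t *E s) = s" using sts mul_assoc[OF c(1) tc c(1)] by simp
  thus ?thesis using 2 s(4) c by auto
 qed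
 moreover have "sp q *E ?t = ?t" "?t *E sp p = ?t" using c rc pp by (simp_all add: E.m_assoc[symmetric]) (simp add: E.m_assoc)
 ultimately show ?thesis using tc by blast
qed

text \<open>For \<open>p \<noteq> q\<close> an isomorphism is excluded because the algebra is basic; for \<open>p = q\<close> the
corner is a division algebra of finite dimension.\<close>

lemma S_corner:
 assumes p: "p : P" and q: "q : P" and s: "s : S"
 shows "EX k:KC. sp p *E (s *E sp q) = (if p = q then k .*E sp p else 0E)"
proof -
 have pS: "sp r : S" if "r : P" for r using sp_props P_props(1)[OF that] by blast
 note c = SD(1)[OF s] SD(1)[OF pS[OF p]] SD(1)[OF pS[OF q]]
 let ?s = "sp p *E (s *E sp q)"
 have sS: "?s : S" using SD(4) pS p q s by simp
 have sc: "?s : |E|" using SD(1)[OF sS] .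
 have sl: "sp p *E ?s = ?s" using c sp_P[OF p p] by (simp add: E.m_assoc[symmetric])
 have sr: "?s *E sp q = ?s" using c sp_P[OF q q] by (simp add: E.m_assoc)
 show ?thesis
 proof (cases "p = q")
  case False
  have "?s = 0E"
  proof (rule ccontr)
   assume "?s ~= 0E"
   then obtain t where "t : |E|" "sp q *E t = t" "t *E sp p = t" "?s *E t = sp p" "t *E ?s = sp q"
    using corner_inverse[OF p q sS sl sr] by blast
   thus False using sp_P_not_equivalent[OF p q False sc sl sr] by blast
  qed
  thus ?thesis using False by auto
 next
  case True
  obtain fs where fs: "set fs <= |E|" "ALL W. submodule W K E --> set fs <= W --> W = |E|" using E_fin_gen by blast
  have whole: "submodule ( |E|) K E" by (rule subspaceI) auto
  have null: "submodule {0E} K E" by (rule subspaceI) auto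
  have fold: "submodule (fold (%f W. adjoin W f) gs W) K E & W \<union> set gs <= fold (%f W. adjoin W f) gs W"
   if "submodule W K E" "set gs <= |E|" for gs W
   using that
  proof (induction gs arbitrary: W)
   case (Cons g gs)
   hence g: "g : |E|" by simp
   show ?case using Cons.IH[OF adjoin_sub[OF Cons.prems(1) g]] adjoin_sup[OF Cons.prems(1) g] Cons.prems(2) by auto
  qed simp
  have "|E| <= fold (%f W. adjoin W f) fs {0E}" using fold[OF null fs(1)] fs(2) by auto
  then obtain n x kp where ds: "dual_system ( |E|) {0E} n x kp"
   using dual_system_exists[OF whole null fs(1)] by blast
  obtain cs where cs: "set cs <= KC" "cs ~= []" "last cs ~= \<zero>" "act (sp p) ?s cs = 0E"
   using annihilating_polynomial[OF c(2) sc ds] by blast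
  have "EX k:KC. ?s = k .*E sp p"
  proof (rule scalar_of_division[OF K_closed c(2) _ sp_P_nonzero[OF p] sc sl _ _ cs])
   show "sp p *E sp p = sp p" using sp_P[OF p p] by simp
   show "?s *E sp p = ?s" using sr True by simp
   fix k assume k: "k : KC" and ne: "?s +E k .*E sp p ~= 0E"
   have "?s +E k .*E sp p : S" using SD(3)[OF sS SD(5)[OF k pS[OF p]]] .
   moreover have "sp p *E (?s +E k .*E sp p) = ?s +E k .*E sp p"
    using mul_distr[OF c(2) sc] sl k c sp_P[OF p p] by (simp add: mul_smult_r)
   moreover have "(?s +E k .*E sp p) *E sp p = ?s +E k .*E sp p"
    using mul_distl[OF sc _ c(2)] sr True k c sp_P[OF p p] by (simp add: mul_smult_l)
   ultimately show "EX d:|E|. d *E (?s +E k .*E sp p) = sp p"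
    using corner_inverse[OF p p _ _ _ ne] by blast
  qed
  thus ?thesis using True by auto
 qed
qed

lemma S_coordinates:
 assumes s: "s : S"
 shows "EX c. (ALL p:P. c p : KC) & s = (S[E, P] %p. c p .*E sp p)"
proof -
 have pc: "sp p : |E|" if "p : P" for p using P_props(1)[OF that] by simp
 note sc = SD(1)[OF s]
 have "ALL p:P. EX k:KC. sp p *E (s *E sp p) = k .*E sp p" using S_corner[OF _ _ s] by (metis (full_types))
 then obtain c where c: "!!p. p : P ==> c p : KC & sp p *E (s *E sp p) = c p .*E sp p" by metis
 have one: "(S[E, P] %p. sp p) = 1E"
  using sp_finsum[OF P_props(5), of "%p. p"] P_props(1,6) sp_one by auto
 have l: "sp p *E s = c p .*E sp p" if p: "p : P" for p
 proof -
  have "sp p *E s = sp p *E (s *E (S[E, P] %q. sp q))" using sc by (simp add: one)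
  also have "s *E (S[E, P] %q. sp q) = (S[E, P] %q. s *E sp q)" using P_props(5) pc sc by (intro finsum_mul_r) auto
  also have "sp p *E ... = (S[E, P] %q. sp p *E (s *E sp q))" using P_props(5) pc sc p by (intro finsum_mul_r) auto
  also have "... = c p .*E sp p"
  proof (rule M.finsum_single[OF P_props(5), of _ p])
   show "sp p *E (s *E sp q) = 0E" if "q : P" "q ~= p" for q using S_corner[OF p that(1) s] that(2) by auto
  qed (use c pc p in auto)
  finally show ?thesis .
 qed
 have "s = (S[E, P] %p. sp p) *E s" using sc by (simp add: one)
 also have "... = (S[E, P] %p. sp p *E s)" using P_props(5) pc sc by (intro finsum_mul_l) auto
 also have "... = (S[E, P] %p. c p .*E sp p)" using l c pc by (intro M.finsum_cong') auto
 finally show ?thesis using c by blast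
qed

lemma primitive_idempotents_S: "{f. primitive_idempotent (E<|S) f} = sp ` P"
proof
 have pc: "sp p : |E|" if "p : P" for p using P_props(1)[OF that] by simp
 have pS: "sp p : S" if "p : P" for p using sp_props P_props(1)[OF that] by blast
 show "sp ` P <= {f. primitive_idempotent (E<|S) f}"
 proof clarify
  fix p assume p: "p : P"
  have False if y: "y : S" "y ~= 0E" "y *E y = y" and z: "z : S" "z ~= 0E"
   and yz: "y *E z = 0E" "z *E y = 0E" "sp p = y +E z" for y z
  proof -
   have c: "y : |E|" "z : |E|" using y z SD(1) by auto
   have "sp p *E y = y" "y *E sp p = y" using c y yz by (simp_all add: E.l_distr E.r_distr)
   hence "y = sp p" using sp_P_primitive[OF p c(1) y(3)] y(2) by blast
   hence "y +E z = y" using yz(3) by simp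
   thus False using c z(2) M.add.l_cancel_one'[of y z] by auto
  qed
  thus "primitive_idempotent (E<|S) (sp p)"
   using p pS[OF p] sp_P_nonzero[OF p] sp_P[OF p p] unfolding primitive_idempotent_def by auto
 qed
 show "{f. primitive_idempotent (E<|S) f} <= sp ` P"
 proof clarify
  fix f assume prim: "primitive_idempotent (E<|S) f"
  hence f: "f : S" "f ~= 0E" "f *E f = f" by (simp_all add: primitive_idempotent_def)
  note fc = SD(1)[OF f(1)]
  obtain c where c: "ALL p:P. c p : KC" "f = (S[E, P] %p. c p .*E sp p)" using S_coordinates[OF f(1)] by blast
  have t: "c p .*E sp p : |E|" if "p : P" for p using c pc that by auto
  have mul: "f *E sp p = c p .*E sp p & sp p *E f = c p .*E sp p" if p: "p : P" for p
  proof
   have "f *E sp p = (S[E, P] %q. (c q .*E sp q) *E sp p)"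
    unfolding c(2) using P_props(5) t pc p by (intro finsum_mul_l) auto
   also have "... = c p .*E sp p"
    using c pc p t sp_P by (intro M.finsum_single[OF P_props(5), of _ p]) (auto simp: mul_smult_l)
   finally show "f *E sp p = c p .*E sp p" .
   have "sp p *E f = (S[E, P] %q. sp p *E (c q .*E sp q))"
    unfolding c(2) using P_props(5) t pc p by (intro finsum_mul_r) auto
   also have "... = c p .*E sp p"
    using c pc p t sp_P by (intro M.finsum_single[OF P_props(5), of _ p]) (auto simp: mul_smult_r)
   finally show "sp p *E f = c p .*E sp p" .
  qed
  have "EX p:P. f *E sp p ~= 0E"
  proof (rule ccontr)
   assume "~ (EX p:P. f *E sp p ~= 0E)"
   hence "c p .*E sp p = 0E" if "p : P" for p using mul[OF that] that by auto
   hence "f = 0E" unfolding c(2) by (rule M.add.finprod_one_eqI)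
   thus False using f by simp
  qed
  then obtain p where p: "p : P" "f *E sp p ~= 0E" by blast
  let ?y = "f *E sp p"
  note m = mul[OF p(1)] and ppc = pc[OF p(1)]
  have yc: "?y : |E|" using fc ppc by simp
  have fy: "f *E ?y = ?y" using mul_assoc[OF fc fc ppc] f by simp
  have y: "sp p *E ?y = ?y" "?y *E sp p = ?y"
   using sp_P[OF p(1) p(1)] m c(1) p(1) ppc by (simp_all add: mul_smult_l mul_smult_r)
  have yf: "?y *E f = ?y" using mul_assoc[OF fc ppc fc] m fy by simp
  have yy: "?y *E ?y = ?y" using mul_assoc[OF fc ppc yc] y fy by simp
  have yp: "?y = sp p" using sp_P_primitive[OF p(1) yc yy y] p(2) by blast
  let ?z = "f -[E] ?y"
  have zc: "?z : |E|" using fc yc by simp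
  have zS: "?z : S" using SD(3)[OF f(1) SD(5)[of "\<ominus> \<one>", OF _ pS[OF p(1)]]] neg_eq_smult[OF yc] yp by (simp add: M.minus_eq)
  have "?y *E ?z = 0E"
   unfolding M.minus_eq mul_distr[OF yc fc M.a_inv_closed[OF yc]] E.r_minus[OF yc yc] yf yy by (rule M.r_neg[OF yc])
  moreover have "?z *E ?y = 0E"
   unfolding M.minus_eq mul_distl[OF fc M.a_inv_closed[OF yc] yc] E.l_minus[OF yc yc] fy yy by (rule M.r_neg[OF yc])
  moreover have "?z *E ?z = ?z"
   using mul_distr[OF zc fc M.a_inv_closed[OF yc]] mul_distl[OF fc M.a_inv_closed[OF yc] fc] \<open>?z *E ?y = 0E\<close>
    f yf yc fc zc E.r_minus[OF zc yc] E.l_minus[OF yc fc] by (simp add: M.minus_eq)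
  moreover have "f = ?y +E ?z" using fc yc by (simp add: M.minus_eq M.a_ac M.r_neg2 M.r_neg1 M.r_neg)
  moreover have "?y : S" using yp pS[OF p(1)] by simp
  ultimately have "?z = 0E" using prim p(2) zS yy unfolding primitive_idempotent_def by auto
  hence "f = ?y" using fc yc E.r_right_minus_eq by blast
  hence "f = sp p" using yp by (rule trans)
  thus "f : sp ` P" using p(1) by simp
 qed
qed

theorem split_filteredI:
 assumes e: "bij_betw e V {f. primitive_idempotent (E<|S) f}"
 shows "split_filtered K E I N V e S"
proof (intro split_filtered.intro split_filtered_axioms.intro filtered_axioms S_sub S_sum E_fin_gen)
 have pc: "sp p : |E|" if "p : P" for p using P_props(1)[OF that] by simp
 have pS: "sp p : S" if "p : P" for p using sp_props P_props(1)[OF that] by blast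
 have bij: "inj_on e V" "e ` V = sp ` P" using e primitive_idempotents_S by (auto simp: bij_betw_def)
 have inj: "inj_on sp P"
 proof (rule inj_onI)
  fix p q assume pq: "p : P" "q : P" "sp p = sp q"
  thus "p = q" using sp_P[OF pq(1,2)] sp_P[OF pq(1,1)] sp_P_nonzero[OF pq(1)] by (cases "p = q") auto
 qed
 have ev: "EX p:P. e v = sp p" if "v : V" for v using bij that by blast
 show "finite V" using bij P_props(5) by (metis finite_imageD finite_imageI)
 fix v assume v: "v : V"
 then obtain p where p: "p : P" "e v = sp p" using ev by blast
 show "e v : |E|" "e v *E e v = e v" "e v : S" using p pc pS sp_P by auto
 show "e v ~: I 1"
 proof
  assume "e v : I 1"
  hence "e v = 0E" using S_int pS p by auto
  thus False using sp_P_nonzero p by auto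
 qed
 fix w assume w: "w : V"
 then obtain q where q: "q : P" "e w = sp q" using ev by blast
 have vw: "v = w <-> p = q" using bij(1) inj v w p q by (metis inj_onD)
 show "e v *E e w = 0E" if "v ~= w" using that vw p q sp_P by simp
 show "EX k:KC. e v *E (s *E e w) = (if v = w then k .*E e v else 0E)" if "s : S" for s
  using S_corner[OF p(1) q(1) that] vw p q by auto
next
 have pc: "sp p : |E|" if "p : P" for p using P_props(1)[OF that] by simp
 have bij: "inj_on e V" "e ` V = sp ` P" using e primitive_idempotents_S by (auto simp: bij_betw_def)
 have inj: "inj_on sp P"
 proof (rule inj_onI)
  fix p q assume pq: "p : P" "q : P" "sp p = sp q"
  thus "p = q" using sp_P[OF pq(1,2)] sp_P[OF pq(1,1)] sp_P_nonzero[OF pq(1)] by (cases "p = q") auto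
 qed
 have "(S[E, V] %v. e v) = (S[E, e ` V] %f. f)" using bij pc by (subst M.finsum_reindex) auto
 also have "... = (S[E, P] %p. sp p)" unfolding bij(2) using inj pc by (subst M.finsum_reindex) auto
 also have "... = 1E" using sp_finsum[OF P_props(5), of "%p. p"] P_props(1,6) sp_one by auto
 finally have "(S[E, V] %v. e v) = 1E" .
 thus "(S[E, V] %v. e v) *E x = x" "x *E (S[E, V] %v. e v) = x" if "x : |E|" for x using that by simp_all
qed

end

subsection \<open>The first half of the proposition\<close>

theorem matrix_algebra_Delta_subalgebra:
 fixes K :: "'k ring" and A :: "('k, 'a) module"
 assumes K: "algebraically_closed K" and A: "fd_algebra K A" "basic_algebra A" and I: "semisimple_filtration A I N"
  and S: "maximal_semisimple_subalgebra K A S" "S \<inter> I 1 = {0[A]}" "S <+>\<^bsub>A\<^esub> I 1 = carrier A"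
  and e: "bij_betw e (V :: 'v set) {x. primitive_idempotent (A<|S) x}"
 shows "strong_exact_Delta_subalgebra TYPE('m) K (V \<times> UNIV) first_order
  (matrix_algebra A I N) (diagonal_entry A I N e) (band_subalgebra A I N S) (diagonal_entry A I N e)"
proof -
 interpret K: algebraically_closed K by (rule K)
 interpret A: ring A using A(1) by (simp add: fd_algebra_def)
 have mod: "module K A" using A(1) by (simp add: fd_algebra_def)
 interpret nalg K A
  by (intro nalg.intro nalg_axioms.intro mod K.field_axioms)
   (use A(1) in \<open>auto simp: fd_algebra_def A.m_assoc A.l_distr A.r_distr\<close>)
 note If = I[unfolded semisimple_filtration_def]
 have ideal: "ideal (I m) A" for m using If by blast
 have I_sub: "submodule (I m) K A" for m
 proof (rule subspaceI)
  interpret i: ideal "I m" A by (rule ideal)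
  show "I m <= carrier A" by (rule i.a_subset)
  show "0[A] : I m" by (rule i.zero_closed)
  show "x +[A] y : I m" if "x : I m" "y : I m" for x y using that by (rule i.a_closed)
  show "k .*[A] x : I m" if k: "k : carrier K" and x: "x : I m" for k x
  proof -
   have "k .*[A] x = (k .*[A] 1[A]) *[A] x" using k i.Icarr[OF x] by (simp add: mul_smult_l)
   thus ?thesis using i.I_l_closed[OF x, of "k .*[A] 1[A]"] k by simp
  qed
 qed
 interpret filtered K A I N
 proof (intro filtered.intro filtered_axioms.intro nalg_axioms I_sub)
  show "0 < N" "I 0 = carrier A" "!!x i y j. x : I i ==> y : I j ==> x *[A] y : I (i + j)"
   "!!m. N <= m ==> I m = {0[A]}" using If by blast+
  fix m show "I (Suc m) <= I m"
  proof (cases "m < N")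
   case False
   hence "I m = {0[A]}" "I (Suc m) = {0[A]}" using If by auto
   thus ?thesis by simp
  qed (use If in blast)
 qed
 obtain P where P: "basic_family A P (%x. x)" using A(2) by (auto simp: basic_algebra_def)
 have fg: "EX fs. set fs <= carrier A & (ALL W. submodule W K A --> set fs <= W --> W = carrier A)"
 proof -
  obtain F where F: "F <= carrier A" "finite F" "generated_submodule K A F = carrier A"
   using A(1) unfolding fd_algebra_def by blast
  obtain fs where fs: "set fs = F" using finite_list[OF F(2)] by blast
  have "W = carrier A" if W: "submodule W K A" "F <= W" for W
  proof -
   have "carrier A <= W" unfolding F(3)[symmetric] generated_submodule_def using W by blast
   thus ?thesis using subspaceD(1)[OF W(1)] by blast
  qed
  thus ?thesis using F(1) fs by blast
 qed
 interpret basic_split K A I N P S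
 proof (intro basic_split.intro basic_split_axioms.intro filtered_axioms A.ring_axioms K P S(2) fg)
  show "subalgebra K A S" "semisimple_algebra (A<|S)" using S(1) by (auto simp: maximal_semisimple_subalgebra_def)
  fix x assume "x : carrier A"
  hence "x : S <+>\<^bsub>A\<^esub> I 1" using S(3) by simp
  thus "EX s:S. EX y:I 1. x = s +[A] y" by (auto simp: set_add_def set_mult_def simp del: One_nat_def)
 qed
 interpret split_filtered K A I N V e S by (rule split_filteredI[OF e])
 obtain T :: "(('v \<times> 'v) \<times> nat \<times> nat) set" and x kp dg lv rv where "adapted K A I N V e S T x kp dg lv rv"
  using adapted_exists by blast
 thus ?thesis by (rule adapted.matrix_algebra_Delta)
qed

section \<open>Quotient algebras\<close>

context nalg begin

context
 fixes D :: "'l set"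
 assumes L_ring: "ring L" and D_ideal: "ideal D L"
begin

abbreviation "cls x \<equiv> D +>[L] x"

lemma ideal_subspace: "submodule D K L"
proof -
 interpret L: ring L by (rule L_ring)
 interpret D: ideal D L by (rule D_ideal)
 show ?thesis
 proof (rule subspaceI)
  show "k .*L x : D" if k: "k : KC" and x: "x : D" for k x
  proof -
   have "k .*L x = (k .*L 1[L]) *L x" using k D.Icarr[OF x] by (simp add: mul_smult_l)
   thus ?thesis using D.I_l_closed[OF x, of "k .*L 1[L]"] k by simp
  qed
 qed auto
qed

lemmas DD = subspaceD[OF ideal_subspace]

lemma quotient_sel:
 "carrier (quotient_algebra L D) = cls ` |L|" "0[quotient_algebra L D] = D" "1[quotient_algebra L D] = cls 1[L]"
 "x : |L| ==> y : |L| ==> cls x +[quotient_algebra L D] cls y = cls (x +L y)"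
 "x : |L| ==> y : |L| ==> cls x *[quotient_algebra L D] cls y = cls (x *L y)"
 "k : KC ==> x : |L| ==> k .*[quotient_algebra L D] cls x = cls (k .*L x)"
 "x : |L| ==> cls x = D <-> x : D"
 "x : |L| ==> y : |L| ==> cls x = cls y <-> (EX u:D. x = u +L y)"
proof -
 interpret L: ring L by (rule L_ring)
 interpret D: ideal D L by (rule D_ideal)
 show "carrier (quotient_algebra L D) = cls ` |L|" by (auto simp: quotient_algebra_def A_RCOSETS_def')
 show "0[quotient_algebra L D] = D" "1[quotient_algebra L D] = cls 1[L]" by (simp_all add: quotient_algebra_def)
 show "x : |L| ==> y : |L| ==> cls x +[quotient_algebra L D] cls y = cls (x +L y)"
  by (simp add: quotient_algebra_def D.a_rcos_sum)
 show "x : |L| ==> y : |L| ==> cls x *[quotient_algebra L D] cls y = cls (x *L y)"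
  by (simp add: quotient_algebra_def D.rcoset_mult_add)
 show "x : |L| ==> cls x = D <-> x : D" by (rule M.add_coset_eq_self_iff[OF DD(6)])
 show eq: "x : |L| ==> y : |L| ==> cls x = cls y <-> (EX u:D. x = u +L y)" for x y by (rule M.add_coset_eq_iff[OF DD(6)])
 assume k: "k : KC" and x: "x : |L|"
 have *: "cls (k .*L z) = cls (k .*L x)" if zx: "z : cls x" for z
 proof -
  obtain u where u: "u : D" "z = u +L x" using zx by (auto simp: M.add_coset_iff)
  hence "k .*L z = k .*L u +L k .*L x" using k x DD(1)[OF u(1)] by (simp add: smult_r_distr)
  thus ?thesis using eq[of "k .*L z" "k .*L x"] k x u DD(1)[OF u(1)] DD(4)[OF k u(1)] by auto
 qed
 have "x : cls x" using M.add_coset_self[OF DD(6) x] .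
 hence "(\<Union>z\<in>cls x. cls (k .*L z)) = cls (k .*L x)" using * by blast
 thus "k .*[quotient_algebra L D] cls x = cls (k .*L x)" by (simp add: quotient_algebra_def)
qed

lemma quotient_zero_cls: "0[quotient_algebra L D] = cls 0L"
 using quotient_sel(2,7) DD(2) M.zero_closed by blast

lemma nalg_quotient: "nalg K (quotient_algebra L D)"
proof -
 note sel = quotient_sel(1,4-6) quotient_zero_cls
 have "abelian_group (quotient_algebra L D)"
 proof (rule abelian_groupI)
  fix x assume "x : carrier (quotient_algebra L D)"
  then obtain y where "x = cls y" "y : |L|" by (auto simp: sel)
  thus "EX y:carrier (quotient_algebra L D). y +[quotient_algebra L D] x = 0[quotient_algebra L D]"
   by (intro bexI[of _ "cls (\<ominus>\<^bsub>L\<^esub> y)"]) (auto simp: sel M.l_neg)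
 qed (auto simp: sel M.a_ac)
 thus ?thesis
  by (intro nalg.intro module.intro module_axioms.intro nalg_axioms.intro R.is_cring field_axioms)
   (auto simp: sel smult_l_distr smult_r_distr smult_assoc1 mul_smult_l mul_smult_r mul_assoc mul_distl mul_distr)
qed

lemma ring_quotient: "ring (quotient_algebra L D)"
proof -
 interpret L: ring L by (rule L_ring)
 interpret E: nalg K "quotient_algebra L D" by (rule nalg_quotient)
 note sel = quotient_sel(1,3-6) quotient_zero_cls
 show ?thesis
  by (intro ringI E.M.abelian_group_axioms monoidI E.mul_closed E.mul_assoc E.mul_distl E.mul_distr) (auto simp: sel)
qed

end

end

section \<open>Path algebras\<close>

text \<open>The reindexing behind associativity of path multiplication: a path is cut into three pieces in two ways.\<close>

lemma (in abelian_monoid) finsum_triangle: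
 fixes n :: nat
 assumes "!!i j. i + j <= n ==> F i j : carrier G"
 shows "(\<Oplus>i\<in>{..n}. \<Oplus>j\<in>{..n - i}. F i j) = (\<Oplus>k\<in>{..n}. \<Oplus>i\<in>{..k}. F i (k - i))"
proof -
 let ?h = "%(k, i). (i, k - i)" and ?A = "Sigma {..n} (%k. {..k})"
 have im: "?h ` ?A = Sigma {..n} (%i. {..n - i})"
 proof
  show "Sigma {..n} (%i. {..n - i}) <= ?h ` ?A"
  proof (rule subsetI)
   fix p assume "p : Sigma {..n} (%i. {..n - i})"
   thus "p : ?h ` ?A" by (intro image_eqI[of _ _ "(fst p + snd p, fst p)"]) auto
  qed
 qed auto
 have inj: "inj_on ?h ?A" by (auto simp: inj_on_def)
 have "(\<Oplus>i\<in>{..n}. \<Oplus>j\<in>{..n - i}. F i j) = (\<Oplus>p\<in>?h ` ?A. F (fst p) (snd p))"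
  unfolding im using assms by (intro finsum_Sigma) auto
 also have "... = (\<Oplus>p\<in>?A. F (fst (?h p)) (snd (?h p)))"
  using assms inj by (intro finsum_reindex) auto
 also have "... = (\<Oplus>p\<in>?A. F (snd p) (fst p - snd p))"
  using assms by (intro finsum_cong') auto
 also have "... = (\<Oplus>k\<in>{..n}. \<Oplus>i\<in>{..k}. F i (k - i))"
  using assms by (intro finsum_Sigma[symmetric]) auto
 finally show ?thesis .
qed

locale path_alg = fin_digraph Q + K: field K for K :: "'k ring" and Q :: "('v, 'q) pre_digraph"
begin
abbreviation "Kc \<equiv> carrier K"

abbreviation "PA \<equiv> path_algebra K Q"
abbreviation carrier_PA ("|PA|") where "|PA| \<equiv> carrier PA"
abbreviation mult_PA (infixl "*PA" 70) where "x *PA y \<equiv> x *[PA] y"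
abbreviation add_PA (infixl "+PA" 65) where "x +PA y \<equiv> x +[PA] y"
abbreviation smult_PA (infixl ".*PA" 70) where "k .*PA x \<equiv> k .*[PA] x"
abbreviation zero_PA ("0PA") where "0PA \<equiv> 0[PA]"
abbreviation one_PA ("1PA") where "1PA \<equiv> 1[PA]"

abbreviation "paths \<equiv> quiver_paths Q"

lemma cas_append: "cas u (p @ q) v <-> cas u p (awlast u p) & cas (awlast u p) q v"
 by (induction p arbitrary: u) auto

lemma awlast_append: "awlast u (p @ q) = awlast (awlast u p) q"
 by (induction p arbitrary: u) auto

lemma paths_iff: "(u, p) : paths <-> u : verts Q & set p <= arcs Q & cas u p (awlast u p)"
 by (auto simp: quiver_paths_def awalk_def awlast_if_cas)

lemma paths_append: "(u, p @ q) : paths <-> (u, p) : paths & (awlast u p, q) : paths"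
 unfolding paths_iff cas_append awlast_append
 using awlast_in_verts[of u p] by auto

lemma awlast_verts: "(u, p) : paths ==> awlast u p : verts Q"
 using awlast_in_verts by (simp add: paths_iff)

lemma PA_D:
 assumes "f : |PA|"
 shows "f w : Kc" "w ~: paths ==> f w = 0[K]" "finite {w. f w ~= 0[K]}"
proof -
 have *: "ALL w:paths. f w : Kc" "ALL w. w ~: paths --> f w = 0[K]" "finite {w. f w ~= 0[K]}"
  using assms unfolding path_algebra_def by simp_all
 show 0: "w ~: paths ==> f w = 0[K]" for w using *(2) by blast
 show "f w : Kc" using *(1) 0[of w] by (cases "w : paths") auto
 show "finite {w. f w ~= 0[K]}" using *(3) .
qed

lemma PA_I: "(!!w. w : paths ==> f w : Kc) ==> (!!w. w ~: paths ==> f w = 0[K]) ==> finite {w. f w ~= 0[K]} ==> f : |PA|"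
 by (simp add: path_algebra_def)

lemma PA_sel:
 "(f *PA g) (u, p) = (S[K, {..length p}] %i. f (awlast u (take i p), drop i p) *[K] g (u, take i p))"
 "(f +PA g) w = f w +[K] g w" "0PA w = 0[K]" "(k .*PA f) w = k *[K] f w"
 "1PA (u, p) = (if p = [] & u : verts Q then 1[K] else 0[K])"
 by (simp_all add: path_algebra_def)

lemma PA_mult_nonzero:
 assumes fg: "f : |PA|" "g : |PA|" and ne: "(f *PA g) (u, p) ~= 0[K]"
 shows "EX i<=length p. f (awlast u (take i p), drop i p) ~= 0[K] & g (u, take i p) ~= 0[K]"
proof (rule ccontr)
 assume n: "~ ?thesis"
 have "(f *PA g) (u, p) = 0[K]"
  unfolding PA_sel
 proof (rule K.add.finprod_one_eqI)
  fix i assume "i : {..length p}"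
  hence "f (awlast u (take i p), drop i p) = 0[K] \<or> g (u, take i p) = 0[K]" using n by auto
  thus "f (awlast u (take i p), drop i p) *[K] g (u, take i p) = 0[K]"
   using PA_D(1)[OF fg(1)] PA_D(1)[OF fg(2)] by auto
 qed
 thus False using ne by simp
qed

lemma PA_mult_closed:
 assumes fg: "f : |PA|" "g : |PA|"
 shows "f *PA g : |PA|"
proof (rule PA_I)
 fix w assume "w : paths"
 show "(f *PA g) w : Kc"
  using PA_D(1)[OF fg(1)] PA_D(1)[OF fg(2)] by (cases w) (auto simp: PA_sel intro!: K.finsum_closed)
next
 fix w assume w: "w ~: paths"
 obtain u p where up: "w = (u, p)" by (cases w)
 show "(f *PA g) w = 0[K]"
 proof (rule ccontr)
  assume "(f *PA g) w ~= 0[K]"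
  then obtain i where "f (awlast u (take i p), drop i p) ~= 0[K]" "g (u, take i p) ~= 0[K]"
   using PA_mult_nonzero[OF fg] up by blast
  hence "(awlast u (take i p), drop i p) : paths" "(u, take i p) : paths" using PA_D(2) fg by blast+
  thus False using paths_append[of u "take i p" "drop i p"] w up by simp
 qed
next
 let ?S = "(%((v, q), (u, p)). (u, p @ q)) ` ({w. f w ~= 0[K]} \<times> {w. g w ~= 0[K]})"
 have "{w. (f *PA g) w ~= 0[K]} <= ?S"
 proof clarify
  fix u p assume "(f *PA g) (u, p) ~= 0[K]"
  then obtain i where "f (awlast u (take i p), drop i p) ~= 0[K]" "g (u, take i p) ~= 0[K]"
   using PA_mult_nonzero[OF fg] by blast
  thus "(u, p) : ?S" by (intro image_eqI[of _ _ "((awlast u (take i p), drop i p), (u, take i p))"]) auto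
 qed
 thus "finite {w. (f *PA g) w ~= 0[K]}" using PA_D(3)[OF fg(1)] PA_D(3)[OF fg(2)] by (auto intro: finite_subset)
qed

lemma PA_assoc:
 assumes f: "f : |PA|" and g: "g : |PA|" and h: "h : |PA|"
 shows "(f *PA g) *PA h = f *PA (g *PA h)"
proof
 fix w :: "'v \<times> 'q list"
 obtain u p where w: "w = (u, p)" by (cases w)
 note c [simp] = PA_D(1)[OF f] PA_D(1)[OF g] PA_D(1)[OF h]
 let ?w = "%i. awlast u (take i p)"
 define F where "F i j = f (awlast (?w i) (take j (drop i p)), drop (i + j) p) *[K] (g (?w i, take j (drop i p)) *[K] h (u, take i p))" for i j
 have Fc: "F i j : Kc" for i j by (simp add: F_def)
 have "((f *PA g) *PA h) (u, p) = (S[K, {..length p}] %i. S[K, {..length p - i}] %j. F i j)"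
  unfolding PA_sel(1)[of "f *PA g"]
 proof (rule K.finsum_cong'[OF refl])
  fix i assume "i : {..length p}"
  have "(f *PA g) (?w i, drop i p) *[K] h (u, take i p) =
   (S[K, {..length p - i}] %j. (f (awlast (?w i) (take j (drop i p)), drop j (drop i p)) *[K] g (?w i, take j (drop i p))) *[K] h (u, take i p))"
   unfolding PA_sel by (subst K.finsum_ldistr) auto
  also have "... = (S[K, {..length p - i}] %j. F i j)"
   by (intro K.finsum_cong') (auto simp: F_def K.m_assoc add.commute)
  finally show "(f *PA g) (?w i, drop i p) *[K] h (u, take i p) = (S[K, {..length p - i}] %j. F i j)" .
 qed (use Fc in \<open>auto intro!: K.finsum_closed\<close>)
 also have "... = (S[K, {..length p}] %k. S[K, {..k}] %i. F i (k - i))" by (rule K.finsum_triangle) (rule Fc)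
 also have "... = (f *PA (g *PA h)) (u, p)"
  unfolding PA_sel(1)[of f "g *PA h"]
 proof (rule K.finsum_cong'[OF refl])
  show "(%k. f (?w k, drop k p) *[K] (g *PA h) (u, take k p)) : {..length p} \<rightarrow> Kc"
   using PA_D(1)[OF PA_mult_closed[OF g h]] by auto
  fix k assume k: "k : {..length p}"
  have "f (?w k, drop k p) *[K] (g *PA h) (u, take k p) = (S[K, {..k}] %i. f (?w k, drop k p) *[K]
    (g (awlast u (take i (take k p)), drop i (take k p)) *[K] h (u, take i (take k p))))"
   unfolding PA_sel using k by (subst K.finsum_rdistr) (auto simp: min_absorb2)
  also have "... = (S[K, {..k}] %i. F i (k - i))"
  proof (rule K.finsum_cong'[OF refl])
   fix i assume i: "i : {..k}"
   hence "take k p = take i p @ take (k - i) (drop i p)" using take_add[of i "k - i" p] by simp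
   hence "awlast (?w i) (take (k - i) (drop i p)) = ?w k" using awlast_append[of u "take i p" "take (k - i) (drop i p)"] by simp
   thus "f (?w k, drop k p) *[K] (g (awlast u (take i (take k p)), drop i (take k p)) *[K] h (u, take i (take k p))) = F i (k - i)"
    using i by (simp add: F_def drop_take min_absorb1)
  qed (use Fc in auto)
  finally show "(S[K, {..k}] %i. F i (k - i)) = f (?w k, drop k p) *[K] (g *PA h) (u, take k p)" by simp
 qed
 finally show "((f *PA g) *PA h) w = (f *PA (g *PA h)) w" using w by simp
qed

definition basis :: "'v \<times> 'q list => 'v \<times> 'q list => 'k" where
 "basis w = (%w'. if w' = w then 1[K] else 0[K])"

lemma basis_closed: "w : paths ==> basis w : |PA|"
 by (rule PA_I) (auto simp: basis_def intro: finite_subset[of _ "{w}"])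

lemma vertex_basis: "path_algebra_vertex K v = basis (v, [])"
 by (simp add: path_algebra_vertex_def basis_def)

lemma vertex_path: "v : verts Q ==> (v, []) : paths"
 by (simp add: paths_iff)

lemma mult_vertex:
 assumes f: "f : |PA|"
 shows "(f *PA basis (v, [])) (u, p) = (if u = v then f (u, p) else 0[K])"
 unfolding PA_sel
proof (rule K.finsum_single[of _ _ 0])
 show "(if u = v then f (u, p) else 0[K]) : Kc" using PA_D(1)[OF f] by simp
 show "f (awlast u (take i p), drop i p) *[K] basis (v, []) (u, take i p) = 0[K]" if "i : {..length p}" "i ~= 0" for i
  using that PA_D(1)[OF f] by (cases p) (auto simp: basis_def)
qed (use PA_D(1)[OF f] in \<open>auto simp: basis_def\<close>)

lemma vertex_mult:
 assumes f: "f : |PA|"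
 shows "(basis (v, []) *PA f) (u, p) = (if awlast u p = v then f (u, p) else 0[K])"
 unfolding PA_sel
proof (rule K.finsum_single[of _ _ "length p"])
 show "(if awlast u p = v then f (u, p) else 0[K]) : Kc" using PA_D(1)[OF f] by simp
 show "basis (v, []) (awlast u (take i p), drop i p) *[K] f (u, take i p) = 0[K]" if "i : {..length p}" "i ~= length p" for i
  using that PA_D(1)[OF f] by (auto simp: basis_def)
qed (use PA_D(1)[OF f] in \<open>auto simp: basis_def\<close>)

lemma one_PA: "1PA : |PA|"
proof (rule PA_I)
 fix w assume "w ~: paths"
 thus "1PA w = 0[K]" using vertex_path by (cases w) (auto simp: PA_sel)
next
 have "{w. 1PA w ~= 0[K]} <= (%v. (v, [])) ` verts Q" by (auto simp: PA_sel split: if_splits)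
 thus "finite {w. 1PA w ~= 0[K]}" by (rule finite_subset) simp
next
 fix w show "1PA w : Kc" by (cases w) (simp add: PA_sel)
qed

lemma one_mult: assumes f: "f : |PA|" shows "1PA *PA f = f" "f *PA 1PA = f"
proof -
 note c = PA_D(1)[OF f]
 have "(1PA *PA f) (u, p) = f (u, p)" for u p
  unfolding PA_sel(1)
 proof (rule K.finsum_single[of _ _ "length p"])
  show "1PA (awlast u (take i p), drop i p) *[K] f (u, take i p) = 0[K]" if "i : {..length p}" "i ~= length p" for i
   using that c by (auto simp: PA_sel)
  show "1PA (awlast u (take (length p) p), drop (length p) p) *[K] f (u, take (length p) p) = f (u, p)"
   using c PA_D(2)[OF f, of "(u, p)"] awlast_verts[of u p] by (cases "(u, p) : paths") (auto simp: PA_sel)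
 qed (use c in auto)
 thus "1PA *PA f = f" by (auto simp: fun_eq_iff)
 have "(f *PA 1PA) (u, p) = f (u, p)" for u p
  unfolding PA_sel(1)
 proof (rule K.finsum_single[of _ _ 0])
  show "f (awlast u (take i p), drop i p) *[K] 1PA (u, take i p) = 0[K]" if "i : {..length p}" "i ~= 0" for i
   using that c by (cases p) (auto simp: PA_sel)
  show "f (awlast u (take 0 p), drop 0 p) *[K] 1PA (u, take 0 p) = f (u, p)"
   using c PA_D(2)[OF f, of "(u, p)"] by (auto simp: PA_sel paths_iff)
 qed (use c in auto)
 thus "f *PA 1PA = f" by (auto simp: fun_eq_iff)
qed

lemma PA_add_closed: "f : |PA| ==> g : |PA| ==> f +PA g : |PA|"
proof (rule PA_I)
 assume f: "f : |PA|" and g: "g : |PA|"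
 have "{w. (f +PA g) w ~= 0[K]} <= {w. f w ~= 0[K]} \<union> {w. g w ~= 0[K]}" by (auto simp: PA_sel)
 thus "finite {w. (f +PA g) w ~= 0[K]}" using PA_D(3)[OF f] PA_D(3)[OF g] by (auto intro: finite_subset)
qed (auto simp: PA_sel PA_D)

lemma PA_smult_closed: "k : Kc ==> f : |PA| ==> k .*PA f : |PA|"
proof (rule PA_I)
 assume k: "k : Kc" and f: "f : |PA|"
 have "{w. (k .*PA f) w ~= 0[K]} <= {w. f w ~= 0[K]}" using k by (auto simp: PA_sel)
 thus "finite {w. (k .*PA f) w ~= 0[K]}" using PA_D(3)[OF f] by (rule finite_subset)
qed (auto simp: PA_sel PA_D)

lemma PA_distl:
 assumes f: "f : |PA|" and g: "g : |PA|" and h: "h : |PA|"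
 shows "(f +PA g) *PA h = f *PA h +PA g *PA h" "h *PA (f +PA g) = h *PA f +PA h *PA g"
proof -
 note c [simp] = PA_D(1)[OF f] PA_D(1)[OF g] PA_D(1)[OF h]
 have "((f +PA g) *PA h) (u, p) = (f *PA h) (u, p) +[K] (g *PA h) (u, p)" for u p
  unfolding PA_sel(1) by (subst K.finsum_addf[symmetric]) (auto simp: PA_sel(2) K.l_distr intro!: K.finsum_cong')
 thus "(f +PA g) *PA h = f *PA h +PA g *PA h" by (auto simp: fun_eq_iff PA_sel(2))
 have "(h *PA (f +PA g)) (u, p) = (h *PA f) (u, p) +[K] (h *PA g) (u, p)" for u p
  unfolding PA_sel(1) by (subst K.finsum_addf[symmetric]) (auto simp: PA_sel(2) K.r_distr intro!: K.finsum_cong')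
 thus "h *PA (f +PA g) = h *PA f +PA h *PA g" by (auto simp: fun_eq_iff PA_sel(2))
qed

lemma PA_smult_mult:
 assumes k: "k : Kc" and f: "f : |PA|" and g: "g : |PA|"
 shows "(k .*PA f) *PA g = k .*PA (f *PA g)" "f *PA (k .*PA g) = k .*PA (f *PA g)"
proof -
 note c [simp] = PA_D(1)[OF f] PA_D(1)[OF g]
 have "((k .*PA f) *PA g) (u, p) = k *[K] (f *PA g) (u, p)" for u p
  unfolding PA_sel(1) using k by (subst K.finsum_rdistr) (auto simp: PA_sel(4) K.m_assoc intro!: K.finsum_cong')
 thus "(k .*PA f) *PA g = k .*PA (f *PA g)" by (auto simp: fun_eq_iff PA_sel(4))
 have "(f *PA (k .*PA g)) (u, p) = k *[K] (f *PA g) (u, p)" for u p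
  unfolding PA_sel(1) using k by (subst K.finsum_rdistr) (auto simp: PA_sel(4) K.m_lcomm intro!: K.finsum_cong')
 thus "f *PA (k .*PA g) = k .*PA (f *PA g)" by (auto simp: fun_eq_iff PA_sel(4))
qed

lemma zero_PA: "0PA : |PA|"
 by (rule PA_I) (auto simp: PA_sel)

lemma abelian_group_PA: "abelian_group PA"
proof (rule abelian_groupI)
 fix f assume f: "f : |PA|"
 have "(\<ominus>\<^bsub>K\<^esub> 1[K]) .*PA f +PA f = 0PA"
  using PA_D(1)[OF f] by (auto simp: fun_eq_iff PA_sel K.l_minus K.l_neg)
 thus "EX g:|PA|. g +PA f = 0PA" using PA_smult_closed[OF _ f, of "\<ominus>\<^bsub>K\<^esub> 1[K]"] by auto
qed (auto simp: PA_add_closed zero_PA fun_eq_iff PA_sel PA_D(1) K.a_ac)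

lemma nalg_PA: "nalg K PA"
 by (intro nalg.intro module.intro module_axioms.intro nalg_axioms.intro K.is_cring K.field_axioms abelian_group_PA
   PA_smult_closed PA_mult_closed PA_assoc PA_distl PA_smult_mult)
  (auto simp: fun_eq_iff PA_sel PA_D(1) K.l_distr K.r_distr K.m_assoc)

lemma ring_PA: "ring PA"
 by (intro ringI abelian_group_PA monoidI PA_mult_closed one_PA PA_assoc one_mult PA_distl)

sublocale nalg K PA
 by (rule nalg_PA)

lemma basis_span:
 assumes U: "submodule U K PA" and f: "f : |PA|" and b: "!!w. w : paths ==> f w ~= 0[K] ==> basis w : U"
 shows "f : U"
proof -
 note UD = subspaceD[OF U]
 have "f : U" if "finite A" "f : |PA|" "{w. f w ~= 0[K]} <= A" "!!w. w : paths ==> f w ~= 0[K] ==> basis w : U" for A f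
  using that
 proof (induction A arbitrary: f rule: finite_induct)
  case empty
  hence "f = 0PA" by (auto simp: fun_eq_iff PA_sel)
  thus ?case using UD(2) by simp
 next
  case (insert w A)
  note c = PA_D(1)[OF insert.prems(1)]
  let ?g = "%w'. if w' = w then 0[K] else f w'"
  have fin: "finite {w'. ?g w' ~= 0[K]}" by (rule finite_subset[OF _ PA_D(3)[OF insert.prems(1)]]) auto
  have g: "?g : |PA|" by (rule PA_I[OF _ _ fin]) (use c PA_D(2)[OF insert.prems(1)] in auto)
  have gU: "?g : U"
  proof (rule insert.IH[OF g])
   show "{w'. ?g w' ~= 0[K]} <= A" using insert.prems(2) by auto
   show "basis w' : U" if "w' : paths" "?g w' ~= 0[K]" for w' using insert.prems(3)[OF that(1)] that(2) by (auto split: if_splits)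
  qed
  show ?case
  proof (cases "f w = 0[K]")
   case True
   hence "?g = f" by auto
   thus ?thesis using gU by simp
  next
   case False
   hence "w : paths" using PA_D(2)[OF insert.prems(1)] by blast
   hence "f w .*PA basis w : U" using insert.prems(3) False c by (intro UD(4)) auto
   moreover have "f = ?g +PA f w .*PA basis w" using c by (auto simp: fun_eq_iff PA_sel basis_def)
   ultimately show ?thesis using UD(3)[OF gU] by metis
  qed
 qed
 thus ?thesis using f b PA_D(3)[OF f] by blast
qed

abbreviation "arrow m \<equiv> arrow_ideal_power K Q m"

lemma arrow_iff: "f : arrow m <-> f : |PA| & (ALL u p. length p < m --> f (u, p) = 0[K])"
 unfolding arrow_ideal_power_def by (auto simp: linorder_not_less[symmetric])

lemma arrow_mul: "f : arrow i ==> g : arrow j ==> f *PA g : arrow (i + j)"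
proof -
 assume f: "f : arrow i" and g: "g : arrow j"
 hence c: "f : |PA|" "g : |PA|" by (auto simp: arrow_iff)
 have "(f *PA g) (u, p) = 0[K]" if p: "length p < i + j" for u p
 proof (rule ccontr)
  assume "(f *PA g) (u, p) ~= 0[K]"
  then obtain m where m: "m <= length p" "f (awlast u (take m p), drop m p) ~= 0[K]" "g (u, take m p) ~= 0[K]"
   using PA_mult_nonzero[OF c] by blast
  hence "i <= length (drop m p)" "j <= length (take m p)" using f g unfolding arrow_ideal_power_def by blast+
  thus False using m(1) p by simp
 qed
 thus ?thesis using PA_mult_closed[OF c] by (simp add: arrow_iff)
qed

lemma arrow_sub: "submodule (arrow m) K PA"
 by (rule subspaceI) (auto simp: arrow_iff PA_add_closed PA_smult_closed zero_PA PA_sel)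

lemma arrow_zero: "arrow 0 = |PA|"
 by (auto simp: arrow_iff)

lemma arrow_ideal: "ideal (arrow m) PA"
proof (rule idealI[OF ring_PA])
 show "subgroup (arrow m) (add_monoid PA)" using arrow_sub by (rule submodule.axioms(1))
 fix f g assume "f : arrow m" "g : |PA|"
 thus "g *PA f : arrow m" "f *PA g : arrow m" using arrow_mul[of g 0 f m] arrow_mul[of f m g 0] arrow_zero by auto
qed

end

section \<open>The extended quiver algebra\<close>

lemma (in path_alg) basis_mult:
 assumes "awlast u p = v"
 shows "basis (v, q) *PA basis (u, p) = basis (u, p @ q)"
proof
 fix w :: "'v \<times> 'q list"
 obtain u1 p1 where w: "w = (u1, p1)" by (cases w)
 show "(basis (v, q) *PA basis (u, p)) w = basis (u, p @ q) w"
  unfolding w PA_sel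
 proof (cases "(u1, p1) = (u, p @ q)")
  case True
  thus "(S[K, {..length p1}] %i. basis (v, q) (awlast u1 (take i p1), drop i p1) *[K] basis (u, p) (u1, take i p1)) = basis (u, p @ q) (u1, p1)"
   using assms by (intro K.finsum_single[of _ _ "length p"]) (auto simp: basis_def dest: arg_cong[where f = length])
 next
  case False
  have "basis (v, q) (awlast u1 (take i p1), drop i p1) *[K] basis (u, p) (u1, take i p1) = 0[K]" for i
   using False append_take_drop_id[of i p1] by (auto simp: basis_def)
  hence "(S[K, {..length p1}] %i. basis (v, q) (awlast u1 (take i p1), drop i p1) *[K] basis (u, p) (u1, take i p1)) = 0[K]"
   by (intro K.add.finprod_one_eqI)
  thus "(S[K, {..length p1}] %i. basis (v, q) (awlast u1 (take i p1), drop i p1) *[K] basis (u, p) (u1, take i p1)) = basis (u, p @ q) (u1, p1)"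
   using False by (simp add: basis_def)
 qed
qed

lemma extended_sel:
 "verts (extended_quiver Q) = Inl ` verts Q \<union> Inr ` verts Q" "arcs (extended_quiver Q) = Inl ` arcs Q \<union> Inr ` verts Q"
 "tail (extended_quiver Q) (Inl a) = Inl (tail Q a)" "tail (extended_quiver Q) (Inr k) = Inl k"
 "head (extended_quiver Q) (Inl a) = Inl (head Q a)" "head (extended_quiver Q) (Inr k) = Inr k"
 by (simp_all add: extended_quiver_def)

locale extended = path_alg K Q for K :: "'k ring" and Q :: "('v, 'q) pre_digraph" +
 fixes R :: "('v \<times> 'q list => 'k) set"
 assumes verts_nonempty: "verts Q ~= {}" and admissible: "admissible_relations K Q R"

sublocale extended \<subseteq> X: path_alg K "extended_quiver Q"
proof (intro path_alg.intro K.field_axioms fin_digraph.intro fin_digraph_axioms.intro wf_digraph.intro)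
 fix a assume "a : arcs (extended_quiver Q)"
 thus "tail (extended_quiver Q) a : verts (extended_quiver Q)" "head (extended_quiver Q) a : verts (extended_quiver Q)"
  by (auto simp: extended_sel)
qed (auto simp: extended_sel)

context extended begin
abbreviation "XQ \<equiv> extended_quiver Q"

abbreviation "PX \<equiv> path_algebra K (extended_quiver Q)"
abbreviation carrier_PX ("|PX|") where "|PX| \<equiv> carrier PX"
abbreviation mult_PX (infixl "*PX" 70) where "x *PX y \<equiv> x *[PX] y"
abbreviation add_PX (infixl "+PX" 65) where "x +PX y \<equiv> x +[PX] y"
abbreviation smult_PX (infixl ".*PX" 70) where "k .*PX x \<equiv> k .*[PX] x"
abbreviation zero_PX ("0PX") where "0PX \<equiv> 0[PX]"

abbreviation "J \<equiv> extended_ideal K Q R"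
abbreviation "E \<equiv> extended_algebra K Q R"
abbreviation carrier_E ("|E|") where "|E| \<equiv> carrier E"
abbreviation mult_E (infixl "*E" 70) where "x *E y \<equiv> x *[E] y"
abbreviation add_E (infixl "+E" 65) where "x +E y \<equiv> x +[E] y"
abbreviation smult_E (infixl ".*E" 70) where "k .*E x \<equiv> k .*[E] x"
abbreviation zero_E ("0E") where "0E \<equiv> 0[E]"
abbreviation one_E ("1E") where "1E \<equiv> 1[E]"

abbreviation "lift \<equiv> lift_relation K"
abbreviation "VX \<equiv> verts (extended_quiver Q)"

lemma cas_map: "X.cas (Inl u) (map Inl p) (Inl v) <-> cas u p v"
 by (induction p arbitrary: u) (auto simp: extended_sel)

lemma awlast_map: "X.awlast (Inl u) (map Inl p) = Inl (awlast u p)"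
 by (induction p arbitrary: u) (auto simp: extended_sel)

lemma paths_map: "(Inl u, map Inl p) : X.paths <-> (u, p) : paths"
 by (auto simp: X.paths_iff paths_iff cas_map awlast_map extended_sel subset_iff image_iff)

text \<open>A path of the extended quiver stays in the old quiver, except that its last arrow may be a new one.\<close>

lemma paths_cases:
 assumes "(u', p') : X.paths"
 shows "(EX k. u' = Inr k & p' = []) \<or> (EX u p. u' = Inl u & (u, p) : paths & (p' = map Inl p \<or> p' = map Inl p @ [Inr (awlast u p)]))"
proof -
 have "u' : VX ==> set p' <= arcs XQ ==> X.cas u' p' v' ==>
  (EX k. u' = Inr k & p' = []) \<or> (EX u p. u' = Inl u & (u, p) : paths & (p' = map Inl p \<or> p' = map Inl p @ [Inr (awlast u p)]))" for v'
 proof (induction p' arbitrary: u')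
  case Nil
  thus ?case
  proof (cases u')
   case (Inl u)
   hence "(u, []) : paths" using Nil by (auto simp: extended_sel paths_iff)
   thus ?thesis using Inl by (intro disjI2 exI[of _ u] exI[of _ "[]"]) simp
  qed auto
 next
  case (Cons a p')
  have c: "X.cas (head XQ a) p' v'" "tail XQ a = u'" "a : arcs XQ"
   "set p' <= arcs XQ" using Cons.prems by auto
  have h: "head XQ a : VX" using c(3) by simp
  note IH = Cons.IH[OF h c(4,1)]
  show ?case
  proof (cases a)
   case (Inl b)
   hence b: "b : arcs Q" using c(3) by (auto simp: extended_sel)
   obtain p where p: "(head Q b, p) : paths" "p' = map Inl p \<or> p' = map Inl p @ [Inr (awlast (head Q b) p)]"
    using IH Inl by (auto simp: extended_sel)
   have h1: "(tail Q b, b # p) : paths" using p(1) b by (auto simp: paths_iff)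
   have h2: "a # p' = map Inl (b # p) \<or> a # p' = map Inl (b # p) @ [Inr (awlast (tail Q b) (b # p))]"
    using p(2) Inl by auto
   have h3: "u' = Inl (tail Q b)" using c(2) Inl by (simp add: extended_sel)
   show ?thesis
    by (rule disjI2, rule exI[of _ "tail Q b"], rule exI[of _ "b # p"], rule conjI[OF h3 conjI[OF h1 h2]])
  next
   case (Inr k)
   hence k: "k : verts Q" "p' = []" "u' = Inl k" using c IH by (auto simp: extended_sel)
   hence "(k, []) : paths" by (simp add: paths_iff)
   thus ?thesis using k Inr by (intro disjI2 exI[of _ k] exI[of _ "[]"]) simp
  qed
 qed
 thus ?thesis using assms by (auto simp: X.paths_iff)
qed

lemma lift_map: "lift f (Inl u, map Inl p) = f (u, p)"
 by (simp add: lift_relation_def list_all_iff comp_def)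

lemma lift_cases:
 obtains (old) u p where "w = (Inl u, map Inl p)"
 | (new) "!!f. lift f w = 0[K]" "~ (isl (fst w) & list_all isl (snd w))"
proof (cases "isl (fst w) & list_all isl (snd w)")
 case True
 have "map (%x. Inl (projl x)) (snd w) = snd w" by (rule map_idI) (use True in \<open>auto simp: list_all_iff\<close>)
 hence "snd w = map Inl (map projl (snd w))" by (simp add: comp_def)
 moreover have "fst w = Inl (projl (fst w))" using True by simp
 ultimately have "w = (Inl (projl (fst w)), map Inl (map projl (snd w)))" by (metis prod.collapse)
 thus ?thesis using old by blast
next
 case False
 hence "lift f w = 0[K]" for f by (cases w) (auto simp: lift_relation_def)
 thus ?thesis using new False by blast
qed

lemma lift_closed: "f : |PA| ==> lift f : |PX|"
proof (rule X.PA_I)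
 assume f: "f : |PA|"
 fix w
 show "lift f w : Kc" by (cases w rule: lift_cases) (use PA_D(1)[OF f] in \<open>auto simp: lift_map\<close>)
 show "lift f w = 0[K]" if "w ~: X.paths"
  using that PA_D(2)[OF f] by (cases w rule: lift_cases) (auto simp: lift_map paths_map)
next
 assume f: "f : |PA|"
 have "{w. lift f w ~= 0[K]} <= (%(u, p). (Inl u, map Inl p)) ` {w. f w ~= 0[K]}"
 proof
  fix w assume w: "w : {w. lift f w ~= 0[K]}"
  thus "w : (%(u, p). (Inl u, map Inl p)) ` {w. f w ~= 0[K]}"
   by (cases w rule: lift_cases) (auto simp: lift_map intro!: image_eqI)
 qed
 thus "finite {w. lift f w ~= 0[K]}" by (rule finite_subset) (use PA_D(3)[OF f] in simp)
qed

lemma lift_hom: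
 assumes f: "f : |PA|" and g: "g : |PA|"
 shows "lift (f +PA g) = lift f +PX lift g" "k : Kc ==> lift (k .*PA f) = k .*PX lift f"
  "lift (f *PA g) = lift f *PX lift g"
proof -
 show "lift (f +PA g) = lift f +PX lift g"
 proof
  fix w show "lift (f +PA g) w = (lift f +PX lift g) w"
   by (cases w rule: lift_cases) (auto simp: lift_map X.PA_sel(2) PA_sel(2))
 qed
 show "k : Kc ==> lift (k .*PA f) = k .*PX lift f"
 proof
  fix w show "k : Kc ==> lift (k .*PA f) w = (k .*PX lift f) w"
   by (cases w rule: lift_cases) (auto simp: lift_map X.PA_sel(4) PA_sel(4))
 qed
 note lc = X.PA_D(1)[OF lift_closed[OF f]] X.PA_D(1)[OF lift_closed[OF g]]
 show "lift (f *PA g) = lift f *PX lift g"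
 proof
  fix w show "lift (f *PA g) w = (lift f *PX lift g) w"
  proof (cases w rule: lift_cases)
   case (old u p)
   have "(lift f *PX lift g) (Inl u, map Inl p) = (S[K, {..length p}] %i. f (awlast u (take i p), drop i p) *[K] g (u, take i p))"
    unfolding X.PA_sel(1) using PA_D(1)[OF f] PA_D(1)[OF g]
    by (intro K.finsum_cong') (auto simp: take_map drop_map awlast_map lift_map)
   thus ?thesis using old by (simp add: lift_map PA_sel(1))
  next
   case new
   obtain u p where w: "w = (u, p)" by (cases w)
   have "lift f (X.awlast u (take i p), drop i p) *[K] lift g (u, take i p) = 0[K]" for i
   proof -
    have "~ list_all isl (drop i p) \<or> ~ (isl u & list_all isl (take i p))"
     using new(2) w list_all_append[of isl "take i p" "drop i p"] by auto
    hence "lift f (X.awlast u (take i p), drop i p) = 0[K] \<or> lift g (u, take i p) = 0[K]"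
     by (auto simp: lift_relation_def)
    thus ?thesis using lc by auto
   qed
   hence "(lift f *PX lift g) (u, p) = 0[K]" unfolding X.PA_sel(1) by (intro K.add.finprod_one_eqI)
   thus ?thesis using new w by simp
  qed
 qed
qed

lemma R_arrow: "R <= arrow 2"
 using admissible by (simp add: admissible_relations_def)

lemma lift_R: "lift ` R <= |PX|"
 using R_arrow arrow_iff lift_closed by blast

lemma J_ideal: "ideal J PX"
 unfolding extended_ideal_def by (rule ring.genideal_ideal[OF X.ring_PA lift_R])

lemmas J_sub = X.ideal_subspace[OF X.ring_PA J_ideal]
lemmas JD = X.subspaceD[OF J_sub]

lemma J_arrow: "J <= X.arrow 2"
 unfolding extended_ideal_def
proof (rule ring.genideal_minimal[OF X.ring_PA X.arrow_ideal])
 show "lift ` R <= X.arrow 2"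
 proof clarify
  fix f assume f: "f : R"
  hence fa: "f : arrow 2" using R_arrow by blast
  have "lift f (u, p) = 0[K]" if "length p < 2" for u p
   using fa that by (auto simp: lift_relation_def arrow_iff)
  thus "lift f : X.arrow 2" using fa lift_closed by (simp add: arrow_iff X.arrow_iff)
 qed
qed

lemma lift_ideal: "f : Idl\<^bsub>PA\<^esub> R ==> lift f : J"
proof -
 interpret JI: ideal J PX by (rule J_ideal)
 let ?U = "{f : |PA|. lift f : J}"
 have "submodule ?U K PA"
 proof (rule subspaceI)
  have "lift 0PA = 0PX"
  proof
   fix w show "lift 0PA w = 0PX w" by (cases w rule: lift_cases) (auto simp: lift_map X.PA_sel(3) PA_sel(3))
  qed
  thus "0PA : ?U" using JD(2) zero_PA by simp
 qed (auto simp: lift_hom PA_add_closed PA_smult_closed JD(3) JD(4))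
 hence "ideal ?U PA"
  by (intro idealI[OF ring_PA] submodule.axioms(1))
   (auto simp: lift_hom PA_mult_closed lift_closed JI.I_l_closed JI.I_r_closed)
 moreover have "R <= ?U"
  using R_arrow arrow_iff ring.genideal_self[OF X.ring_PA lift_R] by (auto simp: extended_ideal_def)
 ultimately have "Idl\<^bsub>PA\<^esub> R <= ?U" by (rule ring.genideal_minimal[OF ring_PA])
 thus "f : Idl\<^bsub>PA\<^esub> R ==> lift f : J" by blast
qed

text \<open>A path of the extended quiver is, up to a last new arrow, a path of the old quiver, and long paths there lie in the
ideal of relations.\<close>

lemma arrow_J: "EX m. X.arrow m <= J"
proof -
 interpret JI: ideal J PX by (rule J_ideal)
 obtain m where m: "arrow m <= Idl\<^bsub>PA\<^esub> R" using admissible by (auto simp: admissible_relations_def)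
 have old: "X.basis (Inl u, map Inl p) : J" if "(u, p) : paths" "m <= length p" for u p
 proof -
  have "basis (u, p) : arrow m" using that basis_closed by (auto simp: arrow_iff) (auto simp: basis_def)
  hence "lift (basis (u, p)) : J" using m lift_ideal by blast
  moreover have "lift (basis (u, p)) = X.basis (Inl u, map Inl p)"
  proof
   fix w show "lift (basis (u, p)) w = X.basis (Inl u, map Inl p) w"
   proof (cases w rule: lift_cases)
    case (old u1 p1)
    have "map Inl p1 = (map Inl p :: ('q + 'v) list) <-> p1 = p" by (intro inj_map_eq_map) simp
    thus ?thesis using old by (simp add: lift_map basis_def X.basis_def)
   next
    case new
    thus ?thesis by (auto simp: X.basis_def list_all_iff)
   qed
  qed
  ultimately show ?thesis by simp
 qed
 have "X.arrow (Suc m) <= J"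
 proof
  fix f assume f: "f : X.arrow (Suc m)"
  show "f : J"
  proof (rule X.basis_span[OF J_sub])
   show "f : |PX|" using f by (simp add: X.arrow_iff)
   fix w assume w: "w : X.paths" "f w ~= 0[K]"
   obtain u' p' where w': "w = (u', p')" by (cases w)
   hence len: "Suc m <= length p'" using f w(2) X.arrow_iff not_less by metis
   then obtain u p where u: "u' = Inl u" "(u, p) : paths" "p' = map Inl p \<or> p' = map Inl p @ [Inr (awlast u p)]"
    using paths_cases[of u' p'] w w' by auto
   from u(3) show "X.basis w : J"
   proof
    assume p: "p' = map Inl p"
    thus ?thesis using old[OF u(2)] u(1) len w' by simp
   next
    assume p: "p' = map Inl p @ [Inr (awlast u p)]"
    let ?k = "awlast u p"
    have "?k : verts Q" using awlast_verts[OF u(2)] .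
    hence "(Inl ?k, [Inr ?k]) : X.paths" by (auto simp: X.paths_iff extended_sel)
    moreover have "X.basis (Inl ?k, [Inr ?k]) *PX X.basis (Inl u, map Inl p) = X.basis (Inl u, p')"
     unfolding p by (rule X.basis_mult) (simp add: awlast_map)
    moreover have "X.basis (Inl u, map Inl p) : J" using old[OF u(2)] len p by simp
    ultimately show ?thesis using JI.I_l_closed X.basis_closed u(1) w' by metis
   qed
  qed
 qed
 thus ?thesis by blast
qed

subsection \<open>The radical filtration\<close>

abbreviation "cl f \<equiv> J +>[PX] f"

lemma E_quotient: "E = quotient_algebra PX J"
 by (simp add: extended_algebra_def)

lemmas E_sel = X.quotient_sel[OF X.ring_PA J_ideal, folded E_quotient]

lemma E_zero: "0E = cl 0PX"
 unfolding E_quotient by (rule X.quotient_zero_cls[OF X.ring_PA J_ideal])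

lemma E_nalg: "nalg K E"
 unfolding E_quotient by (rule X.nalg_quotient[OF X.ring_PA J_ideal])

lemma E_ring: "ring E"
 unfolding E_quotient by (rule X.ring_quotient[OF X.ring_PA J_ideal])

end

sublocale extended \<subseteq> E: nalg K "extended_algebra K Q R"
 by (rule E_nalg)

context extended begin

interpretation Er: ring E by (rule E_ring)

lemma cl_closed [simp, intro]: "f : |PX| ==> cl f : |E|"
 by (simp add: E_sel)

lemma coeff_cl: "f : |PX| ==> g : |PX| ==> cl f = cl g ==> f (v, []) = g (v, [])"
proof -
 assume f: "f : |PX|" and g: "g : |PX|" and "cl f = cl g"
 then obtain h where h: "h : J" "f = h +PX g" using E_sel(8) by blast
 hence "h : X.arrow 2" using J_arrow by blast
 hence "h (v, []) = 0[K]" unfolding X.arrow_iff by (metis list.size(3) zero_less_numeral)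
 thus ?thesis using h X.PA_D(1)[OF g] by (simp add: X.PA_sel)
qed

text \<open>The maximal left ideal belonging to the vertex \<open>v\<close>. It is well defined since the relations have no terms
of length zero.\<close>

definition coeff_ideal :: "'v + 'v => (('v + 'v) \<times> ('q + 'v) list => 'k) set set" where
 "coeff_ideal v = {cl f |f. f : |PX| & f (v, []) = 0[K]}"

lemma coeff_ideal_iff: "f : |PX| ==> cl f : coeff_ideal v <-> f (v, []) = 0[K]"
proof
 assume f: "f : |PX|" and "cl f : coeff_ideal v"
 then obtain g where "cl f = cl g" "g : |PX|" "g (v, []) = 0[K]" unfolding coeff_ideal_def by blast
 thus "f (v, []) = 0[K]" using coeff_cl[OF f] by metis
qed (use coeff_ideal_def in blast)

lemma coeff_mult: "f : |PX| ==> g : |PX| ==> (f *PX g) (v, []) = f (v, []) *[K] g (v, [])"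
 using X.PA_D(1)[of f] X.PA_D(1)[of g] by (simp add: X.PA_sel(1))

lemma coeff_ideal_maximal:
 assumes v: "v : VX"
 shows "maximal_submodule (coeff_ideal v) E (regular_module E)"
proof -
 interpret r: lact E "regular_module E" by (rule E.lact_regular)
 have sub: "submodule (coeff_ideal v) E (regular_module E)"
 proof (rule r.submoduleI)
  show "coeff_ideal v <= carrier (regular_module E)" by (auto simp: coeff_ideal_def)
  show "0[regular_module E] : coeff_ideal v" by (simp add: E_zero coeff_ideal_iff X.zero_PA X.PA_sel)
  fix x assume "x : coeff_ideal v"
  then obtain f where f: "f : |PX|" "x = cl f" "f (v, []) = 0[K]" by (auto simp: coeff_ideal_def)
  have m1: "(\<ominus>\<^bsub>K\<^esub> 1[K]) .*PX f : |PX|" using f by (intro X.PA_smult_closed) auto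
  have "f +PX (\<ominus>\<^bsub>K\<^esub> 1[K]) .*PX f = 0PX" using X.PA_D(1)[OF f(1)] by (auto simp: fun_eq_iff X.PA_sel K.l_minus K.r_neg)
  hence "x +E cl ((\<ominus>\<^bsub>K\<^esub> 1[K]) .*PX f) = 0E" using f m1 by (simp add: E_sel(4) E_zero)
  moreover have "cl ((\<ominus>\<^bsub>K\<^esub> 1[K]) .*PX f) : coeff_ideal v" using f m1 by (simp add: coeff_ideal_iff X.PA_sel)
  ultimately show "EX y:coeff_ideal v. x +[regular_module E] y = 0[regular_module E]" by auto
  show "x +[regular_module E] y : coeff_ideal v" if yv: "y : coeff_ideal v" for y
  proof -
   obtain g where "g : |PX|" "y = cl g" "g (v, []) = 0[K]" using yv by (auto simp: coeff_ideal_def)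
   thus ?thesis using f by (simp add: E_sel coeff_ideal_iff X.PA_add_closed X.PA_sel)
  qed
  show "a .*[regular_module E] x : coeff_ideal v" if ac: "a : |E|" for a
  proof -
   obtain g where "g : |PX|" "a = cl g" using ac by (auto simp: E_sel)
   thus ?thesis using f X.PA_D(1)[of g] by (simp add: E_sel coeff_ideal_iff X.PA_mult_closed coeff_mult)
  qed
 qed
 have bc: "X.basis (v, []) : |PX|" by (rule X.basis_closed[OF X.vertex_path[OF v]])
 have "cl (X.basis (v, [])) ~: coeff_ideal v" using bc by (simp add: coeff_ideal_iff) (simp add: X.basis_def)
 hence ne: "coeff_ideal v ~= carrier (regular_module E)" using cl_closed[OF bc] by auto
 have "W = coeff_ideal v \<or> W = carrier (regular_module E)" if W: "submodule W E (regular_module E)" "coeff_ideal v <= W" for W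
 proof (rule ccontr)
  assume n: "~ (W = coeff_ideal v \<or> W = carrier (regular_module E))"
  then obtain y where y: "y : W" "y ~: coeff_ideal v" using W(2) by blast
  have "y : |E|" using r.submodule_sub[OF W(1) y(1)] by simp
  then obtain f where f: "f : |PX|" "y = cl f" by (auto simp: E_sel)
  let ?k = "f (v, [])"
  have k: "?k : Kc" "?k ~= 0[K]" using X.PA_D(1)[OF f(1)] y f by (auto simp: coeff_ideal_iff)
  hence ki: "inv\<^bsub>K\<^esub> ?k : Kc" "inv\<^bsub>K\<^esub> ?k *[K] ?k = 1[K]" using K.field_Units by auto
  have "|E| <= W"
  proof
   fix z assume "z : |E|"
   then obtain g where g: "g : |PX|" "z = cl g" by (auto simp: E_sel)
   define c where "c = g (v, []) *[K] inv\<^bsub>K\<^esub> ?k"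
   have c: "c : Kc" "c *[K] ?k = g (v, [])" using ki k X.PA_D(1)[OF g(1)] by (auto simp: c_def K.m_assoc)
   let ?h = "(\<ominus>\<^bsub>K\<^esub> c) .*PX f +PX g"
   have hc: "?h : |PX|" using c f g by (intro X.PA_add_closed X.PA_smult_closed) auto
   have "?h (v, []) = 0[K]" using c k X.PA_D(1)[OF g(1)] by (simp add: X.PA_sel K.l_minus K.l_neg)
   hence 1: "cl ?h : W" using hc W(2) coeff_ideal_iff by blast
   have "(c .*E 1E) *E y = c .*E y" using c f by (simp add: E.mul_smult_l)
   hence 2: "cl (c .*PX f) : W" using r.submodule_act[OF W(1) _ y(1), of "c .*E 1E"] c f by (simp add: E_sel(6))
   have "?h +PX c .*PX f = g"
    using c X.PA_D(1)[OF f(1)] X.PA_D(1)[OF g(1)] by (auto simp: fun_eq_iff X.PA_sel K.l_minus K.a_ac K.r_neg2 K.r_neg1 K.r_neg)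
   hence "z = cl ?h +E cl (c .*PX f)" using g hc X.PA_smult_closed[OF c(1) f(1)] by (simp add: E_sel(4))
   thus "z : W" using r.submodule_add[OF W(1) 1 2] by simp
  qed
  moreover have "W <= |E|" using r.submodule_sub[OF W(1)] by auto
  ultimately show False using n by auto
 qed
 thus ?thesis using sub ne unfolding maximal_submodule_def by blast
qed

lemma arrow_nilpotent:
 assumes y: "y : cl ` X.arrow 1"
 shows "EX n. npow E y n = 0E"
proof -
 obtain f where f: "f : X.arrow 1" "y = cl f" using y by blast
 have fc: "f : |PX|" using f by (simp add: X.arrow_iff)
 have "EX g:X.arrow (Suc n). npow E y n = cl g" for n
 proof (induction n)
  case (Suc n)
  then obtain g where g: "g : X.arrow (Suc n)" "npow E y n = cl g" by blast
  thus ?case using X.arrow_mul[OF g(1) f(1)] f fc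
   by (intro bexI[of _ "g *PX f"]) (auto simp: E_sel(5) X.arrow_iff[of g])
 qed (use f in auto)
 moreover obtain m where m: "X.arrow m <= J" using arrow_J by blast
 ultimately obtain g where g: "g : X.arrow (Suc m)" "npow E y m = cl g" by blast
 have "X.arrow (Suc m) <= X.arrow m" by (auto simp: X.arrow_iff)
 hence "g : J" using g m by blast
 hence "cl g = 0E" using E_sel(7)[of g] E_sel(2) JD(1) by auto
 thus ?thesis using g by auto
qed

text \<open>
  The arrows generate a nilpotent ideal, so it lies in every maximal left ideal; conversely it is the
  intersection of the maximal left ideals given by the vanishing of one trivial path coefficient.
\<close>

lemma jacobson_radical_E: "jacobson_radical E = cl ` X.arrow 1"
proof
 interpret r: lact E "regular_module E" by (rule E.lact_regular)
 show "jacobson_radical E <= cl ` X.arrow 1"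
 proof
  fix y assume y: "y : jacobson_radical E"
  hence "y : |E|" by (simp add: jacobson_radical_def module_radical_def)
  then obtain f where f: "f : |PX|" "y = cl f" by (auto simp: E_sel)
  have "f (v, []) = 0[K]" for v
  proof (cases "v : VX")
   case True
   hence "y : coeff_ideal v" using y coeff_ideal_maximal by (auto simp: jacobson_radical_def module_radical_def)
   thus ?thesis using f coeff_ideal_iff by blast
  next
   case False
   thus ?thesis using X.PA_D(2)[OF f(1), of "(v, [])"] by (simp add: X.paths_iff)
  qed
  thus "y : cl ` X.arrow 1" using f by (auto simp: X.arrow_iff)
 qed
 show "cl ` X.arrow 1 <= jacobson_radical E"
 proof
  fix y assume y: "y : cl ` X.arrow 1"
  hence yc: "y : |E|" by (auto simp: X.arrow_iff)
  have "y : U" if U: "maximal_submodule U E (regular_module E)" for U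
  proof (rule ccontr)
   assume n: "y ~: U"
   have Us: "submodule U E (regular_module E)" and Umax: "!!W. submodule W E (regular_module E) ==> U <= W ==> W = U \<or> W = |E|"
    and Une: "U ~= |E|" using U by (auto simp: maximal_submodule_def)
   note Uc = r.submodule_sub[OF Us, simplified]
   let ?W = "{u +E a *E y |u a. u : U & a : |E|}"
   have "submodule ?W E (regular_module E)"
   proof (rule r.submoduleI)
    show "?W <= carrier (regular_module E)" using Uc yc by auto
    show "0[regular_module E] : ?W" using r.submodule_zero[OF Us] yc by (auto intro!: exI[of _ "0E"])
    fix x assume "x : ?W"
    then obtain u a where u: "u : U" "a : |E|" "x = u +E a *E y" by auto
    note uc = Uc[OF u(1)]
    have "x +E (\<ominus>\<^bsub>E\<^esub> u +E (\<ominus>\<^bsub>E\<^esub> a) *E y) = 0E"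
     using u uc yc by (simp add: E.neg_mul E.M.a_ac E.M.r_neg E.M.r_neg1 E.M.r_neg2)
    moreover have "\<ominus>\<^bsub>E\<^esub> u = (\<ominus>\<^bsub>E\<^esub> 1E) *E u" using uc by (simp add: Er.l_minus)
    hence "\<ominus>\<^bsub>E\<^esub> u : U" using r.submodule_act[OF Us, of "\<ominus>\<^bsub>E\<^esub> 1E" u] u by simp
    ultimately show "EX z:?W. x +[regular_module E] z = 0[regular_module E]" using u(2) by (intro bexI[of _ "\<ominus>\<^bsub>E\<^esub> u +E (\<ominus>\<^bsub>E\<^esub> a) *E y"]) auto
    show "x +[regular_module E] x' : ?W" if xW: "x' : ?W" for x'
    proof -
     obtain u' a' where u': "u' : U" "a' : |E|" "x' = u' +E a' *E y" using xW by auto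
     have "x +E x' = (u +E u') +E (a +E a') *E y" using u u' uc Uc[OF u'(1)] yc by (simp add: E.mul_distl E.M.a_ac)
     moreover have "u +E u' : U" using r.submodule_add[OF Us u(1) u'(1)] by simp
     ultimately show ?thesis using u(2) u'(2) by auto
    qed
    show "b .*[regular_module E] x : ?W" if b: "b : |E|" for b
    proof -
     have "b *E x = b *E u +E (b *E a) *E y" using u uc yc b by (simp add: E.mul_distr E.mul_assoc)
     moreover have "b *E u : U" using r.submodule_act[OF Us b u(1)] by simp
     ultimately show ?thesis using u(2) b by auto
    qed
   qed
   moreover have "U <= ?W"
   proof
    fix u assume "u : U"
    thus "u : ?W" using Uc yc by (intro CollectI exI[of _ u] exI[of _ "0E"]) auto
   qed
   moreover have "y : ?W" using r.submodule_zero[OF Us] yc by (intro CollectI exI[of _ "0E"] exI[of _ "1E"]) auto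
   ultimately have "?W = |E|" using Umax[of ?W] n by blast
   hence "1E : ?W" by simp
   then obtain u a where u: "u : U" "a : |E|" "1E = u +E a *E y" by auto
   note uc = Uc[OF u(1)]
   let ?n = "a *E y"
   have nc: "?n : |E|" using u yc by simp
   have "?n : cl ` X.arrow 1"
   proof -
    obtain f g where "f : X.arrow 1" "y = cl f" "g : |PX|" "a = cl g" using y u(2) by (auto simp: E_sel)
    thus ?thesis using X.arrow_mul[of g 0 f 1] X.arrow_zero by (auto simp: E_sel(5) X.arrow_iff[of f])
   qed
   then obtain k where k: "npow E ?n k = 0E" using arrow_nilpotent by blast
   have "EX w:U. 1E = w +E npow E ?n k" for k
   proof (induction k)
    case 0
    thus ?case using u by auto
   next
    case (Suc k)
    then obtain w where w: "w : U" "1E = w +E npow E ?n k" by blast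
    have pc: "npow E ?n k : |E|" using nc by simp
    have "npow E ?n k = npow E ?n k *E (u +E ?n)" using pc u(3) by (metis Er.r_one)
    hence "npow E ?n k = npow E ?n k *E u +E npow E ?n (Suc k)" using pc uc nc by (simp add: E.mul_distr)
    hence "1E = w +E (npow E ?n k *E u +E npow E ?n (Suc k))" using w(2) by metis
    hence "1E = (w +E npow E ?n k *E u) +E npow E ?n (Suc k)"
     using pc uc nc Uc[OF w(1)] by (simp add: E.M.a_assoc)
    moreover have "npow E ?n k *E u : U" using r.submodule_act[OF Us pc u(1)] by simp
    ultimately show ?case using r.submodule_add[OF Us w(1), of "npow E ?n k *E u"] by auto
   qed
   then obtain w where "w : U" "1E = w +E 0E" using k by metis
   hence "1E : U" using Uc by simp
   hence "x : U" if "x : |E|" for x using r.submodule_act[OF Us that, of "1E"] that by simp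
   thus False using Une Uc by blast
  qed
  thus "y : jacobson_radical E" using yc by (auto simp: jacobson_radical_def module_radical_def)
 qed
qed

end

context extended begin

interpretation Er: ring E by (rule E_ring)

abbreviation "rp \<equiv> radical_power E"
abbreviation "NN \<equiv> radical_nilpotency E"

lemma arrow1_ideal: "ideal (cl ` X.arrow 1) E"
proof (rule idealI[OF E_ring])
 have "submodule (cl ` X.arrow 1) K E"
 proof (rule E.subspaceI)
  note AD = X.subspaceD[OF X.arrow_sub[of 1]]
  show "cl ` X.arrow 1 <= |E|" using AD(1) by blast
  show "0E : cl ` X.arrow 1" using AD(2) E_zero by blast
  show "x +E y : cl ` X.arrow 1" if "x : cl ` X.arrow 1" "y : cl ` X.arrow 1" for x y
   using that AD(1,3) by (auto simp: E_sel(4))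
  show "k .*E x : cl ` X.arrow 1" if "k : Kc" "x : cl ` X.arrow 1" for k x
   using that AD(1,4) by (auto simp: E_sel(6))
 qed
 thus "subgroup (cl ` X.arrow 1) (add_monoid E)" by (rule submodule.axioms(1))
 fix x y assume "x : cl ` X.arrow 1" "y : |E|"
 then obtain f g where "f : X.arrow 1" "x = cl f" "g : X.arrow 0" "y = cl g" by (auto simp: E_sel(1) X.arrow_zero)
 thus "y *E x : cl ` X.arrow 1" "x *E y : cl ` X.arrow 1"
  using X.arrow_mul[of g 0 f 1] X.arrow_mul[of f 1 g 0] by (auto simp: E_sel(5) X.arrow_iff[of f] X.arrow_iff[of g])
qed

lemma jac_ideal: "ideal (jacobson_radical E) E"
 unfolding jacobson_radical_E by (rule arrow1_ideal)

lemma rp_ideal: "ideal (rp j) E"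
 by (induction j) (simp_all add: Er.oneideal Er.ideal_prod_is_ideal jac_ideal)

lemma rp_1: "rp 1 = cl ` X.arrow 1"
proof -
 have "|E| \<cdot>\<^bsub>E\<^esub> jacobson_radical E = jacobson_radical E"
 proof
  show "|E| \<cdot>\<^bsub>E\<^esub> jacobson_radical E <= jacobson_radical E"
   using Er.ideal_prod_inter[OF Er.oneideal jac_ideal] by blast
  show "jacobson_radical E <= |E| \<cdot>\<^bsub>E\<^esub> jacobson_radical E"
  proof
   fix x assume x: "x : jacobson_radical E"
   hence "1E *E x : |E| \<cdot>\<^bsub>E\<^esub> jacobson_radical E" by (intro ideal_prod.prod) simp_all
   thus "x : |E| \<cdot>\<^bsub>E\<^esub> jacobson_radical E" using ideal.Icarr[OF jac_ideal x] by simp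
  qed
 qed
 moreover have "rp 1 = |E| \<cdot>\<^bsub>E\<^esub> jacobson_radical E" by simp
 ultimately show ?thesis by (simp only: jacobson_radical_E)
qed

lemma rp_arrow: "rp j <= cl ` X.arrow j"
proof (induction j)
 case 0
 thus ?case by (simp add: E_sel(1) X.arrow_zero)
next
 case (Suc j)
 show ?case
 proof
  fix x assume "x : rp (Suc j)"
  hence "x : rp j \<cdot>\<^bsub>E\<^esub> jacobson_radical E" by simp
  thus "x : cl ` X.arrow (Suc j)"
  proof (induction rule: ideal_prod.induct)
   case (prod a b)
   obtain f where f: "f : X.arrow j" "a = cl f" using prod(1) Suc.IH by blast
   obtain g where g: "g : X.arrow 1" "b = cl g" using prod(2) unfolding jacobson_radical_E by blast
   thus ?case using X.arrow_mul[OF f(1) g(1)] f g by (auto simp: E_sel(5) X.arrow_iff[of f] X.arrow_iff[of g])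
  next
   case (sum a b)
   thus ?case using X.subspaceD(1,3)[OF X.arrow_sub[of "Suc j"]] by (auto simp: E_sel(4))
  qed
 qed
qed

lemma rp_add: "rp (i + j) = rp i \<cdot>\<^bsub>E\<^esub> rp j"
 by (induction j) (simp_all add: Er.ideal_prod_one[OF rp_ideal] Er.ideal_prod_assoc[OF rp_ideal rp_ideal jac_ideal])

lemma rp_anti: "rp (Suc j) <= rp j"
 using Er.ideal_prod_inter[OF rp_ideal[of j] jac_ideal] by simp

lemma rp_zero_mem: "0E : rp j"
 by (rule additive_subgroup.zero_closed[OF ideal.axioms(1)[OF rp_ideal]])

lemma rp_NN: "rp NN = {0E}"
proof -
 obtain m where m: "X.arrow m <= J" using arrow_J by blast
 have "rp m <= {0E}"
 proof
  fix x assume "x : rp m"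
  then obtain f where "f : X.arrow m" "x = cl f" using rp_arrow by blast
  thus "x : {0E}" using m E_sel(2,7) JD(1) by blast
 qed
 hence "rp m = {0E}" using rp_zero_mem by blast
 thus ?thesis unfolding radical_nilpotency_def by (rule LeastI)
qed

lemma vertex_coeff: "cl (X.basis (v, [])) ~: rp 1" if v: "v : VX"
proof
 note bc = X.basis_closed[OF X.vertex_path[OF v]]
 assume "cl (X.basis (v, [])) : rp 1"
 then obtain f where f: "f : X.arrow 1" "cl (X.basis (v, [])) = cl f" unfolding rp_1 by blast
 have fc: "f : |PX|" using f(1) by (simp add: X.arrow_iff)
 have "f (v, []) = 0[K]" using f(1) by (simp add: X.arrow_iff)
 thus False using coeff_cl[OF bc fc f(2), of v] by (simp add: X.basis_def)
qed

lemma filtered_E: "filtered K E rp NN"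
proof (intro filtered.intro filtered_axioms.intro E_nalg)
 have anti: "i <= j ==> rp j <= rp i" for i j by (induction j rule: dec_induct) (use rp_anti in blast)+
 show "0 < NN"
 proof (rule ccontr)
  assume "~ 0 < NN"
  hence 0: "|E| = {0E}" using rp_NN by simp
  obtain v where "v : verts Q" using verts_nonempty by blast
  hence v: "Inl v : VX" by (simp add: extended_sel)
  have "cl (X.basis (Inl v, [])) = 0E" using cl_closed[OF X.basis_closed[OF X.vertex_path[OF v]]] 0 by auto
  thus False using vertex_coeff[OF v] rp_zero_mem[of 1] by simp
 qed
 show "submodule (rp m) K E" for m by (rule E.ideal_subspace[OF E_ring rp_ideal])
 show "rp 0 = |E|" by simp
 show "rp m = {0E}" if "NN <= m" for m using anti[OF that] rp_NN rp_zero_mem[of m] by auto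
 show "rp (Suc m) <= rp m" for m by (rule rp_anti)
 show "x *E y : rp (i + j)" if "x : rp i" "y : rp j" for x y i j
  unfolding rp_add using that by (rule ideal_prod.prod)
qed

subsection \<open>The semisimple part\<close>

abbreviation "ee \<equiv> extended_idempotent K Q R"
abbreviation "SS \<equiv> extended_semisimple K Q R"

lemma ee_cl: "ee v = cl (X.basis (v, []))"
 by (simp add: extended_idempotent_def X.vertex_basis)

lemma vb_closed: "v : VX ==> X.basis (v, []) : |PX|"
 by (rule X.basis_closed[OF X.vertex_path])

lemma ee_closed: "v : VX ==> ee v : |E|"
 unfolding ee_cl by (rule cl_closed[OF vb_closed])

lemma ee_mult: "v : VX ==> w : VX ==> ee v *E ee w = (if v = w then ee v else 0E)"
proof -
 assume v: "v : VX" and w: "w : VX"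
 have "X.basis (v, []) *PX X.basis (w, []) = (if v = w then X.basis (v, []) else 0PX)"
 proof
  fix y :: "('v + 'v) \<times> ('q + 'v) list"
  obtain u p where y: "y = (u, p)" by (cases y)
  show "(X.basis (v, []) *PX X.basis (w, [])) y = (if v = w then X.basis (v, []) else 0PX) y"
   unfolding y X.mult_vertex[OF vb_closed[OF v]] by (auto simp: X.basis_def X.PA_sel(3))
 qed
 thus ?thesis unfolding ee_cl E_sel(5)[OF vb_closed[OF v] vb_closed[OF w]] by (simp add: E_zero)
qed

lemma SS_sub: "submodule SS K E"
proof -
 have whole: "submodule ( |E|) K E" by (rule E.subspaceI) auto
 have SSI: "x : SS" if "!!U. submodule U K E ==> ee ` VX <= U ==> x : U" for x
  using that by (auto simp: extended_semisimple_def generated_submodule_def)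
 have SSD: "x : U" if "x : SS" "submodule U K E" "ee ` VX <= U" for x U
  using that by (auto simp: extended_semisimple_def generated_submodule_def)
 show ?thesis
 proof (rule E.subspaceI)
  show "SS <= |E|" using SSD[OF _ whole] ee_closed by blast
  show "0E : SS" by (rule SSI) (rule E.subspaceD(2))
  show "x +E y : SS" if xy: "x : SS" "y : SS" for x y
  proof (rule SSI)
   fix U assume U: "submodule U K E" "ee ` VX <= U"
   show "x +E y : U" by (rule E.subspaceD(3)[OF U(1) SSD[OF xy(1) U] SSD[OF xy(2) U]])
  qed
  show "k .*E x : SS" if kx: "k : Kc" "x : SS" for k x
  proof (rule SSI)
   fix U assume U: "submodule U K E" "ee ` VX <= U"
   show "k .*E x : U" by (rule E.subspaceD(4)[OF U(1) kx(1) SSD[OF kx(2) U]])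
  qed
 qed
qed

lemma SS_least: "x : SS ==> submodule U K E ==> (!!v. v : VX ==> ee v : U) ==> x : U"
 by (auto simp: extended_semisimple_def generated_submodule_def)

lemma ee_SS: "v : VX ==> ee v : SS"
 by (auto simp: extended_semisimple_def generated_submodule_def)

lemma SS_subalgebra: "subalgebra K E SS"
 unfolding subalgebra_def
proof (intro conjI ballI SS_sub)
 note SD = E.subspaceD[OF SS_sub]
 have 1: "x *E ee w : SS" if x: "x : SS" and w: "w : VX" for x w
 proof -
  have "submodule {x : |E|. x *E ee w : SS} K E"
   by (rule E.subspaceI) (use ee_closed[OF w] SD in \<open>auto simp: E.mul_distl E.mul_smult_l\<close>)
  hence "x : {x : |E|. x *E ee w : SS}"
  proof (rule SS_least[OF x])
   fix v assume v: "v : VX"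
   thus "ee v : {x : |E|. x *E ee w : SS}" using ee_closed[OF v] ee_mult[OF v w] ee_SS[OF v] SD(2) by auto
  qed
  thus ?thesis by simp
 qed
 fix x y assume x: "x : SS" and y: "y : SS"
 have "submodule {y : |E|. x *E y : SS} K E"
  by (rule E.subspaceI) (use SD(1)[OF x] SD in \<open>auto simp: E.mul_distr E.mul_smult_r\<close>)
 hence "y : {y : |E|. x *E y : SS}"
  by (rule SS_least[OF y]) (use ee_closed 1[OF x] in auto)
 thus "x *E y : SS" by simp
qed

lemma SS_comp:
 assumes s: "s : SS" and v: "v : VX" and w: "w : VX"
 shows "EX k:Kc. ee v *E (s *E ee w) = (if v = w then k .*E ee v else 0E)"
proof -
 let ?U = "{s : |E|. EX k:Kc. ee v *E (s *E ee w) = (if v = w then k .*E ee v else 0E)}"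
 note c = ee_closed[OF v] ee_closed[OF w]
 have "submodule ?U K E"
 proof (rule E.subspaceI)
  show "0E : ?U" using c by (auto intro!: bexI[of _ "0[K]"])
  fix x assume "x : ?U"
  then obtain k where k: "x : |E|" "k : Kc" "ee v *E (x *E ee w) = (if v = w then k .*E ee v else 0E)" by blast
  show "x +E y : ?U" if yU: "y : ?U" for y
  proof -
   obtain l where l: "y : |E|" "l : Kc" "ee v *E (y *E ee w) = (if v = w then l .*E ee v else 0E)" using yU by blast
   have "ee v *E ((x +E y) *E ee w) = (if v = w then (k +[K] l) .*E ee v else 0E)"
    using k l c by (simp add: E.mul_distl E.mul_distr E.smult_l_distr)
   thus ?thesis using k l by blast
  qed
  show "a .*E x : ?U" if a: "a : Kc" for a
  proof -
   have "ee v *E ((a .*E x) *E ee w) = (if v = w then (a *[K] k) .*E ee v else 0E)"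
    using k a c by (simp add: E.mul_smult_l E.mul_smult_r E.smult_assoc1)
   thus ?thesis using k a by blast
  qed
 qed blast
 moreover have "ee u : ?U" if u: "u : VX" for u
 proof -
  have "ee v *E (ee u *E ee w) = (if v = w then (if u = w then 1[K] else 0[K]) .*E ee v else 0E)"
   using u v w c by (auto simp: ee_mult)
  thus ?thesis using ee_closed[OF u] by (intro CollectI conjI bexI) auto
 qed
 ultimately show ?thesis using SS_least[OF s, of ?U] by blast
qed

lemma cl_finsum: "finite A ==> f : A \<rightarrow> |PX| ==> (S[E, A] %i. cl (f i)) = cl (finsum PX f A)"
proof (induction A rule: finite_induct)
 case (insert i A)
 hence "(S[E, insert i A] %i. cl (f i)) = cl (f i) +E (S[E, A] %i. cl (f i))" by (intro E.M.finsum_insert) auto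
 thus ?case using insert by (simp add: E_sel(4) X.M.finsum_insert Pi_iff)
qed (simp add: E_zero)

lemma PX_finsum: "finite A ==> f : A \<rightarrow> |PX| ==> finsum PX f A w = (S[K, A] %i. f i w)"
proof (induction A rule: finite_induct)
 case empty
 thus ?case by (cases w) (simp add: X.PA_sel)
next
 case (insert i A)
 have c: "f j w : Kc" if "j : insert i A" for j using X.PA_D(1)[of "f j" w] insert.prems that by auto
 have "(S[K, insert i A] %i. f i w) = f i w +[K] (S[K, A] %i. f i w)" using insert.hyps c by (intro K.finsum_insert) auto
 thus ?case using insert by (simp add: X.M.finsum_insert X.PA_sel(2))
qed

lemma ee_sum: "(S[E, VX] %v. ee v) = 1E"
proof -
 have c: "(%v. X.basis (v, [])) : VX \<rightarrow> |PX|" using vb_closed by auto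
 have "(S[PX, VX] %v. X.basis (v, [])) (u, p) = 1[PX] (u, p)" for u p
  unfolding PX_finsum[OF X.finite_verts c] X.PA_sel(5)
  by (rule K.finsum_single[of _ _ u]) (auto simp: X.basis_def)
 hence "(S[PX, VX] %v. X.basis (v, [])) = 1[PX]" by (auto simp: fun_eq_iff)
 thus ?thesis unfolding ee_cl using cl_finsum[OF X.finite_verts c] by (simp add: E_sel(3))
qed

lemma E_split:
 assumes "x : |E|"
 shows "EX s:SS. EX y:rp 1. x = s +E y"
proof -
 note SD = E.subspaceD[OF SS_sub]
 note ID = E.subspaceD[OF E.ideal_subspace[OF E_ring rp_ideal[of 1]]]
 let ?U = "{f : |PX|. EX s:SS. EX y:rp 1. cl f = s +E y}"
 have U: "submodule ?U K PX"
 proof (rule X.subspaceI)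
  show "0PX : ?U" using SD(2) ID(2) X.zero_PA by (auto simp: E_zero[symmetric] intro!: bexI[of _ "0E"])
  fix f assume "f : ?U"
  then obtain s y where f: "f : |PX|" "s : SS" "y : rp 1" "cl f = s +E y" by blast
  note fc = SD(1)[OF f(2)] ID(1)[OF f(3)]
  show "f +PX g : ?U" if gU: "g : ?U" for g
  proof -
   obtain t z where g: "g : |PX|" "t : SS" "z : rp 1" "cl g = t +E z" using gU by blast
   have "cl (f +PX g) = (s +E t) +E (y +E z)"
    using E_sel(4)[OF f(1) g(1)] f(4) g(4) fc SD(1)[OF g(2)] ID(1)[OF g(3)] by (simp add: E.M.a_ac)
   thus ?thesis using X.PA_add_closed[OF f(1) g(1)] SD(3)[OF f(2) g(2)] ID(3)[OF f(3) g(3)] by blast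
  qed
  show "k .*PX f : ?U" if k: "k : Kc" for k
  proof -
   have "cl (k .*PX f) = k .*E s +E k .*E y"
    using E_sel(6)[OF k f(1)] f(4) fc k by (simp add: E.smult_r_distr)
   thus ?thesis using X.PA_smult_closed[OF k f(1)] SD(4)[OF k f(2)] ID(4)[OF k f(3)] by blast
  qed
 qed blast
 obtain f where f: "f : |PX|" "x = cl f" using assms by (auto simp: E_sel(1))
 have "f : ?U"
 proof (rule X.basis_span[OF U f(1)])
  fix w assume w: "w : X.paths"
  obtain v p where vp: "w = (v, p)" by (cases w)
  note bc = X.basis_closed[OF w]
  show "X.basis w : ?U"
  proof (cases "p = []")
   case True
   hence "v : VX" using w vp by (simp add: X.paths_iff)
   hence "ee v : SS" "cl (X.basis w) = ee v +E 0E" using ee_SS ee_closed vp True by (simp_all add: ee_cl)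
   thus ?thesis using bc ID(2) by blast
  next
   case False
   hence "X.basis w : X.arrow 1" using bc vp by (auto simp: X.arrow_iff) (auto simp: X.basis_def)
   hence "cl (X.basis w) : rp 1" unfolding rp_1 by blast
   moreover have "cl (X.basis w) = 0E +E cl (X.basis w)" using bc by simp
   ultimately show ?thesis using bc SD(2) by blast
  qed
 qed
 thus ?thesis using f(2) by blast
qed

lemma E_fin_gen: "EX fs. set fs <= |E| & (ALL W. submodule W K E --> set fs <= W --> W = |E|)"
proof -
 obtain m where m: "X.arrow m <= J" using arrow_J by blast
 let ?P = "{w : X.paths. length (snd w) < m}"
 have "?P <= VX \<times> {p. set p <= arcs XQ & length p <= m}" by (auto simp: X.paths_iff)
 hence "finite ?P" by (rule finite_subset) (intro finite_cartesian_product finite_lists_length_le X.finite_verts X.finite_arcs)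
 then obtain fs where fs: "set fs = (%w. cl (X.basis w)) ` ?P" using finite_list[of "(%w. cl (X.basis w)) ` ?P"] by blast
 have "W = |E|" if W: "submodule W K E" "set fs <= W" for W
 proof -
  note WD = E.subspaceD[OF W(1)]
  have U: "submodule {f : |PX|. cl f : W} K PX"
   by (rule X.subspaceI)
    (use WD in \<open>auto simp: E_zero[symmetric] E_sel(4,6)[symmetric] X.zero_PA X.PA_add_closed X.PA_smult_closed\<close>)
  have "cl f : W" if f: "f : |PX|" for f
  proof -
   have "f : {f : |PX|. cl f : W}"
   proof (rule X.basis_span[OF U f])
    fix w assume w: "w : X.paths"
    show "X.basis w : {f : |PX|. cl f : W}"
    proof (cases "length (snd w) < m")
     case True
     thus ?thesis using w W(2) fs X.basis_closed[OF w] by auto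
    next
     case False
     hence "X.basis w : X.arrow m" using X.basis_closed[OF w] by (auto simp: X.arrow_iff) (auto simp: X.basis_def)
     hence "cl (X.basis w) = 0E" using m E_sel(2,7) X.basis_closed[OF w] by blast
     thus ?thesis using WD(2) X.basis_closed[OF w] by simp
    qed
   qed
   thus ?thesis by simp
  qed
  thus ?thesis using WD(1) by (auto simp: E_sel(1))
 qed
 moreover have "set fs <= |E|" unfolding fs using X.basis_closed by blast
 ultimately show ?thesis by blast
qed

lemma split_filtered_E: "split_filtered K E rp NN VX ee SS"
proof (intro split_filtered.intro split_filtered_axioms.intro filtered_E X.finite_verts ee_closed SS_subalgebra ee_SS SS_comp E_split E_fin_gen)
 show "ee v *E ee v = ee v" if "v : VX" for v using ee_mult[OF that that] by simp
 show "ee v *E ee w = 0E" if "v : VX" "w : VX" "v ~= w" for v w using ee_mult[OF that(1,2)] that(3) by simp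
 show "ee v ~: rp 1" if "v : VX" for v unfolding ee_cl by (rule vertex_coeff[OF that])
 show "(S[E, VX] %v. ee v) *E x = x" "x *E (S[E, VX] %v. ee v) = x" if "x : |E|" for x
  unfolding ee_sum using that by simp_all
qed

text \<open>No path leads from a new vertex to an old one.\<close>

lemma no_hom_new_old:
 assumes v: "v : VX" "~ isl v" and w: "w : VX" "isl w" and y: "y : |E|"
 shows "ee w *E (y *E ee v) = 0E"
proof -
 obtain f where f: "f : |PX|" "y = cl f" using y by (auto simp: E_sel(1))
 note b = vb_closed[OF v(1)] vb_closed[OF w(1)]
 have fb: "f *PX X.basis (v, []) : |PX|" using f b by (intro X.PA_mult_closed)
 have "(X.basis (w, []) *PX (f *PX X.basis (v, []))) (u, p) = 0[K]" for u p
 proof -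
  have "f (u, p) = 0[K]" if u: "u = v" "X.awlast u p = w"
  proof (cases "(u, p) : X.paths")
   case True
   hence "p = []" using paths_cases[OF True] u v by auto
   thus ?thesis using u v w by auto
  qed (use X.PA_D(2)[OF f(1)] in blast)
  thus ?thesis unfolding X.vertex_mult[OF fb] X.mult_vertex[OF f(1)] by auto
 qed
 hence "X.basis (w, []) *PX (f *PX X.basis (v, [])) = 0PX" by (auto simp: fun_eq_iff X.PA_sel(3))
 thus ?thesis unfolding ee_cl f(2) E_sel(5)[OF f(1) b(1)] E_sel(5)[OF b(2) fb] by (simp add: E_zero)
qed

theorem extended_Delta:
 "strong_exact_Delta_subalgebra TYPE('m) K (verts XQ \<times> UNIV) first_order_ext
  (extended_trivial_extension K Q R)
  (ext_embed K (extended_matrix_algebra K Q R) \<circ> extended_matrix_idempotent K Q R)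
  (ext_embed K (extended_matrix_algebra K Q R) ` extended_band_subalgebra K Q R)
  (ext_embed K (extended_matrix_algebra K Q R) \<circ> extended_matrix_idempotent K Q R)"
proof -
 interpret S: split_filtered K E rp NN VX ee SS by (rule split_filtered_E)
 obtain T :: "((('v + 'v) \<times> ('v + 'v)) \<times> nat \<times> nat) set" and x kp dg lv rv where A: "adapted K E rp NN VX ee SS T x kp dg lv rv"
  using S.adapted_exists by blast
 show ?thesis
  unfolding extended_trivial_extension_def extended_matrix_algebra_def extended_matrix_idempotent_def extended_band_subalgebra_def
 proof (rule adapted.trivial_extension_Delta[OF A, of _ "%v w. isl w & ~ isl v"])
  show "first_order_ext (v, i) (w, j) = (i < j \<or> i = j & isl w & ~ isl v)" for v w :: "'v + 'v" and i j
   by (auto simp: first_order_ext_def)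
  show "~ (isl v & ~ isl v)" for v :: "'v + 'v" by simp
  show "ee w *E (y *E ee v) = 0E" if "v : VX" "w : VX" "isl w & ~ isl v" "y : |E|" for v w y
   using no_hom_new_old[of v w y] that by blast
 qed
qed

end

theorem proposition11:
  fixes K :: "'k ring"
    and A :: "('k, 'a) module" and I :: "nat \<Rightarrow> 'a set" and N :: nat
    and S :: "'a set" and V :: "'v set" and e :: "'v \<Rightarrow> 'a"
    and Q :: "('w, 'q) pre_digraph" and R :: "('w \<times> 'q list \<Rightarrow> 'k) set"
  assumes "algebraically_closed K"
  shows
    "(fd_algebra K A \<and> basic_algebra A \<and> semisimple_filtration A I N \<and>
      maximal_semisimple_subalgebra K A S \<and>
      S \<inter> I 1 = {\<zero>\<^bsub>A\<^esub>} \<and> S <+>\<^bsub>A\<^esub> I 1 = carrier A \<and>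
      bij_betw e V {x. primitive_idempotent (A\<lparr>carrier := S\<rparr>) x} \<longrightarrow>
      strong_exact_Delta_subalgebra TYPE('m) K (V \<times> UNIV) first_order
        (matrix_algebra A I N) (diagonal_entry A I N e)
        (band_subalgebra A I N S) (diagonal_entry A I N e))
     \<and>
     (fin_digraph Q \<and> verts Q \<noteq> {} \<and> admissible_relations K Q R \<longrightarrow>
      strong_exact_Delta_subalgebra TYPE('n) K
        (verts (extended_quiver Q) \<times> UNIV) first_order_ext
        (extended_trivial_extension K Q R)
        (ext_embed K (extended_matrix_algebra K Q R) \<circ> extended_matrix_idempotent K Q R)
        (ext_embed K (extended_matrix_algebra K Q R) ` extended_band_subalgebra K Q R)
        (ext_embed K (extended_matrix_algebra K Q R) \<circ> extended_matrix_idempotent K Q R))"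
proof (intro conjI impI)
  assume "fd_algebra K A \<and> basic_algebra A \<and> semisimple_filtration A I N \<and>
      maximal_semisimple_subalgebra K A S \<and>
      S \<inter> I 1 = {\<zero>\<^bsub>A\<^esub>} \<and> S <+>\<^bsub>A\<^esub> I 1 = carrier A \<and>
      bij_betw e V {x. primitive_idempotent (A\<lparr>carrier := S\<rparr>) x}"
  then show "strong_exact_Delta_subalgebra TYPE('m) K (V \<times> UNIV) first_order
        (matrix_algebra A I N) (diagonal_entry A I N e)
        (band_subalgebra A I N S) (diagonal_entry A I N e)"
    by (elim conjE) (rule matrix_algebra_Delta_subalgebra[OF assms])
next
  assume Q: "fin_digraph Q \<and> verts Q \<noteq> {} \<and> admissible_relations K Q R"
  have "field K" using assms by (rule algebraically_closed.axioms(1))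
  then have "extended K Q R"
    using Q by (intro extended.intro extended_axioms.intro path_alg.intro) auto
  then show "strong_exact_Delta_subalgebra TYPE('n) K
        (verts (extended_quiver Q) \<times> UNIV) first_order_ext
        (extended_trivial_extension K Q R)
        (ext_embed K (extended_matrix_algebra K Q R) \<circ> extended_matrix_idempotent K Q R)
        (ext_embed K (extended_matrix_algebra K Q R) ` extended_band_subalgebra K Q R)
        (ext_embed K (extended_matrix_algebra K Q R) \<circ> extended_matrix_idempotent K Q R)"
    by (rule extended.extended_Delta)
qed

end
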